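(* Consider a kernel-based spatial random graph as in the context in dimension $d\ge1$, with vertex set a homogeneous Poisson point process, $\alpha\in(1,\infty]$, $\sigma>0$ and $\tau\in(2,2+\sigma)$. Then $$\frac{|\mathcal{C}_n^{(1)}|}{n}\ \longrightarrow\ \mathbb{P}^{0}(0\leftrightarrow\infty)\qquad\text{in probability, as } n\to\infty.$$
   Context: Model. The vertex set is a unit-intensity homogeneous Poisson point process on $\mathbb{R}^d$. Each vertex $u$ at location $x_u$ has an i.i.d. mark $w_u\ge 1$ with $\mathbb{P}(W\ge w)=w^{-(\tau-1)}$, $w\ge1$. Let $\beta>0$, $p\in(0,1]$, $\kappa_\sigma(w_1,w_2)=(w_1\vee w_2)(w_1\wedge w_2)^\sigma$. Conditionally on all locations and marks, each pair $\{u,v\}$ is independently an edge with probability $p\,\varrho\big(\beta\kappa_\sigma(w_u,w_v)/\|x_u-x_v\|^d\big)$, where $\varrho(s)=(1\wedge s)^\alpha$ if $\alpha<\infty$ and $\varrho(s)=\mathbf{1}\{s\ge1\}$ if $\alpha=\infty$. The resulting infinite graph is $\mathcal{G}$; $\Lambda_n:=[-n^{1/d}/2,n^{1/d}/2]^d$; $\mathcal{G}_n$ is the subgraph induced by vertices located in $\Lambda_n$; $\mathcal{C}_n^{(1)}$ is the largest component of $\mathcal{G}_n$. $\mathbb{P}^{0}$ is the Palm measure of having a vertex at location $0$ with unknown (random) mark, and $\{0\leftrightarrow\infty\}$ is the event that this vertex lies in an infinite component of $\mathcal{G}$. *)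

theory Defs
  imports "HOL-Probability.Probability"
begin

section \<open>Components of a graph\<close>

text \<open>A simple graph on the vertex type is given by its (symmetric, irreflexive) adjacency
  relation \<open>R\<close>; \<open>component R V v\<close> is the component of \<open>v \<in> V\<close> in the subgraph induced by \<open>V\<close>.\<close>

definition component :: "('v \<Rightarrow> 'v \<Rightarrow> bool) \<Rightarrow> 'v set \<Rightarrow> 'v \<Rightarrow> 'v set" where
  "component R V v = {u. (\<lambda>a b. a \<in> V \<and> b \<in> V \<and> R a b)\<^sup>*\<^sup>* v u}"

text \<open>The inserted \<open>0\<close> is the value for the graph without vertices.\<close>

definition largest_component_size :: "('v \<Rightarrow> 'v \<Rightarrow> bool) \<Rightarrow> 'v set \<Rightarrow> nat" where
  "largest_component_size R V = Max (insert 0 ((\<lambda>v. card (component R V v)) ` V))"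

section \<open>Poisson point processes\<close>

text \<open>A point process is represented by an enumeration \<open>X 0, X 1, \<dots>\<close> of its points by random
  variables. This is no restriction for a unit-intensity Poisson process on the whole space, which
  almost surely has infinitely many points. The law of a count is written out, instead of using
  \<^const>\<open>poisson_pmf\<close>, because the latter requires a positive rate.\<close>

definition poisson_point_process ::
    "'w measure \<Rightarrow> (nat \<Rightarrow> 'w \<Rightarrow> 'a::euclidean_space) \<Rightarrow> bool" where
  "poisson_point_process M X \<longleftrightarrow>
     (\<forall>i. X i \<in> borel_measurable M) \<and>
     (AE \<omega> in M. \<forall>r. finite {i. X i \<omega> \<in> cball 0 r}) \<and>
     (\<forall>A \<in> sets borel. emeasure lborel A < \<infinity> \<longrightarrow>
        (\<forall>k. measure M {\<omega> \<in> space M. card {i. X i \<omega> \<in> A} = k}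
             = measure lborel A ^ k / fact k * exp (- measure lborel A))) \<and>
     (\<forall>(m::nat) A. (\<forall>l<m. A l \<in> sets borel \<and> emeasure lborel (A l) < \<infinity>) \<longrightarrow>
        disjoint_family_on A {..<m} \<longrightarrow>
        prob_space.indep_vars M (\<lambda>_. count_space UNIV) (\<lambda>l \<omega>. card {i. X i \<omega> \<in> A l}) {..<m})"

section \<open>Kernel-based spatial random graphs\<close>

definition kernel :: "real \<Rightarrow> real \<Rightarrow> real \<Rightarrow> real" where
  "kernel \<sigma> w1 w2 = max w1 w2 * min w1 w2 powr \<sigma>"

definition profile :: "ereal \<Rightarrow> real \<Rightarrow> real" where
  "profile \<alpha> s = (if \<alpha> = \<infinity> then (if 1 \<le> s then 1 else 0) else min 1 s powr real_of_ereal \<alpha>)"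

definition connection_prob ::
    "ereal \<Rightarrow> real \<Rightarrow> real \<Rightarrow> real \<Rightarrow> 'a::euclidean_space \<Rightarrow> real \<Rightarrow> 'a \<Rightarrow> real \<Rightarrow> real" where
  "connection_prob \<alpha> \<beta> p \<sigma> x1 w1 x2 w2 =
     p * profile \<alpha> (\<beta> * kernel \<sigma> w1 w2 / norm (x1 - x2) ^ DIM('a))"

text \<open>Vertex \<open>i\<close> has location \<open>X i\<close> and mark \<open>W i\<close>, and \<open>E i j\<close> is the event that \<open>{i, j}\<close> is an
  edge. The last assumption is the conditional independence of the edges, with the prescribed
  conditional probabilities, given the \<open>\<sigma>\<close>-algebra generated by all locations and marks.\<close>

locale spatial_random_graph = prob_space M
  for M :: "'w measure" +
  fixes \<alpha> :: ereal and \<beta> p \<sigma> \<tau> :: real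
    and X :: "nat \<Rightarrow> 'w \<Rightarrow> 'a::euclidean_space"
    and W :: "nat \<Rightarrow> 'w \<Rightarrow> real"
    and E :: "nat \<Rightarrow> nat \<Rightarrow> 'w \<Rightarrow> bool"
  assumes locations: "poisson_point_process M X"
    and marks_indep: "indep_vars (\<lambda>_. borel) W UNIV"
    and marks_law: "1 \<le> w \<Longrightarrow> prob {\<omega> \<in> space M. w \<le> W i \<omega>} = w powr (- (\<tau> - 1))"
    and marks_indep_locations:
      "indep_set
         (sets (vimage_algebra (space M) (\<lambda>\<omega> i. X i \<omega>) (\<Pi>\<^sub>M i\<in>UNIV. borel)))
         (sets (vimage_algebra (space M) (\<lambda>\<omega> i. W i \<omega>) (\<Pi>\<^sub>M i\<in>UNIV. borel)))"
    and edge_measurable: "{\<omega> \<in> space M. E i j \<omega>} \<in> events"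
    and edge_sym: "\<omega> \<in> space M \<Longrightarrow> E i j \<omega> \<longleftrightarrow> E j i \<omega>"
    and edge_irrefl: "\<omega> \<in> space M \<Longrightarrow> \<not> E i i \<omega>"
    and edges_given_vertices:
      "finite S \<Longrightarrow> S \<subseteq> {(i, j). i < j} \<Longrightarrow>
       AE \<omega> in M.
         real_cond_exp M
           (vimage_algebra (space M) (\<lambda>\<omega>. (\<lambda>i. X i \<omega>, \<lambda>i. W i \<omega>))
             ((\<Pi>\<^sub>M i\<in>UNIV. borel) \<Otimes>\<^sub>M (\<Pi>\<^sub>M i\<in>UNIV. borel)))
           (indicator {\<omega> \<in> space M. \<forall>(i, j)\<in>S. E i j \<omega>}) \<omega>
         = (\<Prod>(i, j)\<in>S. connection_prob \<alpha> \<beta> p \<sigma> (X i \<omega>) (W i \<omega>) (X j \<omega>) (W j \<omega>))"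

text \<open>The cube of volume \<open>n\<close> centred at the origin.\<close>

definition Lambda :: "real \<Rightarrow> 'a::euclidean_space set" where
  "Lambda n = cbox (- (n powr (1 / DIM('a)) / 2) *\<^sub>R One) ((n powr (1 / DIM('a)) / 2) *\<^sub>R One)"

section \<open>The Palm measure\<close>

type_synonym 'a config = "(nat \<Rightarrow> 'a) \<times> (nat \<Rightarrow> real) \<times> (nat \<times> nat \<Rightarrow> bool)"

definition config_space :: "'a::euclidean_space config measure" where
  "config_space = (\<Pi>\<^sub>M i\<in>UNIV. borel) \<Otimes>\<^sub>M (\<Pi>\<^sub>M i\<in>UNIV. borel) \<Otimes>\<^sub>M (\<Pi>\<^sub>M e\<in>UNIV. count_space UNIV)"

text \<open>The graph seen from the point \<open>x\<close>, i.e. translated by \<open>-x\<close>.\<close>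

definition seen_from :: "'a::euclidean_space \<Rightarrow> 'a config \<Rightarrow> 'a config" where
  "seen_from x = (\<lambda>(y, w, e). (\<lambda>i. y i - x, w, e))"

text \<open>The Palm measure of a stationary process of unit intensity:
  the measure of \<open>A\<close> is the expected number of vertices in the unit cube from which the graph is
  seen to satisfy \<open>A\<close>. The typical vertex is at the origin, and its mark is random. Configurations
  are labelled by the enumeration, so only events invariant under relabelling are meaningful.\<close>

definition palm_measure ::
    "'w measure \<Rightarrow> (nat \<Rightarrow> 'w \<Rightarrow> 'a::euclidean_space) \<Rightarrow> (nat \<Rightarrow> 'w \<Rightarrow> real)
      \<Rightarrow> (nat \<Rightarrow> nat \<Rightarrow> 'w \<Rightarrow> bool) \<Rightarrow> 'a config measure" where
  "palm_measure M X W E = measure_of (space config_space) (sets config_space)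
     (\<lambda>A. \<integral>\<^sup>+ \<omega>. (\<Sum>i. indicator (cbox 0 One) (X i \<omega>) *
        indicator A (seen_from (X i \<omega>) (\<lambda>j. X j \<omega>, \<lambda>j. W j \<omega>, \<lambda>(j, k). E j k \<omega>))) \<partial>M)"

definition zero_to_infinity :: "'a::euclidean_space config set" where
  "zero_to_infinity =
     {(y, w, e). \<exists>i. y i = 0 \<and> infinite (component (\<lambda>j k. e (j, k)) UNIV i)}"

section \<open>Convergence in probability\<close>

definition tendsto_in_prob ::
    "'w measure \<Rightarrow> ('n \<Rightarrow> 'w \<Rightarrow> real) \<Rightarrow> real \<Rightarrow> 'n filter \<Rightarrow> bool" where
  "tendsto_in_prob M Z c F \<longleftrightarrow>
     (\<forall>n. Z n \<in> borel_measurable M) \<and>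
     (\<forall>\<epsilon>>0. ((\<lambda>n. measure M {\<omega> \<in> space M. \<bar>Z n \<omega> - c\<bar> > \<epsilon>}) \<longlongrightarrow> 0) F)"

end

theory Submission
  imports Defs "HOL-Combinatorics.Multiset_Permutations"
begin

text \<open>Let \<open>N\<^sub>k(h)\<close> be the number of vertices of the cube of half-width \<open>h\<close> and volume \<open>v\<close> that have a component of
  size at least \<open>k\<close> in the graph induced by the cube. Up to \<open>k\<close>, it dominates the largest component.
  Comparing each component with its part near the vertex and its extension to the whole space, one gets
  \<open>N\<^sub>k(h) / v \<longlonglongrightarrow> \<theta>\<^sub>k\<close>, the Palm probability of a component of size at least \<open>k\<close>: a sum of local, finitely
  dependent counts bounds \<open>N\<^sub>k(h)\<close> from below (second moments), and the mean of \<open>N\<^sub>k(h)\<close> is at most about \<open>v \<theta>\<^sub>k\<close>.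
  Moreover \<open>\<theta>\<^sub>k\<close> decreases to the Palm probability of an infinite component.

  Conversely almost all vertices in components of size at least \<open>k\<close> lie in one component. Vertices of mark at least
  \<open>K = v powr (1 / \<gamma>)\<close>, where \<open>\<tau> - 1 < \<gamma> < 1 + \<sigma>\<close>, pairwise have a common neighbour among them. A large component is unlikely to
  have only vertices of mark below a constant, since given the graph with all marks cut off at that constant, each of its vertices still has an independent chance of a larger mark. And
  a component whose largest mark lies in \<open>[2 ^ l, 2 ^ (l + 1))\<close> is unlikely, since \<open>\<tau> < 2 + \<sigma>\<close> makes the expected number
  of neighbours of larger mark of such a vertex grow like a power of \<open>2 ^ l\<close>.\<close>

section \<open>Infinite products of probability spaces\<close>

text \<open>The points are given by an enumeration that may depend on the configuration, so no index
  carries a fixed law; what is available is the independence of counts in disjoint sets. Summing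
  over all orderings of the points of a bounded set turns it into independent uniform points in
  Poisson number (\<open>nn_integral_mixed_binomial\<close>), for functionals that do not see the
  labels. Marks and edges are rebuilt from an i.i.d. family \<open>\<eta>\<close> indexed by vertex
  sets, so that the estimates reduce to resampling a few coordinates; only the joint law of
  locations and edges is compared with the given graph at the end. Upper tails of the counts come
  from a first moment combined with the lower tail, so no long-range correlation is estimated. Edges
  are only forced where the profile equals 1, hence with probability \<open>p\<close>. The exponent
  of the hub threshold is the midpoint \<open>(\<tau> + \<sigma>) / 2\<close> of \<tau> - 1 and 1 +
  \<sigma>: up to that threshold the number of better neighbours gains a factor of at least 2 to the
  power \<open>\<epsilon>0\<close> per dyadic level, which makes the errors of all levels summable
  uniformly in the cube.\<close>

lemma product_prob_space_const: "prob_space N \<Longrightarrow> product_prob_space (\<lambda>_. N)"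
  by (simp add: product_prob_space_def product_sigma_finite_def product_prob_space_axioms_def
      prob_space_imp_sigma_finite)

lemma measurable_PiM_UNIV:
  assumes "\<And>i. (\<lambda>\<omega>. f \<omega> i) \<in> measurable M N"
  shows "f \<in> measurable M (PiM UNIV (\<lambda>_. N))"
proof (rule measurable_PiM_single')
  show "f \<in> space M \<rightarrow> (\<Pi>\<^sub>E i\<in>UNIV. space N)"
    using measurable_space[OF assms] by auto
qed (use assms in auto)

lemma emeasure_PiM_UNIV_Collect:
  assumes "prob_space N" "finite J" "\<And>i. i \<in> J \<Longrightarrow> A i \<in> sets N"
  shows "emeasure (PiM UNIV (\<lambda>_. N)) {x \<in> space (PiM UNIV (\<lambda>_. N)). \<forall>i\<in>J. x i \<in> A i}
    = (\<Prod>i\<in>J. emeasure N (A i))"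
  by (rule product_prob_space.emeasure_PiM_Collect[OF product_prob_space_const[OF assms(1)]])
     (use assms in auto)

lemma PiM_UNIV_eqI:
  assumes N: "prob_space N" and sets: "sets P = sets (PiM (UNIV::'i set) (\<lambda>_. N))"
    and eq: "\<And>J A. finite J \<Longrightarrow> (\<And>i. A i \<in> sets N) \<Longrightarrow>
      emeasure P {x \<in> space P. \<forall>i\<in>J. x i \<in> A i} = (\<Prod>i\<in>J. emeasure N (A i))"
  shows "P = PiM UNIV (\<lambda>_. N)"
proof (rule product_prob_space.PiM_eq[OF product_prob_space_const[OF N] sets])
  fix J :: "'i set" and F assume J: "finite J" "\<And>j. j \<in> J \<Longrightarrow> F j \<in> sets N"
  define A where "A = (\<lambda>j. if j \<in> J then F j else {})"
  have "prod_emb UNIV (\<lambda>_. N) J (Pi\<^sub>E J F) = {x \<in> space P. \<forall>i\<in>J. x i \<in> A i}"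
    using sets_eq_imp_space_eq[OF sets] by (auto simp: prod_emb_def space_PiM A_def PiE_iff)
  then show "emeasure P (prod_emb UNIV (\<lambda>_. N) J (Pi\<^sub>E J F)) = (\<Prod>j\<in>J. emeasure N (F j))"
    using eq[of J A] J by (auto simp: A_def intro!: prod.cong)
qed

text \<open>Gluing two independent samples along \<open>S\<close> reproduces the product law, so
  that the inner integral is the conditional expectation given the coordinates in
  \<open>S\<close>.\<close>

lemma nn_integral_PiM_merge:
  fixes f :: "('i \<Rightarrow> 'a) \<Rightarrow> ennreal" and N :: "'a measure"
  assumes N: "prob_space N"
    and f[measurable]: "f \<in> borel_measurable (PiM UNIV (\<lambda>_. N))"
  shows "(\<integral>\<^sup>+\<omega>. f \<omega> \<partial>PiM UNIV (\<lambda>_. N)) =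
    (\<integral>\<^sup>+\<omega>. \<integral>\<^sup>+\<omega>'. f (\<lambda>i. if i \<in> S then \<omega> i else \<omega>' i) \<partial>PiM UNIV (\<lambda>_. N) \<partial>PiM UNIV (\<lambda>_. N))"
proof -
  let ?P = "PiM (UNIV::'i set) (\<lambda>_. N)"
  let ?g = "\<lambda>(a, b) i. if i \<in> S then a i else (b i :: 'a)"
  interpret P: prob_space ?P using N by (intro prob_space_PiM)
  have g[measurable]: "?g \<in> measurable (?P \<Otimes>\<^sub>M ?P) ?P"
  proof (rule measurable_PiM_UNIV)
    show "(\<lambda>\<omega>. ?g \<omega> i) \<in> measurable (?P \<Otimes>\<^sub>M ?P) N" for i by (cases "i \<in> S") (simp_all add: split_beta')
  qed
  have "distr (?P \<Otimes>\<^sub>M ?P) ?P ?g = ?P"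
  proof (rule PiM_UNIV_eqI[OF N])
    fix J :: "'i set" and A :: "'i \<Rightarrow> _" assume J: "finite J" and A[measurable]: "\<And>i. A i \<in> sets N"
    let ?E = "\<lambda>J. {x \<in> space ?P. \<forall>i\<in>J. x i \<in> A i}"
    have [measurable]: "?E J \<in> sets ?P" if "finite J" for J
      using that by measurable
    have *: "?g -` ?E J \<inter> space (?P \<Otimes>\<^sub>M ?P) = ?E (J \<inter> S) \<times> ?E (J - S)"
      by (auto simp: space_pair_measure space_PiM PiE_iff split: if_splits)
    have "emeasure (distr (?P \<Otimes>\<^sub>M ?P) ?P ?g) (?E J) = emeasure ?P (?E (J \<inter> S)) * emeasure ?P (?E (J - S))"
      unfolding emeasure_distr[OF g \<open>finite J \<Longrightarrow> ?E J \<in> sets ?P\<close>[OF J]] *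
      using J by (simp add: P.emeasure_pair_measure_Times)
    also have "\<dots> = (\<Prod>i\<in>J \<inter> S. emeasure N (A i)) * (\<Prod>i\<in>J - S. emeasure N (A i))"
      using J by (simp add: emeasure_PiM_UNIV_Collect[OF N])
    also have "\<dots> = (\<Prod>i\<in>J. emeasure N (A i))"
      using J by (subst prod.union_disjoint[symmetric]) (auto intro!: prod.cong)
    finally show "emeasure (distr (?P \<Otimes>\<^sub>M ?P) ?P ?g) {x \<in> space (distr (?P \<Otimes>\<^sub>M ?P) ?P ?g). \<forall>i\<in>J. x i \<in> A i}
       = (\<Prod>i\<in>J. emeasure N (A i))" by simp
  qed simp
  then have "(\<integral>\<^sup>+\<omega>. f \<omega> \<partial>?P) = (\<integral>\<^sup>+\<omega>. f \<omega> \<partial>distr (?P \<Otimes>\<^sub>M ?P) ?P ?g)" by simp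
  also have "\<dots> = (\<integral>\<^sup>+x. f (?g x) \<partial>(?P \<Otimes>\<^sub>M ?P))"
    by (rule nn_integral_distr) measurable
  also have "\<dots> = (\<integral>\<^sup>+\<omega>. \<integral>\<^sup>+\<omega>'. f (?g (\<omega>, \<omega>')) \<partial>?P \<partial>?P)"
    by (rule P.nn_integral_fst[symmetric]) measurable
  finally show ?thesis by simp
qed

lemma nn_integral_PiM_indep:
  fixes f g :: "('i \<Rightarrow> 'a) \<Rightarrow> ennreal"
  assumes N: "prob_space N"
    and [measurable]: "f \<in> borel_measurable (PiM UNIV (\<lambda>_. N))"
      "g \<in> borel_measurable (PiM UNIV (\<lambda>_. N))"
    and f: "\<And>\<omega> \<omega>'. (\<And>i. i \<in> S \<Longrightarrow> \<omega> i = \<omega>' i) \<Longrightarrow> f \<omega> = f \<omega>'"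
    and g: "\<And>\<omega> \<omega>'. (\<And>i. i \<notin> S \<Longrightarrow> \<omega> i = \<omega>' i) \<Longrightarrow> g \<omega> = g \<omega>'"
  shows "(\<integral>\<^sup>+\<omega>. f \<omega> * g \<omega> \<partial>PiM UNIV (\<lambda>_. N)) =
    (\<integral>\<^sup>+\<omega>. f \<omega> \<partial>PiM UNIV (\<lambda>_. N)) * (\<integral>\<^sup>+\<omega>. g \<omega> \<partial>PiM UNIV (\<lambda>_. N))"
proof -
  have "f (\<lambda>i. if i \<in> S then \<omega> i else \<omega>' i) = f \<omega>" for \<omega> \<omega>' by (rule f) auto
  moreover have "g (\<lambda>i. if i \<in> S then \<omega> i else \<omega>' i) = g \<omega>'" for \<omega> \<omega>' by (rule g) auto
  ultimately show ?thesis
    by (subst nn_integral_PiM_merge[OF N, of _ S])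
       (auto simp: nn_integral_cmult nn_integral_multc)
qed

text \<open>The merging identity for the complement of one coordinate. Iterating it reveals
  coordinates one at a time, which is how the product bounds for probabilities below arise.\<close>

lemma nn_integral_PiM_resample:
  fixes f :: "('i \<Rightarrow> 'a) \<Rightarrow> ennreal"
  assumes N: "prob_space N"
    and f[measurable]: "f \<in> borel_measurable (PiM UNIV (\<lambda>_. N))"
  shows "(\<integral>\<^sup>+\<omega>. f \<omega> \<partial>PiM UNIV (\<lambda>_. N)) = (\<integral>\<^sup>+\<omega>. \<integral>\<^sup>+a. f (fun_upd \<omega> s a) \<partial>N \<partial>PiM UNIV (\<lambda>_. N))"
proof -
  let ?P = "PiM (UNIV::'i set) (\<lambda>_. N)"
  interpret N: prob_space N by fact
  interpret P: prob_space ?P using N by (intro prob_space_PiM)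
  have "(\<integral>\<^sup>+\<omega>. f \<omega> \<partial>?P) = (\<integral>\<^sup>+\<omega>. \<integral>\<^sup>+\<omega>'. f (\<lambda>i. if i \<in> - {s} then \<omega> i else \<omega>' i) \<partial>?P \<partial>?P)"
    by (rule nn_integral_PiM_merge[OF N f])
  also have "\<dots> = (\<integral>\<^sup>+\<omega>. \<integral>\<^sup>+\<omega>'. f (fun_upd \<omega> s (\<omega>' s)) \<partial>?P \<partial>?P)"
    by (intro nn_integral_cong arg_cong[where f = f]) auto
  also have "\<dots> = (\<integral>\<^sup>+\<omega>. \<integral>\<^sup>+a. f (fun_upd \<omega> s a) \<partial>N \<partial>?P)"
  proof (intro nn_integral_cong)
    fix \<omega> assume "\<omega> \<in> space ?P"
    have "(\<integral>\<^sup>+a. f (fun_upd \<omega> s a) \<partial>N) = (\<integral>\<^sup>+a. f (fun_upd \<omega> s a) \<partial>distr ?P N (\<lambda>\<omega>. \<omega> s))"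
      using distr_PiM_component[of UNIV "\<lambda>_. N" s] N by simp
    also have "\<dots> = (\<integral>\<^sup>+\<omega>'. f (fun_upd \<omega> s (\<omega>' s)) \<partial>?P)"
    proof -
      have "fun_upd \<omega> s \<in> measurable N ?P"
      proof (rule measurable_PiM_UNIV)
        show "(\<lambda>a. fun_upd \<omega> s a i) \<in> measurable N N" for i
          using measurable_space[OF measurable_component_singleton[of i UNIV "\<lambda>_. N"] \<open>\<omega> \<in> space ?P\<close>]
          by (cases "i = s") auto
      qed
      then have "(\<lambda>a. f (fun_upd \<omega> s a)) \<in> borel_measurable N" by (rule measurable_compose[OF _ f])
      then show ?thesis by (intro nn_integral_distr) simp_all
    qed
    finally show "(\<integral>\<^sup>+\<omega>'. f (fun_upd \<omega> s (\<omega>' s)) \<partial>?P) = (\<integral>\<^sup>+a. f (fun_upd \<omega> s a) \<partial>N)" by simp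
  qed
  finally show ?thesis .
qed

lemma PiM_UNIV_distr:
  assumes N: "prob_space N" and g[measurable]: "g \<in> measurable N K" and h: "inj h"
  shows "distr (PiM (UNIV::'i set) (\<lambda>_. N)) (PiM (UNIV::'j set) (\<lambda>_. K)) (\<lambda>\<omega> j. g (\<omega> (h j)))
    = PiM UNIV (\<lambda>_. distr N K g)"
proof (rule PiM_UNIV_eqI)
  interpret N: prob_space N by fact
  let ?P = "PiM (UNIV::'i set) (\<lambda>_. N)" and ?R = "PiM (UNIV::'j set) (\<lambda>_. K)"
  show "prob_space (distr N K g)" by (rule N.prob_space_distr) measurable
  show "sets (distr ?P ?R (\<lambda>\<omega> j. g (\<omega> (h j)))) = sets (PiM UNIV (\<lambda>_. distr N K g))"
    by (simp cong: sets_PiM_cong)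
  have m[measurable]: "(\<lambda>\<omega> j. g (\<omega> (h j))) \<in> measurable ?P ?R"
    by (rule measurable_PiM_UNIV) measurable
  fix J :: "'j set" and A :: "'j \<Rightarrow> _" assume J: "finite J" and A: "\<And>i. A i \<in> sets (distr N K g)"
  then have [measurable]: "A i \<in> sets K" for i by simp
  have "emeasure (distr ?P ?R (\<lambda>\<omega> j. g (\<omega> (h j)))) {x \<in> space (distr ?P ?R (\<lambda>\<omega> j. g (\<omega> (h j)))). \<forall>i\<in>J. x i \<in> A i}
    = emeasure ?P {\<omega> \<in> space ?P. \<forall>i\<in>h ` J. \<omega> i \<in> g -` A (inv h i) \<inter> space N}"
  proof (subst emeasure_distr)
    have "{x \<in> space ?R. \<forall>i\<in>J. x i \<in> A i} \<in> sets ?R" using J by measurable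
    then show "{x \<in> space (distr ?P ?R (\<lambda>\<omega> j. g (\<omega> (h j)))). \<forall>i\<in>J. x i \<in> A i} \<in> sets ?R" by simp
  qed (use h measurable_space[OF m] in
      \<open>auto simp: space_PiM intro!: arg_cong[where f = "emeasure ?P"]\<close>)
  also have "\<dots> = (\<Prod>i\<in>h ` J. emeasure N (g -` A (inv h i) \<inter> space N))"
    using J by (intro emeasure_PiM_UNIV_Collect N) auto
  also have "\<dots> = (\<Prod>i\<in>J. emeasure (distr N K g) (A i))"
    using h by (subst prod.reindex) (auto simp: emeasure_distr intro: inj_on_subset)
  finally show "emeasure (distr ?P ?R (\<lambda>\<omega> j. g (\<omega> (h j)))) {x \<in> space (distr ?P ?R (\<lambda>\<omega> j. g (\<omega> (h j)))). \<forall>i\<in>J. x i \<in> A i}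
    = (\<Prod>i\<in>J. emeasure (distr N K g) (A i))" .
qed

text \<open>The relabelling is injective only on the coordinates that matter, so it is not a change
  of variables on the full product; the integral is therefore taken down to the product over
  \<open>K\<close>, where reindexing is available.\<close>

lemma nn_integral_PiM_relabel:
  fixes h :: "'i \<Rightarrow> 'i" and f :: "('i \<Rightarrow> 'a) \<Rightarrow> ennreal"
  assumes N: "prob_space N" and h: "inj_on h K"
    and f[measurable]: "f \<in> borel_measurable (PiM UNIV (\<lambda>_. N))"
    and loc: "\<And>\<omega> \<omega>'. (\<And>i. i \<in> K \<Longrightarrow> \<omega> i = \<omega>' i) \<Longrightarrow> f \<omega> = f \<omega>'"
  shows "(\<integral>\<^sup>+\<omega>. f (\<lambda>i. \<omega> (h i)) \<partial>PiM UNIV (\<lambda>_. N)) = (\<integral>\<^sup>+\<omega>. f \<omega> \<partial>PiM UNIV (\<lambda>_. N))"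
proof -
  let ?P = "PiM (UNIV::'i set) (\<lambda>_. N)" and ?K = "PiM K (\<lambda>_. N)"
  interpret N: prob_space N by fact
  obtain a where a: "a \<in> space N" using N.not_empty by auto
  \<comment> \<open>\<open>e\<close> completes a partial family by a fixed value outside
    \<open>K\<close>, where \<open>f\<close> does not look.\<close>
  define e where "e = (\<lambda>\<omega> i. if i \<in> K then \<omega> i else a)"
  have e[measurable]: "e \<in> measurable ?K ?P"
  proof (rule measurable_PiM_UNIV)
    show "(\<lambda>\<omega>. e \<omega> i) \<in> measurable ?K N" for i
      using a by (cases "i \<in> K") (simp_all add: e_def)
  qed
  have *: "(\<integral>\<^sup>+\<omega>. f (\<lambda>i. \<omega> (h i)) \<partial>?P) = (\<integral>\<^sup>+\<omega>. f (e \<omega>) \<partial>?K)" if "inj_on h K" for h :: "'i \<Rightarrow> 'i"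
  proof -
    have m: "(\<lambda>\<omega>. \<lambda>i\<in>K. \<omega> (h i)) \<in> measurable ?P ?K" by measurable
    have "(\<integral>\<^sup>+\<omega>. f (e \<omega>) \<partial>?K) = (\<integral>\<^sup>+\<omega>. f (e \<omega>) \<partial>distr ?P ?K (\<lambda>\<omega>. \<lambda>i\<in>K. \<omega> (h i)))"
      using distr_PiM_reindex[of UNIV "\<lambda>_. N" h K] that N by simp
    also have "\<dots> = (\<integral>\<^sup>+\<omega>. f (e (\<lambda>i\<in>K. \<omega> (h i))) \<partial>?P)"
      using m by (rule nn_integral_distr) measurable
    also have "\<dots> = (\<integral>\<^sup>+\<omega>. f (\<lambda>i. \<omega> (h i)) \<partial>?P)"
      by (intro nn_integral_cong loc) (auto simp: e_def)
    finally show ?thesis by simp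
  qed
  show ?thesis using *[OF h] *[of id] by (simp add: id_def)
qed

section \<open>Components\<close>

lemma component_self [simp]: "v \<in> component R V v"
  by (simp add: component_def)

lemma component_subset: "v \<in> V \<Longrightarrow> component R V v \<subseteq> V"
proof
  fix u assume "v \<in> V" "u \<in> component R V v"
  then have "(\<lambda>a b. a \<in> V \<and> b \<in> V \<and> R a b)\<^sup>*\<^sup>* v u" by (simp add: component_def)
  then show "u \<in> V" using \<open>v \<in> V\<close> by (induction) auto
qed

lemma component_mono:
  assumes "\<And>a b. a \<in> V \<Longrightarrow> b \<in> V \<Longrightarrow> R a b \<Longrightarrow> a \<in> V' \<and> b \<in> V' \<and> R' a b"
  shows "component R V v \<subseteq> component R' V' v"
  unfolding component_def using assms by (auto elim!: rtranclp_mono[THEN predicate2D, rotated])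

lemma component_cong:
  assumes "\<And>a b. a \<in> V \<Longrightarrow> b \<in> V \<Longrightarrow> R a b = R' a b"
  shows "component R V v = component R' V v"
  using assms by (intro equalityI component_mono) auto

lemma component_step:
  "u \<in> component R V v \<Longrightarrow> u \<in> V \<Longrightarrow> w \<in> V \<Longrightarrow> R u w \<Longrightarrow> w \<in> component R V v"
  unfolding component_def by (auto intro: rtranclp.rtrancl_into_rtrancl)

lemma component_eq:
  assumes sym: "\<And>a b. R a b \<longleftrightarrow> R b a" and u: "u \<in> component R V v"
  shows "component R V u = component R V v"
proof -
  let ?S = "\<lambda>a b. a \<in> V \<and> b \<in> V \<and> R a b"
  have "symp ?S" using sym by (auto simp: symp_def)
  then have s: "symp ?S\<^sup>*\<^sup>*" by (rule symp_rtranclp)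
  have "?S\<^sup>*\<^sup>* v u" using u by (simp add: component_def)
  moreover from s this have "?S\<^sup>*\<^sup>* u v" by (rule sympD)
  ultimately show ?thesis by (auto simp: component_def intro: rtranclp_trans)
qed

lemma component_subset_closed:
  assumes v: "v \<in> D"
    and D: "\<And>a b. a \<in> D \<Longrightarrow> a \<in> V \<Longrightarrow> b \<in> V \<Longrightarrow> R a b \<Longrightarrow> b \<in> D"
  shows "component R V v \<subseteq> D"
proof
  fix u assume "u \<in> component R V v"
  then have "(\<lambda>a b. a \<in> V \<and> b \<in> V \<and> R a b)\<^sup>*\<^sup>* v u" by (simp add: component_def)
  then show "u \<in> D" using v D by (induction) auto
qed

text \<open>A component is already the component within any vertex set containing it; this is how
  information about the complement of a component gets separated from the component itself.\<close>

lemma component_restrict: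
  assumes v: "v \<in> V" and D: "component R V v \<subseteq> D" "D \<subseteq> V"
  shows "component R D v = component R V v"
proof (rule equalityI)
  show "component R D v \<subseteq> component R V v" using D by (intro component_mono) auto
  show "component R V v \<subseteq> component R D v"
  proof
    fix u assume "u \<in> component R V v"
    then have "(\<lambda>a b. a \<in> V \<and> b \<in> V \<and> R a b)\<^sup>*\<^sup>* v u" by (simp add: component_def)
    then show "u \<in> component R D v"
    proof (induction)
      case (step y z)
      have "y \<in> component R V v" using step.hyps(1) by (simp add: component_def)
      moreover from this have "z \<in> component R V v" using step.hyps(2) by (auto intro: component_step)
      ultimately show ?case using step.IH step.hyps(2) D by (auto intro: component_step)
    qed simp
  qed
qed

lemma component_image:
  assumes h: "inj_on h V" and v: "v \<in> V"
    and R: "\<And>a b. a \<in> V \<Longrightarrow> b \<in> V \<Longrightarrow> R (h a) (h b) = R' a b"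
  shows "component R (h ` V) (h v) = h ` component R' V v"
proof (rule equalityI)
  show "component R (h ` V) (h v) \<subseteq> h ` component R' V v"
  proof (rule component_subset_closed)
    fix a b assume "a \<in> h ` component R' V v" "b \<in> h ` V" "R a b"
    then obtain a' b' where *: "a = h a'" "a' \<in> component R' V v" "b = h b'" "b' \<in> V" by auto
    have "a' \<in> V" using * component_subset[OF v, of R'] by auto
    then have "R' a' b'" using R[of a' b'] * \<open>R a b\<close> by auto
    then show "b \<in> h ` component R' V v" using * \<open>a' \<in> V\<close> by (auto intro: component_step)
  qed simp
  show "h ` component R' V v \<subseteq> component R (h ` V) (h v)"
  proof clarify
    fix u assume "u \<in> component R' V v"
    then have "(\<lambda>a b. a \<in> V \<and> b \<in> V \<and> R' a b)\<^sup>*\<^sup>* v u" by (simp add: component_def)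
    then show "h u \<in> component R (h ` V) (h v)"
    proof (induction)
      case (step y z)
      then show ?case using R[of y z] by (auto intro: component_step)
    qed simp
  qed
qed

text \<open>Each vertex of a component is reached by a finite path, hence already inside some
  \<open>V n\<close>. This is what lets large components of the whole graph be seen in bounded
  regions.\<close>

lemma component_finite_witness:
  assumes inc: "incseq V" and T: "finite T" "T \<subseteq> component R (\<Union>n. V n) v"
  shows "\<exists>n. T \<subseteq> component R (V n) v"
proof -
  have "\<exists>n. u \<in> component R (V n) v" if "u \<in> component R (\<Union>n. V n) v" for u
  proof -
    have "(\<lambda>a b. a \<in> (\<Union>n. V n) \<and> b \<in> (\<Union>n. V n) \<and> R a b)\<^sup>*\<^sup>* v u"
      using that by (simp add: component_def)
    then show ?thesis
    proof (induction)
      case base then show ?case by auto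
    next
      case (step y z)
      then obtain n n1 n2 where *: "y \<in> component R (V n) v" "y \<in> V n1" "z \<in> V n2" by auto
      define m where "m = max n (max n1 n2)"
      have le: "V n \<subseteq> V m" "V n1 \<subseteq> V m" "V n2 \<subseteq> V m"
        using inc by (auto simp: m_def incseq_def le_max_iff_disj)
      then have "component R (V n) v \<subseteq> component R (V m) v" by (intro component_mono) auto
      then show ?case using * le step.hyps(2) component_step[of y R "V m" v z] by blast
    qed
  qed
  then obtain n where n: "\<And>u. u \<in> T \<Longrightarrow> u \<in> component R (V (n u)) v" using T(2) by (metis subsetD)
  define m where "m = Max (insert 0 (n ` T))"
  have "component R (V (n u)) v \<subseteq> component R (V m) v" if "u \<in> T" for u
  proof -
    have "n u \<le> m" unfolding m_def using T(1) that by (intro Max_ge) auto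
    then have "V (n u) \<subseteq> V m" by (rule incseqD[OF inc])
    then show ?thesis by (intro component_mono) auto
  qed
  then show ?thesis using n by blast
qed

lemma largest_component_size_attained:
  assumes "finite V" "V \<noteq> {}"
  obtains v where "v \<in> V" "card (component R V v) = largest_component_size R V"
proof -
  let ?S = "(\<lambda>v. card (component R V v)) ` V"
  have "Max (insert 0 ?S) \<in> insert 0 ?S" using assms by (intro Max_in) auto
  \<comment> \<open>The inserted 0 is not the maximum, because every vertex lies in its own
    component.\<close>
  moreover have "Max (insert 0 ?S) \<noteq> 0"
  proof -
    obtain v where v: "v \<in> V" using assms by auto
    have "finite (component R V v)" using component_subset[OF v] assms finite_subset by blast
    then have "0 < card (component R V v)" using component_self[of v R V] by (metis card_gt_0_iff empty_iff)
    moreover have "card (component R V v) \<le> Max (insert 0 ?S)" using v assms by (intro Max_ge) auto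
    ultimately show ?thesis by simp
  qed
  ultimately show ?thesis using that by (auto simp: largest_component_size_def)
qed

lemma largest_component_size_ge:
  "finite V \<Longrightarrow> v \<in> V \<Longrightarrow> card (component R V v) \<le> largest_component_size R V"
  unfolding largest_component_size_def by (intro Max_ge) auto

text \<open>A size condition that infinite sets satisfy for every \<open>k\<close>;
  \<open>k \<le> card D\<close> would fail for them, as \<open>card\<close> is 0 there. It is
  monotone in the set, and infinity of a set is the conjunction over all \<open>k\<close>.\<close>

definition big :: "nat \<Rightarrow> 'v set \<Rightarrow> bool" where
  "big k D \<longleftrightarrow> (\<exists>T. finite T \<and> card T = k \<and> T \<subseteq> D)"

lemma big_mono: "big k D \<Longrightarrow> D \<subseteq> D' \<Longrightarrow> big k D'"
  unfolding big_def by blast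

lemma big_finite: "finite D \<Longrightarrow> big k D \<longleftrightarrow> k \<le> card D"
  unfolding big_def by (metis card_mono obtain_subset_with_card_n)

lemma big_infinite: "infinite D \<Longrightarrow> big k D"
  unfolding big_def using infinite_arbitrarily_large by blast

lemma infinite_iff_big: "infinite D \<longleftrightarrow> (\<forall>k. big k D)"
proof
  show "\<forall>k. big k D \<Longrightarrow> infinite D"
    by (metis big_finite Suc_n_not_le_n)
qed (simp add: big_infinite)

lemma big_antimono: "big k D \<Longrightarrow> l \<le> k \<Longrightarrow> big l D"
  by (cases "finite D") (auto simp: big_finite big_infinite)

lemma big_image: "inj_on h D \<Longrightarrow> big k (h ` D) \<longleftrightarrow> big k D"
  by (cases "finite D") (auto simp: big_finite big_infinite card_image finite_image_iff)

section \<open>Measurability of graph functionals\<close>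

text \<open>Reachability is a countable union over path lengths and intermediate vertices, so only
  the events of single vertices and edges enter.\<close>

lemma measurable_component [measurable (raw)]:
  fixes R :: "'w \<Rightarrow> 'v::countable \<Rightarrow> 'v \<Rightarrow> bool" and V :: "'w \<Rightarrow> 'v set"
  assumes [measurable]: "\<And>a b. Measurable.pred M (\<lambda>\<omega>. R \<omega> a b)" "\<And>a. Measurable.pred M (\<lambda>\<omega>. a \<in> V \<omega>)"
  shows "Measurable.pred M (\<lambda>\<omega>. u \<in> component (R \<omega>) (V \<omega>) v)"
proof -
  define S where "S = (\<lambda>\<omega> a b. a \<in> V \<omega> \<and> b \<in> V \<omega> \<and> R \<omega> a b)"
  have *: "Measurable.pred M (\<lambda>\<omega>. (S \<omega> ^^ n) v u)" for n u
  proof (induction n arbitrary: u)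
    case 0
    then show ?case by simp
  next
    case (Suc n)
    have "(\<lambda>\<omega>. (S \<omega> ^^ Suc n) v u) = (\<lambda>\<omega>. \<exists>c. (S \<omega> ^^ n) v c \<and> S \<omega> c u)"
      by (auto simp: relcompp.simps fun_eq_iff)
    moreover note Suc[measurable]
    ultimately show ?case unfolding S_def by simp
  qed
  have "(\<lambda>\<omega>. u \<in> component (R \<omega>) (V \<omega>) v) = (\<lambda>\<omega>. \<exists>n. (S \<omega> ^^ n) v u)"
    by (auto simp: component_def S_def rtranclp_power fun_eq_iff)
  then show ?thesis using * by simp
qed

lemma measurable_finite_subset:
  fixes D :: "'w \<Rightarrow> nat set"
  assumes [measurable]: "\<And>a. Measurable.pred M (\<lambda>\<omega>. a \<in> D \<omega>)"
  shows "Measurable.pred M (\<lambda>\<omega>. set xs \<subseteq> D \<omega>)"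
  by (induction xs) auto

lemma measurable_big [measurable (raw)]:
  fixes D :: "'w \<Rightarrow> nat set"
  assumes [measurable]: "\<And>a. Measurable.pred M (\<lambda>\<omega>. a \<in> D \<omega>)"
  shows "Measurable.pred M (\<lambda>\<omega>. big k (D \<omega>))"
proof -
  note measurable_finite_subset[OF assms, measurable]
  have "(\<lambda>\<omega>. big k (D \<omega>)) = (\<lambda>\<omega>. \<exists>xs. card (set xs) = k \<and> set xs \<subseteq> D \<omega>)"
    unfolding big_def by (metis List.finite_set finite_list)
  then show ?thesis by simp
qed

lemma measurable_infinite [measurable (raw)]:
  fixes D :: "'w \<Rightarrow> nat set"
  assumes [measurable]: "\<And>a. Measurable.pred M (\<lambda>\<omega>. a \<in> D \<omega>)"
  shows "Measurable.pred M (\<lambda>\<omega>. infinite (D \<omega>))" "Measurable.pred M (\<lambda>\<omega>. finite (D \<omega>))"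
proof -
  show "Measurable.pred M (\<lambda>\<omega>. infinite (D \<omega>))" unfolding infinite_iff_big by measurable
  then show "Measurable.pred M (\<lambda>\<omega>. finite (D \<omega>))" by simp
qed

lemma measurable_card_random_set [measurable (raw)]:
  fixes D :: "'w \<Rightarrow> nat set"
  assumes [measurable]: "\<And>a. Measurable.pred M (\<lambda>\<omega>. a \<in> D \<omega>)"
  shows "(\<lambda>\<omega>. card (D \<omega>)) \<in> measurable M (count_space UNIV)"
proof (subst measurable_count_space_eq2_countable, safe)
  fix k :: nat
  \<comment> \<open>An infinite set has \<open>card\<close> 0 although it is \<open>big\<close> for
    all \<open>k\<close>, hence the separate case.\<close>
  have "card (D \<omega>) = k \<longleftrightarrow> (infinite (D \<omega>) \<and> k = 0) \<or> (finite (D \<omega>) \<and> big k (D \<omega>) \<and> \<not> big (Suc k) (D \<omega>))" for \<omega>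
    by (cases "finite (D \<omega>)") (auto simp: big_finite)
  then have "(\<lambda>\<omega>. card (D \<omega>)) -` {k} \<inter> space M = {\<omega> \<in> space M. (infinite (D \<omega>) \<and> k = 0) \<or> (finite (D \<omega>) \<and> big k (D \<omega>) \<and> \<not> big (Suc k) (D \<omega>))}"
    by (simp add: vimage_def Int_def conj_commute)
  also have "\<dots> \<in> sets M" by measurable
  finally show "(\<lambda>\<omega>. card (D \<omega>)) -` {k} \<inter> space M \<in> sets M" .
qed auto

text \<open>On an infinite set \<^const>\<open>Max\<close> is one fixed junk value, so no finiteness is needed.\<close>

lemma measurable_Max_random_set:
  fixes S :: "'w \<Rightarrow> nat set"
  assumes [measurable]: "\<And>a. Measurable.pred M (\<lambda>\<omega>. a \<in> S \<omega>)"
  shows "(\<lambda>\<omega>. Max (S \<omega>)) \<in> measurable M (count_space UNIV)"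
proof -
  obtain j where j: "\<And>A::nat set. infinite A \<Longrightarrow> Max A = j"
    by (simp add: Max.eq_fold' Finite_Set.fold_def)
  obtain j0 where j0: "Max ({}::nat set) = j0" by simp
  have eq: "Max (S \<omega>) = k \<longleftrightarrow> (infinite (S \<omega>) \<and> k = j) \<or> (finite (S \<omega>) \<and>
      ((\<forall>a. a \<notin> S \<omega>) \<and> k = j0 \<or> (k \<in> S \<omega> \<and> (\<forall>a. a \<in> S \<omega> \<longrightarrow> a \<le> k))))" for k \<omega>
  proof (cases "finite (S \<omega>)")
    case True
    show ?thesis
    proof (cases "S \<omega> = {}")
      case False
      with True show ?thesis by (auto simp: Max_eq_iff)
    qed (auto simp: j0)
  qed (auto simp: j)
  show ?thesis
  proof (subst measurable_count_space_eq2_countable, safe)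
    fix k :: nat
    have "(\<lambda>\<omega>. Max (S \<omega>)) -` {k} \<inter> space M = {\<omega> \<in> space M. (infinite (S \<omega>) \<and> k = j) \<or> (finite (S \<omega>) \<and>
      ((\<forall>a. a \<notin> S \<omega>) \<and> k = j0 \<or> (k \<in> S \<omega> \<and> (\<forall>a. a \<in> S \<omega> \<longrightarrow> a \<le> k))))}"
      using eq by auto
    also have "\<dots> \<in> sets M" by measurable
    finally show "(\<lambda>\<omega>. Max (S \<omega>)) -` {k} \<inter> space M \<in> sets M" .
  qed auto
qed

lemma measurable_largest_component_size [measurable (raw)]:
  fixes R :: "'w \<Rightarrow> nat \<Rightarrow> nat \<Rightarrow> bool" and V :: "'w \<Rightarrow> nat set"
  assumes [measurable]: "\<And>a b. Measurable.pred M (\<lambda>\<omega>. R \<omega> a b)" "\<And>a. Measurable.pred M (\<lambda>\<omega>. a \<in> V \<omega>)"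
  shows "(\<lambda>\<omega>. largest_component_size (R \<omega>) (V \<omega>)) \<in> measurable M (count_space UNIV)"
  unfolding largest_component_size_def
proof (rule measurable_Max_random_set)
  fix a
  have [measurable]: "(\<lambda>\<omega>. card (component (R \<omega>) (V \<omega>) v)) \<in> measurable M (count_space UNIV)" for v
    by measurable
  have "(\<lambda>\<omega>. a \<in> insert 0 ((\<lambda>v. card (component (R \<omega>) (V \<omega>) v)) ` V \<omega>)) =
    (\<lambda>\<omega>. a = 0 \<or> (\<exists>v. v \<in> V \<omega> \<and> card (component (R \<omega>) (V \<omega>) v) = a))"
    by (auto simp: fun_eq_iff)
  then show "Measurable.pred M (\<lambda>\<omega>. a \<in> insert 0 ((\<lambda>v. card (component (R \<omega>) (V \<omega>) v)) ` V \<omega>))"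
    by simp
qed

section \<open>Counting\<close>

text \<open>The counting measure as an extended number. In contrast to \<open>card\<close> it is
  monotone and continuous along increasing sets without finiteness conditions, and its expectation
  is a sum over the indices.\<close>

definition ncard :: "nat set \<Rightarrow> ennreal" where
  "ncard D = (\<Sum>i. indicator D i)"

lemma ncard_finite: "finite D \<Longrightarrow> ncard D = of_nat (card D)"
proof -
  assume D: "finite D"
  have "(\<Sum>i. indicator D i) = (\<Sum>i\<in>D. (indicator D i :: ennreal))"
    using D by (intro suminf_finite) (auto simp: indicator_def)
  also have "\<dots> = of_nat (card D)" by simp
  finally show ?thesis by (simp add: ncard_def)
qed

lemma ncard_mono: "D \<subseteq> D' \<Longrightarrow> ncard D \<le> ncard D'"
  unfolding ncard_def by (intro suminf_le) (auto simp: indicator_def)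

lemma measurable_ncard [measurable (raw)]:
  assumes [measurable]: "\<And>a. Measurable.pred M (\<lambda>\<omega>. a \<in> D \<omega>)"
  shows "(\<lambda>\<omega>. ncard (D \<omega>)) \<in> borel_measurable M"
  unfolding ncard_def by measurable

lemma ncard_eq_nn_integral: "ncard D = (\<integral>\<^sup>+i. indicator D i \<partial>count_space UNIV)"
  by (simp add: ncard_def nn_integral_count_space_nat)

lemma nn_integral_ncard:
  assumes [measurable]: "\<And>a. Measurable.pred M (\<lambda>\<omega>. a \<in> D \<omega>)"
  shows "(\<integral>\<^sup>+\<omega>. ncard (D \<omega>) \<partial>M) = (\<Sum>i. emeasure M {\<omega> \<in> space M. i \<in> D \<omega>})"
proof -
  have *: "(\<integral>\<^sup>+\<omega>. ncard (D \<omega>) \<partial>M) = (\<Sum>i. \<integral>\<^sup>+\<omega>. indicator (D \<omega>) i \<partial>M)"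
    unfolding ncard_def by (intro nn_integral_suminf) measurable
  have "(\<integral>\<^sup>+\<omega>. indicator (D \<omega>) i \<partial>M) = emeasure M {\<omega> \<in> space M. i \<in> D \<omega>}" for i
  proof -
    have "(\<integral>\<^sup>+\<omega>. indicator (D \<omega>) i \<partial>M) = (\<integral>\<^sup>+\<omega>. indicator {\<omega> \<in> space M. i \<in> D \<omega>} \<omega> \<partial>M)"
      by (intro nn_integral_cong) (auto split: split_indicator)
    then show ?thesis by simp
  qed
  then show ?thesis unfolding * by simp
qed

lemma ncard_Un_le: "ncard (A \<union> B) \<le> ncard A + ncard B"
proof -
  have ncard_em: "ncard S = emeasure (count_space UNIV) S" for S
    by (simp add: ncard_eq_nn_integral)
  show ?thesis unfolding ncard_em by (rule emeasure_subadditive) auto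
qed

section \<open>Poisson point processes\<close>

definition points_in :: "(nat \<Rightarrow> 'a) \<Rightarrow> 'a set \<Rightarrow> nat set" where
  "points_in x B = {i. x i \<in> B}"

lemma points_in_iff [simp]: "i \<in> points_in x B \<longleftrightarrow> x i \<in> B"
  by (simp add: points_in_def)

definition pois :: "real \<Rightarrow> nat \<Rightarrow> real" where
  "pois v k = v ^ k / fact k * exp (- v)"

lemma pois_nonneg [simp]: "0 \<le> v \<Longrightarrow> 0 \<le> pois v k"
  by (simp add: pois_def)

lemma measurable_pred_points_in [measurable (raw)]:
  assumes [measurable]: "\<And>i. (\<lambda>\<omega>. X i \<omega>) \<in> borel_measurable M" "B \<in> sets borel"
  shows "Measurable.pred M (\<lambda>\<omega>. i \<in> points_in (\<lambda>i. X i \<omega>) B)"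
  by simp

lemma separating_sequence:
  obtains U :: "nat \<Rightarrow> 'a::euclidean_space set"
  where "\<And>i. U i \<in> sets borel" "\<And>x y. x \<noteq> y \<Longrightarrow> \<exists>i. x \<in> U i \<and> y \<notin> U i"
proof -
  obtain \<B> :: "'a set set" where \<B>: "countable \<B>" "topological_basis \<B>"
    using ex_countable_basis by auto
  have ne: "\<B> \<noteq> {}" using \<B>(2) topological_basisE[of \<B> UNIV undefined] by auto
  have "\<exists>i. x \<in> from_nat_into \<B> i \<and> y \<notin> from_nat_into \<B> i" if "x \<noteq> y" for x y
  proof -
    have "open (- {y})" "x \<in> - {y}" using that by auto
    from topological_basisE[OF \<B>(2) this] obtain O' where "O' \<in> \<B>" "x \<in> O'" "O' \<subseteq> - {y}" by auto
    moreover obtain i where "from_nat_into \<B> i = O'"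
      using from_nat_into_surj[OF \<B>(1) \<open>O' \<in> \<B>\<close>] by auto
    ultimately show ?thesis by auto
  qed
  moreover have "from_nat_into \<B> i \<in> sets borel" for i
    using topological_basis_open[OF \<B>(2) from_nat_into[OF ne]] by auto
  ultimately show ?thesis using that by blast
qed

text \<open>The cells are the level sets of this function: the finite partition generated by the
  first \<open>r\<close> sets of \<open>U\<close>. For a separating sequence of Borel sets these
  partitions are Borel, get finer with \<open>r\<close> and eventually separate any two
  points.\<close>

definition cell_of :: "(nat \<Rightarrow> 'a set) \<Rightarrow> nat \<Rightarrow> 'a \<Rightarrow> nat set" where
  "cell_of U r x = {i. i < r \<and> x \<in> U i}"

lemma cell_of_in_Pow: "cell_of U r x \<in> Pow {..<r}"
  by (auto simp: cell_of_def)

lemma cell_of_refine: "r \<le> s \<Longrightarrow> cell_of U s x = cell_of U s y \<Longrightarrow> cell_of U r x = cell_of U r y"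
proof -
  assume "r \<le> s" "cell_of U s x = cell_of U s y"
  moreover have "cell_of U r z = cell_of U s z \<inter> {..<r}" if "r \<le> s" for z
    using that by (auto simp: cell_of_def)
  ultimately show ?thesis by simp
qed

lemma cell_of_separates:
  assumes "\<And>x y. x \<noteq> y \<Longrightarrow> \<exists>i. x \<in> U i \<and> y \<notin> U i" "x \<noteq> y"
  shows "\<exists>r. cell_of U r x \<noteq> cell_of U r y"
proof -
  obtain i where "x \<in> U i" "y \<notin> U i" using assms by blast
  then have "i \<in> cell_of U (Suc i) x" "i \<notin> cell_of U (Suc i) y" by (auto simp: cell_of_def)
  then show ?thesis by metis
qed

lemma sets_cell_of [measurable]:
  assumes [measurable]: "\<And>i. U i \<in> sets borel"
  shows "{x. cell_of U r x = c} \<in> sets borel"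
proof (cases "c \<subseteq> {..<r}")
  case True
  then have "{x. cell_of U r x = c} = {x \<in> space borel. \<forall>i\<in>{..<r}. x \<in> U i \<longleftrightarrow> i \<in> c}"
    by (auto simp: cell_of_def)
  also have "\<dots> \<in> sets borel" by measurable
  finally show ?thesis .
next
  case False
  then have "{x. cell_of U r x = c} = {}" by (auto simp: cell_of_def)
  then show ?thesis by (simp only: sets.empty_sets)
qed

section \<open>Counts of a Poisson process and almost sure distinctness of its points\<close>

locale poisson_process = prob_space M
  for M :: "'w measure" +
  fixes X :: "nat \<Rightarrow> 'w \<Rightarrow> 'a::euclidean_space"
  assumes ppp: "poisson_point_process M X"
begin

abbreviation pts :: "'w \<Rightarrow> nat \<Rightarrow> 'a" where
  "pts \<omega> \<equiv> (\<lambda>i. X i \<omega>)"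

lemma measurable_point [measurable]: "X i \<in> borel_measurable M"
  using ppp by (simp add: poisson_point_process_def)

lemma measurable_pts [measurable]: "pts \<in> measurable M (PiM UNIV (\<lambda>_. borel))"
  by (rule measurable_PiM_UNIV) (rule measurable_point)

lemma AE_finite_points_in:
  assumes "bounded B"
  shows "AE \<omega> in M. finite (points_in (pts \<omega>) B)"
proof -
  obtain r where r: "B \<subseteq> cball 0 r" using bounded_subset_ballD[OF assms, of 0] ball_subset_cball by blast
  have "AE \<omega> in M. \<forall>r. finite {i. X i \<omega> \<in> cball 0 r}"
    using ppp by (simp add: poisson_point_process_def)
  then show ?thesis
  proof eventually_elim
    case (elim \<omega>)
    then show ?case using r by (auto simp: points_in_def intro: finite_subset[of _ "{i. X i \<omega> \<in> cball 0 r}"])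
  qed
qed

lemma emeasure_lborel_bounded:
  assumes "bounded B" "B \<in> sets borel"
  shows "emeasure lborel B = ennreal (measure lborel B)"
  using emeasure_bounded_finite[OF assms(1)] by (simp add: emeasure_eq_ennreal_measure)

lemma prob_card_points_in:
  assumes "A \<in> sets borel" "bounded A"
  shows "prob {\<omega> \<in> space M. card (points_in (pts \<omega>) A) = k} = pois (measure lborel A) k"
proof -
  have "\<forall>A\<in>sets borel. emeasure lborel A < \<infinity> \<longrightarrow> (\<forall>k. measure M {\<omega> \<in> space M. card {i. X i \<omega> \<in> A} = k}
             = measure lborel A ^ k / fact k * exp (- measure lborel A))"
    using ppp unfolding poisson_point_process_def by (elim conjE)
  from this[rule_format, OF assms(1) emeasure_bounded_finite[OF assms(2)]] show ?thesis
    by (simp only: pois_def points_in_def)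
qed

lemma prob_counts:
  fixes m :: nat
  assumes A: "\<And>l. l < m \<Longrightarrow> A l \<in> sets borel" "\<And>l. l < m \<Longrightarrow> bounded (A l)"
    and disj: "disjoint_family_on A {..<m}"
  shows "prob {\<omega> \<in> space M. \<forall>l<m. card (points_in (pts \<omega>) (A l)) = k l} = (\<Prod>l<m. pois (measure lborel (A l)) (k l))"
proof (cases "m = 0")
  case True
  then show ?thesis by (simp add: prob_space)
next
  case False
  have ind: "indep_vars (\<lambda>_. count_space UNIV) (\<lambda>l \<omega>. card {i. X i \<omega> \<in> A l}) {..<m}"
    using ppp A disj emeasure_bounded_finite unfolding poisson_point_process_def by blast
  have "prob (\<Inter>l\<in>{..<m}. (\<lambda>\<omega>. card {i. X i \<omega> \<in> A l}) -` {k l} \<inter> space M)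
      = (\<Prod>l<m. prob ((\<lambda>\<omega>. card {i. X i \<omega> \<in> A l}) -` {k l} \<inter> space M))"
    using False by (intro indep_varsD[OF ind]) auto
  moreover have "(\<Inter>l\<in>{..<m}. (\<lambda>\<omega>. card {i. X i \<omega> \<in> A l}) -` {k l} \<inter> space M)
     = {\<omega> \<in> space M. \<forall>l<m. card (points_in (pts \<omega>) (A l)) = k l}"
    using False by (auto simp: points_in_def)
  moreover have "prob ((\<lambda>\<omega>. card {i. X i \<omega> \<in> A l}) -` {k l} \<inter> space M) = pois (measure lborel (A l)) (k l)"
    if "l < m" for l
  proof -
    have "(\<lambda>\<omega>. card {i. X i \<omega> \<in> A l}) -` {k l} \<inter> space M = {\<omega> \<in> space M. card (points_in (pts \<omega>) (A l)) = k l}"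
      by (auto simp: points_in_def)
    then show ?thesis using prob_card_points_in A that by simp
  qed
  ultimately show ?thesis by simp
qed

text \<open>From \<open>1 - exp (- v) * (1 + v) \<le> v\<^sup>2\<close>. The bound is quadratic in
  the volume, so its sum over the cells of a fine partition is small.\<close>

lemma prob_two_points:
  assumes A[measurable]: "A \<in> sets borel" and "bounded A"
  shows "prob {\<omega> \<in> space M. 2 \<le> card (points_in (pts \<omega>) A)} \<le> (measure lborel A)\<^sup>2"
proof -
  let ?v = "measure lborel A"
  let ?E = "\<lambda>k. {\<omega> \<in> space M. card (points_in (pts \<omega>) A) = k}"
  have [measurable]: "?E k \<in> events" for k by measurable
  have "{\<omega> \<in> space M. 2 \<le> card (points_in (pts \<omega>) A)} = space M - (?E 0 \<union> ?E 1)" by auto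
  moreover have "prob (?E 0 \<union> ?E 1) = prob (?E 0) + prob (?E 1)"
    by (rule finite_measure_Union) auto
  ultimately have "prob {\<omega> \<in> space M. 2 \<le> card (points_in (pts \<omega>) A)} = 1 - (pois ?v 0 + pois ?v 1)"
    using prob_card_points_in[OF assms] by (simp add: prob_compl)
  also have "\<dots> = 1 - exp (- ?v) * (1 + ?v)" by (simp add: pois_def algebra_simps)
  also have "\<dots> \<le> 1 - (1 - ?v) * (1 + ?v)"
    using exp_ge_add_one_self[of "- ?v"] by (intro diff_left_mono mult_right_mono) auto
  also have "\<dots> = ?v\<^sup>2" by (simp add: algebra_simps power2_eq_square)
  finally show ?thesis .
qed

text \<open>Coinciding points share a cell of every partition. The union bound over the cells gives
  the sum of their squared volumes, which is the volume in the product space of \<open>?D r\<close>,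
  the union of the squares of the cells.\<close>

lemma AE_simple: "AE \<omega> in M. \<forall>i j. X i \<omega> = X j \<omega> \<longrightarrow> i = j"
proof -
  obtain U :: "nat \<Rightarrow> 'a set" where U[measurable]: "\<And>i. U i \<in> sets borel"
    and sep: "\<And>x y. x \<noteq> y \<Longrightarrow> \<exists>i. x \<in> U i \<and> y \<notin> U i"
    using separating_sequence by blast
  have "AE \<omega> in M. \<forall>i j. X i \<omega> \<in> B \<longrightarrow> X i \<omega> = X j \<omega> \<longrightarrow> i = j" if B: "B = cball 0 (real n)" for B n
  proof -
    have [measurable]: "B \<in> sets borel" and bB: "bounded B" by (auto simp: B)
    let ?C = "\<lambda>r c. B \<inter> {x. cell_of U r x = c}"
    let ?D = "\<lambda>r. {z \<in> space (lborel \<Otimes>\<^sub>M lborel). fst z \<in> B \<and> snd z \<in> B \<and> (\<forall>i\<in>{..<r}. fst z \<in> U i \<longleftrightarrow> snd z \<in> U i)}"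
    let ?N = "{\<omega> \<in> space M. \<exists>i j. X i \<omega> \<in> B \<and> X i \<omega> = X j \<omega> \<and> i \<noteq> j}"
    have bC: "bounded (?C r c)" for r c using bB by (rule bounded_subset) auto
    have D: "?D r = (\<Union>c\<in>Pow {..<r}. ?C r c \<times> ?C r c)" for r
      by (auto simp: cell_of_def space_pair_measure)
    have Dm: "?D r \<in> sets (lborel \<Otimes>\<^sub>M lborel)" for r
      unfolding D by (intro sets.finite_UN pair_measureI) auto
    have emD: "emeasure (lborel \<Otimes>\<^sub>M lborel) (?D r) = (\<Sum>c\<in>Pow {..<r}. ennreal ((measure lborel (?C r c))\<^sup>2))" for r
    proof -
      have "emeasure (lborel \<Otimes>\<^sub>M lborel) (?D r) = (\<Sum>c\<in>Pow {..<r}. emeasure (lborel \<Otimes>\<^sub>M lborel) (?C r c \<times> ?C r c))"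
        unfolding D by (intro sum_emeasure[symmetric]) (auto simp: disjoint_family_on_def)
      also have "\<dots> = (\<Sum>c\<in>Pow {..<r}. ennreal ((measure lborel (?C r c))\<^sup>2))"
        by (intro sum.cong) (auto simp: lborel.emeasure_pair_measure_Times emeasure_lborel_bounded[OF bC] power2_eq_square ennreal_mult)
      finally show ?thesis .
    qed
    have le: "emeasure M ?N \<le> emeasure (lborel \<Otimes>\<^sub>M lborel) (?D r)" for r
    proof -
      have "emeasure M ?N \<le> emeasure M (\<Union>c\<in>Pow {..<r}. {\<omega> \<in> space M. 2 \<le> card (points_in (pts \<omega>) (?C r c))})"
      proof (rule emeasure_mono_AE)
        show "AE \<omega> in M. \<omega> \<in> ?N \<longrightarrow> \<omega> \<in> (\<Union>c\<in>Pow {..<r}. {\<omega> \<in> space M. 2 \<le> card (points_in (pts \<omega>) (?C r c))})"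
          using AE_finite_points_in[OF bB]
        proof eventually_elim
          case (elim \<omega>)
          show ?case
          proof
            assume "\<omega> \<in> ?N"
            then obtain i j where ij: "X i \<omega> \<in> B" "X i \<omega> = X j \<omega>" "i \<noteq> j" "\<omega> \<in> space M" by auto
            let ?c = "cell_of U r (X i \<omega>)"
            have fin: "finite (points_in (pts \<omega>) (?C r ?c))" using elim by (rule rev_finite_subset) auto
            have "{i, j} \<subseteq> points_in (pts \<omega>) (?C r ?c)" using ij by auto
            from card_mono[OF fin this] have "2 \<le> card (points_in (pts \<omega>) (?C r ?c))" using ij by simp
            then show "\<omega> \<in> (\<Union>c\<in>Pow {..<r}. {\<omega> \<in> space M. 2 \<le> card (points_in (pts \<omega>) (?C r c))})"
              using cell_of_in_Pow[of U r "X i \<omega>"] ij by blast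
          qed
        qed
      qed (intro sets.finite_UN, auto)
      also have "\<dots> \<le> (\<Sum>c\<in>Pow {..<r}. emeasure M {\<omega> \<in> space M. 2 \<le> card (points_in (pts \<omega>) (?C r c))})"
        by (rule emeasure_subadditive_finite) auto
      also have "\<dots> \<le> (\<Sum>c\<in>Pow {..<r}. ennreal ((measure lborel (?C r c))\<^sup>2))"
        by (intro sum_mono) (simp add: emeasure_eq_measure prob_two_points bC)
      finally show ?thesis by (simp add: emD)
    qed
    \<comment> \<open>The squares of the cells decrease to the diagonal of \<open>B\<close>, and
      their volumes are finite; the diagonal is a null set by Fubini.\<close>
    have "(\<lambda>r. emeasure (lborel \<Otimes>\<^sub>M lborel) (?D r)) \<longlonglongrightarrow> emeasure (lborel \<Otimes>\<^sub>M lborel) (\<Inter>r. ?D r)"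
    proof (rule Lim_emeasure_decseq)
      show "emeasure (lborel \<Otimes>\<^sub>M lborel) (?D r) \<noteq> \<infinity>" for r unfolding emD by simp
      show "range ?D \<subseteq> sets (lborel \<Otimes>\<^sub>M lborel)" using Dm by blast
      show "decseq ?D" by (auto simp: decseq_def)
    qed
    moreover have "emeasure (lborel \<Otimes>\<^sub>M lborel) (\<Inter>r. ?D r) = 0"
    proof -
      have eq: "(\<Inter>r. ?D r) = {z \<in> space (lborel \<Otimes>\<^sub>M lborel). fst z \<in> B \<and> fst z = snd z}"
      proof -
        have "x = y" if "\<And>r. \<forall>i\<in>{..<r}. x \<in> U i \<longleftrightarrow> y \<in> U i" for x y
        proof (rule ccontr)
          assume "x \<noteq> y"
          then obtain i where "x \<in> U i" "y \<notin> U i" using sep by blast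
          then show False using that[of "Suc i"] by simp
        qed
        note * = this
        show ?thesis
        proof (intro set_eqI iffI)
          fix z :: "'a \<times> 'a" assume z: "z \<in> (\<Inter>r. ?D r)"
          then have "fst z = snd z" by (intro *) blast
          then show "z \<in> {z \<in> space (lborel \<Otimes>\<^sub>M lborel). fst z \<in> B \<and> fst z = snd z}"
            using z by simp
        qed auto
      qed
      have "emeasure (lborel \<Otimes>\<^sub>M lborel) {z \<in> space (lborel \<Otimes>\<^sub>M lborel). fst z \<in> B \<and> fst z = (snd z::'a)} =
        (\<integral>\<^sup>+x. emeasure lborel (Pair x -` {z \<in> space (lborel \<Otimes>\<^sub>M lborel). fst z \<in> B \<and> fst z = (snd z::'a)}) \<partial>lborel)"
        by (rule lborel.emeasure_pair_measure_alt) measurable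
      also have "\<dots> = (\<integral>\<^sup>+x. 0 \<partial>(lborel::'a measure))"
      proof (intro nn_integral_cong)
        fix x :: 'a
        have "emeasure lborel (Pair x -` {z \<in> space (lborel \<Otimes>\<^sub>M lborel). fst z \<in> B \<and> fst z = (snd z::'a)}) \<le> emeasure lborel {x}"
          by (intro emeasure_mono) auto
        then show "emeasure lborel (Pair x -` {z \<in> space (lborel \<Otimes>\<^sub>M lborel). fst z \<in> B \<and> fst z = (snd z::'a)}) = 0" by simp
      qed
      finally show ?thesis unfolding eq by simp
    qed
    ultimately have "(\<lambda>r. emeasure (lborel \<Otimes>\<^sub>M lborel) (?D r)) \<longlonglongrightarrow> 0" by simp
    then have "emeasure M ?N \<le> 0" by (rule LIMSEQ_le_const) (use le in auto)
    then have "emeasure M ?N = 0" by simp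
    then show ?thesis by (intro AE_I[of _ _ ?N]) auto
  qed
  then have "AE \<omega> in M. \<forall>n. \<forall>i j. X i \<omega> \<in> cball 0 (real n) \<longrightarrow> X i \<omega> = X j \<omega> \<longrightarrow> i = j"
    by (subst AE_all_countable) auto
  then show ?thesis
  proof eventually_elim
    case (elim \<omega>)
    show ?case
    proof safe
      fix i j assume "X i \<omega> = X j \<omega>"
      moreover obtain n where "norm (X i \<omega>) \<le> real n" using real_arch_simple by blast
      ultimately show "i = j" using elim by auto
    qed
  qed
qed

end

section \<open>Laws of tuples of distinct points\<close>

lemma measure_lborel_positive_bounded:
  assumes "bounded B" "B \<in> sets borel" "0 < measure lborel (B::'a::euclidean_space set)"
  shows "emeasure lborel B \<noteq> 0" "emeasure lborel B \<noteq> \<infinity>"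
  using assms emeasure_bounded_finite[OF assms(1)]
  by (auto simp: measure_def)

lemma AE_uniform_distinct:
  fixes B :: "'a::euclidean_space set" and m :: nat
  assumes B: "bounded B" "B \<in> sets borel" "0 < measure lborel B"
  shows "AE y in PiM (UNIV :: nat set) (\<lambda>_. uniform_measure lborel B). inj_on y {..<m}"
proof -
  let ?U = "uniform_measure lborel B"
  let ?Y = "PiM (UNIV :: nat set) (\<lambda>_. ?U)"
  note nz = measure_lborel_positive_bounded[OF B]
  have U: "prob_space ?U" using nz by (intro prob_space_uniform_measure) auto
  have "AE y in ?Y. y i \<noteq> y j" if "i \<noteq> j" for i j
  proof (rule AE_I')
    let ?E = "{y \<in> space ?Y. y i = y j}"
    have E[measurable]: "?E \<in> sets ?Y" by measurable
    have "emeasure ?Y ?E = (\<integral>\<^sup>+y. indicator ?E y \<partial>?Y)" using E by simp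
    also have "\<dots> = (\<integral>\<^sup>+y. \<integral>\<^sup>+a. indicator ?E (fun_upd y i a) \<partial>?U \<partial>?Y)"
      by (rule nn_integral_PiM_resample[OF U]) measurable
    also have "\<dots> \<le> (\<integral>\<^sup>+y. 0 \<partial>?Y)"
    proof (intro nn_integral_mono)
      fix y :: "nat \<Rightarrow> 'a"
      have "(\<integral>\<^sup>+a. indicator ?E (fun_upd y i a) \<partial>?U) \<le> (\<integral>\<^sup>+a. indicator {y j} a \<partial>?U)"
        using that by (intro nn_integral_mono) (auto split: split_indicator)
      also have "\<dots> = emeasure ?U {y j}" by simp
      also have "\<dots> = 0"
      proof -
        have "emeasure lborel (B \<inter> {y j}) \<le> emeasure lborel {y j}" by (intro emeasure_mono) auto
        then have "emeasure lborel (B \<inter> {y j}) = 0" by simp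
        then show ?thesis using B by simp
      qed
      finally show "(\<integral>\<^sup>+a. indicator ?E (fun_upd y i a) \<partial>?U) \<le> 0" .
    qed
    finally show "{y \<in> space ?Y. y i = y j} \<in> null_sets ?Y"
      using E by (simp add: null_sets_def)
  qed auto
  then have "AE y in ?Y. \<forall>i j. i \<noteq> j \<longrightarrow> y i \<noteq> y j"
    by (simp add: AE_all_countable)
  then show ?thesis by eventually_elim (auto simp: inj_on_def)
qed

text \<open>Independence of counts gives information on rectangles with disjoint sides only. These
  suffice: off the diagonals, which are null for both measures, any rectangle is an increasing union
  of finite disjoint unions of rectangles with disjoint sides, cut out by finer and finer
  cells.\<close>

lemma AE_count_space_PiM_finite_eqI:
  fixes P Q :: "(nat \<Rightarrow> 'a::euclidean_space) measure" and m :: nat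
  assumes sets: "sets P = sets (PiM {..<m} (\<lambda>_. borel))" "sets Q = sets (PiM {..<m} (\<lambda>_. borel))"
    and fin: "emeasure P (space P) \<noteq> \<infinity>"
    and inj: "AE z in P. inj_on z {..<m}" "AE z in Q. inj_on z {..<m}"
    and eq: "\<And>A. (\<And>j. j < m \<Longrightarrow> A j \<in> sets borel) \<Longrightarrow> disjoint_family_on A {..<m} \<Longrightarrow>
      emeasure P (Pi\<^sub>E {..<m} A) = emeasure Q (Pi\<^sub>E {..<m} A)"
  shows "P = Q"
proof (rule measure_eqI_PiM_finite[OF _ sets])
  let ?N = "PiM {..<m} (\<lambda>_. borel :: 'a measure)"
  show "range (\<lambda>_::nat. \<Pi>\<^sub>E i\<in>{..<m}. UNIV) \<subseteq> prod_algebra {..<m} (\<lambda>_. borel :: 'a measure)"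
    by (auto intro!: prod_algebraI_finite)
  show "(\<Union>i::nat. (\<Pi>\<^sub>E i\<in>{..<m}. UNIV)) = space ?N" by (simp add: space_PiM)
  show "emeasure P (\<Pi>\<^sub>E i\<in>{..<m}. UNIV) \<noteq> \<infinity>"
    using fin sets_eq_imp_space_eq[OF sets(1)] by (simp add: space_PiM)
  fix A :: "nat \<Rightarrow> 'a set" assume "\<And>i. i \<in> {..<m} \<Longrightarrow> A i \<in> sets borel"
  then have A[measurable]: "\<And>i. i < m \<Longrightarrow> A i \<in> sets borel" by simp
  obtain U :: "nat \<Rightarrow> 'a set" where U[measurable]: "\<And>i. U i \<in> sets borel"
    and sep: "\<And>x y. x \<noteq> y \<Longrightarrow> \<exists>i. x \<in> U i \<and> y \<notin> U i"
    using separating_sequence by blast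
  \<comment> \<open>The possible ways to place the \<open>m\<close> coordinates into pairwise
    different cells of the partition of level \<open>r\<close>.\<close>
  define K where "K = (\<lambda>r::nat. {\<kappa> \<in> {..<m} \<rightarrow>\<^sub>E Pow {..<r}. inj_on \<kappa> {..<m}})"
  define G where "G = (\<lambda>r \<kappa>. \<Pi>\<^sub>E j\<in>{..<m}. A j \<inter> {x. cell_of U r x = \<kappa> j})"
  define R where "R = (\<lambda>r. \<Union>\<kappa>\<in>K r. G r \<kappa>)"
  have finK: "finite (K r)" for r unfolding K_def by (rule finite_subset[of _ "{..<m} \<rightarrow>\<^sub>E Pow {..<r}"]) (auto intro!: finite_PiE)
  have G[measurable]: "G r \<kappa> \<in> sets ?N" for r \<kappa> unfolding G_def by (intro sets_PiM_I_finite) auto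
  have R[measurable]: "R r \<in> sets ?N" for r unfolding R_def using finK by (intro sets.finite_UN) auto
  have R_alt: "R r = {z \<in> Pi\<^sub>E {..<m} A. inj_on (\<lambda>j. cell_of U r (z j)) {..<m}}" for r
  proof (intro set_eqI iffI)
    fix z assume "z \<in> R r"
    then obtain \<kappa> where "\<kappa> \<in> K r" "z \<in> G r \<kappa>" by (auto simp: R_def)
    then show "z \<in> {z \<in> Pi\<^sub>E {..<m} A. inj_on (\<lambda>j. cell_of U r (z j)) {..<m}}"
      by (auto simp: G_def K_def PiE_iff inj_on_def)
  next
    fix z assume z: "z \<in> {z \<in> Pi\<^sub>E {..<m} A. inj_on (\<lambda>j. cell_of U r (z j)) {..<m}}"
    define \<kappa> where "\<kappa> = (\<lambda>j\<in>{..<m}. cell_of U r (z j))"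
    have "\<kappa> \<in> K r" using z cell_of_in_Pow[of U r] by (auto simp: \<kappa>_def K_def inj_on_def)
    moreover have "z \<in> G r \<kappa>" using z by (auto simp: \<kappa>_def G_def PiE_iff)
    ultimately show "z \<in> R r" by (auto simp: R_def)
  qed
  have disj: "disjoint_family_on (G r) (K r)" for r
    unfolding disjoint_family_on_def
  proof (intro ballI impI)
    fix \<kappa> \<kappa>' assume *: "\<kappa> \<in> K r" "\<kappa>' \<in> K r" "\<kappa> \<noteq> \<kappa>'"
    show "G r \<kappa> \<inter> G r \<kappa>' = {}"
    proof (rule ccontr)
      assume "G r \<kappa> \<inter> G r \<kappa>' \<noteq> {}"
      then obtain z where z: "z \<in> G r \<kappa>" "z \<in> G r \<kappa>'" by auto
      have "\<kappa> j = \<kappa>' j" for j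
      proof (cases "j < m")
        case True
        then show ?thesis using z by (auto simp: G_def PiE_iff)
      next
        case False
        then show ?thesis using * PiE_arb[of \<kappa> "{..<m}" _ j] PiE_arb[of \<kappa>' "{..<m}" _ j] by (auto simp: K_def)
      qed
      with * show False by auto
    qed
  qed
  have eqR: "emeasure P (R r) = emeasure Q (R r)" for r
  proof -
    have "emeasure P (G r \<kappa>) = emeasure Q (G r \<kappa>)" if "\<kappa> \<in> K r" for \<kappa>
      unfolding G_def
    proof (rule eq)
      show "disjoint_family_on (\<lambda>j. A j \<inter> {x. cell_of U r x = \<kappa> j}) {..<m}"
        using that by (auto simp: disjoint_family_on_def K_def inj_on_def)
    qed auto
    moreover have "emeasure P (R r) = (\<Sum>\<kappa>\<in>K r. emeasure P (G r \<kappa>))"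
      unfolding R_def using disj finK by (intro sum_emeasure[symmetric]) (auto simp: sets)
    moreover have "emeasure Q (R r) = (\<Sum>\<kappa>\<in>K r. emeasure Q (G r \<kappa>))"
      unfolding R_def using disj finK by (intro sum_emeasure[symmetric]) (auto simp: sets)
    ultimately show ?thesis by simp
  qed
  have inc: "incseq R"
  proof (rule incseq_SucI)
    fix r
    have "cell_of U r x = cell_of U r y" if "cell_of U (Suc r) x = cell_of U (Suc r) y" for x y
      by (rule cell_of_refine[OF _ that]) simp
    then show "R r \<subseteq> R (Suc r)" unfolding R_alt inj_on_def by blast
  qed
  have union: "(\<Union>r. R r) = {z \<in> Pi\<^sub>E {..<m} A. inj_on z {..<m}}"
  proof (intro set_eqI iffI)
    fix z assume "z \<in> (\<Union>r. R r)"
    then show "z \<in> {z \<in> Pi\<^sub>E {..<m} A. inj_on z {..<m}}"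
      unfolding R_alt by (auto simp: inj_on_def)
  next
    fix z assume z: "z \<in> {z \<in> Pi\<^sub>E {..<m} A. inj_on z {..<m}}"
    have "\<exists>r. i < m \<longrightarrow> j < m \<longrightarrow> i \<noteq> j \<longrightarrow> cell_of U r (z i) \<noteq> cell_of U r (z j)" for i j
    proof (cases "i < m \<and> j < m \<and> i \<noteq> j")
      case True
      then have "z i \<noteq> z j" using z by (auto simp: inj_on_def)
      from cell_of_separates[OF sep this] show ?thesis by blast
    qed auto
    then obtain \<rho> where \<rho>: "\<And>i j. i < m \<Longrightarrow> j < m \<Longrightarrow> i \<noteq> j \<Longrightarrow> cell_of U (\<rho> i j) (z i) \<noteq> cell_of U (\<rho> i j) (z j)"
      by metis
    \<comment> \<open>A level at which all pairs of coordinates have been separated; cells only get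
      finer, so each separation persists.\<close>
    define r where "r = Max (insert 0 ((\<lambda>(i, j). \<rho> i j) ` ({..<m} \<times> {..<m})))"
    have le: "\<rho> i j \<le> r" if "i < m" "j < m" for i j
      unfolding r_def using that by (intro Max_ge) auto
    have "inj_on (\<lambda>j. cell_of U r (z j)) {..<m}"
    proof (rule inj_onI, rule ccontr)
      fix i j assume ij: "i \<in> {..<m}" "j \<in> {..<m}" "cell_of U r (z i) = cell_of U r (z j)" "i \<noteq> j"
      then have "cell_of U (\<rho> i j) (z i) = cell_of U (\<rho> i j) (z j)"
        by (intro cell_of_refine[OF le]) auto
      then show False using \<rho>[of i j] ij by auto
    qed
    then have "z \<in> R r" unfolding R_alt using z by auto
    then show "z \<in> (\<Union>r. R r)" by blast
  qed
  have *: "emeasure P' (Pi\<^sub>E {..<m} A) = (SUP r. emeasure P' (R r))"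
    if "AE z in P'. inj_on z {..<m}" and s: "sets P' = sets ?N" for P'
  proof -
    have [simp]: "Pi\<^sub>E {..<m} A \<in> sets P'" unfolding s by (intro sets_PiM_I_finite) auto
    have "(SUP r. emeasure P' (R r)) = emeasure P' (\<Union>r. R r)"
      by (intro SUP_emeasure_incseq inc) (auto simp: s)
    also have "\<dots> = emeasure P' (Pi\<^sub>E {..<m} A)"
    proof (rule emeasure_eq_AE)
      show "AE z in P'. z \<in> (\<Union>r. R r) \<longleftrightarrow> z \<in> Pi\<^sub>E {..<m} A"
        unfolding union using that(1) by eventually_elim auto
      show "(\<Union>r. R r) \<in> sets P'" by (simp add: s)
    qed simp
    finally show ?thesis by simp
  qed
  show "emeasure P (Pi\<^sub>E {..<m} A) = emeasure Q (Pi\<^sub>E {..<m} A)"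
    using *[OF inj(1) sets(1)] *[OF inj(2) sets(2)] eqR by simp
qed simp

section \<open>Conditional uniformity of the points in a bounded set\<close>

context poisson_process
begin

text \<open>The weight \<open>\<psi>\<close> factorises from all counts in disjoint subsets of
  \<open>B\<close>. Typically it depends on what happens outside \<open>B\<close>; carrying it along
  makes the description of the points in \<open>B\<close> valid conditionally, from which
  independence over disjoint regions follows.\<close>

definition uncorrelated :: "('w \<Rightarrow> ennreal) \<Rightarrow> 'a set \<Rightarrow> bool" where
  "uncorrelated \<psi> B \<longleftrightarrow> (\<forall>(m::nat) A k. (\<forall>l<m. A l \<in> sets borel \<and> A l \<subseteq> B) \<longrightarrow> disjoint_family_on A {..<m} \<longrightarrow>
     (\<integral>\<^sup>+\<omega>. \<psi> \<omega> * indicator {\<omega> \<in> space M. \<forall>l<m. card (points_in (pts \<omega>) (A l)) = k l} \<omega> \<partial>M)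
       = (\<integral>\<^sup>+\<omega>. \<psi> \<omega> \<partial>M) * ennreal (\<Prod>l<m. pois (measure lborel (A l)) (k l)))"

lemma uncorrelated_1: "bounded B \<Longrightarrow> uncorrelated (\<lambda>_. 1) B"
proof -
  assume B: "bounded B"
  show ?thesis unfolding uncorrelated_def
  proof (intro allI impI)
    fix m :: nat and A :: "nat \<Rightarrow> 'a set" and k
    assume A: "\<forall>l<m. A l \<in> sets borel \<and> A l \<subseteq> B" and d: "disjoint_family_on A {..<m}"
    let ?E = "{\<omega> \<in> space M. \<forall>l<m. card (points_in (pts \<omega>) (A l)) = k l}"
    have "(\<lambda>\<omega>. card (points_in (pts \<omega>) (A l))) \<in> measurable M (count_space UNIV)" if "l < m" for l
      using A that by (intro measurable_card_random_set) auto
    then have "{\<omega> \<in> space M. \<forall>l\<in>{..<m}. card (points_in (pts \<omega>) (A l)) = k l} \<in> events"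
      by (intro sets.sets_Collect_finite_All) auto
    moreover have "{\<omega> \<in> space M. \<forall>l\<in>{..<m}. card (points_in (pts \<omega>) (A l)) = k l} = ?E" by blast
    ultimately have E: "?E \<in> events" by (simp only:)
    have "prob ?E = (\<Prod>l<m. pois (measure lborel (A l)) (k l))"
    proof (rule prob_counts[OF _ _ d])
      show "bounded (A l)" if "l < m" for l using bounded_subset[OF B, of "A l"] A that by blast
    qed (use A in blast)
    then have "emeasure M ?E = ennreal (\<Prod>l<m. pois (measure lborel (A l)) (k l))"
      by (simp only: emeasure_eq_measure)
    then show "(\<integral>\<^sup>+\<omega>. 1 * indicator ?E \<omega> \<partial>M) = (\<integral>\<^sup>+\<omega>. 1 \<partial>M) * ennreal (\<Prod>l<m. pois (measure lborel (A l)) (k l))"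
      by (simp only: mult_1 nn_integral_indicator[OF E] nn_integral_const emeasure_space_1)
  qed
qed

text \<open>All orderings of the points in \<open>B\<close>, and none unless there are exactly
  \<open>m\<close> of them. Using every ordering removes the unknown dependence between the
  enumeration and the locations.\<close>

definition tuples :: "nat \<Rightarrow> 'a set \<Rightarrow> 'w \<Rightarrow> nat list set" where
  "tuples m B \<omega> = {xs \<in> permutations_of_set (points_in (pts \<omega>) B). length xs = m}"

definition tuple :: "nat \<Rightarrow> nat list \<Rightarrow> 'w \<Rightarrow> nat \<Rightarrow> 'a" where
  "tuple m xs \<omega> = (\<lambda>j\<in>{..<m}. X (xs ! j) \<omega>)"

lemma pred_tuples:
  assumes [measurable]: "B \<in> sets borel"
  shows "Measurable.pred M (\<lambda>\<omega>. xs \<in> tuples m B \<omega>)"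
proof -
  have "(\<lambda>\<omega>. xs \<in> tuples m B \<omega>) = (\<lambda>\<omega>. (\<forall>i. i \<in> set xs \<longleftrightarrow> X i \<omega> \<in> B) \<and> distinct xs \<and> length xs = m)"
    by (auto simp: tuples_def permutations_of_set_def points_in_def fun_eq_iff)
  then show ?thesis by simp
qed

lemma measurable_tuple: "tuple m xs \<in> measurable M (PiM {..<m} (\<lambda>_. borel))"
  unfolding tuple_def by measurable

text \<open>The \<open>\<psi>\<close>-weighted expected number of orderings of the points in
  \<open>B\<close> whose list of locations lies in a given set, as a measure on location
  tuples.\<close>

definition tuple_measure :: "nat \<Rightarrow> 'a set \<Rightarrow> ('w \<Rightarrow> ennreal) \<Rightarrow> (nat \<Rightarrow> 'a) measure" where
  "tuple_measure m B \<psi> = distr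
     (density (count_space UNIV \<Otimes>\<^sub>M M) (\<lambda>z. \<psi> (snd z) * indicator (tuples m B (snd z)) (fst z)))
     (PiM {..<m} (\<lambda>_. borel)) (\<lambda>z. tuple m (fst z) (snd z))"

lemma
  fixes \<psi> :: "'w \<Rightarrow> ennreal"
  assumes [measurable]: "B \<in> sets borel" "\<psi> \<in> borel_measurable M"
  shows measurable_tuple_density: "(\<lambda>z. \<psi> (snd z) * indicator (tuples m B (snd z)) (fst z)) \<in> borel_measurable (count_space UNIV \<Otimes>\<^sub>M M)"
    and measurable_tuple_pair: "(\<lambda>z. tuple m (fst z) (snd z)) \<in> measurable (count_space UNIV \<Otimes>\<^sub>M M) (PiM {..<m} (\<lambda>_. borel))"
proof -
  have [measurable]: "Measurable.pred M (\<lambda>\<omega>. xs \<in> tuples m B \<omega>)" for xs by (rule pred_tuples) simp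
  have ind: "(\<lambda>\<omega>. indicator (tuples m B \<omega>) xs :: ennreal) \<in> borel_measurable M" for xs
    by (rule borel_measurable_indicator') measurable
  show "(\<lambda>z. \<psi> (snd z) * indicator (tuples m B (snd z)) (fst z)) \<in> borel_measurable (count_space UNIV \<Otimes>\<^sub>M M)"
  proof (rule measurable_pair_measure_countable1)
    fix xs
    have "(\<lambda>\<omega>. \<psi> \<omega> * indicator (tuples m B \<omega>) xs) \<in> borel_measurable M"
      by (rule borel_measurable_times_ennreal[OF assms(2) ind])
    then show "(\<lambda>\<omega>. \<psi> (snd (xs, \<omega>)) * indicator (tuples m B (snd (xs, \<omega>))) (fst (xs, \<omega>))) \<in> borel_measurable M"
      by (simp only: fst_conv snd_conv)
  qed simp
  show "(\<lambda>z. tuple m (fst z) (snd z)) \<in> measurable (count_space UNIV \<Otimes>\<^sub>M M) (PiM {..<m} (\<lambda>_. borel))"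
    by (rule measurable_pair_measure_countable1) (auto simp: measurable_tuple)
qed

lemma nn_integral_tuple_measure:
  assumes B[measurable]: "B \<in> sets borel" and \<psi>[measurable]: "\<psi> \<in> borel_measurable M"
    and h[measurable]: "h \<in> borel_measurable (PiM {..<m} (\<lambda>_. borel))"
  shows "(\<integral>\<^sup>+z. h z \<partial>tuple_measure m B \<psi>) =
    (\<integral>\<^sup>+\<omega>. \<psi> \<omega> * (\<integral>\<^sup>+xs. indicator (tuples m B \<omega>) xs * h (tuple m xs \<omega>) \<partial>count_space UNIV) \<partial>M)"
proof -
  note [measurable] = measurable_tuple_density[OF B \<psi>] measurable_tuple_pair[OF B \<psi>]
  interpret C: sigma_finite_measure "count_space (UNIV :: nat list set)"
    by (rule sigma_finite_measure_count_space_countable) simp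
  interpret pair_sigma_finite "count_space (UNIV :: nat list set)" M ..
  have m: "(\<lambda>z. h (tuple m (fst z) (snd z))) \<in> borel_measurable (count_space UNIV \<Otimes>\<^sub>M M)"
    by measurable
  have "(\<integral>\<^sup>+z. h z \<partial>tuple_measure m B \<psi>) =
    (\<integral>\<^sup>+z. \<psi> (snd z) * indicator (tuples m B (snd z)) (fst z) * h (tuple m (fst z) (snd z)) \<partial>(count_space UNIV \<Otimes>\<^sub>M M))"
    unfolding tuple_measure_def
    by (subst nn_integral_distr, simp, simp, subst nn_integral_density) (use m in auto)
  also have "\<dots> = (\<integral>\<^sup>+\<omega>. \<integral>\<^sup>+xs. \<psi> \<omega> * indicator (tuples m B \<omega>) xs * h (tuple m xs \<omega>) \<partial>count_space UNIV \<partial>M)"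
    by (subst nn_integral_snd[symmetric]) (use m in auto)
  also have "\<dots> = (\<integral>\<^sup>+\<omega>. \<psi> \<omega> * (\<integral>\<^sup>+xs. indicator (tuples m B \<omega>) xs * h (tuple m xs \<omega>) \<partial>count_space UNIV) \<partial>M)"
    by (intro nn_integral_cong, subst nn_integral_cmult[symmetric]) (auto simp: mult.assoc)
  finally show ?thesis .
qed

text \<open>With disjoint sides at most one ordering fits into the rectangle, so the number of
  fitting orderings is the indicator of a count event: one point in each side within
  \<open>B\<close> and none elsewhere in \<open>B\<close>.\<close>

lemma tuples_rectangle:
  assumes fin: "finite (points_in (pts \<omega>) B)" and disj: "disjoint_family_on A {..<m}"
  shows "(\<integral>\<^sup>+xs. indicator (tuples m B \<omega>) xs * indicator (Pi\<^sub>E {..<m} A) (tuple m xs \<omega>) \<partial>count_space UNIV) =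
    indicator {\<omega>. (\<forall>l<m. card (points_in (pts \<omega>) (A l \<inter> B)) = 1) \<and> card (points_in (pts \<omega>) (B - (\<Union>l<m. A l))) = 0} \<omega>"
    (is "?L = indicator ?E \<omega>")
proof -
  let ?S = "{xs \<in> tuples m B \<omega>. \<forall>j<m. X (xs ! j) \<omega> \<in> A j}"
  \<comment> \<open>The only candidate: its entry \<open>j\<close> is the label of the unique point
    in the side \<open>A j\<close>.\<close>
  define xs0 where "xs0 = map (\<lambda>j. the_elem (points_in (pts \<omega>) (A j \<inter> B))) [0..<m]"
  have len0: "length xs0 = m" by (simp add: xs0_def)
  have d: "i = j" if "i < m" "j < m" "a \<in> A i" "a \<in> A j" for i j a
    using disj that by (auto simp: disjoint_family_on_def)
  have "?L = (\<integral>\<^sup>+xs. indicator ?S xs \<partial>count_space UNIV)"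
    by (intro nn_integral_cong) (auto simp: tuple_def PiE_iff split: split_indicator)
  also have "\<dots> = emeasure (count_space UNIV) ?S" by simp
  finally have L: "?L = emeasure (count_space UNIV) ?S" .
  have 1: "\<omega> \<in> ?E \<and> xs = xs0" if xs: "xs \<in> ?S" for xs
  proof -
    have len: "length xs = m" and set: "set xs = points_in (pts \<omega>) B"
      using xs by (auto simp: tuples_def permutations_of_set_def)
    have p: "points_in (pts \<omega>) (A l \<inter> B) = {xs ! l}" if "l < m" for l
    proof (intro set_eqI iffI)
      fix i assume i: "i \<in> points_in (pts \<omega>) (A l \<inter> B)"
      then have "i \<in> set xs" using set by auto
      then obtain j where j: "j < m" "i = xs ! j" using len by (auto simp: in_set_conv_nth)
      then have "X i \<omega> \<in> A j" using xs by auto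
      then have "j = l" using d[OF j(1) that] i by auto
      then show "i \<in> {xs ! l}" using j by simp
    next
      fix i assume "i \<in> {xs ! l}"
      moreover have "xs ! l \<in> set xs" using that len by auto
      ultimately show "i \<in> points_in (pts \<omega>) (A l \<inter> B)" using xs that set by auto
    qed
    have "points_in (pts \<omega>) (B - (\<Union>l<m. A l)) = {}"
    proof (rule ccontr)
      assume "points_in (pts \<omega>) (B - (\<Union>l<m. A l)) \<noteq> {}"
      then obtain i where "i \<in> points_in (pts \<omega>) (B - (\<Union>l<m. A l))" by blast
      then have i: "X i \<omega> \<in> B" "\<And>l. l < m \<Longrightarrow> X i \<omega> \<notin> A l" by auto
      then have "i \<in> set xs" using set by auto
      then show False using i xs len by (auto simp: in_set_conv_nth)
    qed
    moreover have "xs = xs0" unfolding xs0_def by (rule nth_equalityI) (auto simp: len p)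
    ultimately show ?thesis using p by simp
  qed
  have 2: "xs0 \<in> ?S" if E: "\<omega> \<in> ?E"
  proof -
    have p: "points_in (pts \<omega>) (A l \<inter> B) = {xs0 ! l}" if l: "l < m" for l
    proof -
      have "card (points_in (pts \<omega>) (A l \<inter> B)) = 1" using E l by simp
      then obtain a where "points_in (pts \<omega>) (A l \<inter> B) = {a}" by (rule card_1_singletonE)
      then show ?thesis using l by (simp add: xs0_def)
    qed
    then have in0: "X (xs0 ! l) \<omega> \<in> A l \<inter> B" if "l < m" for l
      using that by (metis points_in_iff singletonI)
    have "finite (points_in (pts \<omega>) (B - (\<Union>l<m. A l)))" using fin by (rule rev_finite_subset) auto
    then have e: "points_in (pts \<omega>) (B - (\<Union>l<m. A l)) = {}" using E by simp
    have "set xs0 = points_in (pts \<omega>) B"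
    proof (intro set_eqI iffI)
      fix i assume "i \<in> set xs0"
      then show "i \<in> points_in (pts \<omega>) B" using in0 len0 by (auto simp: in_set_conv_nth)
    next
      fix i assume i: "i \<in> points_in (pts \<omega>) B"
      have "i \<notin> points_in (pts \<omega>) (B - (\<Union>l<m. A l))" by (simp add: e)
      then obtain l where "l < m" "i \<in> points_in (pts \<omega>) (A l \<inter> B)" using i by auto
      then have "i = xs0 ! l" "l < m" using p by auto
      then show "i \<in> set xs0" using len0 by auto
    qed
    moreover have "distinct xs0"
      unfolding distinct_conv_nth using d in0 len0 by (metis IntD1)
    ultimately show ?thesis using in0 len0 by (auto simp: tuples_def permutations_of_set_def)
  qed
  show ?thesis
  proof (cases "\<omega> \<in> ?E")
    case True
    then have S: "?S = {xs0}" using 1 2 by blast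
    have "indicator ?E \<omega> = (1 :: ennreal)" using True by (rule indicator_simps)
    then show ?thesis unfolding L S by simp
  next
    case False
    then have S: "?S = {}" using 1 by blast
    have "indicator ?E \<omega> = (0 :: ennreal)" using False by (rule indicator_simps)
    then show ?thesis unfolding L S by (simp only: emeasure_empty)
  qed
qed

text \<open>The count event has independent factors: a side of volume \<open>v\<close> with one
  point contributes \<open>v * exp (- v)\<close>, the empty remainder \<open>exp (- v)\<close>, and
  the exponentials multiply to that of the whole volume.\<close>

lemma tuple_measure_rectangle:
  assumes B[measurable]: "B \<in> sets borel" and bB: "bounded B" and \<psi>[measurable]: "\<psi> \<in> borel_measurable M"
    and unc: "uncorrelated \<psi> B"
    and A: "\<And>j. j < m \<Longrightarrow> A j \<in> sets borel" and disj: "disjoint_family_on A {..<m}"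
  shows "emeasure (tuple_measure m B \<psi>) (Pi\<^sub>E {..<m} A) =
    (\<integral>\<^sup>+\<omega>. \<psi> \<omega> \<partial>M) * ennreal (exp (- measure lborel B) * (\<Prod>j<m. measure lborel (A j \<inter> B)))"
proof -
  let ?v = "measure lborel B"
  \<comment> \<open>Index \<open>m\<close> stands for the part of \<open>B\<close> outside all
    sides, whose prescribed count is 0.\<close>
  define A' where "A' = (\<lambda>l. if l < m then A l \<inter> B else B - (\<Union>l<m. A l))"
  define k where "k = (\<lambda>l. if l < m then 1 else 0 :: nat)"
  have A'[measurable]: "A' l \<in> sets borel" for l
    using A unfolding A'_def by (auto intro!: sets.Diff sets.finite_UN)
  have A'B: "A' l \<subseteq> B" for l by (auto simp: A'_def)
  have dA': "disjoint_family_on A' {..<Suc m}"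
    unfolding disjoint_family_on_def
  proof (intro ballI impI)
    fix i j assume "i \<in> {..<Suc m}" "j \<in> {..<Suc m}" "i \<noteq> j"
    then consider "i < m" "j < m" | "i < m" "j = m" | "i = m" "j < m" by force
    then show "A' i \<inter> A' j = {}"
      using disj \<open>i \<noteq> j\<close> by cases (auto simp: A'_def disjoint_family_on_def)
  qed
  have meas: "Pi\<^sub>E {..<m} A \<in> sets (PiM {..<m} (\<lambda>_. borel))"
    using A by (intro sets_PiM_I_finite) auto
  have s: "sets (tuple_measure m B \<psi>) = sets (PiM {..<m} (\<lambda>_. borel))" by (simp add: tuple_measure_def)
  have vol: "?v = (\<Sum>l<Suc m. measure lborel (A' l))"
  proof -
    have "B = (\<Union>l\<in>{..<Suc m}. A' l)"
    proof (intro set_eqI iffI)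
      fix b assume b: "b \<in> B"
      show "b \<in> (\<Union>l\<in>{..<Suc m}. A' l)"
      proof (cases "\<exists>l<m. b \<in> A l")
        case True
        then obtain l where "l < m" "b \<in> A l" by auto
        then show ?thesis using b by (auto simp: A'_def intro!: bexI[of _ l])
      next
        case False
        then show ?thesis using b by (auto simp: A'_def intro!: bexI[of _ m])
      qed
    qed (use A'B in auto)
    moreover have "measure lborel (\<Union>l\<in>{..<Suc m}. A' l) = (\<Sum>l<Suc m. measure lborel (A' l))"
    proof (rule measure_UNION_AE)
      have "emeasure lborel (A' l) < \<infinity>" for l
        by (rule emeasure_bounded_finite[OF bounded_subset[OF bB A'B]])
      then show "A' l \<in> fmeasurable lborel" for l by (simp add: fmeasurable_def)
    qed (use dA' in \<open>auto simp: disjoint_family_on_def pairwise_def\<close>)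
    ultimately show ?thesis by simp
  qed
  have "emeasure (tuple_measure m B \<psi>) (Pi\<^sub>E {..<m} A) = (\<integral>\<^sup>+z. indicator (Pi\<^sub>E {..<m} A) z \<partial>tuple_measure m B \<psi>)"
    using meas s by simp
  also have "\<dots> = (\<integral>\<^sup>+\<omega>. \<psi> \<omega> * (\<integral>\<^sup>+xs. indicator (tuples m B \<omega>) xs * indicator (Pi\<^sub>E {..<m} A) (tuple m xs \<omega>) \<partial>count_space UNIV) \<partial>M)"
    using meas by (intro nn_integral_tuple_measure) auto
  also have "\<dots> = (\<integral>\<^sup>+\<omega>. \<psi> \<omega> * indicator {\<omega> \<in> space M. \<forall>l<Suc m. card (points_in (pts \<omega>) (A' l)) = k l} \<omega> \<partial>M)"
  proof (intro nn_integral_cong_AE)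
    show "AE \<omega> in M. \<psi> \<omega> * (\<integral>\<^sup>+xs. indicator (tuples m B \<omega>) xs * indicator (Pi\<^sub>E {..<m} A) (tuple m xs \<omega>) \<partial>count_space UNIV)
      = \<psi> \<omega> * indicator {\<omega> \<in> space M. \<forall>l<Suc m. card (points_in (pts \<omega>) (A' l)) = k l} \<omega>"
      using AE_finite_points_in[OF bB] AE_space
    proof eventually_elim
      case (elim \<omega>)
      have "(\<forall>l<Suc m. card (points_in (pts \<omega>) (A' l)) = k l) \<longleftrightarrow>
        (\<forall>l<m. card (points_in (pts \<omega>) (A l \<inter> B)) = 1) \<and> card (points_in (pts \<omega>) (B - (\<Union>l<m. A l))) = 0"
        by (auto simp: A'_def k_def less_Suc_eq)
      then show ?case using elim(2)
        by (subst tuples_rectangle[OF elim(1) disj]) (auto split: split_indicator)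
    qed
  qed
  also have "\<dots> = (\<integral>\<^sup>+\<omega>. \<psi> \<omega> \<partial>M) * ennreal (\<Prod>l<Suc m. pois (measure lborel (A' l)) (k l))"
    using unc dA' A'B A' unfolding uncorrelated_def by blast
  also have "(\<Prod>l<Suc m. pois (measure lborel (A' l)) (k l)) = exp (- ?v) * (\<Prod>j<m. measure lborel (A j \<inter> B))"
  proof -
    have "(\<Prod>l<Suc m. pois (measure lborel (A' l)) (k l)) =
      (\<Prod>l<Suc m. exp (- measure lborel (A' l)) * (if l < m then measure lborel (A' l) else 1))"
      by (intro prod.cong) (auto simp: pois_def k_def)
    also have "\<dots> = exp (- ?v) * (\<Prod>l<Suc m. if l < m then measure lborel (A' l) else 1)"
      unfolding prod.distrib vol by (simp only: exp_sum[symmetric] finite_lessThan sum_negf)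
    also have "(\<Prod>l<Suc m. if l < m then measure lborel (A' l) else 1) = (\<Prod>j<m. measure lborel (A j \<inter> B))"
      by (simp add: A'_def)
    finally show ?thesis .
  qed
  finally show ?thesis .
qed

end

context poisson_process
begin

lemma measurable_tuple_sum:
  assumes B: "B \<in> sets borel" and h: "h \<in> borel_measurable (PiM {..<m} (\<lambda>_. borel))"
  shows "(\<lambda>\<omega>. \<integral>\<^sup>+xs. indicator (tuples m B \<omega>) xs * h (tuple m xs \<omega>) \<partial>count_space UNIV) \<in> borel_measurable M"
proof -
  interpret C: sigma_finite_measure "count_space (UNIV :: nat list set)"
    by (rule sigma_finite_measure_count_space_countable) simp
  have 1: "(\<lambda>z. 1 * indicator (tuples m B (snd z)) (fst z) :: ennreal) \<in> borel_measurable (count_space UNIV \<Otimes>\<^sub>M M)"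
    by (rule measurable_tuple_density[OF B]) simp
  have 2: "(\<lambda>z. h (tuple m (fst z) (snd z))) \<in> borel_measurable (count_space UNIV \<Otimes>\<^sub>M M)"
    by (rule measurable_compose[OF measurable_tuple_pair[OF B, of "\<lambda>_. 1"] h]) simp
  have "(\<lambda>z. indicator (tuples m B (snd z)) (fst z) * h (tuple m (fst z) (snd z))) \<in> borel_measurable (count_space UNIV \<Otimes>\<^sub>M M)"
    using borel_measurable_times_ennreal[OF 1 2] by simp
  from measurable_compose[OF measurable_pair_swap' this]
  have "case_prod (\<lambda>\<omega> xs. indicator (tuples m B \<omega>) xs * h (tuple m xs \<omega>)) \<in> borel_measurable (M \<Otimes>\<^sub>M count_space UNIV)"
    by (simp add: split_beta')
  then show ?thesis by (rule C.borel_measurable_nn_integral)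
qed

text \<open>Given their number, the points in \<open>B\<close>, listed in a random order, are independent and uniform.\<close>

lemma tuple_measure_eq:
  assumes B: "B \<in> sets borel" "bounded B" "0 < measure lborel B" and \<psi>[measurable]: "\<psi> \<in> borel_measurable M"
    and fin: "(\<integral>\<^sup>+\<omega>. \<psi> \<omega> \<partial>M) \<noteq> \<infinity>" and unc: "uncorrelated \<psi> B"
  shows "tuple_measure m B \<psi> = density
    (distr (PiM UNIV (\<lambda>_. uniform_measure lborel B)) (PiM {..<m} (\<lambda>_. borel)) (\<lambda>y. restrict y {..<m}))
    (\<lambda>_. (\<integral>\<^sup>+\<omega>. \<psi> \<omega> \<partial>M) * ennreal (exp (- measure lborel B) * measure lborel B ^ m))"
    (is "?P = density (distr ?Y ?N ?r) (\<lambda>_. ?c * ?e)")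
proof -
  let ?v = "measure lborel B"
  note [measurable] = B(1)
  note nz = measure_lborel_positive_bounded[OF B(2,1,3)]
  have U: "prob_space (uniform_measure lborel B)" using nz by (intro prob_space_uniform_measure) auto
  have r[measurable]: "?r \<in> measurable ?Y ?N"
    by (intro measurable_restrict) simp
  have rect: "emeasure (density (distr ?Y ?N ?r) (\<lambda>_. ?c * ?e)) (Pi\<^sub>E {..<m} A) =
    ?c * ennreal (exp (- ?v) * (\<Prod>j<m. measure lborel (A j \<inter> B)))"
    if A: "\<And>j. j < m \<Longrightarrow> A j \<in> sets borel" for A
  proof -
    have S: "Pi\<^sub>E {..<m} A \<in> sets ?N" using A by (intro sets_PiM_I_finite) auto
    have "?r -` Pi\<^sub>E {..<m} A \<inter> space ?Y = {y \<in> space ?Y. \<forall>j\<in>{..<m}. y j \<in> A j}"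
      unfolding vimage_def Int_def restrict_PiE_iff by blast
    then have "emeasure (distr ?Y ?N ?r) (Pi\<^sub>E {..<m} A) = (\<Prod>j<m. emeasure (uniform_measure lborel B) (A j))"
      using A by (simp only: emeasure_distr[OF r S]) (intro emeasure_PiM_UNIV_Collect[OF U], auto)
    also have "\<dots> = (\<Prod>j<m. ennreal (measure lborel (A j \<inter> B) / ?v))"
    proof (intro prod.cong refl)
      fix j assume "j \<in> {..<m}"
      then have [measurable]: "A j \<in> sets borel" using A by simp
      have "bounded (B \<inter> A j)" using B(2) by (rule bounded_subset) auto
      then show "emeasure (uniform_measure lborel B) (A j) = ennreal (measure lborel (A j \<inter> B) / ?v)"
        using B by (simp add: emeasure_lborel_bounded divide_ennreal Int_commute)
    qed
    also have "\<dots> = ennreal ((\<Prod>j<m. measure lborel (A j \<inter> B)) / ?v ^ m)"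
      by (simp add: prod_ennreal prod_dividef)
    finally have d: "emeasure (distr ?Y ?N ?r) (Pi\<^sub>E {..<m} A) = \<dots>" .
    have "emeasure (density (distr ?Y ?N ?r) (\<lambda>_. ?c * ?e)) (Pi\<^sub>E {..<m} A) = ?c * ?e * emeasure (distr ?Y ?N ?r) (Pi\<^sub>E {..<m} A)"
      using S by (intro emeasure_density_const) simp
    also have "\<dots> = ?c * (ennreal (exp (- ?v) * ?v ^ m) * ennreal ((\<Prod>j<m. measure lborel (A j \<inter> B)) / ?v ^ m))"
      unfolding d by (simp add: mult.assoc)
    also have "\<dots> = ?c * ennreal (exp (- ?v) * (\<Prod>j<m. measure lborel (A j \<inter> B)))"
      using B(3) by (subst ennreal_mult[symmetric]) (auto intro!: prod_nonneg divide_nonneg_nonneg)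
    finally show ?thesis .
  qed
  show ?thesis
  proof (rule AE_count_space_PiM_finite_eqI[where m = m])
    show sP: "sets ?P = sets ?N" by (simp add: tuple_measure_def)
    show "sets (density (distr ?Y ?N ?r) (\<lambda>_. ?c * ?e)) = sets ?N" by simp
    have "space ?P = Pi\<^sub>E {..<m} (\<lambda>_. UNIV)" using sets_eq_imp_space_eq[OF sP] by (simp add: space_PiM)
    note PiM_top = this
    have PM: "emeasure ?P C = (\<integral>\<^sup>+\<omega>. \<psi> \<omega> * (\<integral>\<^sup>+xs. indicator (tuples m B \<omega>) xs * indicator C (tuple m xs \<omega>) \<partial>count_space UNIV) \<partial>M)"
      if C: "C \<in> sets ?N" for C
    proof -
      have "emeasure ?P C = (\<integral>\<^sup>+z. indicator C z \<partial>?P)" using C sP by simp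
      also have "\<dots> = (\<integral>\<^sup>+\<omega>. \<psi> \<omega> * (\<integral>\<^sup>+xs. indicator (tuples m B \<omega>) xs * indicator C (tuple m xs \<omega>) \<partial>count_space UNIV) \<partial>M)"
        using C by (intro nn_integral_tuple_measure) (auto simp: B)
      finally show ?thesis .
    qed
    \<comment> \<open>There are at most \<open>fact m\<close> orderings, so the measure is finite,
      as needed for uniqueness from a generator.\<close>
    have "emeasure ?P (space ?P) \<le> (\<integral>\<^sup>+\<omega>. \<psi> \<omega> * of_nat (fact m) \<partial>M)"
    proof -
      have "space ?P \<in> sets ?N" using sP by (metis sets.top)
      then have "emeasure ?P (space ?P) = (\<integral>\<^sup>+\<omega>. \<psi> \<omega> * (\<integral>\<^sup>+xs. indicator (tuples m B \<omega>) xs * indicator (space ?P) (tuple m xs \<omega>) \<partial>count_space UNIV) \<partial>M)"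
        by (rule PM)
      also have "\<dots> \<le> (\<integral>\<^sup>+\<omega>. \<psi> \<omega> * of_nat (fact m) \<partial>M)"
      proof (rule nn_integral_mono_AE)
        show "AE \<omega> in M. \<psi> \<omega> * (\<integral>\<^sup>+xs. indicator (tuples m B \<omega>) xs * indicator (space ?P) (tuple m xs \<omega>) \<partial>count_space UNIV) \<le> \<psi> \<omega> * of_nat (fact m)"
          using AE_finite_points_in[OF B(2)]
        proof eventually_elim
          case (elim \<omega>)
          have "(\<integral>\<^sup>+xs. indicator (tuples m B \<omega>) xs * indicator (space ?P) (tuple m xs \<omega>) \<partial>count_space UNIV) \<le> (\<integral>\<^sup>+xs. indicator (tuples m B \<omega>) xs \<partial>count_space UNIV)"
            by (intro nn_integral_mono) (auto split: split_indicator)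
          also have "\<dots> = emeasure (count_space UNIV) (tuples m B \<omega>)" by simp
          also have "\<dots> \<le> of_nat (fact m)"
          proof (cases "m = card (points_in (pts \<omega>) B)")
            case True
            have "emeasure (count_space UNIV) (tuples m B \<omega>) \<le> emeasure (count_space UNIV) (permutations_of_set (points_in (pts \<omega>) B))"
              by (intro emeasure_mono) (auto simp: tuples_def)
            also have "\<dots> = of_nat (fact m)" using elim True by simp
            finally show ?thesis .
          next
            case False
            then have "tuples m B \<omega> = {}"
              by (auto simp: tuples_def permutations_of_set_def dest: distinct_card)
            then show ?thesis by simp
          qed
          finally show ?case by (intro mult_left_mono) auto
        qed
      qed
      finally show ?thesis .
    qed
    also have "\<dots> = ?c * of_nat (fact m)" by (intro nn_integral_multc) auto
    also have "\<dots> < \<infinity>" using fin of_nat_less_top[of "fact m"] by (simp add: ennreal_mult_less_top less_top)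
    finally show "emeasure ?P (space ?P) \<noteq> \<infinity>" by simp
    have inj_meas: "{z \<in> space ?N. \<not> inj_on z {..<m}} \<in> sets ?N"
    proof -
      have "{z \<in> space ?N. \<not> inj_on z {..<m}} = {z \<in> space ?N. \<exists>i\<in>{..<m}. \<exists>j\<in>{..<m}. z i = z j \<and> i \<noteq> j}"
        by (auto simp: inj_on_def)
      also have "\<dots> \<in> sets ?N"
      proof (intro sets.sets_Collect_finite_Ex finite_lessThan)
        fix i j assume "i \<in> {..<m}" "j \<in> {..<m}"
        then have "(\<lambda>z. z i) \<in> borel_measurable ?N" "(\<lambda>z. z j) \<in> borel_measurable ?N"
          by auto
        from measurable_equality_set[OF this]
        show "{z \<in> space ?N. z i = z j \<and> i \<noteq> j} \<in> sets ?N" by (cases "i = j") auto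
      qed
      finally show ?thesis .
    qed
    show "AE z in ?P. inj_on z {..<m}"
    proof (rule AE_I'[where N = "{z \<in> space ?N. \<not> inj_on z {..<m}}"])
      have "emeasure ?P {z \<in> space ?N. \<not> inj_on z {..<m}} = (\<integral>\<^sup>+\<omega>. 0 \<partial>M)"
        unfolding PM[OF inj_meas]
      proof (rule nn_integral_cong_AE)
        show "AE \<omega> in M. \<psi> \<omega> * (\<integral>\<^sup>+xs. indicator (tuples m B \<omega>) xs * indicator {z \<in> space ?N. \<not> inj_on z {..<m}} (tuple m xs \<omega>) \<partial>count_space UNIV) = 0"
          using AE_simple
        proof eventually_elim
          case (elim \<omega>)
          have "indicator (tuples m B \<omega>) xs * indicator {z \<in> space ?N. \<not> inj_on z {..<m}} (tuple m xs \<omega>) = (0::ennreal)" for xs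
          proof (cases "xs \<in> tuples m B \<omega>")
            case True
            then have xs: "distinct xs" "length xs = m" by (auto simp: tuples_def permutations_of_set_def)
            have "inj_on (tuple m xs \<omega>) {..<m}"
            proof (rule inj_onI)
              fix i j assume ij: "i \<in> {..<m}" "j \<in> {..<m}" "tuple m xs \<omega> i = tuple m xs \<omega> j"
              then have "xs ! i = xs ! j" using elim by (auto simp: tuple_def)
              then show "i = j" using ij xs by (simp add: nth_eq_iff_index_eq)
            qed
            then show ?thesis by simp
          qed simp
          then show ?case by (simp only: nn_integral_const mult_zero_right mult_zero_left)
        qed
      qed
      then show "{z \<in> space ?N. \<not> inj_on z {..<m}} \<in> null_sets ?P"
        using inj_meas sP by (simp add: null_sets_def)
    qed (simp add: sets_eq_imp_space_eq[OF sP])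
    have "AE z in distr ?Y ?N ?r. inj_on z {..<m}"
    proof (subst AE_distr_iff)
      show "{z \<in> space ?N. inj_on z {..<m}} \<in> sets ?N"
        using sets.Diff[OF sets.top inj_meas] by (rule back_subst[of "\<lambda>S. S \<in> sets ?N"]) auto
      show "AE y in ?Y. inj_on (?r y) {..<m}"
        using AE_uniform_distinct[OF B(2,1,3)] by eventually_elim (auto simp: inj_on_def)
    qed simp
    then show "AE z in density (distr ?Y ?N ?r) (\<lambda>_. ?c * ?e). inj_on z {..<m}"
      by (subst AE_density) auto
    fix A assume A: "\<And>j. j < m \<Longrightarrow> A j \<in> sets (borel::'a measure)" "disjoint_family_on A {..<m}"
    show "emeasure ?P (Pi\<^sub>E {..<m} A) = emeasure (density (distr ?Y ?N ?r) (\<lambda>_. ?c * ?e)) (Pi\<^sub>E {..<m} A)"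
      by (rule trans[OF tuple_measure_rectangle[OF B(1,2) \<psi> unc A] rect[OF A(1), symmetric]])
  qed
qed

end

section \<open>Label-free functionals and the mixed binomial formula\<close>

definition relabel_invariant :: "(nat set \<Rightarrow> (nat \<Rightarrow> 'a) \<Rightarrow> (nat set \<Rightarrow> 'o) \<Rightarrow> ennreal) \<Rightarrow> bool" where
  "relabel_invariant F \<longleftrightarrow>
     (\<forall>V x x' \<eta> \<eta>'. finite V \<longrightarrow> (\<forall>i\<in>V. x i = x' i) \<longrightarrow> (\<forall>s. s \<noteq> {} \<longrightarrow> s \<subseteq> V \<longrightarrow> \<eta> s = \<eta>' s) \<longrightarrow> F V x \<eta> = F V x' \<eta>') \<and>
     (\<forall>h V x \<eta>. finite V \<longrightarrow> inj_on h V \<longrightarrow> F (h ` V) x \<eta> = F V (\<lambda>i. x (h i)) (\<lambda>s. \<eta> (h ` s)))"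

lemma relabel_invariantI:
  assumes "\<And>V x x' \<eta> \<eta>'. finite V \<Longrightarrow> (\<And>i. i \<in> V \<Longrightarrow> x i = x' i) \<Longrightarrow>
      (\<And>s. s \<noteq> {} \<Longrightarrow> s \<subseteq> V \<Longrightarrow> \<eta> s = \<eta>' s) \<Longrightarrow> F V x \<eta> = F V x' \<eta>'"
    and "\<And>h V x \<eta>. finite V \<Longrightarrow> inj_on h V \<Longrightarrow> F (h ` V) x \<eta> = F V (\<lambda>i. x (h i)) (\<lambda>s. \<eta> (h ` s))"
  shows "relabel_invariant F"
  unfolding relabel_invariant_def by (intro conjI allI impI; rule assms; simp)

context poisson_process
begin

text \<open>By invariance every ordering of the points gives the same average over
  \<open>\<eta>\<close>, so the functional is the average over all \<open>fact m\<close> orderings,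
  whose weighted location law is \<open>tuple_measure\<close>. The factor
  \<open>exp (- v) * v ^ m\<close> found there, divided by \<open>fact m\<close>, is the Poisson
  weight.\<close>

theorem nn_integral_mixed_binomial:
  fixes F :: "nat set \<Rightarrow> (nat \<Rightarrow> 'a) \<Rightarrow> (nat set \<Rightarrow> 'o) \<Rightarrow> ennreal" and N :: "'o measure"
  assumes B: "B \<in> sets borel" "bounded B" "0 < measure lborel B" and \<psi>[measurable]: "\<psi> \<in> borel_measurable M"
    and fin: "(\<integral>\<^sup>+\<omega>. \<psi> \<omega> \<partial>M) \<noteq> \<infinity>" and unc: "uncorrelated \<psi> B"
    and N: "prob_space N" and inv: "relabel_invariant F"
    and F: "\<And>m::nat. (\<lambda>z. F {..<m} (fst z) (snd z)) \<in> borel_measurable (PiM UNIV (\<lambda>_. borel) \<Otimes>\<^sub>M PiM UNIV (\<lambda>_. N))"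
  shows "(\<integral>\<^sup>+\<omega>. \<psi> \<omega> * (\<integral>\<^sup>+\<eta>. F (points_in (pts \<omega>) B) (pts \<omega>) \<eta> \<partial>PiM UNIV (\<lambda>_. N)) \<partial>M) =
    (\<integral>\<^sup>+\<omega>. \<psi> \<omega> \<partial>M) * (\<Sum>m. ennreal (pois (measure lborel B) m) *
      (\<integral>\<^sup>+y. \<integral>\<^sup>+\<eta>. F {..<m} y \<eta> \<partial>PiM UNIV (\<lambda>_. N) \<partial>PiM UNIV (\<lambda>_. uniform_measure lborel B)))"
proof -
  let ?v = "measure lborel B" and ?Q = "PiM (UNIV :: nat set set) (\<lambda>_. N)"
  let ?Y = "PiM (UNIV :: nat set) (\<lambda>_. uniform_measure lborel B)"
  let ?c = "\<integral>\<^sup>+\<omega>. \<psi> \<omega> \<partial>M"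
  let ?N = "\<lambda>m. PiM {..<m::nat} (\<lambda>_. borel :: 'a measure)"
  note [measurable] = B(1) F
  interpret Q: prob_space ?Q using N by (intro prob_space_PiM)
  have loc: "F V x \<eta> = F V x' \<eta>'" if "finite V" "\<And>i. i \<in> V \<Longrightarrow> x i = x' i" "\<And>s. s \<noteq> {} \<Longrightarrow> s \<subseteq> V \<Longrightarrow> \<eta> s = \<eta>' s" for V x x' \<eta> \<eta>'
    by (rule inv[unfolded relabel_invariant_def, THEN conjunct1, rule_format]) (use that in auto)
  have rel: "F (h ` V) x \<eta> = F V (\<lambda>i. x (h i)) (\<lambda>s. \<eta> (h ` s))" if "finite V" "inj_on h V" for h V x \<eta>
    by (rule inv[unfolded relabel_invariant_def, THEN conjunct2, rule_format]) (use that in auto)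
  define h where "h = (\<lambda>(m::nat) y. \<integral>\<^sup>+\<eta>. F {..<m} y \<eta> \<partial>?Q)"
  define ext where "ext = (\<lambda>(m::nat) z i. if i < m then z i else (0::'a))"
  have hloc: "h m y = h m y'" if "\<And>i. i < m \<Longrightarrow> y i = y' i" for m y y'
    unfolding h_def using that by (intro nn_integral_cong loc) auto
  have hm: "h m \<in> borel_measurable (PiM UNIV (\<lambda>_. borel))" for m
    unfolding h_def by measurable
  have ext: "ext m \<in> measurable (?N m) (PiM UNIV (\<lambda>_. borel))" for m
  proof (rule measurable_PiM_UNIV)
    show "(\<lambda>z. ext m z i) \<in> borel_measurable (?N m)" for i
      by (cases "i < m") (simp_all add: ext_def)
  qed
  have hN: "(\<lambda>z. h m (ext m z)) \<in> borel_measurable (?N m)" for m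
    by (rule measurable_compose[OF ext hm])
  have key: "(\<integral>\<^sup>+\<omega>. \<psi> \<omega> * (\<integral>\<^sup>+xs. indicator (tuples m B \<omega>) xs * h m (ext m (tuple m xs \<omega>)) \<partial>count_space UNIV) \<partial>M) =
      ?c * ennreal (exp (- ?v) * ?v ^ m) * (\<integral>\<^sup>+y. h m y \<partial>?Y)" for m
  proof -
    have r: "(\<lambda>y. restrict y {..<m}) \<in> measurable ?Y (?N m)" by (intro measurable_restrict) simp
    have "(\<integral>\<^sup>+\<omega>. \<psi> \<omega> * (\<integral>\<^sup>+xs. indicator (tuples m B \<omega>) xs * h m (ext m (tuple m xs \<omega>)) \<partial>count_space UNIV) \<partial>M) =
      (\<integral>\<^sup>+z. h m (ext m z) \<partial>tuple_measure m B \<psi>)"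
      by (rule nn_integral_tuple_measure[OF B(1) \<psi> hN, symmetric])
    also have "\<dots> = (\<integral>\<^sup>+z. ?c * ennreal (exp (- ?v) * ?v ^ m) * h m (ext m z) \<partial>distr ?Y (?N m) (\<lambda>y. restrict y {..<m}))"
      unfolding tuple_measure_eq[OF B \<psi> fin unc] using hN by (intro nn_integral_density) auto
    also have "\<dots> = ?c * ennreal (exp (- ?v) * ?v ^ m) * (\<integral>\<^sup>+z. h m (ext m z) \<partial>distr ?Y (?N m) (\<lambda>y. restrict y {..<m}))"
      using hN by (intro nn_integral_cmult) simp
    also have "(\<integral>\<^sup>+z. h m (ext m z) \<partial>distr ?Y (?N m) (\<lambda>y. restrict y {..<m})) = (\<integral>\<^sup>+y. h m (ext m (restrict y {..<m})) \<partial>?Y)"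
      using hN r by (intro nn_integral_distr) auto
    also have "\<dots> = (\<integral>\<^sup>+y. h m y \<partial>?Y)"
      by (intro nn_integral_cong hloc) (auto simp: ext_def)
    finally show ?thesis .
  qed
  \<comment> \<open>Renaming the vertex \<open>xs ! i\<close> to \<open>i\<close> also permutes the
    coordinates of \<open>\<eta>\<close>, which does not change their law.\<close>
  have relabel: "(\<integral>\<^sup>+\<eta>. F (points_in (pts \<omega>) B) (pts \<omega>) \<eta> \<partial>?Q) = h m (ext m (tuple m xs \<omega>))"
    if xs: "xs \<in> tuples m B \<omega>" for xs \<omega> m
  proof -
    have len: "length xs = m" and sx: "set xs = points_in (pts \<omega>) B" and dx: "distinct xs"
      using xs by (auto simp: tuples_def permutations_of_set_def)
    have "set xs = (!) xs ` {..<m}" using len by (metis lessThan_atLeast0 list.set_map map_nth set_upt)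
    then have set: "points_in (pts \<omega>) B = (!) xs ` {..<m}" using sx by simp
    have inj: "inj_on ((!) xs) {..<m}"
      using len dx by (intro inj_onI) (simp add: nth_eq_iff_index_eq)
    let ?K = "{s. s \<noteq> {} \<and> s \<subseteq> {..<m}}" and ?G = "\<lambda>\<eta>. F {..<m} (\<lambda>i. pts \<omega> (xs ! i)) \<eta>"
    have injK: "inj_on (image ((!) xs)) ?K" by (rule inj_on_image) (use inj in \<open>auto intro: inj_on_subset\<close>)
    have "(\<lambda>i. pts \<omega> (xs ! i)) \<in> space (PiM UNIV (\<lambda>_. borel))" by (simp add: space_PiM)
    from measurable_compose_Pair1[OF this F[of m]]
    have G: "?G \<in> borel_measurable ?Q" by simp
    have "(\<integral>\<^sup>+\<eta>. F (points_in (pts \<omega>) B) (pts \<omega>) \<eta> \<partial>?Q) = (\<integral>\<^sup>+\<eta>. ?G (\<lambda>s. \<eta> ((!) xs ` s)) \<partial>?Q)"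
      unfolding set by (intro nn_integral_cong rel inj) simp
    also have "\<dots> = (\<integral>\<^sup>+\<eta>. ?G \<eta> \<partial>?Q)"
      by (rule nn_integral_PiM_relabel[OF N injK G], rule loc) auto
    also have "\<dots> = h m (ext m (tuple m xs \<omega>))"
      unfolding h_def by (intro nn_integral_cong loc) (auto simp: ext_def tuple_def)
    finally show ?thesis .
  qed
  \<comment> \<open>Only the term with \<open>m\<close> equal to the number of points is nonzero,
    and its \<open>fact m\<close> equal summands cancel the factor in front.\<close>
  have "AE \<omega> in M. (\<integral>\<^sup>+\<eta>. F (points_in (pts \<omega>) B) (pts \<omega>) \<eta> \<partial>?Q) = (\<Sum>m. ennreal (1 / fact m) *
      (\<integral>\<^sup>+xs. indicator (tuples m B \<omega>) xs * h m (ext m (tuple m xs \<omega>)) \<partial>count_space UNIV))"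
    using AE_finite_points_in[OF B(2)]
  proof eventually_elim
    case (elim \<omega>)
    let ?I = "points_in (pts \<omega>) B"
    let ?g = "\<integral>\<^sup>+\<eta>. F ?I (pts \<omega>) \<eta> \<partial>?Q"
    let ?t = "\<lambda>m. ennreal (1 / fact m) * (\<integral>\<^sup>+xs. indicator (tuples m B \<omega>) xs * h m (ext m (tuple m xs \<omega>)) \<partial>count_space UNIV)"
    have "?t m = (if m = card ?I then ?g else 0)" for m
    proof (cases "m = card ?I")
      case True
      have t: "tuples m B \<omega> = permutations_of_set ?I"
        using True by (auto simp: tuples_def permutations_of_set_def dest: distinct_card)
      have "(\<integral>\<^sup>+xs. indicator (tuples m B \<omega>) xs * h m (ext m (tuple m xs \<omega>)) \<partial>count_space UNIV) =
        (\<integral>\<^sup>+xs. ?g * indicator (tuples m B \<omega>) xs \<partial>count_space UNIV)"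
        by (intro nn_integral_cong) (auto split: split_indicator simp: relabel)
      also have "\<dots> = ?g * emeasure (count_space UNIV) (tuples m B \<omega>)"
        by (intro nn_integral_cmult_indicator) simp
      also have "\<dots> = ?g * of_nat (fact m)" unfolding t using elim True by simp
      finally have "?t m = ?g * (ennreal (1 / fact m) * ennreal (fact m))"
        by (simp add: ac_simps ennreal_of_nat_eq_real_of_nat)
      also have "ennreal (1 / fact m) * ennreal (fact m) = 1"
        by (simp add: ennreal_mult[symmetric])
      finally show ?thesis using True by simp
    next
      case False
      then have "tuples m B \<omega> = {}"
        by (auto simp: tuples_def permutations_of_set_def dest: distinct_card)
      then show ?thesis using False by simp
    qed
    then have "(\<Sum>m. ?t m) = (\<Sum>m. if m = card ?I then ?g else 0)" by simp
    also have "\<dots> = ?g" using sums_single[of "card ?I" "\<lambda>_. ?g"] by (simp add: sums_unique[symmetric])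
    finally show ?case by simp
  qed
  then have "(\<integral>\<^sup>+\<omega>. \<psi> \<omega> * (\<integral>\<^sup>+\<eta>. F (points_in (pts \<omega>) B) (pts \<omega>) \<eta> \<partial>?Q) \<partial>M) =
    (\<integral>\<^sup>+\<omega>. (\<Sum>m. ennreal (1 / fact m) * (\<psi> \<omega> *
      (\<integral>\<^sup>+xs. indicator (tuples m B \<omega>) xs * h m (ext m (tuple m xs \<omega>)) \<partial>count_space UNIV))) \<partial>M)"
    by (intro nn_integral_cong_AE, eventually_elim)
       (simp only: ennreal_suminf_cmult[symmetric] mult.left_commute[of "\<psi> _"])
  also have "\<dots> = (\<Sum>m. \<integral>\<^sup>+\<omega>. ennreal (1 / fact m) * (\<psi> \<omega> *
      (\<integral>\<^sup>+xs. indicator (tuples m B \<omega>) xs * h m (ext m (tuple m xs \<omega>)) \<partial>count_space UNIV)) \<partial>M)"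
    by (intro nn_integral_suminf borel_measurable_times_ennreal borel_measurable_const \<psi> measurable_tuple_sum B hN)
  also have "\<dots> = (\<Sum>m. ennreal (1 / fact m) * (?c * ennreal (exp (- ?v) * ?v ^ m) * (\<integral>\<^sup>+y. h m y \<partial>?Y)))"
    by (intro arg_cong[where f = suminf] HOL.ext, subst nn_integral_cmult)
       (intro borel_measurable_times_ennreal \<psi> measurable_tuple_sum B hN, simp only: key)
  also have "\<dots> = (\<Sum>m. ?c * (ennreal (pois ?v m) * (\<integral>\<^sup>+y. h m y \<partial>?Y)))"
  proof (intro arg_cong[where f = suminf] HOL.ext)
    fix m :: nat
    have "ennreal (pois ?v m) = ennreal (1 / fact m) * ennreal (exp (- ?v) * ?v ^ m)"
      by (simp add: pois_def ennreal_mult[symmetric] field_simps)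
    then show "ennreal (1 / fact m) * (?c * ennreal (exp (- ?v) * ?v ^ m) * (\<integral>\<^sup>+y. h m y \<partial>?Y)) = ?c * (ennreal (pois ?v m) * (\<integral>\<^sup>+y. h m y \<partial>?Y))"
      by (simp add: ac_simps)
  qed
  also have "\<dots> = ?c * (\<Sum>m. ennreal (pois ?v m) * (\<integral>\<^sup>+y. h m y \<partial>?Y))"
    by (rule ennreal_suminf_cmult)
  finally show ?thesis unfolding h_def .
qed

end

section \<open>Poisson sums\<close>

lemma exp_sums': "(\<lambda>k. v ^ k / fact k) sums exp (v::real)"
  using exp_converges[of v] by (simp add: field_simps scaleR_conv_of_real)

lemma sums_shift_zero:
  fixes f :: "nat \<Rightarrow> real"
  shows "f 0 = 0 \<Longrightarrow> (\<lambda>k. f (Suc k)) sums s \<Longrightarrow> f sums s"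
  using sums_Suc_iff[of f s] by simp

text \<open>The first derivative in \<open>r\<close> of the Poisson generating function
  \<open>exp (- (v * (1 - r)))\<close>. It occurs when each of \<open>m\<close> vertices is bad
  unless one of the \<open>m - 1\<close> others helps.\<close>

lemma pois_factorial_1:
  assumes "0 \<le> v" "0 \<le> r"
  shows "(\<Sum>m. ennreal (pois v m) * ennreal (real m * r ^ (m - 1))) = ennreal (v * exp (- (v * (1 - r))))"
proof -
  have "(\<lambda>k. v * exp (- v) * ((v * r) ^ k / fact k)) sums (v * exp (- v) * exp (v * r))"
    by (intro sums_mult exp_sums')
  also have "v * exp (- v) * exp (v * r) = v * exp (- (v * (1 - r)))"
    by (simp add: exp_add[symmetric] algebra_simps)
  also have "(\<lambda>k. v * exp (- v) * ((v * r) ^ k / fact k)) = (\<lambda>k. pois v (Suc k) * (real (Suc k) * r ^ (Suc k - 1)))"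
    by (simp add: pois_def fun_eq_iff power_mult_distrib fact_Suc del: of_nat_Suc)
  finally have s: "(\<lambda>m. pois v m * (real m * r ^ (m - 1))) sums (v * exp (- (v * (1 - r))))"
    by (rule sums_shift_zero[rotated]) simp
  have "(\<Sum>m. ennreal (pois v m) * ennreal (real m * r ^ (m - 1))) = (\<Sum>m. ennreal (pois v m * (real m * r ^ (m - 1))))"
    by (intro arg_cong[where f = suminf] ext ennreal_mult[symmetric]) (use assms in auto)
  also have "\<dots> = ennreal (v * exp (- (v * (1 - r))))"
    using s assms by (intro suminf_ennreal_eq) auto
  finally show ?thesis .
qed

text \<open>The second derivative of the same generating function, for ordered pairs of vertices and
  the \<open>m - 2\<close> others.\<close>

lemma pois_factorial_2:
  assumes "0 \<le> v" "0 \<le> r"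
  shows "(\<Sum>m. ennreal (pois v m) * ennreal (real m * real (m - 1) * r ^ (m - 2))) = ennreal (v\<^sup>2 * exp (- (v * (1 - r))))"
proof -
  have "(\<lambda>k. v\<^sup>2 * exp (- v) * ((v * r) ^ k / fact k)) sums (v\<^sup>2 * exp (- v) * exp (v * r))"
    by (intro sums_mult exp_sums')
  also have "v\<^sup>2 * exp (- v) * exp (v * r) = v\<^sup>2 * exp (- (v * (1 - r)))"
    by (simp add: exp_add[symmetric] algebra_simps)
  also have "(\<lambda>k. v\<^sup>2 * exp (- v) * ((v * r) ^ k / fact k)) =
     (\<lambda>k. pois v (k + 2) * (real (k + 2) * real (k + 2 - 1) * r ^ (k + 2 - 2)))"
    by (simp add: pois_def fun_eq_iff field_simps power_mult_distrib power2_eq_square del: of_nat_Suc)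
  finally have s: "(\<lambda>m. pois v m * (real m * real (m - 1) * r ^ (m - 2))) sums (v\<^sup>2 * exp (- (v * (1 - r))))"
    by (intro sums_shift_zero[of "\<lambda>m. pois v m * (real m * real (m - 1) * r ^ (m - 2))"]
        sums_shift_zero[of "\<lambda>k. pois v (Suc k) * (real (Suc k) * real (Suc k - 1) * r ^ (Suc k - 2))"])
      (simp_all add: numeral_2_eq_2)
  have "(\<Sum>m. ennreal (pois v m) * ennreal (real m * real (m - 1) * r ^ (m - 2))) = (\<Sum>m. ennreal (pois v m * (real m * real (m - 1) * r ^ (m - 2))))"
    by (intro arg_cong[where f = suminf] ext ennreal_mult[symmetric]) (use assms in auto)
  also have "\<dots> = ennreal (v\<^sup>2 * exp (- (v * (1 - r))))"
    using s assms by (intro suminf_ennreal_eq) auto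
  finally show ?thesis .
qed

section \<open>The graph on given locations\<close>

definition mark :: "(nat set \<Rightarrow> real \<times> real) \<Rightarrow> nat \<Rightarrow> real" where
  "mark \<eta> i = fst (\<eta> {i})"

definition unif01 :: "real measure" where
  "unif01 = uniform_measure lborel {0..1}"

lemma prob_space_unif01: "prob_space unif01"
  unfolding unif01_def by (rule prob_space_uniform_measure) auto

lemma sets_unif01 [simp, measurable_cong]: "sets unif01 = sets borel"
  by (simp add: unif01_def)

lemma space_unif01 [simp]: "space unif01 = UNIV"
  by (simp add: unif01_def)

lemma emeasure_unif01_atMost: "0 \<le> c \<Longrightarrow> c \<le> 1 \<Longrightarrow> emeasure unif01 {..c} = ennreal c"
proof -
  assume c: "0 \<le> c" "c \<le> 1"
  then have "{0..1} \<inter> {..c} = {0..c}" by auto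
  then show ?thesis using c by (simp add: unif01_def divide_ennreal_def)
qed

text \<open>A concrete version of the graph: only the locations live on \<open>M\<close>, while
  marks and edges are functions of an independent i.i.d. family on a second factor. There any single
  mark or edge can be resampled; the given graph has the same joint law of locations and
  edges.\<close>

locale random_graph_model = poisson_process M X
  for M :: "'w measure" and X :: "nat \<Rightarrow> 'w \<Rightarrow> 'a::euclidean_space" +
  fixes \<alpha> :: ereal and \<beta> p \<sigma> \<tau> :: real and \<mu> :: "real measure"
  assumes \<alpha>: "1 < \<alpha>" and \<beta>: "0 < \<beta>" and p: "0 < p" "p \<le> 1" and \<sigma>: "0 < \<sigma>" and \<tau>: "2 < \<tau>" "\<tau> < 2 + \<sigma>"
    and prob_space_\<mu>: "prob_space \<mu>" and sets_\<mu> [simp, measurable_cong]: "sets \<mu> = sets borel"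
    and tail: "1 \<le> w \<Longrightarrow> measure \<mu> {w..} = w powr (- (\<tau> - 1))"
begin

text \<open>Each set \<open>s\<close> of vertices carries an independent pair \<open>\<eta> s\<close>: its first component is the mark of \<open>i\<close> if \<open>s = {i}\<close>,
  its second one decides about the edge \<open>{i, j}\<close> if \<open>s = {i, j}\<close>. The other components are never used.\<close>

definition N :: "(real \<times> real) measure" where
  "N = \<mu> \<Otimes>\<^sub>M unif01"

definition Q :: "(nat set \<Rightarrow> real \<times> real) measure" where
  "Q = PiM UNIV (\<lambda>_. N)"

definition cp :: "(nat \<Rightarrow> 'a) \<Rightarrow> (nat set \<Rightarrow> real \<times> real) \<Rightarrow> nat \<Rightarrow> nat \<Rightarrow> real" where
  "cp x \<eta> i j = connection_prob \<alpha> \<beta> p \<sigma> (x i) (mark \<eta> i) (x j) (mark \<eta> j)"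

definition edge :: "(nat \<Rightarrow> 'a) \<Rightarrow> (nat set \<Rightarrow> real \<times> real) \<Rightarrow> nat \<Rightarrow> nat \<Rightarrow> bool" where
  "edge x \<eta> i j \<longleftrightarrow> i \<noteq> j \<and> snd (\<eta> {i, j}) \<le> cp x \<eta> i j"

definition comp :: "nat set \<Rightarrow> (nat \<Rightarrow> 'a) \<Rightarrow> (nat set \<Rightarrow> real \<times> real) \<Rightarrow> nat \<Rightarrow> nat set" where
  "comp V x \<eta> v = component (edge x \<eta>) V v"

lemma prob_space_N: "prob_space N"
  unfolding N_def by (intro prob_space_pair prob_space_\<mu> prob_space_unif01)

lemma prob_space_Q: "prob_space Q"
  unfolding Q_def by (intro prob_space_PiM prob_space_N)

lemma space_\<mu> [simp]: "space \<mu> = UNIV"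
  using sets_eq_imp_space_eq[OF sets_\<mu>] by simp

lemma sets_N [simp, measurable_cong]: "sets N = sets borel"
  unfolding N_def borel_prod[symmetric] by (rule sets_pair_measure_cong) simp_all

lemma space_N [simp]: "space N = UNIV"
  by (simp add: N_def space_pair_measure)

lemma space_Q [simp]: "space Q = UNIV"
  by (simp add: Q_def space_PiM)

lemma measurable_coord [measurable]: "(\<lambda>\<eta>. \<eta> s) \<in> borel_measurable Q"
proof -
  have "(\<lambda>\<eta>. \<eta> s) \<in> measurable Q N" unfolding Q_def by measurable
  then show ?thesis by (simp cong: measurable_cong_sets)
qed

lemma measurable_fst_coord [measurable]: "(\<lambda>\<eta>. fst (\<eta> s)) \<in> borel_measurable Q"
  and measurable_snd_coord [measurable]: "(\<lambda>\<eta>. snd (\<eta> s)) \<in> borel_measurable Q"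
proof -
  have "fst \<in> borel_measurable (borel :: (real \<times> real) measure)" "snd \<in> borel_measurable (borel :: (real \<times> real) measure)"
    by (simp_all add: borel_prod[symmetric])
  then show "(\<lambda>\<eta>. fst (\<eta> s)) \<in> borel_measurable Q" "(\<lambda>\<eta>. snd (\<eta> s)) \<in> borel_measurable Q"
    using measurable_compose[OF measurable_coord] by blast+
qed

lemma measurable_mark [measurable]: "(\<lambda>\<eta>. mark \<eta> i) \<in> borel_measurable Q"
  unfolding mark_def by measurable

lemma measurable_kernel [measurable]: "(\<lambda>z. kernel \<sigma> (fst z) (snd z)) \<in> borel_measurable (borel \<Otimes>\<^sub>M borel)"
  unfolding kernel_def by measurable

lemma measurable_profile [measurable]: "profile \<alpha> \<in> borel_measurable borel"
  unfolding profile_def[abs_def] by (cases "\<alpha> = \<infinity>") simp_all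

lemma measurable_connection_prob:
  assumes [measurable]: "f1 \<in> borel_measurable K" "g1 \<in> borel_measurable K" "f2 \<in> borel_measurable K" "g2 \<in> borel_measurable K"
  shows "(\<lambda>z. connection_prob \<alpha> \<beta> p \<sigma> (f1 z :: 'a) (g1 z) (f2 z) (g2 z)) \<in> borel_measurable K"
proof -
  have "(\<lambda>z. kernel \<sigma> (fst (g1 z, g2 z)) (snd (g1 z, g2 z))) \<in> borel_measurable K" by measurable
  then have [measurable]: "(\<lambda>z. kernel \<sigma> (g1 z) (g2 z)) \<in> borel_measurable K" by simp
  show ?thesis unfolding connection_prob_def by measurable
qed

lemma pred_edge [measurable (raw)]:
  assumes [measurable]: "(\<lambda>z. x z i) \<in> borel_measurable K" "(\<lambda>z. x z j) \<in> borel_measurable K" "\<eta> \<in> measurable K Q"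
  shows "Measurable.pred K (\<lambda>z. edge (x z) (\<eta> z) i j)"
proof -
  have 1: "(\<lambda>z. fst (\<eta> z s)) \<in> borel_measurable K" for s
    by (rule measurable_compose[OF assms(3) measurable_fst_coord])
  have [measurable]: "(\<lambda>z. snd (\<eta> z s)) \<in> borel_measurable K" for s
    by (rule measurable_compose[OF assms(3) measurable_snd_coord])
  have [measurable]: "(\<lambda>z. cp (x z) (\<eta> z) i j) \<in> borel_measurable K"
    unfolding cp_def mark_def by (rule measurable_connection_prob[OF assms(1) 1 assms(2) 1])
  show ?thesis unfolding edge_def by measurable
qed

lemma pred_comp [measurable (raw)]:
  assumes "\<And>i. (\<lambda>z. x z i) \<in> borel_measurable K" "\<eta> \<in> measurable K Q" "\<And>a. Measurable.pred K (\<lambda>z. a \<in> V z)"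
  shows "Measurable.pred K (\<lambda>z. u \<in> comp (V z) (x z) (\<eta> z) v)"
  unfolding comp_def by (intro measurable_component pred_edge assms)

lemma connection_prob_sym: "connection_prob \<alpha> \<beta> p \<sigma> x1 w1 x2 w2 = connection_prob \<alpha> \<beta> p \<sigma> (x2::'a) w2 x1 w1"
  by (simp add: connection_prob_def kernel_def max.commute min.commute norm_minus_commute)

lemma edge_sym: "edge x \<eta> i j \<longleftrightarrow> edge x \<eta> j i"
  by (auto simp: edge_def cp_def connection_prob_sym[of "x i"] insert_commute)

lemma edge_cong:
  assumes "x i = x' i" "x j = x' j" "\<eta> {i} = \<eta>' {i}" "\<eta> {j} = \<eta>' {j}" "\<eta> {i, j} = \<eta>' {i, j}"
  shows "edge x \<eta> i j = edge x' \<eta>' i j"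
  using assms by (simp add: edge_def cp_def mark_def)

lemma comp_cong:
  assumes "\<And>i. i \<in> V \<Longrightarrow> x i = x' i" "\<And>s. s \<noteq> {} \<Longrightarrow> s \<subseteq> V \<Longrightarrow> \<eta> s = \<eta>' s"
  shows "comp V x \<eta> v = comp V x' \<eta>' v"
  unfolding comp_def using assms by (intro component_cong edge_cong) auto

lemma edge_relabel: "h i \<noteq> h j \<or> i = j \<Longrightarrow> edge x \<eta> (h i) (h j) = edge (\<lambda>i. x (h i)) (\<lambda>s. \<eta> (h ` s)) i j"
  by (auto simp: edge_def cp_def mark_def)

lemma comp_relabel:
  assumes "inj_on h V" "v \<in> V"
  shows "comp (h ` V) x \<eta> (h v) = h ` comp V (\<lambda>i. x (h i)) (\<lambda>s. \<eta> (h ` s)) v"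
  unfolding comp_def
proof (rule component_image[OF assms])
  fix a b assume "a \<in> V" "b \<in> V"
  then show "edge x \<eta> (h a) (h b) = edge (\<lambda>i. x (h i)) (\<lambda>s. \<eta> (h ` s)) a b"
    using assms(1) by (intro edge_relabel) (auto simp: inj_on_def)
qed

lemma comp_subset: "v \<in> V \<Longrightarrow> comp V x \<eta> v \<subseteq> V"
  unfolding comp_def by (rule component_subset)

lemma mark_relabel: "mark \<eta> (h i) = mark (\<lambda>s. \<eta> (h ` s)) i"
  by (simp add: mark_def)

lemma relabel_invariant_ncard:
  assumes loc: "\<And>V x x' \<eta> \<eta>' v. finite V \<Longrightarrow> v \<in> V \<Longrightarrow> (\<And>i. i \<in> V \<Longrightarrow> x i = x' i) \<Longrightarrow>
      (\<And>s. s \<noteq> {} \<Longrightarrow> s \<subseteq> V \<Longrightarrow> \<eta> s = \<eta>' s) \<Longrightarrow> P V x \<eta> v = P V x' \<eta>' v"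
    and rel: "\<And>h V x \<eta> v. finite V \<Longrightarrow> inj_on h V \<Longrightarrow> v \<in> V \<Longrightarrow> P (h ` V) x \<eta> (h v) = P V (\<lambda>i. x (h i)) (\<lambda>s. \<eta> (h ` s)) v"
  shows "relabel_invariant (\<lambda>V x \<eta>. ncard {v \<in> V. P V x \<eta> v})"
proof (rule relabel_invariantI)
  fix V :: "nat set" and x x' :: "nat \<Rightarrow> 'b" and \<eta> \<eta>' :: "nat set \<Rightarrow> 'c"
  assume V: "finite V" "\<And>i. i \<in> V \<Longrightarrow> x i = x' i" "\<And>s. s \<noteq> {} \<Longrightarrow> s \<subseteq> V \<Longrightarrow> \<eta> s = \<eta>' s"
  have "P V x \<eta> v = P V x' \<eta>' v" if "v \<in> V" for v by (rule loc) (use V that in auto)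
  then have "{v \<in> V. P V x \<eta> v} = {v \<in> V. P V x' \<eta>' v}" by blast
  then show "ncard {v \<in> V. P V x \<eta> v} = ncard {v \<in> V. P V x' \<eta>' v}" by simp
next
  fix h :: "nat \<Rightarrow> nat" and V :: "nat set" and x :: "nat \<Rightarrow> 'b" and \<eta> :: "nat set \<Rightarrow> 'c"
  assume V: "finite V" "inj_on h V"
  have eq: "{v \<in> h ` V. P (h ` V) x \<eta> v} = h ` {v \<in> V. P V (\<lambda>i. x (h i)) (\<lambda>s. \<eta> (h ` s)) v}"
    using rel[OF V] by auto
  have "card (h ` {v \<in> V. P V (\<lambda>i. x (h i)) (\<lambda>s. \<eta> (h ` s)) v}) = card {v \<in> V. P V (\<lambda>i. x (h i)) (\<lambda>s. \<eta> (h ` s)) v}"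
    using V(2) by (intro card_image) (auto intro: inj_on_subset)
  then show "ncard {v \<in> h ` V. P (h ` V) x \<eta> v} = ncard {v \<in> V. P V (\<lambda>i. x (h i)) (\<lambda>s. \<eta> (h ` s)) v}"
    unfolding eq using V(1) by (simp add: ncard_finite)
qed

lemma relabel_invariant_big:
  "relabel_invariant (\<lambda>V x \<eta>. ncard {v \<in> V. x v \<in> C \<and> big k (comp V x \<eta> v)})"
proof (rule relabel_invariant_ncard)
  fix V :: "nat set" and x x' :: "nat \<Rightarrow> 'a" and \<eta> \<eta>' :: "nat set \<Rightarrow> real \<times> real" and v assume "v \<in> V" "\<And>i. i \<in> V \<Longrightarrow> x i = x' i" "\<And>s. s \<noteq> {} \<Longrightarrow> s \<subseteq> V \<Longrightarrow> \<eta> s = \<eta>' s"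
  then show "(x v \<in> C \<and> big k (comp V x \<eta> v)) = (x' v \<in> C \<and> big k (comp V x' \<eta>' v))"
    using comp_cong[of V x x' \<eta> \<eta>' v] by simp
next
  fix h :: "nat \<Rightarrow> nat" and V :: "nat set" and x :: "nat \<Rightarrow> 'a" and \<eta> :: "nat set \<Rightarrow> real \<times> real" and v assume V: "inj_on h V" "v \<in> V"
  have "inj_on h (comp V (\<lambda>i. x (h i)) (\<lambda>s. \<eta> (h ` s)) v)"
    by (rule inj_on_subset[OF V(1) comp_subset[OF V(2)]])
  then show "(x (h v) \<in> C \<and> big k (comp (h ` V) x \<eta> (h v))) = (x (h v) \<in> C \<and> big k (comp V (\<lambda>i. x (h i)) (\<lambda>s. \<eta> (h ` s)) v))"
    by (simp add: comp_relabel[OF V] big_image)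
qed

lemma relabel_invariant_marks:
  "relabel_invariant (\<lambda>V x \<eta>. ncard {v \<in> V. (\<exists>u\<in>comp V x \<eta> v. K \<le> mark \<eta> u) \<and> (\<forall>u\<in>comp V x \<eta> v. mark \<eta> u < K')})"
proof (rule relabel_invariant_ncard)
  fix V :: "nat set" and x x' :: "nat \<Rightarrow> 'a" and \<eta> \<eta>' :: "nat set \<Rightarrow> real \<times> real" and v assume V: "v \<in> V" "\<And>i. i \<in> V \<Longrightarrow> x i = x' i" "\<And>s. s \<noteq> {} \<Longrightarrow> s \<subseteq> V \<Longrightarrow> \<eta> s = \<eta>' s"
  have c: "comp V x \<eta> v = comp V x' \<eta>' v" using V by (intro comp_cong) auto
  have "mark \<eta> u = mark \<eta>' u" if "u \<in> comp V x' \<eta>' v" for u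
    using V(3)[of "{u}"] subsetD[OF comp_subset[OF V(1)] that] by (simp add: mark_def)
  then show "((\<exists>u\<in>comp V x \<eta> v. K \<le> mark \<eta> u) \<and> (\<forall>u\<in>comp V x \<eta> v. mark \<eta> u < K')) =
    ((\<exists>u\<in>comp V x' \<eta>' v. K \<le> mark \<eta>' u) \<and> (\<forall>u\<in>comp V x' \<eta>' v. mark \<eta>' u < K'))"
    unfolding c by auto
next
  fix h :: "nat \<Rightarrow> nat" and V :: "nat set" and x :: "nat \<Rightarrow> 'a" and \<eta> :: "nat set \<Rightarrow> real \<times> real" and v assume V: "inj_on h V" "v \<in> V"
  show "((\<exists>u\<in>comp (h ` V) x \<eta> (h v). K \<le> mark \<eta> u) \<and> (\<forall>u\<in>comp (h ` V) x \<eta> (h v). mark \<eta> u < K')) =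
    ((\<exists>u\<in>comp V (\<lambda>i. x (h i)) (\<lambda>s. \<eta> (h ` s)) v. K \<le> mark (\<lambda>s. \<eta> (h ` s)) u) \<and>
     (\<forall>u\<in>comp V (\<lambda>i. x (h i)) (\<lambda>s. \<eta> (h ` s)) v. mark (\<lambda>s. \<eta> (h ` s)) u < K'))"
    by (simp add: comp_relabel[OF V] mark_relabel)
qed

text \<open>Two vertices of mark at least \<open>K\<close> without a common neighbour of mark at least \<open>K\<close>,
  provided all vertices of mark at least \<open>K\<close> are joined with probability \<open>p\<close>.\<close>

definition unlinked :: "real \<Rightarrow> nat set \<Rightarrow> (nat set \<Rightarrow> real \<times> real) \<Rightarrow> nat \<Rightarrow> nat \<Rightarrow> bool" where
  "unlinked K V \<eta> i j \<longleftrightarrow> i \<noteq> j \<and> K \<le> mark \<eta> i \<and> K \<le> mark \<eta> j \<and>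
     (\<forall>h\<in>V - {i, j}. \<not> (K \<le> mark \<eta> h \<and> snd (\<eta> {i, h}) \<le> p \<and> snd (\<eta> {j, h}) \<le> p))"

lemma relabel_invariant_unlinked:
  "relabel_invariant (\<lambda>V x \<eta>. ncard {i \<in> V. \<exists>j\<in>V. unlinked K V \<eta> i j})"
proof (rule relabel_invariant_ncard)
  fix V :: "nat set" and x x' :: "nat \<Rightarrow> 'b" and \<eta> \<eta>' :: "nat set \<Rightarrow> real \<times> real" and i
  assume V: "i \<in> V" "\<And>s. s \<noteq> {} \<Longrightarrow> s \<subseteq> V \<Longrightarrow> \<eta> s = \<eta>' s"
  have e: "\<eta> {a} = \<eta>' {a}" "\<eta> {a, b} = \<eta>' {a, b}" if "a \<in> V" "b \<in> V" for a b using that V(2) by auto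
  have "unlinked K V \<eta> i j = unlinked K V \<eta>' i j" if "j \<in> V" for j
    unfolding unlinked_def mark_def using e that V(1) by (auto cong: conj_cong)
  then show "(\<exists>j\<in>V. unlinked K V \<eta> i j) = (\<exists>j\<in>V. unlinked K V \<eta>' i j)" by auto
next
  fix h :: "nat \<Rightarrow> nat" and V and x :: "nat \<Rightarrow> 'b" and \<eta> :: "nat set \<Rightarrow> real \<times> real" and i assume V: "inj_on h V" "i \<in> V"
  have "unlinked K (h ` V) \<eta> (h i) (h j) = unlinked K V (\<lambda>s. \<eta> (h ` s)) i j" if j: "j \<in> V" for j
  proof -
    have "h ` V - {h i, h j} = h ` (V - {i, j})" using V j by (auto simp: inj_on_def)
    moreover have "h i = h j \<longleftrightarrow> i = j" using V j by (auto simp: inj_on_def)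
    ultimately show ?thesis unfolding unlinked_def by (simp add: mark_def)
  qed
  then show "(\<exists>j\<in>h ` V. unlinked K (h ` V) \<eta> (h i) j) = (\<exists>j\<in>V. unlinked K V (\<lambda>s. \<eta> (h ` s)) i j)" by auto
qed

lemma nn_integral_binomial:
  assumes B: "B \<in> sets borel" "bounded B" "0 < measure lborel B" and inv: "relabel_invariant F"
    and F: "\<And>m::nat. (\<lambda>z. F {..<m} (fst z) (snd z)) \<in> borel_measurable (PiM UNIV (\<lambda>_. borel) \<Otimes>\<^sub>M Q)"
  shows "(\<integral>\<^sup>+\<omega>. \<integral>\<^sup>+\<eta>. F (points_in (pts \<omega>) B) (pts \<omega>) \<eta> \<partial>Q \<partial>M) =
    (\<Sum>m. ennreal (pois (measure lborel B) m) *
      (\<integral>\<^sup>+y. \<integral>\<^sup>+\<eta>. F {..<m} y \<eta> \<partial>Q \<partial>PiM UNIV (\<lambda>_. uniform_measure lborel B)))"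
  using nn_integral_mixed_binomial[OF B, of "\<lambda>_. 1" N F] uncorrelated_1[OF B(2)] prob_space_N inv F
  by (simp add: emeasure_space_1 Q_def)

lemma measurable_pair_fst_app [measurable]: "(\<lambda>z. fst z i) \<in> borel_measurable (PiM UNIV (\<lambda>_. borel :: 'a measure) \<Otimes>\<^sub>M Q)"
  by (rule measurable_compose[OF measurable_fst]) simp

lemma expected_count:
  assumes B: "B \<in> sets borel" "bounded B" "0 < measure lborel B"
  shows "(\<integral>\<^sup>+\<omega>. ncard (points_in (pts \<omega>) B) \<partial>M) = ennreal (measure lborel B)"
    and "(\<integral>\<^sup>+\<omega>. (ncard (points_in (pts \<omega>) B))\<^sup>2 \<partial>M) = ennreal ((measure lborel B)\<^sup>2 + measure lborel B)"
proof -
  interpret Q: prob_space Q by (rule prob_space_Q)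
  let ?U = "PiM (UNIV :: nat set) (\<lambda>_. uniform_measure lborel B)" and ?v = "measure lborel B"
  interpret U: prob_space ?U
    using measure_lborel_positive_bounded[OF B(2,1,3)] by (intro prob_space_PiM prob_space_uniform_measure) auto
  have inv: "relabel_invariant (\<lambda>V (x :: nat \<Rightarrow> 'a) (\<eta> :: nat set \<Rightarrow> real \<times> real). f (ncard V))" for f :: "ennreal \<Rightarrow> ennreal"
    by (rule relabel_invariantI) (auto simp: ncard_finite card_image)
  have *: "(\<integral>\<^sup>+\<omega>. f (ncard (points_in (pts \<omega>) B)) \<partial>M) = (\<Sum>m. ennreal (pois ?v m) * f (of_nat m))" for f
    using nn_integral_binomial[OF B inv[of f]]
    by (simp add: Q.emeasure_space_1 U.emeasure_space_1 ncard_finite Q.emeasure_space_1[simplified])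
  have 1: "(\<Sum>m. ennreal (pois ?v m) * of_nat m) = ennreal ?v"
    using pois_factorial_1[of ?v 1] by (simp add: ennreal_of_nat_eq_real_of_nat)
  show "(\<integral>\<^sup>+\<omega>. ncard (points_in (pts \<omega>) B) \<partial>M) = ennreal ?v"
    using *[of "\<lambda>x. x"] 1 by simp
  have sq: "(of_nat m :: ennreal)\<^sup>2 = ennreal (real m * real (m - 1) * 1 ^ (m - 2)) + of_nat m" for m
  proof -
    have "(real m)\<^sup>2 = real m * real (m - 1) + real m" by (cases m) (auto simp: power2_eq_square algebra_simps)
    then show ?thesis
      by (simp add: ennreal_of_nat_eq_real_of_nat ennreal_power ennreal_plus[symmetric] del: ennreal_plus)
  qed
  have "(\<Sum>m. ennreal (pois ?v m) * (of_nat m)\<^sup>2) = (\<Sum>m. ennreal (pois ?v m) * ennreal (real m * real (m - 1) * 1 ^ (m - 2)) + ennreal (pois ?v m) * of_nat m)"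
    unfolding sq by (simp add: distrib_left)
  also have "\<dots> = (\<Sum>m. ennreal (pois ?v m) * ennreal (real m * real (m - 1) * 1 ^ (m - 2))) + (\<Sum>m. ennreal (pois ?v m) * of_nat m)"
    by (intro suminf_add[symmetric]) auto
  also have "\<dots> = ennreal (?v\<^sup>2 + ?v)"
    unfolding 1 using pois_factorial_2[of ?v 1] by simp
  finally show "(\<integral>\<^sup>+\<omega>. (ncard (points_in (pts \<omega>) B))\<^sup>2 \<partial>M) = ennreal (?v\<^sup>2 + ?v)"
    using *[of "\<lambda>x. x\<^sup>2"] by simp
qed

end

lemma measurable_PiM_UNIV_coordinate:
  assumes "g \<in> measurable N K"
  shows "(\<lambda>\<omega>. g (\<omega> i)) \<in> measurable (PiM UNIV (\<lambda>_. N)) K"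
  by (rule measurable_compose[OF _ assms]) (rule measurable_component_singleton, simp)

text \<open>\<open>J\<close> averages over part of the randomness; a uniform bound on the conditional probability
  of \<open>G\<close> given \<open>A\<close> and the remaining randomness can then be integrated.\<close>

lemma emeasure_resample_le:
  fixes P :: "'w measure"
  assumes A: "A \<in> sets P" and G: "G \<in> sets P"
    and J: "\<And>f. f \<in> borel_measurable P \<Longrightarrow> (\<integral>\<^sup>+\<omega>. f \<omega> \<partial>P) = (\<integral>\<^sup>+\<omega>. J f \<omega> \<partial>P)"
    and m: "J (indicator A) \<in> borel_measurable P"
    and le: "\<And>\<omega>. \<omega> \<in> space P \<Longrightarrow> J (indicator (A \<inter> G)) \<omega> \<le> c * J (indicator A) \<omega>"
  shows "emeasure P (A \<inter> G) \<le> c * emeasure P A"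
proof -
  have "emeasure P (A \<inter> G) = (\<integral>\<^sup>+\<omega>. indicator (A \<inter> G) \<omega> \<partial>P)" using A G by simp
  also have "\<dots> = (\<integral>\<^sup>+\<omega>. J (indicator (A \<inter> G)) \<omega> \<partial>P)"
    using A G by (intro J) auto
  also have "\<dots> \<le> (\<integral>\<^sup>+\<omega>. c * J (indicator A) \<omega> \<partial>P)"
    by (intro nn_integral_mono le)
  also have "\<dots> = c * (\<integral>\<^sup>+\<omega>. J (indicator A) \<omega> \<partial>P)"
    by (rule nn_integral_cmult[OF m])
  also have "(\<integral>\<^sup>+\<omega>. J (indicator A) \<omega> \<partial>P) = (\<integral>\<^sup>+\<omega>. indicator A \<omega> \<partial>P)"
    using A by (intro J[symmetric]) auto
  also have "\<dots> = emeasure P A" using A by simp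
  finally show ?thesis .
qed

section \<open>Monotonicity in the marks and large components without large marks\<close>

context random_graph_model
begin

lemma kernel_mono1:
  assumes "1 \<le> w1" "w1 \<le> w1'"
  shows "kernel \<sigma> w1 w2 \<le> kernel \<sigma> w1' w2" "0 \<le> kernel \<sigma> w1 w2"
proof -
  consider "w2 \<le> w1" | "w1 \<le> w2" "w2 \<le> w1'" | "w1' \<le> w2" using assms by linarith
  then show "kernel \<sigma> w1 w2 \<le> kernel \<sigma> w1' w2"
  proof cases
    case 1
    then have "max w1 w2 = w1" "max w1' w2 = w1'" "min w1 w2 = w2" "min w1' w2 = w2" using assms by auto
    then show ?thesis using assms by (simp add: kernel_def mult_right_mono)
  next
    \<comment> \<open>The raised mark overtakes \<open>w2\<close>, so the two marks swap roles; both
      the maximum and the minimum still increase.\<close>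
    case 2
    then have *: "max w1 w2 = w2" "max w1' w2 = w1'" "min w1 w2 = w1" "min w1' w2 = w2" using assms by auto
    show ?thesis unfolding kernel_def * using assms 2 \<sigma> by (intro mult_mono powr_mono2) auto
  next
    case 3
    then have *: "max w1 w2 = w2" "max w1' w2 = w2" "min w1 w2 = w1" "min w1' w2 = w1'" using assms by auto
    show ?thesis unfolding kernel_def * using assms 3 \<sigma> by (intro mult_left_mono powr_mono2) auto
  qed
  show "0 \<le> kernel \<sigma> w1 w2" using assms by (auto simp: kernel_def)
qed

lemma profile_mono: "0 \<le> s \<Longrightarrow> s \<le> s' \<Longrightarrow> profile \<alpha> s \<le> profile \<alpha> s'"
  using \<alpha> by (cases \<alpha>) (auto simp: profile_def intro!: powr_mono2)

lemma profile_ge_1: "1 \<le> s \<Longrightarrow> profile \<alpha> s = 1"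
  by (simp add: profile_def)

lemma profile_bounds: "0 \<le> profile \<alpha> s" "0 \<le> s \<Longrightarrow> profile \<alpha> s \<le> 1"
proof -
  show "0 \<le> profile \<alpha> s" by (simp add: profile_def)
  show "profile \<alpha> s \<le> 1" if "0 \<le> s"
    using profile_mono[OF that, of "max 1 s"] by (simp add: profile_ge_1)
qed

lemma connection_prob_mono1:
  assumes "1 \<le> w1" "w1 \<le> w1'"
  shows "connection_prob \<alpha> \<beta> p \<sigma> x1 w1 x2 w2 \<le> connection_prob \<alpha> \<beta> p \<sigma> (x1::'a) w1' x2 w2"
  unfolding connection_prob_def using kernel_mono1[OF assms, of w2] p \<beta>
  by (intro mult_left_mono profile_mono divide_right_mono divide_nonneg_nonneg mult_nonneg_nonneg) auto

text \<open>The alternative of equal marks also covers marks below 1, which occur on a null set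
  only; with it the comparison holds pointwise and needs no exceptional set.\<close>

lemma cp_mono:
  assumes "\<And>i. i \<in> {a, b} \<Longrightarrow> mark \<eta> i = mark \<eta>' i \<or> (1 \<le> mark \<eta> i \<and> mark \<eta> i \<le> mark \<eta>' i)"
  shows "cp x \<eta> a b \<le> cp x \<eta>' a b"
proof -
  have "cp x \<eta> a b \<le> connection_prob \<alpha> \<beta> p \<sigma> (x a) (mark \<eta>' a) (x b) (mark \<eta> b)"
    unfolding cp_def using assms[of a] connection_prob_mono1 by auto
  also have "\<dots> \<le> cp x \<eta>' a b"
    unfolding cp_def connection_prob_sym[of "x a"] using assms[of b] connection_prob_mono1 by auto
  finally show ?thesis .
qed

lemma AE_\<mu>_ge_1: "AE w in \<mu>. 1 \<le> w"
proof -
  interpret \<mu>: prob_space \<mu> by (rule prob_space_\<mu>)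
  have "\<mu>.prob {1..} = 1" using tail[of 1] by simp
  then have "AE w in \<mu>. w \<in> {1..}" using \<mu>.AE_in_set_eq_1[of "{1..}"] by simp
  then show ?thesis by simp
qed

definition tailprob :: "real \<Rightarrow> real" where
  "tailprob K = K powr (- (\<tau> - 1))"

lemma tailprob: "1 \<le> K \<Longrightarrow> 0 < tailprob K" "1 \<le> K \<Longrightarrow> tailprob K \<le> 1" "1 < K \<Longrightarrow> tailprob K < 1"
  using \<tau> powr_mono[of "- (\<tau> - 1)" 0 K] powr_less_mono[of "- (\<tau> - 1)" 0 K] by (auto simp: tailprob_def)

lemma emeasure_\<mu>_tail: "1 \<le> K \<Longrightarrow> emeasure \<mu> {K..} = ennreal (tailprob K)" 
  and emeasure_\<mu>_low: "1 \<le> K \<Longrightarrow> emeasure \<mu> {..<K} = ennreal (1 - tailprob K)"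
proof -
  interpret \<mu>: prob_space \<mu> by (rule prob_space_\<mu>)
  assume K: "1 \<le> K"
  show "emeasure \<mu> {K..} = ennreal (tailprob K)"
    using tail[OF K] by (simp add: \<mu>.emeasure_eq_measure tailprob_def)
  have "{..<K} = space \<mu> - {K..}" by auto
  then show "emeasure \<mu> {..<K} = ennreal (1 - tailprob K)"
    using tail[OF K] \<mu>.prob_compl[of "{K..}"] by (simp add: \<mu>.emeasure_eq_measure tailprob_def)
qed

text \<open>Every vertex gets a base mark with the law of a mark conditioned to be below \<open>K\<close>, which is
  independent of the event that its mark is at least \<open>K\<close>. On the event in question the component
  is the component of the base graph, and each of its vertices has mark below \<open>K\<close> independently.\<close>

lemma prob_large_component_low_marks:
  assumes V: "finite V" "v \<in> V" and K: "1 < K"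
  shows "emeasure Q {\<eta>. k \<le> card (comp V x \<eta> v) \<and> (\<forall>u\<in>comp V x \<eta> v. mark \<eta> u < K)}
    \<le> ennreal ((1 - tailprob K) ^ k)"
proof -
  let ?q = "tailprob K"
  have q: "0 < ?q" "?q < 1" using tailprob[of K] K by auto
  interpret \<mu>: prob_space \<mu> by (rule prob_space_\<mu>)
  interpret U: prob_space unif01 by (rule prob_space_unif01)
  interpret N: prob_space N by (rule prob_space_N)
  have low: "emeasure \<mu> {..<K} = ennreal (1 - ?q)" using K by (intro emeasure_\<mu>_low) auto
  have high: "emeasure \<mu> {K..} = ennreal ?q" using K by (intro emeasure_\<mu>_tail) auto
  define \<mu>0 where "\<mu>0 = uniform_measure \<mu> {..<K}"
  have sets\<mu>0[simp, measurable_cong]: "sets \<mu>0 = sets borel" by (simp add: \<mu>0_def)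
  have \<mu>0: "prob_space \<mu>0" unfolding \<mu>0_def using low q by (intro prob_space_uniform_measure) auto
  interpret \<mu>0: prob_space \<mu>0 by (rule \<mu>0)
  define N' where "N' = N \<Otimes>\<^sub>M \<mu>0"
  define Q' where "Q' = PiM (UNIV :: nat set set) (\<lambda>_. N')"
  \<comment> \<open>The base mark: the mark itself if it is below \<open>K\<close>, otherwise the
    extra sample \<open>snd a\<close>. The truncation to the interval from 1 to \<open>K\<close>
    changes nothing almost surely and makes base marks never exceed the marks they replace.\<close>
  define b where "b = (\<lambda>a::(real \<times> real) \<times> real. (if fst (fst a) < K then fst (fst a) else max 1 (min (snd a) K), snd (fst a)))"
  have N': "prob_space N'" unfolding N'_def by (intro prob_space_pair prob_space_N \<mu>0)
  interpret Q': prob_space Q' unfolding Q'_def by (intro prob_space_PiM N')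
  have spN': "space N' = UNIV" unfolding N'_def space_pair_measure using sets_eq_imp_space_eq[OF sets\<mu>0] by simp
  have spQ': "space Q' = UNIV" unfolding Q'_def by (simp add: space_PiM spN')
  have ms[measurable]: "fst \<in> borel_measurable (borel :: (real \<times> real) measure)" "snd \<in> borel_measurable (borel :: (real \<times> real) measure)"
    by (simp_all add: borel_prod[symmetric])
  have f1: "fst \<in> measurable N' N" unfolding N'_def by measurable
  have f1'[measurable]: "(\<lambda>a. fst a) \<in> borel_measurable N'" using f1 by (simp cong: measurable_cong_sets)
  have [measurable]: "(\<lambda>a. snd a) \<in> borel_measurable N'"
    unfolding N'_def by (rule measurable_compose[OF measurable_snd]) simp
  have ff[measurable]: "(\<lambda>a. fst (fst a)) \<in> borel_measurable N'" "(\<lambda>a. snd (fst a)) \<in> borel_measurable N'"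
    using measurable_compose[OF f1' ms(1)] measurable_compose[OF f1' ms(2)] by auto
  have sbN: "sets (borel \<Otimes>\<^sub>M borel) = sets N"
    unfolding N_def by (rule sets_pair_measure_cong) simp_all
  have bm: "b \<in> measurable N' N"
  proof -
    have "b \<in> measurable N' (borel \<Otimes>\<^sub>M borel)" unfolding b_def by measurable
    then show ?thesis using measurable_cong_sets[OF refl sbN] by blast
  qed
  define \<eta>0 where "\<eta>0 = (\<lambda>\<eta>'::nat set \<Rightarrow> (real \<times> real) \<times> real. \<lambda>s. fst (\<eta>' s))"
  define \<eta>1 where "\<eta>1 = (\<lambda>\<eta>'::nat set \<Rightarrow> (real \<times> real) \<times> real. \<lambda>s. b (\<eta>' s))"
  have m0: "\<eta>0 \<in> measurable Q' Q" unfolding Q_def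
  proof (rule measurable_PiM_UNIV)
    show "(\<lambda>\<omega>. \<eta>0 \<omega> i) \<in> measurable Q' N" for i
      unfolding \<eta>0_def Q'_def by (rule measurable_PiM_UNIV_coordinate[OF f1])
  qed
  have m1: "\<eta>1 \<in> measurable Q' Q" unfolding Q_def
  proof (rule measurable_PiM_UNIV)
    show "(\<lambda>\<omega>. \<eta>1 \<omega> i) \<in> measurable Q' N" for i
      unfolding \<eta>1_def Q'_def by (rule measurable_PiM_UNIV_coordinate[OF bm])
  qed
  have QQ': "Q = distr Q' Q \<eta>0"
  proof -
    have "distr (PiM UNIV (\<lambda>_. N')) (PiM UNIV (\<lambda>_. N)) (\<lambda>\<omega> j. fst (\<omega> (id j))) = PiM (UNIV :: nat set set) (\<lambda>_. distr N' N fst)"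
      by (rule PiM_UNIV_distr[OF N' f1]) simp
    moreover have "distr N' N fst = N" unfolding N'_def by (rule \<mu>0.distr_pair_fst)
    ultimately show ?thesis by (simp add: Q_def Q'_def \<eta>0_def)
  qed
  \<comment> \<open>The independence behind the bound: whether the mark is below \<open>K\<close> is
    independent of the base mark, since a mark conditioned to be below \<open>K\<close> and its
    replacement have the same law.\<close>
  have base: "(\<integral>\<^sup>+a. indicator {a. fst (fst a) < K} a * g (b a) \<partial>N') = ennreal (1 - ?q) * (\<integral>\<^sup>+a. g (b a) \<partial>N')"
    if g[measurable]: "g \<in> borel_measurable N" for g :: "real \<times> real \<Rightarrow> ennreal"
  proof -
    have gm[measurable]: "(\<lambda>w. g (w, t)) \<in> borel_measurable borel" for t
    proof -
      have "(\<lambda>w. (w, t)) \<in> measurable borel (borel \<Otimes>\<^sub>M borel)" by measurable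
      moreover have "g \<in> borel_measurable (borel \<Otimes>\<^sub>M borel)" using g measurable_cong_sets[OF sbN refl] by blast
      ultimately show ?thesis by (rule measurable_compose)
    qed
    define \<gamma> where "\<gamma> = (\<lambda>t. \<integral>\<^sup>+w. g (max 1 (min w K), t) \<partial>\<mu>0)"
    have \<gamma>: "(\<integral>\<^sup>+w. indicator {..<K} w * g (w, t) \<partial>\<mu>) = ennreal (1 - ?q) * \<gamma> t" for t
    proof -
      have "\<gamma> t = (\<integral>\<^sup>+w. g (max 1 (min w K), t) * indicator {..<K} w \<partial>\<mu>) / emeasure \<mu> {..<K}"
        unfolding \<gamma>_def \<mu>0_def by (rule nn_integral_uniform_measure) auto
      also have "(\<integral>\<^sup>+w. g (max 1 (min w K), t) * indicator {..<K} w \<partial>\<mu>) = (\<integral>\<^sup>+w. indicator {..<K} w * g (w, t) \<partial>\<mu>)"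
        using AE_\<mu>_ge_1 by (intro nn_integral_cong_AE, eventually_elim) (auto split: split_indicator simp: max_absorb2 min_absorb1)
      finally have "ennreal (1 - ?q) * \<gamma> t = ennreal (1 - ?q) * ((\<integral>\<^sup>+w. indicator {..<K} w * g (w, t) \<partial>\<mu>) / ennreal (1 - ?q))"
        unfolding low by simp
      also have "\<dots> = (\<integral>\<^sup>+w. indicator {..<K} w * g (w, t) \<partial>\<mu>)"
        unfolding ennreal_times_divide mult.commute[of "ennreal (1 - ?q)"]
        by (rule mult_divide_eq_ennreal) (use q in auto)
      finally show ?thesis by simp
    qed
    interpret pair_sigma_finite \<mu> unif01 ..
    have int: "(\<integral>\<^sup>+a. f a \<partial>N') = (\<integral>\<^sup>+t. \<integral>\<^sup>+w. \<integral>\<^sup>+w0. f ((w, t), w0) \<partial>\<mu>0 \<partial>\<mu> \<partial>unif01)"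
      if f: "f \<in> borel_measurable N'" for f :: "_ \<Rightarrow> ennreal"
    proof -
      have "(\<integral>\<^sup>+a. f a \<partial>N') = (\<integral>\<^sup>+z. \<integral>\<^sup>+w0. f (z, w0) \<partial>\<mu>0 \<partial>N)"
        unfolding N'_def by (rule \<mu>0.nn_integral_fst[symmetric]) (use f in \<open>simp add: N'_def\<close>)
      also have "\<dots> = (\<integral>\<^sup>+t. \<integral>\<^sup>+w. \<integral>\<^sup>+w0. f ((w, t), w0) \<partial>\<mu>0 \<partial>\<mu> \<partial>unif01)"
      proof -
        have "(\<lambda>z. \<integral>\<^sup>+w0. f (z, w0) \<partial>\<mu>0) \<in> borel_measurable N"
          by (rule \<mu>0.borel_measurable_nn_integral_fst) (use f in \<open>simp add: N'_def\<close>)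
        then show ?thesis unfolding N_def by (subst nn_integral_snd[symmetric]) auto
      qed
      finally show ?thesis .
    qed
    have gb[measurable]: "(\<lambda>a. g (b a)) \<in> borel_measurable N'" by (rule measurable_compose[OF bm g])
    have ind: "(\<lambda>a. indicator {a. fst (fst a) < K} a :: ennreal) \<in> borel_measurable N'"
    proof -
      have "{a \<in> space N'. fst (fst a) < K} \<in> sets N'" by measurable
      then show ?thesis by (simp add: spN')
    qed
    have 1: "(\<integral>\<^sup>+a. indicator {a. fst (fst a) < K} a * g (b a) \<partial>N') = (\<integral>\<^sup>+t. ennreal (1 - ?q) * \<gamma> t \<partial>unif01)"
    proof -
      have "(\<integral>\<^sup>+a. indicator {a. fst (fst a) < K} a * g (b a) \<partial>N') =
        (\<integral>\<^sup>+t. \<integral>\<^sup>+w. \<integral>\<^sup>+w0. indicator {..<K} w * g (w, t) \<partial>\<mu>0 \<partial>\<mu> \<partial>unif01)"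
        using ind by (subst int) (auto intro!: nn_integral_cong simp: b_def split: split_indicator)
      then show ?thesis by (simp add: \<mu>0.emeasure_space_1 \<gamma>)
    qed
    have 2: "(\<integral>\<^sup>+a. g (b a) \<partial>N') = (\<integral>\<^sup>+t. \<gamma> t \<partial>unif01)"
    proof -
      have "(\<integral>\<^sup>+a. g (b a) \<partial>N') =
        (\<integral>\<^sup>+t. \<integral>\<^sup>+w. indicator {..<K} w * g (w, t) + indicator {K..} w * \<gamma> t \<partial>\<mu> \<partial>unif01)"
      proof (subst int)
        have "(\<integral>\<^sup>+w0. g (b ((w, t), w0)) \<partial>\<mu>0) = indicator {..<K} w * g (w, t) + indicator {K..} w * \<gamma> t" for w t
          by (cases "w < K") (auto simp: b_def \<gamma>_def \<mu>0.emeasure_space_1)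
        then show "(\<integral>\<^sup>+t. \<integral>\<^sup>+w. \<integral>\<^sup>+w0. g (b ((w, t), w0)) \<partial>\<mu>0 \<partial>\<mu> \<partial>unif01) =
           (\<integral>\<^sup>+t. \<integral>\<^sup>+w. indicator {..<K} w * g (w, t) + indicator {K..} w * \<gamma> t \<partial>\<mu> \<partial>unif01)" by simp
      qed simp
      also have "\<dots> = (\<integral>\<^sup>+t. \<gamma> t \<partial>unif01)"
      proof (intro nn_integral_cong)
        fix t
        have "(\<integral>\<^sup>+w. indicator {..<K} w * g (w, t) + indicator {K..} w * \<gamma> t \<partial>\<mu>) =
          (\<integral>\<^sup>+w. indicator {..<K} w * g (w, t) \<partial>\<mu>) + (\<integral>\<^sup>+w. indicator {K..} w * \<gamma> t \<partial>\<mu>)"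
          by (intro nn_integral_add) measurable
        also have "(\<integral>\<^sup>+w. indicator {K..} w * \<gamma> t \<partial>\<mu>) = ennreal ?q * \<gamma> t"
          using high by (subst nn_integral_multc) auto
        finally show "(\<integral>\<^sup>+w. indicator {..<K} w * g (w, t) + indicator {K..} w * \<gamma> t \<partial>\<mu>) = \<gamma> t"
          using q by (simp add: \<gamma> distrib_right[symmetric] ennreal_plus[symmetric] del: ennreal_plus)
      qed
      finally show ?thesis .
    qed
    have "\<gamma> \<in> borel_measurable unif01"
    proof -
      have "g \<in> borel_measurable (borel \<Otimes>\<^sub>M borel)" using g measurable_cong_sets[OF sbN refl] by blast
      then have "(\<lambda>z. g (max 1 (min (snd z) K), fst z)) \<in> borel_measurable (unif01 \<Otimes>\<^sub>M \<mu>0)"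
        by (rule measurable_compose[rotated]) measurable
      from \<mu>0.borel_measurable_nn_integral_fst[OF this] show ?thesis by (simp add: \<gamma>_def)
    qed
    then show ?thesis unfolding 1 2 by (rule nn_integral_cmult)
  qed
  define D where "D = (\<lambda>\<eta>'. comp V x (\<eta>1 \<eta>') v)"
  have mD: "Measurable.pred Q' (\<lambda>\<eta>'. D \<eta>' = C)" for C
  proof -
    have "Measurable.pred Q' (\<lambda>\<eta>'. u \<in> D \<eta>')" for u
      unfolding D_def by (rule pred_comp[OF _ m1]) auto
    then have "Measurable.pred Q' (\<lambda>\<eta>'. \<forall>u. u \<in> D \<eta>' \<longleftrightarrow> u \<in> C)" by measurable
    then show ?thesis by (simp add: set_eq_iff)
  qed
  have mlow: "Measurable.pred Q' (\<lambda>\<eta>'. fst (fst (\<eta>' {u})) < K)" for u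
  proof -
    have "(\<lambda>\<eta>'. fst (fst (\<eta>' {u}))) \<in> borel_measurable Q'"
      unfolding Q'_def by (rule measurable_PiM_UNIV_coordinate[OF ff(1)])
    then show ?thesis by measurable
  qed
  \<comment> \<open>\<open>D\<close> is determined by the base marks, so on the event that it equals
    \<open>C\<close> every vertex still has its own chance of a mark at least \<open>K\<close>; the
    vertices of \<open>S\<close> are resampled one by one.\<close>
  have step: "emeasure Q' {\<eta>'. D \<eta>' = C \<and> (\<forall>u\<in>S. fst (fst (\<eta>' {u})) < K)} \<le> ennreal (1 - ?q) ^ card S * emeasure Q' {\<eta>'. D \<eta>' = C}"
    if "finite S" for S C using that
  proof (induction S)
    case empty
    then show ?case by simp
  next
    case (insert u S)
    let ?A = "{\<eta>'. D \<eta>' = C \<and> (\<forall>u\<in>S. fst (fst (\<eta>' {u})) < K)}" and ?G = "{\<eta>'. fst (fst (\<eta>' {u})) < K}"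
    have A: "?A \<in> sets Q'" and G: "?G \<in> sets Q'"
    proof -
      have "Measurable.pred Q' (\<lambda>\<eta>'. D \<eta>' = C \<and> (\<forall>u\<in>S. fst (fst (\<eta>' {u})) < K))"
        by (intro pred_intros_logic pred_intros_finite mD mlow insert.hyps)
      then show "?A \<in> sets Q'" by (simp add: pred_def spQ')
      show "?G \<in> sets Q'" using mlow[of u] by (simp add: pred_def spQ')
    qed
    have "emeasure Q' (?A \<inter> ?G) \<le> ennreal (1 - ?q) * emeasure Q' ?A"
    proof (rule emeasure_resample_le[OF A G, where J = "\<lambda>f \<eta>'. \<integral>\<^sup>+a. f (fun_upd \<eta>' {u} a) \<partial>N'"])
      show "(\<integral>\<^sup>+\<omega>. f \<omega> \<partial>Q') = (\<integral>\<^sup>+\<omega>. \<integral>\<^sup>+a. f (fun_upd \<omega> {u} a) \<partial>N' \<partial>Q')" if "f \<in> borel_measurable Q'" for f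
        using that unfolding Q'_def by (rule nn_integral_PiM_resample[OF N'])
      have upd: "(\<lambda>z. fun_upd (fst z) {u} (snd z)) \<in> measurable (Q' \<Otimes>\<^sub>M N') Q'" unfolding Q'_def
      proof (rule measurable_PiM_UNIV)
        show "(\<lambda>z. fun_upd (fst z) {u} (snd z) i) \<in> measurable (PiM UNIV (\<lambda>_. N') \<Otimes>\<^sub>M N') N'" for i
          by (cases "i = {u}") simp_all
      qed
      have "(\<lambda>z. indicator ?A (fun_upd (fst z) {u} (snd z)) :: ennreal) \<in> borel_measurable (Q' \<Otimes>\<^sub>M N')"
        by (rule measurable_compose[OF upd]) (use A in auto)
      interpret N'': prob_space N' by (rule N')
      from N''.borel_measurable_nn_integral_fst[OF \<open>_ \<in> borel_measurable (Q' \<Otimes>\<^sub>M N')\<close>]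
      show "(\<lambda>\<eta>'. \<integral>\<^sup>+a. indicator ?A (fun_upd \<eta>' {u} a) \<partial>N') \<in> borel_measurable Q'" by simp
      fix \<eta>' :: "nat set \<Rightarrow> (real \<times> real) \<times> real"
      define g where "g = (\<lambda>z. indicator {\<eta>. comp V x \<eta> v = C \<and> (\<forall>u\<in>S. fst (fst (\<eta>' {u})) < K)} (fun_upd (\<eta>1 \<eta>') {u} z) :: ennreal)"
      have gm: "g \<in> borel_measurable N"
      proof -
        have u: "fun_upd (\<eta>1 \<eta>') {u} \<in> measurable N Q" unfolding Q_def
        proof (rule measurable_PiM_UNIV)
          show "(\<lambda>z. fun_upd (\<eta>1 \<eta>') {u} z i) \<in> measurable N N" for i by (cases "i = {u}") simp_all
        qed
        have "Measurable.pred Q (\<lambda>\<eta>. u \<in> comp V x \<eta> v)" for u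
          by (rule pred_comp) auto
        then have "Measurable.pred Q (\<lambda>\<eta>. (\<forall>u. u \<in> comp V x \<eta> v \<longleftrightarrow> u \<in> C) \<and> (\<forall>u\<in>S. fst (fst (\<eta>' {u})) < K))" by measurable
        then have "{\<eta>. comp V x \<eta> v = C \<and> (\<forall>u\<in>S. fst (fst (\<eta>' {u})) < K)} \<in> sets Q"
          by (simp add: pred_def set_eq_iff)
        then show ?thesis unfolding g_def by (intro measurable_compose[OF u]) auto
      qed
      have \<eta>1u: "\<eta>1 (fun_upd \<eta>' {u} a) = fun_upd (\<eta>1 \<eta>') {u} (b a)" for a
        by (auto simp: \<eta>1_def)
      have S: "(\<forall>w\<in>S. fst (fst ((fun_upd \<eta>' {u} a) {w})) < K) \<longleftrightarrow> (\<forall>w\<in>S. fst (fst (\<eta>' {w})) < K)" for a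
        using insert.hyps(2) by auto
      have iA: "indicator ?A (fun_upd \<eta>' {u} a) = g (b a)" for a
        unfolding g_def indicator_def by (simp only: mem_Collect_eq D_def \<eta>1u S)
      have iAG: "indicator (?A \<inter> ?G) (fun_upd \<eta>' {u} a) = indicator {a. fst (fst a) < K} a * g (b a)" for a
        unfolding indicator_inter_arith iA by (simp add: indicator_def)
      show "(\<integral>\<^sup>+a. indicator (?A \<inter> ?G) (fun_upd \<eta>' {u} a) \<partial>N') \<le> ennreal (1 - ?q) * (\<integral>\<^sup>+a. indicator ?A (fun_upd \<eta>' {u} a) \<partial>N')"
        unfolding iA iAG base[OF gm] ..
    qed
    also have "\<dots> \<le> ennreal (1 - ?q) * (ennreal (1 - ?q) ^ card S * emeasure Q' {\<eta>'. D \<eta>' = C})"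
      by (intro mult_left_mono insert.IH) auto
    also have "?A \<inter> ?G = {\<eta>'. D \<eta>' = C \<and> (\<forall>u\<in>insert u S. fst (fst (\<eta>' {u})) < K)}" by auto
    finally show ?case using insert.hyps by (simp add: mult.assoc)
  qed
  let ?E = "{\<eta>. k \<le> card (comp V x \<eta> v) \<and> (\<forall>u\<in>comp V x \<eta> v. mark \<eta> u < K)}"
  let ?C = "{C. C \<subseteq> V \<and> k \<le> card C}"
  have finC: "finite ?C" using V by simp
  \<comment> \<open>Lowering marks only removes edges, so the base component is contained in the
    true one. Conversely all marks in the true component are below \<open>K\<close>, hence
    unchanged, so the true component is connected in the base graph too.\<close>
  have key: "\<eta>' \<in> (\<Union>C\<in>?C. {\<eta>'. D \<eta>' = C \<and> (\<forall>u\<in>C. fst (fst (\<eta>' {u})) < K)})" if "\<eta>0 \<eta>' \<in> ?E" for \<eta>'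
  proof -
    let ?c = "comp V x (\<eta>0 \<eta>') v"
    have lowc: "fst (fst (\<eta>' {u})) < K" if "u \<in> ?c" for u
      using \<open>\<eta>0 \<eta>' \<in> ?E\<close> that by (auto simp: mark_def \<eta>0_def)
    have "D \<eta>' \<subseteq> ?c"
      unfolding D_def comp_def
    proof (rule component_mono)
      fix a c assume "a \<in> V" "c \<in> V" "edge x (\<eta>1 \<eta>') a c"
      moreover have "cp x (\<eta>1 \<eta>') a c \<le> cp x (\<eta>0 \<eta>') a c"
        by (rule cp_mono) (use K in \<open>auto simp: mark_def \<eta>1_def \<eta>0_def b_def\<close>)
      ultimately show "a \<in> V \<and> c \<in> V \<and> edge x (\<eta>0 \<eta>') a c"
        by (auto simp: edge_def \<eta>1_def \<eta>0_def b_def)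
    qed
    moreover have "?c \<subseteq> D \<eta>'"
    proof -
      have "?c = component (edge x (\<eta>0 \<eta>')) ?c v"
        unfolding comp_def by (rule component_restrict[symmetric]) (use V component_subset[OF V(2)] in auto)
      also have "\<dots> = component (edge x (\<eta>1 \<eta>')) ?c v"
      proof (rule component_cong)
        fix a c assume "a \<in> ?c" "c \<in> ?c"
        then show "edge x (\<eta>0 \<eta>') a c = edge x (\<eta>1 \<eta>') a c"
          using lowc[of a] lowc[of c] by (auto simp: edge_def cp_def mark_def \<eta>0_def \<eta>1_def b_def)
      qed
      also have "\<dots> \<subseteq> D \<eta>'" unfolding D_def comp_def[of _ _ "\<eta>1 \<eta>'"]
        using comp_subset[OF V(2)] by (intro component_mono) auto
      finally show ?thesis .
    qed
    ultimately have "D \<eta>' = ?c" by (rule equalityI)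
    moreover have "?c \<in> ?C" using comp_subset[OF V(2)] that by auto
    ultimately show ?thesis using lowc by blast
  qed
  have mE: "?E \<in> sets Q"
  proof -
    have c: "Measurable.pred Q (\<lambda>\<eta>. u \<in> comp V x \<eta> v)" for u by (rule pred_comp) auto
    have "?E = {\<eta> \<in> space Q. \<exists>C\<in>?C. (\<forall>u. u \<in> comp V x \<eta> v \<longleftrightarrow> u \<in> C) \<and> (\<forall>u\<in>C. mark \<eta> u < K)}"
      using comp_subset[OF V(2)] by (auto simp: set_eq_iff[symmetric])
    also have "\<dots> \<in> sets Q"
    proof (intro sets.sets_Collect_finite_Ex finC)
      fix C assume "C \<in> ?C"
      then have "finite C" using V(1) finite_subset by blast
      then show "{\<eta> \<in> space Q. (\<forall>u. u \<in> comp V x \<eta> v \<longleftrightarrow> u \<in> C) \<and> (\<forall>u\<in>C. mark \<eta> u < K)} \<in> sets Q"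
        using c by measurable
    qed
    finally show ?thesis .
  qed
  have mDC: "{\<eta>'. D \<eta>' = C \<and> (\<forall>u\<in>S. fst (fst (\<eta>' {u})) < K)} \<in> sets Q'" if "finite S" for C S
  proof -
    have "Measurable.pred Q' (\<lambda>\<eta>'. D \<eta>' = C \<and> (\<forall>u\<in>S. fst (fst (\<eta>' {u})) < K))"
      by (intro pred_intros_logic pred_intros_finite mD mlow that)
    then show ?thesis by (simp add: pred_def spQ')
  qed
  have mDCC: "{\<eta>'. D \<eta>' = C \<and> (\<forall>u\<in>C. fst (fst (\<eta>' {u})) < K)} \<in> sets Q'" if "C \<in> ?C" for C
    by (rule mDC, rule finite_subset[OF _ V(1)]) (use that in auto)
  have mDC0: "{\<eta>'. D \<eta>' = C} \<in> sets Q'" for C using mDC[of "{}" C] by simp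
  have "emeasure Q ?E = emeasure Q' (\<eta>0 -` ?E \<inter> space Q')"
    by (subst QQ', rule emeasure_distr[OF m0 mE])
  also have "\<dots> \<le> emeasure Q' (\<Union>C\<in>?C. {\<eta>'. D \<eta>' = C \<and> (\<forall>u\<in>C. fst (fst (\<eta>' {u})) < K)})"
    using key by (intro emeasure_mono sets.finite_UN[OF finC] mDCC) auto
  also have "\<dots> \<le> (\<Sum>C\<in>?C. emeasure Q' {\<eta>'. D \<eta>' = C \<and> (\<forall>u\<in>C. fst (fst (\<eta>' {u})) < K)})"
    by (rule emeasure_subadditive_finite[OF finC]) (use mDCC in blast)
  also have "\<dots> \<le> (\<Sum>C\<in>?C. ennreal (1 - ?q) ^ k * emeasure Q' {\<eta>'. D \<eta>' = C})"
  proof (intro sum_mono)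
    fix C assume C: "C \<in> ?C"
    then have "emeasure Q' {\<eta>'. D \<eta>' = C \<and> (\<forall>u\<in>C. fst (fst (\<eta>' {u})) < K)} \<le> ennreal (1 - ?q) ^ card C * emeasure Q' {\<eta>'. D \<eta>' = C}"
      by (intro step finite_subset[OF _ V(1)]) auto
    also have "\<dots> \<le> ennreal (1 - ?q) ^ k * emeasure Q' {\<eta>'. D \<eta>' = C}"
      using C q by (intro mult_right_mono) (auto simp: ennreal_power intro!: ennreal_leI power_decreasing)
    finally show "emeasure Q' {\<eta>'. D \<eta>' = C \<and> (\<forall>u\<in>C. fst (fst (\<eta>' {u})) < K)} \<le> ennreal (1 - ?q) ^ k * emeasure Q' {\<eta>'. D \<eta>' = C}" .
  qed
  \<comment> \<open>The events that the base component equals \<open>C\<close> are disjoint, so no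
    entropy factor for the choice of \<open>C\<close> appears.\<close>
  also have "\<dots> = ennreal (1 - ?q) ^ k * emeasure Q' (\<Union>C\<in>?C. {\<eta>'. D \<eta>' = C})"
    unfolding sum_distrib_left[symmetric] using finC mDC0
    by (subst sum_emeasure) (auto simp: disjoint_family_on_def)
  also have "\<dots> \<le> ennreal (1 - ?q) ^ k * 1"
    by (intro mult_left_mono) (auto intro: Q'.emeasure_le_1)
  finally show ?thesis using q by (simp add: ennreal_power)
qed

end

lemma measurable_fun_upd_pair:
  assumes "f \<in> measurable K (PiM UNIV (\<lambda>_. N))" "g \<in> measurable K N"
  shows "(\<lambda>z. fun_upd (f z) i (g z)) \<in> measurable K (PiM (UNIV :: 'i set) (\<lambda>_. N))"
proof (rule measurable_PiM_UNIV)
  show "(\<lambda>z. fun_upd (f z) i (g z) j) \<in> measurable K N" for j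
    using assms(2) measurable_compose[OF assms(1) measurable_component_singleton[of j UNIV "\<lambda>_. N"]]
    by (cases "j = i") simp_all
qed

text \<open>Measurability of the resampled functional is part of the claim, because resampling is
  iterated over several coordinates of both factors.\<close>

lemma resample_fst:
  fixes f :: "('i \<Rightarrow> 'a) \<times> 'b \<Rightarrow> ennreal"
  assumes N: "prob_space N" and R: "prob_space R"
    and f: "f \<in> borel_measurable (PiM UNIV (\<lambda>_. N) \<Otimes>\<^sub>M R)"
  shows "(\<lambda>z. \<integral>\<^sup>+a. f (fun_upd (fst z) i a, snd z) \<partial>N) \<in> borel_measurable (PiM UNIV (\<lambda>_. N) \<Otimes>\<^sub>M R)"
    and "(\<integral>\<^sup>+z. f z \<partial>(PiM UNIV (\<lambda>_. N) \<Otimes>\<^sub>M R)) = (\<integral>\<^sup>+z. \<integral>\<^sup>+a. f (fun_upd (fst z) i a, snd z) \<partial>N \<partial>(PiM UNIV (\<lambda>_. N) \<Otimes>\<^sub>M R))"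
proof -
  let ?P = "PiM (UNIV::'i set) (\<lambda>_. N)"
  interpret N: prob_space N by fact
  interpret R: prob_space R by fact
  interpret P: prob_space ?P using N by (intro prob_space_PiM)
  interpret pair_sigma_finite ?P R ..
  have u: "(\<lambda>w. fun_upd (fst (fst w)) i (snd w)) \<in> measurable ((?P \<Otimes>\<^sub>M R) \<Otimes>\<^sub>M N) ?P"
    by (rule measurable_fun_upd_pair) measurable
  then have "(\<lambda>w. (fun_upd (fst (fst w)) i (snd w), snd (fst w))) \<in> measurable ((?P \<Otimes>\<^sub>M R) \<Otimes>\<^sub>M N) (?P \<Otimes>\<^sub>M R)"
    by (rule measurable_Pair[OF _ measurable_compose[OF measurable_fst measurable_snd]])
  from measurable_compose[OF this f]
  have "(\<lambda>w. f (fun_upd (fst (fst w)) i (snd w), snd (fst w))) \<in> borel_measurable ((?P \<Otimes>\<^sub>M R) \<Otimes>\<^sub>M N)" .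
  from N.borel_measurable_nn_integral_fst[OF this]
  show m: "(\<lambda>z. \<integral>\<^sup>+a. f (fun_upd (fst z) i a, snd z) \<partial>N) \<in> borel_measurable (?P \<Otimes>\<^sub>M R)" by simp
  have "(\<integral>\<^sup>+z. f z \<partial>(?P \<Otimes>\<^sub>M R)) = (\<integral>\<^sup>+t. \<integral>\<^sup>+y. f (y, t) \<partial>?P \<partial>R)"
    using f by (rule nn_integral_snd[symmetric])
  also have "\<dots> = (\<integral>\<^sup>+t. \<integral>\<^sup>+y. \<integral>\<^sup>+a. f (fun_upd y i a, t) \<partial>N \<partial>?P \<partial>R)"
    using f by (intro nn_integral_cong nn_integral_PiM_resample[OF N]) simp
  also have "\<dots> = (\<integral>\<^sup>+z. \<integral>\<^sup>+a. f (fun_upd (fst z) i a, snd z) \<partial>N \<partial>(?P \<Otimes>\<^sub>M R))"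
    by (subst nn_integral_snd[symmetric, OF m]) simp
  finally show "(\<integral>\<^sup>+z. f z \<partial>(?P \<Otimes>\<^sub>M R)) = (\<integral>\<^sup>+z. \<integral>\<^sup>+a. f (fun_upd (fst z) i a, snd z) \<partial>N \<partial>(?P \<Otimes>\<^sub>M R))" .
qed

lemma resample_snd:
  fixes f :: "'b \<times> ('i \<Rightarrow> 'a) \<Rightarrow> ennreal"
  assumes N: "prob_space N" and R: "prob_space R"
    and f: "f \<in> borel_measurable (R \<Otimes>\<^sub>M PiM UNIV (\<lambda>_. N))"
  shows "(\<lambda>z. \<integral>\<^sup>+a. f (fst z, fun_upd (snd z) i a) \<partial>N) \<in> borel_measurable (R \<Otimes>\<^sub>M PiM UNIV (\<lambda>_. N))"
    and "(\<integral>\<^sup>+z. f z \<partial>(R \<Otimes>\<^sub>M PiM UNIV (\<lambda>_. N))) = (\<integral>\<^sup>+z. \<integral>\<^sup>+a. f (fst z, fun_upd (snd z) i a) \<partial>N \<partial>(R \<Otimes>\<^sub>M PiM UNIV (\<lambda>_. N)))"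
proof -
  let ?P = "PiM (UNIV::'i set) (\<lambda>_. N)"
  interpret N: prob_space N by fact
  interpret R: prob_space R by fact
  interpret P: prob_space ?P using N by (intro prob_space_PiM)
  have u: "(\<lambda>w. fun_upd (snd (fst w)) i (snd w)) \<in> measurable ((R \<Otimes>\<^sub>M ?P) \<Otimes>\<^sub>M N) ?P"
    by (rule measurable_fun_upd_pair) measurable
  then have "(\<lambda>w. (fst (fst w), fun_upd (snd (fst w)) i (snd w))) \<in> measurable ((R \<Otimes>\<^sub>M ?P) \<Otimes>\<^sub>M N) (R \<Otimes>\<^sub>M ?P)"
    by (rule measurable_Pair[OF measurable_compose[OF measurable_fst measurable_fst]])
  from measurable_compose[OF this f]
  have "(\<lambda>w. f (fst (fst w), fun_upd (snd (fst w)) i (snd w))) \<in> borel_measurable ((R \<Otimes>\<^sub>M ?P) \<Otimes>\<^sub>M N)" .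
  from N.borel_measurable_nn_integral_fst[OF this]
  show m: "(\<lambda>z. \<integral>\<^sup>+a. f (fst z, fun_upd (snd z) i a) \<partial>N) \<in> borel_measurable (R \<Otimes>\<^sub>M ?P)" by simp
  have "(\<integral>\<^sup>+z. f z \<partial>(R \<Otimes>\<^sub>M ?P)) = (\<integral>\<^sup>+t. \<integral>\<^sup>+y. f (t, y) \<partial>?P \<partial>R)"
    using f by (rule P.nn_integral_fst[symmetric])
  also have "\<dots> = (\<integral>\<^sup>+t. \<integral>\<^sup>+y. \<integral>\<^sup>+a. f (t, fun_upd y i a) \<partial>N \<partial>?P \<partial>R)"
    using f by (intro nn_integral_cong nn_integral_PiM_resample[OF N]) simp
  also have "\<dots> = (\<integral>\<^sup>+z. \<integral>\<^sup>+a. f (fst z, fun_upd (snd z) i a) \<partial>N \<partial>(R \<Otimes>\<^sub>M ?P))"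
    by (subst P.nn_integral_fst[symmetric, OF m]) simp
  finally show "(\<integral>\<^sup>+z. f z \<partial>(R \<Otimes>\<^sub>M ?P)) = (\<integral>\<^sup>+z. \<integral>\<^sup>+a. f (fst z, fun_upd (snd z) i a) \<partial>N \<partial>(R \<Otimes>\<^sub>M ?P))" .
qed

lemma ennreal_le_diffI:
  fixes I :: ennreal
  assumes "I + J = ennreal x" "ennreal c \<le> J" "0 \<le> c"
  shows "I \<le> ennreal (x - c)"
proof -
  have "J \<le> I + J" by simp
  then have J: "J \<noteq> top" unfolding assms(1) by (auto simp: top_unique)
  have "I = (I + J) - J" by (rule ennreal_add_diff_cancel_right[OF J, symmetric])
  then have "I = ennreal x - J" unfolding assms(1) .
  also have "\<dots> \<le> ennreal x - ennreal c" by (rule ennreal_mono_minus[OF assms(2)])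
  also have "\<dots> = ennreal (x - c)" using assms(3) by (rule ennreal_minus)
  finally show ?thesis .
qed

lemma nn_integral_ncard_lessThan:
  assumes "\<And>i. Measurable.pred M (\<lambda>\<omega>. P i \<omega>)"
  shows "(\<integral>\<^sup>+\<omega>. ncard {i \<in> {..<m}. P i \<omega>} \<partial>M) = (\<Sum>i<m. emeasure M {\<omega> \<in> space M. P i \<omega>})"
proof -
  have "(\<integral>\<^sup>+\<omega>. ncard {i \<in> {..<m}. P i \<omega>} \<partial>M) = (\<Sum>i. emeasure M {\<omega> \<in> space M. i \<in> {i \<in> {..<m}. P i \<omega>}})"
    using assms by (intro nn_integral_ncard) simp
  also have "\<dots> = (\<Sum>i<m. emeasure M {\<omega> \<in> space M. i \<in> {i \<in> {..<m}. P i \<omega>}})"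
    by (intro suminf_finite) auto
  finally show ?thesis by simp
qed

section \<open>Hubs have common neighbours\<close>

context random_graph_model
begin

lemma nn_integral_N_mark: "1 \<le> K \<Longrightarrow> (\<integral>\<^sup>+a. indicator {a. K \<le> fst a} a \<partial>N) = ennreal (tailprob K)"
  and nn_integral_N_coin: "(\<integral>\<^sup>+a. indicator {a. snd a \<le> p} a \<partial>N) = ennreal p"
  and sets_N_mark: "{a. K \<le> fst a} \<in> sets N" and sets_N_coin: "{a. snd a \<le> p} \<in> sets N"
proof -
  interpret \<mu>: prob_space \<mu> by (rule prob_space_\<mu>)
  interpret U: prob_space unif01 by (rule prob_space_unif01)
  have 1: "{a. K \<le> fst a} = {K..} \<times> (UNIV :: real set)" for K
    by auto
  have 2: "{a. snd a \<le> p} = (UNIV :: real set) \<times> {..p}" by auto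
  show s1: "{a. K \<le> fst a} \<in> sets N" for K unfolding 1 N_def by (intro pair_measureI) auto
  show s2: "{a. snd a \<le> p} \<in> sets N" unfolding 2 N_def by (intro pair_measureI) auto
  show "(\<integral>\<^sup>+a. indicator {a. K \<le> fst a} a \<partial>N) = ennreal (tailprob K)" if "1 \<le> K"
    using that s1 U.emeasure_space_1 unfolding 1 N_def
    by (simp add: U.emeasure_pair_measure_Times emeasure_\<mu>_tail)
  show "(\<integral>\<^sup>+a. indicator {a. snd a \<le> p} a \<partial>N) = ennreal p"
    using s2 \<mu>.emeasure_space_1 p unfolding 2 N_def
    by (simp add: U.emeasure_pair_measure_Times emeasure_unif01_atMost)
qed

text \<open>A third vertex \<open>h\<close> links \<open>i\<close> and \<open>j\<close> if its mark
  and the two coins of \<open>{i, h}\<close> and \<open>{j, h}\<close> are favourable, with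
  probability \<open>tailprob K * p\<^sup>2\<close>. These coordinates are different for different
  \<open>h\<close>, so the failures are independent.\<close>

lemma prob_unlinked:
  assumes "i < m" "j < m" "1 \<le> K"
  shows "emeasure Q {\<eta>. unlinked K {..<m} \<eta> i j} \<le> ennreal ((1 - tailprob K * p\<^sup>2) ^ (m - 2))"
proof (cases "i = j")
  case True
  then show ?thesis by (simp add: unlinked_def)
next
  case ij: False
  interpret N: prob_space N by (rule prob_space_N)
  interpret Q: prob_space Q by (rule prob_space_Q)
  let ?q = "tailprob K"
  let ?c = "1 - ?q * p\<^sup>2"
  have q: "0 \<le> ?q" "?q \<le> 1" using tailprob[of K] assms by auto
  have "p\<^sup>2 \<le> 1" using p by (simp add: power_le_one)
  then have c: "0 \<le> ?c" "0 \<le> ?q * p\<^sup>2" using q mult_le_one[of ?q "p\<^sup>2"] by auto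
  define G where "G = (\<lambda>h. {\<eta>. \<not> (K \<le> mark \<eta> h \<and> snd (\<eta> {i, h}) \<le> p \<and> snd (\<eta> {j, h}) \<le> p)})"
  have G: "G h \<in> sets Q" for h
  proof -
    have "Measurable.pred Q (\<lambda>\<eta>. \<not> (K \<le> mark \<eta> h \<and> snd (\<eta> {i, h}) \<le> p \<and> snd (\<eta> {j, h}) \<le> p))" by measurable
    then show ?thesis by (simp add: pred_def G_def)
  qed
  have "emeasure Q {\<eta>. \<forall>h\<in>S. \<eta> \<in> G h} \<le> ennreal ?c ^ card S" if "finite S" "S \<subseteq> {..<m} - {i, j}" for S
    using that
  proof (induction S)
    case empty
    then show ?case using Q.emeasure_space_1 by simp
  next
    case (insert h S)
    let ?A = "{\<eta>. \<forall>h\<in>S. \<eta> \<in> G h}"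
    \<comment> \<open>The three coordinates that belong to \<open>h\<close>; the event for the
      vertices in \<open>S\<close> does not involve them.\<close>
    let ?r = "\<lambda>\<eta> a b c. fun_upd (fun_upd (fun_upd \<eta> {h} a) {i, h} b) {j, h} c"
    have A: "?A \<in> sets Q"
    proof -
      have "?A = {\<eta> \<in> space Q. \<forall>h\<in>S. \<eta> \<in> G h}" by simp
      also have "\<dots> \<in> sets Q" using insert.hyps(1) G by (intro sets.sets_Collect_finite_All) auto
      finally show ?thesis .
    qed
    have h: "h \<noteq> i" "h \<noteq> j" using insert.prems by auto
    have invA: "?r \<eta> a b c \<in> ?A \<longleftrightarrow> \<eta> \<in> ?A" for \<eta> a b c
      using insert.hyps(2) h ij by (auto simp: G_def mark_def doubleton_eq_iff)
    have memG: "?r \<eta> a b c \<in> G h \<longleftrightarrow> \<not> (K \<le> fst a \<and> snd b \<le> p \<and> snd c \<le> p)" for \<eta> a b c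
      using h ij by (auto simp: G_def mark_def doubleton_eq_iff)
    have "emeasure Q (?A \<inter> G h) \<le> ennreal ?c * emeasure Q ?A"
    proof (rule emeasure_resample_le[OF A G, where J = "\<lambda>f \<eta>. \<integral>\<^sup>+a. \<integral>\<^sup>+b. \<integral>\<^sup>+c. f (?r \<eta> a b c) \<partial>N \<partial>N \<partial>N"])
      fix f :: "(nat set \<Rightarrow> real \<times> real) \<Rightarrow> ennreal" assume f: "f \<in> borel_measurable Q"
      have m: "(\<lambda>\<eta>. \<integral>\<^sup>+c. f (fun_upd \<eta> s c) \<partial>N) \<in> borel_measurable Q" if f: "f \<in> borel_measurable Q" for f :: "_ \<Rightarrow> ennreal" and s
      proof -
        have "(\<lambda>z. fun_upd (fst z) s (snd z)) \<in> measurable (Q \<Otimes>\<^sub>M N) Q"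
          unfolding Q_def by (rule measurable_fun_upd_pair) measurable
        from measurable_compose[OF this f] N.borel_measurable_nn_integral_fst show ?thesis by fastforce
      qed
      have r: "(\<integral>\<^sup>+\<eta>. f \<eta> \<partial>Q) = (\<integral>\<^sup>+\<eta>. \<integral>\<^sup>+a. f (fun_upd \<eta> s a) \<partial>N \<partial>Q)" if "f \<in> borel_measurable Q" for f s
        unfolding Q_def by (rule nn_integral_PiM_resample[OF prob_space_N that[unfolded Q_def]])
      have "(\<integral>\<^sup>+\<eta>. f \<eta> \<partial>Q) = (\<integral>\<^sup>+\<eta>. \<integral>\<^sup>+c. f (fun_upd \<eta> {j, h} c) \<partial>N \<partial>Q)" by (rule r[OF f])
      also have "\<dots> = (\<integral>\<^sup>+\<eta>. \<integral>\<^sup>+b. \<integral>\<^sup>+c. f (fun_upd (fun_upd \<eta> {i, h} b) {j, h} c) \<partial>N \<partial>N \<partial>Q)"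
        by (rule r[OF m[OF f]])
      also have "\<dots> = (\<integral>\<^sup>+\<eta>. \<integral>\<^sup>+a. \<integral>\<^sup>+b. \<integral>\<^sup>+c. f (?r \<eta> a b c) \<partial>N \<partial>N \<partial>N \<partial>Q)"
        by (rule r[OF m[OF m[OF f]]])
      finally show "(\<integral>\<^sup>+\<eta>. f \<eta> \<partial>Q) = (\<integral>\<^sup>+\<eta>. \<integral>\<^sup>+a. \<integral>\<^sup>+b. \<integral>\<^sup>+c. f (?r \<eta> a b c) \<partial>N \<partial>N \<partial>N \<partial>Q)" .
    next
      have JA: "(\<integral>\<^sup>+a. \<integral>\<^sup>+b. \<integral>\<^sup>+c. indicator ?A (?r \<eta> a b c) \<partial>N \<partial>N \<partial>N) = indicator ?A \<eta>" for \<eta>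
      proof -
        have "indicator ?A (?r \<eta> a b c) = (indicator ?A \<eta> :: ennreal)" for a b c
          unfolding indicator_def invA ..
        then show ?thesis using N.emeasure_space_1 by simp
      qed
      show "(\<lambda>\<eta>. \<integral>\<^sup>+a. \<integral>\<^sup>+b. \<integral>\<^sup>+c. indicator ?A (?r \<eta> a b c) \<partial>N \<partial>N \<partial>N) \<in> borel_measurable Q"
        unfolding JA using A by (rule borel_measurable_indicator)
      fix \<eta>
      let ?I = "\<integral>\<^sup>+a. \<integral>\<^sup>+b. \<integral>\<^sup>+c. indicator {(a, b, c). \<not> (K \<le> fst a \<and> snd b \<le> p \<and> snd c \<le> p)} (a, b, c) \<partial>N \<partial>N \<partial>N"
      let ?a = "\<lambda>a. indicator {a. K \<le> fst a} a :: ennreal" and ?b = "\<lambda>a. indicator {a. snd a \<le> p} a :: ennreal"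
      note [measurable] = sets_N_mark[of K] sets_N_coin
      \<comment> \<open>Failure and success of \<open>h\<close> have total probability 1; adding
        them avoids truncated subtraction inside the integrals.\<close>
      have "?I + ennreal (?q * p\<^sup>2) = ennreal 1"
      proof -
        have ms: "{c. \<not> (K \<le> fst a \<and> snd b \<le> p \<and> snd c \<le> p)} \<in> sets N" for a b :: "real \<times> real"
        proof -
          show ?thesis
          proof (cases "K \<le> fst a \<and> snd b \<le> p")
            case True
            then have "{c. \<not> (K \<le> fst a \<and> snd b \<le> p \<and> snd c \<le> p)} = space N - {c. snd c \<le> p}" by auto
            then show ?thesis using sets.compl_sets[OF sets_N_coin] by (simp only:)
          next
            case False
            then have "{c. \<not> (K \<le> fst a \<and> snd b \<le> p \<and> snd c \<le> p)} = space N" by auto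
            then show ?thesis by (simp only: sets.top)
          qed
        qed
        have 1: "(\<integral>\<^sup>+c. indicator {(a, b, c). \<not> (K \<le> fst a \<and> snd b \<le> p \<and> snd c \<le> p)} (a, b, c) \<partial>N) + ?a a * ?b b * ennreal p = 1" for a b :: "real \<times> real"
        proof -
          have e: "indicator {c. \<not> (K \<le> fst a \<and> snd b \<le> p \<and> snd c \<le> p)} c + ?a a * ?b b * ?b c = 1" for c
            by (auto simp: indicator_def)
          have "1 = (\<integral>\<^sup>+c. 1 \<partial>N)" using N.emeasure_space_1 by simp
          also have "\<dots> = (\<integral>\<^sup>+c. indicator {c. \<not> (K \<le> fst a \<and> snd b \<le> p \<and> snd c \<le> p)} c + ?a a * ?b b * ?b c \<partial>N)"
            by (simp only: e)
          also have "\<dots> = (\<integral>\<^sup>+c. indicator {c. \<not> (K \<le> fst a \<and> snd b \<le> p \<and> snd c \<le> p)} c \<partial>N) + (\<integral>\<^sup>+c. ?a a * ?b b * ?b c \<partial>N)"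
            by (intro nn_integral_add borel_measurable_indicator[OF ms] borel_measurable_times_ennreal
                borel_measurable_const borel_measurable_indicator[OF sets_N_coin])
          also have "(\<integral>\<^sup>+c. ?a a * ?b b * ?b c \<partial>N) = ?a a * ?b b * ennreal p"
            by (simp only: nn_integral_cmult[OF borel_measurable_indicator[OF sets_N_coin]] nn_integral_N_coin)
          finally show ?thesis by (simp only: indicator_def mem_Collect_eq case_prod_conv)
        qed
        have eq1: "(\<integral>\<^sup>+c. indicator {(a, b, c). \<not> (K \<le> fst a \<and> snd b \<le> p \<and> snd c \<le> p)} (a, b, c) \<partial>N) = 1 - ?a a * ?b b * ennreal p" for a b :: "real \<times> real"
        proof -
          have "?a a * ?b b * ennreal p \<noteq> top" by (auto simp: indicator_def ennreal_mult_eq_top_iff)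
          from ennreal_add_diff_cancel_right[OF this] show ?thesis unfolding 1[of a b, symmetric] by (rule sym)
        qed
        have "1 = (\<integral>\<^sup>+a. \<integral>\<^sup>+b. (1 - ?a a * ?b b * ennreal p) + ?a a * ?b b * ennreal p \<partial>N \<partial>N)"
          using N.emeasure_space_1 unfolding 1[unfolded eq1] by simp
        also have "\<dots> = (\<integral>\<^sup>+a. (\<integral>\<^sup>+b. 1 - ?a a * ?b b * ennreal p \<partial>N) + ?a a * ennreal p * ennreal p \<partial>N)"
        proof (intro nn_integral_cong)
          fix a
          have "(\<integral>\<^sup>+b. (1 - ?a a * ?b b * ennreal p) + ?a a * ?b b * ennreal p \<partial>N) =
            (\<integral>\<^sup>+b. (1 - ?a a * ?b b * ennreal p) \<partial>N) + (\<integral>\<^sup>+b. ?a a * ?b b * ennreal p \<partial>N)"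
            by (intro nn_integral_add) measurable
          also have "(\<integral>\<^sup>+b. ?a a * ?b b * ennreal p \<partial>N) = ?a a * ennreal p * ennreal p"
            by (subst nn_integral_multc, simp, subst nn_integral_cmult) (auto simp: nn_integral_N_coin)
          finally show "(\<integral>\<^sup>+b. (1 - ?a a * ?b b * ennreal p) + ?a a * ?b b * ennreal p \<partial>N) =
            (\<integral>\<^sup>+b. (1 - ?a a * ?b b * ennreal p) \<partial>N) + ?a a * ennreal p * ennreal p" .
        qed
        also have "\<dots> = ?I + (\<integral>\<^sup>+a. ?a a * ennreal p * ennreal p \<partial>N)"
        proof -
          have "(\<lambda>z. 1 - ?a (fst z) * ?b (snd z) * ennreal p) \<in> borel_measurable (N \<Otimes>\<^sub>M N)" by measurable
          from N.borel_measurable_nn_integral_fst[OF this]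
          show ?thesis unfolding eq1 by (subst nn_integral_add) simp_all
        qed
        also have "(\<integral>\<^sup>+a. ?a a * ennreal p * ennreal p \<partial>N) = ennreal (?q * p\<^sup>2)"
          using p q assms(3) by (simp add: nn_integral_multc nn_integral_N_mark ennreal_mult power2_eq_square mult.assoc)
        finally show ?thesis by simp
      qed
      then have I: "?I \<le> ennreal ?c" by (rule ennreal_le_diffI) (use c in auto)
      have "indicator (?A \<inter> G h) (?r \<eta> a b c) = (indicator ?A \<eta> :: ennreal) * indicator {(a, b, c). \<not> (K \<le> fst a \<and> snd b \<le> p \<and> snd c \<le> p)} (a, b, c)" for a b c
        unfolding indicator_def Int_iff invA memG of_bool_conj by (simp only: mem_Collect_eq case_prod_conv)
      then have "(\<integral>\<^sup>+a. \<integral>\<^sup>+b. \<integral>\<^sup>+c. indicator (?A \<inter> G h) (?r \<eta> a b c) \<partial>N \<partial>N \<partial>N) = indicator ?A \<eta> * ?I"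
        by (cases "\<eta> \<in> ?A") simp_all
      also have "\<dots> \<le> ennreal ?c * indicator ?A \<eta>" using I by (simp add: mult.commute mult_left_mono)
      finally show "(\<integral>\<^sup>+a. \<integral>\<^sup>+b. \<integral>\<^sup>+c. indicator (?A \<inter> G h) (?r \<eta> a b c) \<partial>N \<partial>N \<partial>N) \<le>
        ennreal ?c * (\<integral>\<^sup>+a. \<integral>\<^sup>+b. \<integral>\<^sup>+c. indicator ?A (?r \<eta> a b c) \<partial>N \<partial>N \<partial>N)"
        unfolding JA .
    qed
    also have "\<dots> \<le> ennreal ?c * ennreal ?c ^ card S"
      using insert by (intro mult_left_mono insert.IH) auto
    also have "?A \<inter> G h = {\<eta>. \<forall>h\<in>insert h S. \<eta> \<in> G h}" by auto
    finally show ?case using insert.hyps by simp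
  qed
  from this[of "{..<m} - {i, j}"]
  have "emeasure Q {\<eta>. \<forall>h\<in>{..<m} - {i, j}. \<eta> \<in> G h} \<le> ennreal ?c ^ card ({..<m} - {i, j})" by simp
  moreover have "card ({..<m} - {i, j}) = m - 2"
    using assms ij by (subst card_Diff_subset) auto
  moreover have "emeasure Q {\<eta>. unlinked K {..<m} \<eta> i j} \<le> emeasure Q {\<eta>. \<forall>h\<in>{..<m} - {i, j}. \<eta> \<in> G h}"
  proof (rule emeasure_mono)
    have "{\<eta>. \<forall>h\<in>{..<m} - {i, j}. \<eta> \<in> G h} = {\<eta> \<in> space Q. \<forall>h\<in>{..<m} - {i, j}. \<eta> \<in> G h}" by simp
    also have "\<dots> \<in> sets Q" using G by (intro sets.sets_Collect_finite_All) auto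
    finally show "{\<eta>. \<forall>h\<in>{..<m} - {i, j}. \<eta> \<in> G h} \<in> sets Q" .
  qed (auto simp: unlinked_def G_def)
  ultimately show ?thesis using c by (simp add: ennreal_power)
qed

lemma pred_unlinked: "Measurable.pred Q (\<lambda>\<eta>. unlinked K {..<m::nat} \<eta> i j)"
  unfolding unlinked_def by measurable

text \<open>Union bound over the partner \<open>j\<close>: at most \<open>m * (m - 1)\<close>
  ordered pairs, each unlinked with a probability that is geometric in \<open>m - 2\<close>, so the
  second factorial moment applies.\<close>

lemma expected_unlinked:
  assumes B: "B \<in> sets borel" "bounded B" "0 < measure lborel B" and K: "1 \<le> K"
  shows "(\<integral>\<^sup>+\<omega>. \<integral>\<^sup>+\<eta>. ncard {i \<in> points_in (pts \<omega>) B. \<exists>j\<in>points_in (pts \<omega>) B. unlinked K (points_in (pts \<omega>) B) \<eta> i j} \<partial>Q \<partial>M)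
    \<le> ennreal ((measure lborel B)\<^sup>2 * exp (- (measure lborel B * (tailprob K * p\<^sup>2))))"
proof -
  let ?v = "measure lborel B" and ?q = "tailprob K"
  let ?r = "1 - ?q * p\<^sup>2"
  let ?Y = "PiM (UNIV :: nat set) (\<lambda>_. uniform_measure lborel B)"
  interpret Y: prob_space ?Y
    using measure_lborel_positive_bounded[OF B(2,1,3)] by (intro prob_space_PiM prob_space_uniform_measure) auto
  have q: "0 \<le> ?q" "?q \<le> 1" using tailprob[of K] K by auto
  have "p\<^sup>2 \<le> 1" using p by (simp add: power_le_one)
  then have r: "0 \<le> ?r" using q mult_le_one[of ?q "p\<^sup>2"] by auto
  let ?F = "\<lambda>V (x :: nat \<Rightarrow> 'a) \<eta>. ncard {i \<in> V. \<exists>j\<in>V. unlinked K V \<eta> i j}"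
  have m: "(\<lambda>z. ?F {..<m} (fst z) (snd z)) \<in> borel_measurable (PiM UNIV (\<lambda>_. borel) \<Otimes>\<^sub>M Q)" for m :: nat
  proof -
    note [measurable] = pred_unlinked
    have "(\<lambda>\<eta>. ncard {i \<in> {..<m}. \<exists>j\<in>{..<m}. unlinked K {..<m} \<eta> i j}) \<in> borel_measurable Q"
      by (rule measurable_ncard) measurable
    then show ?thesis by (rule measurable_compose[OF measurable_snd])
  qed
  have "(\<integral>\<^sup>+\<omega>. \<integral>\<^sup>+\<eta>. ?F (points_in (pts \<omega>) B) (pts \<omega>) \<eta> \<partial>Q \<partial>M) =
    (\<Sum>m. ennreal (pois ?v m) * (\<integral>\<^sup>+y. \<integral>\<^sup>+\<eta>. ?F {..<m} y \<eta> \<partial>Q \<partial>?Y))"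
    by (rule nn_integral_binomial[OF B relabel_invariant_unlinked m])
  also have "\<dots> \<le> (\<Sum>m. ennreal (pois ?v m) * ennreal (real m * real (m - 1) * ?r ^ (m - 2)))"
  proof (intro suminf_le mult_left_mono)
    fix m :: nat
    have "(\<integral>\<^sup>+\<eta>. ncard {i \<in> {..<m}. \<exists>j\<in>{..<m}. unlinked K {..<m} \<eta> i j} \<partial>Q) =
       (\<Sum>i<m. emeasure Q {\<eta> \<in> space Q. \<exists>j\<in>{..<m}. unlinked K {..<m} \<eta> i j})"
      using pred_unlinked[measurable] by (intro nn_integral_ncard_lessThan) measurable
    also have "\<dots> \<le> (\<Sum>i<m. ennreal (real (m - 1) * ?r ^ (m - 2)))"
    proof (intro sum_mono)
      fix i assume i: "i \<in> {..<m}"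
      have "{\<eta> \<in> space Q. \<exists>j\<in>{..<m}. unlinked K {..<m} \<eta> i j} = (\<Union>j\<in>{..<m} - {i}. {\<eta>. unlinked K {..<m} \<eta> i j})"
        by (auto simp: unlinked_def)
      also have "emeasure Q \<dots> \<le> (\<Sum>j\<in>{..<m} - {i}. emeasure Q {\<eta>. unlinked K {..<m} \<eta> i j})"
        using pred_unlinked by (intro emeasure_subadditive_finite) (auto simp: pred_def)
      also have "\<dots> \<le> (\<Sum>j\<in>{..<m} - {i}. ennreal (?r ^ (m - 2)))"
        using i K by (intro sum_mono prob_unlinked) auto
      also have "\<dots> = ennreal (real (m - 1) * ?r ^ (m - 2))"
        using i r by (simp add: card_Diff_singleton ennreal_mult ennreal_of_nat_eq_real_of_nat)
      finally show "emeasure Q {\<eta> \<in> space Q. \<exists>j\<in>{..<m}. unlinked K {..<m} \<eta> i j} \<le> ennreal (real (m - 1) * ?r ^ (m - 2))" .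
    qed
    also have "\<dots> = ennreal (real m * real (m - 1) * ?r ^ (m - 2))"
      using r by (cases m) (simp_all add: ennreal_mult ennreal_of_nat_eq_real_of_nat mult.assoc)
    finally have "(\<integral>\<^sup>+y. \<integral>\<^sup>+\<eta>. ?F {..<m} y \<eta> \<partial>Q \<partial>?Y) \<le> (\<integral>\<^sup>+y. ennreal (real m * real (m - 1) * ?r ^ (m - 2)) \<partial>?Y)"
      by (intro nn_integral_mono)
    then show "(\<integral>\<^sup>+y. \<integral>\<^sup>+\<eta>. ?F {..<m} y \<eta> \<partial>Q \<partial>?Y) \<le> ennreal (real m * real (m - 1) * ?r ^ (m - 2))"
      by (simp add: Y.emeasure_space_1)
  qed auto
  also have "\<dots> = ennreal (?v\<^sup>2 * exp (- (?v * (1 - ?r))))"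
    using r by (intro pois_factorial_2) auto
  finally show ?thesis by simp
qed

end

section \<open>Components whose largest mark lies in a given interval\<close>

context random_graph_model
begin

text \<open>Fix the set \<open>H\<close> of vertices of mark at least \<open>K'\<close>. The
  component of \<open>v\<close> avoids \<open>H\<close>, so it can be explored without looking at
  \<open>H\<close>. Its vertex \<open>j\<close> of least index with mark at least \<open>K\<close>
  must miss every \<open>h\<close> in \<open>H\<close>, although each \<open>h\<close> is uniformly
  placed, in reach of \<open>j\<close> with probability at least \<open>a\<close>, and then joined
  with probability \<open>p\<close>. Summing over \<open>H\<close> gives a binomial
  expansion.\<close>

lemma prob_ladder:
  fixes B :: "'a set" and m v :: nat
  defines "P \<equiv> PiM (UNIV :: nat set) (\<lambda>_. uniform_measure lborel B) \<Otimes>\<^sub>M Q"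
  assumes B: "B \<in> sets borel" "bounded B" "0 < measure lborel B" and v: "v < m"
    and K: "1 \<le> K" "K \<le> K'" and a0: "0 \<le> a"
    and near: "\<And>y. y \<in> B \<Longrightarrow> ennreal a \<le> emeasure (uniform_measure lborel B) {z. norm (y - z) ^ DIM('a) \<le> \<beta> * (K' * K powr \<sigma>)}"
  shows "emeasure P {z. (\<exists>u\<in>comp {..<m} (fst z) (snd z) v. K \<le> mark (snd z) u) \<and>
      (\<forall>u\<in>comp {..<m} (fst z) (snd z) v. mark (snd z) u < K')} \<le> ennreal ((1 - tailprob K' * p * a) ^ (m - 1))"
proof -
  let ?U = "uniform_measure lborel B" and ?q = "tailprob K'"
  let ?Y = "PiM (UNIV :: nat set) (\<lambda>_. ?U)" and ?\<rho> = "\<beta> * (K' * K powr \<sigma>)"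
  note nz = measure_lborel_positive_bounded[OF B(2,1,3)]
  have U: "prob_space ?U" using nz by (intro prob_space_uniform_measure) auto
  interpret U: prob_space ?U by (rule U)
  interpret Y: prob_space ?Y by (intro prob_space_PiM U)
  interpret N: prob_space N by (rule prob_space_N)
  interpret Q: prob_space Q by (rule prob_space_Q)
  interpret P: prob_space P unfolding P_def by (intro prob_space_pair Y.prob_space_axioms Q.prob_space_axioms)
  have K': "1 \<le> K'" using K by simp
  have q: "0 \<le> ?q" "?q \<le> 1" using tailprob[of K'] K' by auto
  have a1: "a \<le> 1"
  proof -
    have "B \<noteq> {}" using B(3) by auto
    then obtain y where "y \<in> B" by auto
    from order_trans[OF near[OF this] U.emeasure_le_1] show ?thesis by simp
  qed
  have spP: "space P = UNIV" by (simp add: P_def space_pair_measure space_PiM)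
  have mfst: "(\<lambda>z. fst z i) \<in> borel_measurable P" for i
  proof -
    have "(\<lambda>z. fst z i) \<in> measurable P ?U" unfolding P_def by measurable
    moreover have "measurable P ?U = measurable P (borel :: 'a measure)" by (rule measurable_cong_sets) simp_all
    ultimately show ?thesis by blast
  qed
  have msnd: "snd \<in> measurable P Q" unfolding P_def by (rule measurable_snd)
  have mmark: "(\<lambda>z. mark (snd z) i) \<in> borel_measurable P" for i
    by (rule measurable_compose[OF msnd measurable_mark])
  have mcoin: "(\<lambda>z. snd (snd z s)) \<in> borel_measurable P" for s
    by (rule measurable_compose[OF msnd measurable_snd_coord])
  note [measurable] = mfst msnd mmark mcoin
  \<comment> \<open>Taking the least label makes the events disjoint in \<open>j\<close>; they
    depend only on locations, marks and coins of vertices outside \<open>H\<close>.\<close>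
  define E where "E = (\<lambda>H j. {z. (\<forall>i\<in>{..<m} - H. mark (snd z) i < K') \<and> j \<in> comp ({..<m} - H) (fst z) (snd z) v \<and>
      K \<le> mark (snd z) j \<and> (\<forall>i\<in>{..<j}. i \<in> comp ({..<m} - H) (fst z) (snd z) v \<longrightarrow> mark (snd z) i < K) \<and> fst z j \<in> B})"
  \<comment> \<open>\<open>h\<close> has a mark at least \<open>K'\<close> but no forced edge to
    \<open>j\<close>. Within volume-distance \<open>?\<rho>\<close> the kernel is large enough for
    the profile to be 1, so that the coin alone decides.\<close>
  define G where "G = (\<lambda>j h. {z :: (nat \<Rightarrow> 'a) \<times> (nat set \<Rightarrow> real \<times> real). K' \<le> mark (snd z) h \<and> \<not> (norm (fst z j - fst z h) ^ DIM('a) \<le> ?\<rho> \<and> snd (snd z {j, h}) \<le> p)})"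
  have mc: "Measurable.pred P (\<lambda>z. j \<in> comp V (fst z) (snd z) v)" for j V v
    by (rule pred_comp) (simp_all add: mfst msnd)
  have mE: "E H j \<in> sets P" for H j
  proof -
    note [measurable] = mc
    note [measurable] = B(1)
    have "Measurable.pred P (\<lambda>z. (\<forall>i\<in>{..<m} - H. mark (snd z) i < K') \<and> j \<in> comp ({..<m} - H) (fst z) (snd z) v \<and>
      K \<le> mark (snd z) j \<and> (\<forall>i\<in>{..<j}. i \<in> comp ({..<m} - H) (fst z) (snd z) v \<longrightarrow> mark (snd z) i < K) \<and> fst z j \<in> B)"
      by measurable
    then show ?thesis by (simp add: pred_def spP E_def)
  qed
  have mG: "G j h \<in> sets P" for j h
  proof -
    have "Measurable.pred P (\<lambda>z. K' \<le> mark (snd z) h \<and> \<not> (norm (fst z j - fst z h) ^ DIM('a) \<le> ?\<rho> \<and> snd (snd z {j, h}) \<le> p))"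
      by measurable
    then show ?thesis by (simp add: pred_def spP G_def)
  qed
  have mAll: "{z. \<forall>h\<in>S. z \<in> G j h} \<in> sets P" if "finite S" for S j
  proof -
    have "{z. \<forall>h\<in>S. z \<in> G j h} = {z \<in> space P. \<forall>h\<in>S. z \<in> G j h}" by (simp add: spP)
    also have "\<dots> \<in> sets P" using mG that by (intro sets.sets_Collect_finite_All) (simp_all add: spP)
    finally show ?thesis .
  qed
  \<comment> \<open>The location, mark and coin of each \<open>h\<close> in \<open>S\<close> are
    fresh given \<open>E H j\<close>; per vertex the factor is the chance of a large mark times the
    chance of a missed connection.\<close>
  have step: "emeasure P (E H j \<inter> {z. \<forall>h\<in>S. z \<in> G j h}) \<le> ennreal (?q * (1 - p * a)) ^ card S * emeasure P (E H j)"
    if "finite S" "S \<subseteq> H" "H \<subseteq> {..<m}" "j \<in> {..<m} - H" "v \<notin> H" for S H j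
    using that
  proof (induction S)
    case empty
    then show ?case by simp
  next
    case (insert h S)
    let ?I = "{..<m} - H"
    let ?A = "E H j \<inter> {z. \<forall>h\<in>S. z \<in> G j h}"
    \<comment> \<open>Location of \<open>h\<close>, mark of \<open>h\<close> and coin of the pair
      \<open>{j, h}\<close>, to be resampled in this order of nesting.\<close>
    let ?r = "\<lambda>z a b c. (fun_upd (fst z) h a, fun_upd (fun_upd (snd z) {h} b) {j, h} c)"
    have A: "?A \<in> sets P" using mE mAll insert.hyps(1) by (intro sets.Int) auto
    have h: "h \<noteq> j" "h \<notin> ?I" and vI: "v \<in> ?I" using insert.prems v by auto
    have F1: "mark (snd (?r z a b c)) i = mark (snd z) i" if "i \<noteq> h" for z :: "(nat \<Rightarrow> 'a) \<times> (nat set \<Rightarrow> real \<times> real)" and a b c i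
      using that h by (auto simp: mark_def)
    have F2: "fst (?r z a b c) i = fst z i" if "i \<noteq> h" for z :: "(nat \<Rightarrow> 'a) \<times> (nat set \<Rightarrow> real \<times> real)" and a b c i
      using that by simp
    have F3: "comp ?I (fst (?r z a b c)) (snd (?r z a b c)) v = comp ?I (fst z) (snd z) v" for z a b c
      using h by (intro comp_cong) auto
    have F4: "snd (?r z a b c) {j, h'} = snd z {j, h'}" if "h' \<noteq> h" for z :: "(nat \<Rightarrow> 'a) \<times> (nat set \<Rightarrow> real \<times> real)" and a b c h'
      using that h by (auto simp: doubleton_eq_iff)
    have invE: "?r z a b c \<in> E H j \<longleftrightarrow> z \<in> E H j" for z a b c
    proof -
      have 1: "(\<forall>i\<in>?I. mark (snd (?r z a b c)) i < K') \<longleftrightarrow> (\<forall>i\<in>?I. mark (snd z) i < K')"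
      proof (intro ball_cong refl)
        fix i assume "i \<in> ?I"
        then have "i \<noteq> h" using h by auto
        show "(mark (snd (?r z a b c)) i < K') = (mark (snd z) i < K')" unfolding F1[OF \<open>i \<noteq> h\<close>] by (rule refl)
      qed
      have 2: "(\<forall>i\<in>{..<j}. i \<in> comp ?I (fst z) (snd z) v \<longrightarrow> mark (snd (?r z a b c)) i < K) \<longleftrightarrow>
        (\<forall>i\<in>{..<j}. i \<in> comp ?I (fst z) (snd z) v \<longrightarrow> mark (snd z) i < K)"
      proof (intro ball_cong refl imp_cong)
        fix i assume "i \<in> comp ?I (fst z) (snd z) v"
        then have "i \<noteq> h" using comp_subset[OF vI] h by auto
        show "(mark (snd (?r z a b c)) i < K) = (mark (snd z) i < K)" unfolding F1[OF \<open>i \<noteq> h\<close>] by (rule refl)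
      qed
      show ?thesis unfolding E_def mem_Collect_eq F3 1 2 F1[OF h(1)[symmetric]] F2[OF h(1)[symmetric]] ..
    qed
    have invG: "?r z a b c \<in> G j h' \<longleftrightarrow> z \<in> G j h'" if "h' \<noteq> h" for z a b c h'
      unfolding G_def mem_Collect_eq F1[OF that] F2[OF that] F2[OF h(1)[symmetric]] F4[OF that] ..
    have invA: "?r z a b c \<in> ?A \<longleftrightarrow> z \<in> ?A" for z a b c
    proof -
      have "(\<forall>h\<in>S. ?r z a b c \<in> G j h) \<longleftrightarrow> (\<forall>h\<in>S. z \<in> G j h)"
        using insert.hyps(2) by (intro ball_cong refl invG) auto
      then show ?thesis unfolding Int_iff mem_Collect_eq invE by simp
    qed
    have memG: "?r z a b c \<in> G j h \<longleftrightarrow> K' \<le> fst b \<and> \<not> (norm (fst z j - a) ^ DIM('a) \<le> ?\<rho> \<and> snd c \<le> p)" for z a b c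
      using h by (simp add: G_def mark_def)
    have "emeasure P (?A \<inter> G j h) \<le> ennreal (?q * (1 - p * a)) * emeasure P ?A"
    proof (rule emeasure_resample_le[OF A mG, where J = "\<lambda>f z. \<integral>\<^sup>+a. \<integral>\<^sup>+b. \<integral>\<^sup>+c. f (?r z a b c) \<partial>N \<partial>N \<partial>?U"])
      fix f :: "(nat \<Rightarrow> 'a) \<times> (nat set \<Rightarrow> real \<times> real) \<Rightarrow> ennreal" assume f: "f \<in> borel_measurable P"
      let ?f1 = "\<lambda>z. \<integral>\<^sup>+c. f (fst z, fun_upd (snd z) {j, h} c) \<partial>N"
      let ?f2 = "\<lambda>z. \<integral>\<^sup>+b. ?f1 (fst z, fun_upd (snd z) {h} b) \<partial>N"
      have e1: "(\<integral>\<^sup>+z. f z \<partial>P) = (\<integral>\<^sup>+z. ?f1 z \<partial>P)" and f1: "?f1 \<in> borel_measurable P"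
        using resample_snd[OF prob_space_N Y.prob_space_axioms, of f "{j, h}"] f unfolding P_def Q_def by auto
      have e2: "(\<integral>\<^sup>+z. ?f1 z \<partial>P) = (\<integral>\<^sup>+z. ?f2 z \<partial>P)" and f2: "?f2 \<in> borel_measurable P"
        using resample_snd[OF prob_space_N Y.prob_space_axioms, of ?f1 "{h}"] f1 unfolding P_def Q_def by auto
      have e3: "(\<integral>\<^sup>+z. ?f2 z \<partial>P) = (\<integral>\<^sup>+z. \<integral>\<^sup>+a. ?f2 (fun_upd (fst z) h a, snd z) \<partial>?U \<partial>P)"
        using resample_fst(2)[OF U Q.prob_space_axioms, of ?f2 h] f2 unfolding P_def by simp
      show "(\<integral>\<^sup>+z. f z \<partial>P) = (\<integral>\<^sup>+z. \<integral>\<^sup>+a. \<integral>\<^sup>+b. \<integral>\<^sup>+c. f (?r z a b c) \<partial>N \<partial>N \<partial>?U \<partial>P)"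
        unfolding e1 e2 e3 by (simp only: fst_conv snd_conv)
    next
      have JA: "(\<integral>\<^sup>+a. \<integral>\<^sup>+b. \<integral>\<^sup>+c. indicator ?A (?r z a b c) \<partial>N \<partial>N \<partial>?U) = indicator ?A z" for z
      proof -
        have "indicator ?A (?r z a b c) = (indicator ?A z :: ennreal)" for a b c
          unfolding indicator_def invA ..
        then show ?thesis by (simp only: nn_integral_const N.emeasure_space_1 U.emeasure_space_1 mult_1_right)
      qed
      show "(\<lambda>z. \<integral>\<^sup>+a. \<integral>\<^sup>+b. \<integral>\<^sup>+c. indicator ?A (?r z a b c) \<partial>N \<partial>N \<partial>?U) \<in> borel_measurable P"
        unfolding JA using A by (rule borel_measurable_indicator)
      fix z :: "(nat \<Rightarrow> 'a) \<times> (nat set \<Rightarrow> real \<times> real)"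
      let ?n = "{a. norm (fst z j - a) ^ DIM('a) \<le> ?\<rho>}"
      let ?X = "\<lambda>a b c. indicator {(a, b, c). K' \<le> fst b \<and> \<not> (norm (fst z j - a) ^ DIM('a) \<le> ?\<rho> \<and> snd c \<le> p)} (a, b, c) :: ennreal"
      \<comment> \<open>The probability, given the location of \<open>h\<close>, that no edge to
        \<open>j\<close> is forced: 1 out of reach and \<open>1 - p\<close> within reach.\<close>
      let ?w = "\<lambda>a. indicator (- ?n) a + indicator ?n a * ennreal (1 - p) :: ennreal"
      have n: "?n \<in> sets ?U"
      proof -
        have "?n = {a \<in> space borel. norm (fst z j - a) ^ DIM('a) \<le> ?\<rho>}" by simp
        also have "\<dots> \<in> sets borel" by measurable
        finally show ?thesis by simp
      qed
      have n': "- ?n \<in> sets ?U" using sets.compl_sets[OF n] by (simp add: Compl_eq_Diff_UNIV)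
      have coin: "(\<integral>\<^sup>+c. indicator {c. \<not> snd c \<le> p} c \<partial>N) = ennreal (1 - p)" and mcc: "{c. \<not> snd c \<le> p} \<in> sets N"
      proof -
        have eq: "{c. \<not> snd c \<le> p} = space N - {c. snd c \<le> p}" by auto
        show s: "{c. \<not> snd c \<le> p} \<in> sets N" unfolding eq by (rule sets.compl_sets[OF sets_N_coin])
        have "emeasure N {c. snd c \<le> p} = ennreal p"
          using nn_integral_N_coin sets_N_coin by (simp only: nn_integral_indicator)
        then have "emeasure N {c. \<not> snd c \<le> p} = 1 - ennreal p"
          unfolding eq using sets_N_coin N.emeasure_space_1 by (subst emeasure_compl) simp_all
        then show "(\<integral>\<^sup>+c. indicator {c. \<not> snd c \<le> p} c \<partial>N) = ennreal (1 - p)"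
          using s p ennreal_minus[of p 1] by (simp only: nn_integral_indicator) simp
      qed
      have c: "(\<integral>\<^sup>+c. ?X a b c \<partial>N) = indicator {b. K' \<le> fst b} b * ?w a" for a and b :: "real \<times> real"
      proof (cases "K' \<le> fst b \<and> a \<in> ?n")
        case True
        then have "(\<integral>\<^sup>+c. ?X a b c \<partial>N) = (\<integral>\<^sup>+c. indicator {c. \<not> snd c \<le> p} c \<partial>N)"
          by (intro nn_integral_cong) (auto simp: indicator_def)
        moreover have "indicator {b. K' \<le> fst b} b * ?w a = ennreal (1 - p)" using True by (simp add: indicator_def)
        ultimately show ?thesis using coin by simp
      next
        case False
        then have "(\<integral>\<^sup>+c. ?X a b c \<partial>N) = (\<integral>\<^sup>+c. indicator {b. K' \<le> fst b} b \<partial>N)"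
          by (intro nn_integral_cong) (auto simp: indicator_def)
        moreover have "indicator {b. K' \<le> fst b} b * ?w a = indicator {b. K' \<le> fst b} b" using False by (auto simp: indicator_def)
        ultimately show ?thesis by (simp only: nn_integral_const N.emeasure_space_1 mult_1_right)
      qed
      have wm: "?w \<in> borel_measurable ?U"
        by (intro borel_measurable_add borel_measurable_times_ennreal borel_measurable_indicator n n' borel_measurable_const)
      have I: "(\<integral>\<^sup>+a. \<integral>\<^sup>+b. \<integral>\<^sup>+c. ?X a b c \<partial>N \<partial>N \<partial>?U) = ennreal ?q * (\<integral>\<^sup>+a. ?w a \<partial>?U)"
        unfolding c
        by (simp only: nn_integral_multc[OF borel_measurable_indicator[OF sets_N_mark]] nn_integral_N_mark[OF K'] nn_integral_cmult[OF wm])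
      have le: "(\<integral>\<^sup>+a. \<integral>\<^sup>+b. \<integral>\<^sup>+c. ?X a b c \<partial>N \<partial>N \<partial>?U) \<le> ennreal (?q * (1 - p * a))" if zB: "fst z j \<in> B"
      proof -
        have "(\<integral>\<^sup>+a. ?w a \<partial>?U) + ennreal p * emeasure ?U ?n = (\<integral>\<^sup>+a. ?w a \<partial>?U) + (\<integral>\<^sup>+a. ennreal p * indicator ?n a \<partial>?U)"
          using n by (simp only: nn_integral_cmult[OF borel_measurable_indicator[OF n]] nn_integral_indicator)
        also have "\<dots> = (\<integral>\<^sup>+a. ?w a + ennreal p * indicator ?n a \<partial>?U)"
          by (intro nn_integral_add[symmetric] wm borel_measurable_times_ennreal borel_measurable_const borel_measurable_indicator n)
        also have "\<dots> = (\<integral>\<^sup>+a. 1 \<partial>?U)"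
          using p by (intro nn_integral_cong) (auto simp: indicator_def ennreal_plus[symmetric] simp del: ennreal_plus)
        also have "\<dots> = ennreal 1" using U.emeasure_space_1 by simp
        finally have "(\<integral>\<^sup>+a. ?w a \<partial>?U) \<le> ennreal (1 - p * a)"
        proof (rule ennreal_le_diffI)
          show "ennreal (p * a) \<le> ennreal p * emeasure ?U ?n"
            using near[OF zB] p a0 by (simp add: ennreal_mult mult_left_mono)
        qed (use p a0 in simp)
        then have "ennreal ?q * (\<integral>\<^sup>+a. ?w a \<partial>?U) \<le> ennreal ?q * ennreal (1 - p * a)" by (rule mult_left_mono) simp
        then show ?thesis unfolding I using q by (simp add: ennreal_mult')
      qed
      have split: "indicator (?A \<inter> G j h) (?r z a b c) = (indicator ?A z :: ennreal) * ?X a b c" for a b c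
        unfolding indicator_def Int_iff[of _ ?A] invA memG of_bool_conj by (simp only: mem_Collect_eq case_prod_conv of_bool_conj)
      show "(\<integral>\<^sup>+a. \<integral>\<^sup>+b. \<integral>\<^sup>+c. indicator (?A \<inter> G j h) (?r z a b c) \<partial>N \<partial>N \<partial>?U) \<le>
        ennreal (?q * (1 - p * a)) * (\<integral>\<^sup>+a. \<integral>\<^sup>+b. \<integral>\<^sup>+c. indicator ?A (?r z a b c) \<partial>N \<partial>N \<partial>?U)"
      proof (cases "z \<in> ?A")
        case True
        then have zB: "fst z j \<in> B" by (simp add: E_def)
        have i: "indicator ?A z = (1 :: ennreal)" using True by (rule indicator_simps)
        show ?thesis unfolding JA unfolding split i using le[OF zB] by (simp only: mult_1 mult_1_right)
      next
        case False
        have i: "indicator ?A z = (0 :: ennreal)" using False by (rule indicator_simps)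
        show ?thesis unfolding JA unfolding split i by simp
      qed
    qed
    also have "\<dots> \<le> ennreal (?q * (1 - p * a)) * (ennreal (?q * (1 - p * a)) ^ card S * emeasure P (E H j))"
      using insert by (intro mult_left_mono insert.IH) auto
    also have "?A \<inter> G j h = E H j \<inter> {z. \<forall>h\<in>insert h S. z \<in> G j h}" by auto
    finally show ?case using insert.hyps by (simp add: mult.assoc)
  qed
  let ?bad = "{z. (\<exists>u\<in>comp {..<m} (fst z) (snd z) v. K \<le> mark (snd z) u) \<and> (\<forall>u\<in>comp {..<m} (fst z) (snd z) v. mark (snd z) u < K')}"
  let ?HH = "Pow ({..<m} - {v})"
  \<comment> \<open>Distinct locations keep the denominator of the connection strength positive;
    division by 0 would give strength 0 instead of a very large one.\<close>
  have AE_good: "AE z in P. inj_on (fst z) {..<m} \<and> (\<forall>i. fst z i \<in> B)"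
  proof -
    have "AE y in ?Y. \<forall>i. y i \<in> B"
    proof (subst AE_all_countable, intro allI)
      fix i
      have "AE x in ?U. x \<in> B" using B(1) by (intro AE_uniform_measureI) auto
      then show "AE y in ?Y. y i \<in> B" by (intro AE_PiM_component U) auto
    qed
    with AE_uniform_distinct[OF B(2,1,3), of m] have "AE y in ?Y. inj_on y {..<m} \<and> (\<forall>i. y i \<in> B)"
      by eventually_elim auto
    then have "AE y in distr P ?Y fst. inj_on y {..<m} \<and> (\<forall>i. y i \<in> B)"
      unfolding P_def Q.distr_pair_fst .
    then show ?thesis by (rule AE_distrD[rotated]) (simp add: P_def)
  qed
  \<comment> \<open>\<open>H\<close> is read off from the marks. An unmissed \<open>h\<close> would
    be adjacent to \<open>j\<close>, hence belong to the component and contradict the bound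
    \<open>K'\<close> on its marks.\<close>
  have cover: "z \<in> (\<Union>H\<in>?HH. \<Union>j\<in>{..<m} - H. E H j \<inter> {z. \<forall>h\<in>H. z \<in> G j h})"
    if bad: "z \<in> ?bad" and good: "inj_on (fst z) {..<m}" "\<forall>i. fst z i \<in> B" for z
  proof -
    let ?x = "fst z" and ?\<eta> = "snd z"
    define H where "H = {i. i < m \<and> K' \<le> mark ?\<eta> i}"
    let ?C = "comp {..<m} ?x ?\<eta> v"
    have low: "mark ?\<eta> u < K'" if "u \<in> ?C" for u using bad that by blast
    have vC: "v \<in> ?C" by (simp add: comp_def)
    have CV: "?C \<subseteq> {..<m}" using v by (intro comp_subset) simp
    have CH: "?C \<subseteq> {..<m} - H" using CV low by (force simp: H_def)
    have C: "comp ({..<m} - H) ?x ?\<eta> v = ?C"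
      unfolding comp_def by (rule component_restrict) (use v CH in \<open>auto simp: comp_def\<close>)
    define j where "j = (LEAST u. u \<in> ?C \<and> K \<le> mark ?\<eta> u)"
    have "\<exists>u. u \<in> ?C \<and> K \<le> mark ?\<eta> u" using bad by blast
    from LeastI_ex[OF this] have j: "j \<in> ?C" "K \<le> mark ?\<eta> j" unfolding j_def by blast+
    have jl: "mark ?\<eta> i < K" if "i < j" "i \<in> ?C" for i
      using not_less_Least[of i "\<lambda>u. u \<in> ?C \<and> K \<le> mark ?\<eta> u"] that unfolding j_def by (metis not_le)
    have jH: "j \<in> {..<m} - H" using j(1) CH by blast
    have Ej: "z \<in> E H j"
      unfolding E_def mem_Collect_eq C using j jl good(2) by (auto simp: H_def not_le)
    have Gj: "z \<in> G j h" if h: "h \<in> H" for h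
    proof (rule ccontr)
      assume "z \<notin> G j h"
      moreover have mh: "K' \<le> mark ?\<eta> h" "h < m" using h by (auto simp: H_def)
      ultimately have n: "norm (?x j - ?x h) ^ DIM('a) \<le> ?\<rho>" and co: "snd (?\<eta> {j, h}) \<le> p"
        by (auto simp: G_def)
      have jh: "j \<noteq> h" using jH h by auto
      then have "?x j \<noteq> ?x h" using good(1) jH mh by (auto simp: inj_on_def)
      then have pos: "0 < norm (?x j - ?x h) ^ DIM('a)" by simp
      have mj: "mark ?\<eta> j < K'" using low j(1) by blast
      have "K' * K powr \<sigma> \<le> kernel \<sigma> (mark ?\<eta> j) (mark ?\<eta> h)"
      proof -
        have "max (mark ?\<eta> j) (mark ?\<eta> h) = mark ?\<eta> h" "min (mark ?\<eta> j) (mark ?\<eta> h) = mark ?\<eta> j" using mj mh by auto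
        then show ?thesis unfolding kernel_def using mh j(2) K \<sigma>
          by (simp only:) (intro mult_mono powr_mono2, auto)
      qed
      then have "norm (?x j - ?x h) ^ DIM('a) \<le> \<beta> * kernel \<sigma> (mark ?\<eta> j) (mark ?\<eta> h)"
        using n \<beta> by (smt (verit) mult_left_mono)
      then have "1 \<le> \<beta> * kernel \<sigma> (mark ?\<eta> j) (mark ?\<eta> h) / norm (?x j - ?x h) ^ DIM('a)"
        using pos by (simp add: le_divide_eq)
      then have "cp ?x ?\<eta> j h = p" by (simp add: cp_def connection_prob_def profile_ge_1)
      then have "edge ?x ?\<eta> j h" using jh co by (simp add: edge_def)
      moreover have "j \<in> {..<m}" "h \<in> {..<m}" using jH mh by auto
      ultimately have "h \<in> ?C" using j(1) unfolding comp_def by (blast intro: component_step)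
      then show False using low[of h] mh by auto
    qed
    have "H \<in> ?HH" using vC low[of v] by (auto simp: H_def)
    then show ?thesis using jH Ej Gj by blast
  qed
  have fH: "finite H" if "H \<in> ?HH" for H using that finite_subset[of H "{..<m} - {v}"] by auto
  have mEG: "E H j \<inter> {z. \<forall>h\<in>H. z \<in> G j h} \<in> sets P" if "H \<in> ?HH" for H j
    using mE mAll[OF fH[OF that]] by (rule sets.Int)
  have mU: "(\<Union>j\<in>{..<m} - H. E H j \<inter> {z. \<forall>h\<in>H. z \<in> G j h}) \<in> sets P" if "H \<in> ?HH" for H
    using mEG[OF that] by (intro sets.finite_UN) auto
  have mW: "(\<Union>H\<in>?HH. \<Union>j\<in>{..<m} - H. E H j \<inter> {z. \<forall>h\<in>H. z \<in> G j h}) \<in> sets P"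
    by (rule sets.finite_UN[OF _ mU]) simp
  have m1: "{\<eta> \<in> space Q. mark \<eta> i < K'} \<in> sets Q" for i by measurable
  \<comment> \<open>The events are disjoint in \<open>j\<close>, and each of them forces the marks
    of all vertices outside \<open>H\<close> below \<open>K'\<close>; so the choice of
    \<open>j\<close> costs nothing.\<close>
  have sumE: "(\<Sum>j\<in>{..<m} - H. emeasure P (E H j)) \<le> ennreal (1 - ?q) ^ card ({..<m} - H)" for H
  proof -
    have "disjoint_family_on (E H) ({..<m} - H)"
      unfolding disjoint_family_on_def
    proof (intro ballI impI)
      fix i j :: nat assume "i \<noteq> j"
      then consider "i < j" | "j < i" by linarith
      then show "E H i \<inter> E H j = {}" by cases (auto simp: E_def not_le[symmetric])
    qed
    then have "(\<Sum>j\<in>{..<m} - H. emeasure P (E H j)) = emeasure P (\<Union>j\<in>{..<m} - H. E H j)"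
      using mE by (intro sum_emeasure) auto
    also have "\<dots> \<le> emeasure P (UNIV \<times> {\<eta> \<in> space Q. \<forall>s\<in>(\<lambda>i. {i}) ` ({..<m} - H). \<eta> s \<in> {a. fst a < K'}})"
    proof (rule emeasure_mono)
      show "(\<Union>j\<in>{..<m} - H. E H j) \<subseteq> UNIV \<times> {\<eta> \<in> space Q. \<forall>s\<in>(\<lambda>i. {i}) ` ({..<m} - H). \<eta> s \<in> {a. fst a < K'}}"
        by (auto simp: E_def mark_def)
      have "{\<eta> \<in> space Q. \<forall>i\<in>{..<m} - H. mark \<eta> i < K'} \<in> sets Q"
        by (intro sets.sets_Collect_finite_All m1) auto
      then have "{\<eta> \<in> space Q. \<forall>s\<in>(\<lambda>i. {i}) ` ({..<m} - H). \<eta> s \<in> {a. fst a < K'}} \<in> sets Q"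
        by (simp add: mark_def)
      moreover have "UNIV \<in> sets ?Y" using sets.top[of ?Y] by (simp add: space_PiM)
      ultimately show "UNIV \<times> {\<eta> \<in> space Q. \<forall>s\<in>(\<lambda>i. {i}) ` ({..<m} - H). \<eta> s \<in> {a. fst a < K'}} \<in> sets P"
        unfolding P_def by (intro pair_measureI)
    qed
    also have "\<dots> = emeasure Q {\<eta> \<in> space Q. \<forall>s\<in>(\<lambda>i. {i}) ` ({..<m} - H). \<eta> s \<in> {a. fst a < K'}}"
    proof -
      have "{\<eta> \<in> space Q. \<forall>i\<in>{..<m} - H. mark \<eta> i < K'} \<in> sets Q"
        by (intro sets.sets_Collect_finite_All m1) auto
      then have "{\<eta> \<in> space Q. \<forall>s\<in>(\<lambda>i. {i}) ` ({..<m} - H). \<eta> s \<in> {a. fst a < K'}} \<in> sets Q"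
        by (simp add: mark_def)
      moreover have "UNIV \<in> sets ?Y" "emeasure ?Y UNIV = 1" using sets.top[of ?Y] Y.emeasure_space_1 by (simp_all add: space_PiM)
      ultimately show ?thesis unfolding P_def by (simp add: Q.emeasure_pair_measure_Times)
    qed
    also have "\<dots> = (\<Prod>s\<in>(\<lambda>i. {i}) ` ({..<m} - H). emeasure N {a. fst a < K'})"
    proof -
      have "{a. fst a < K'} = space N - {a. K' \<le> fst a}" by auto
      then have "{a. fst a < K'} \<in> sets N" using sets.compl_sets[OF sets_N_mark[of K']] by (simp only:)
      then show ?thesis unfolding Q_def by (intro emeasure_PiM_UNIV_Collect prob_space_N) auto
    qed
    also have "emeasure N {a. fst a < K'} = ennreal (1 - ?q)"
    proof -
      have eq: "{a. fst a < K'} = space N - {a. K' \<le> fst a}" by auto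
      have "emeasure N {a. K' \<le> fst a} = ennreal ?q"
        using nn_integral_N_mark[OF K'] sets_N_mark[of K'] by (simp only: nn_integral_indicator)
      then have "emeasure N {a. fst a < K'} = 1 - ennreal ?q"
        unfolding eq using sets_N_mark[of K'] N.emeasure_space_1 by (subst emeasure_compl) simp_all
      then show ?thesis using q ennreal_minus[of ?q 1] by simp
    qed
    also have "(\<Prod>s\<in>(\<lambda>i. {i}) ` ({..<m} - H). ennreal (1 - ?q)) = ennreal (1 - ?q) ^ card ({..<m} - H)"
      by (simp add: card_image)
    finally show ?thesis .
  qed
  have pa: "0 \<le> 1 - p * a" using p a0 a1 mult_le_one[of p a] by simp
  have "emeasure P ?bad \<le> emeasure P (\<Union>H\<in>?HH. \<Union>j\<in>{..<m} - H. E H j \<inter> {z. \<forall>h\<in>H. z \<in> G j h})"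
  proof (rule emeasure_mono_AE)
    show "AE z in P. z \<in> ?bad \<longrightarrow> z \<in> (\<Union>H\<in>?HH. \<Union>j\<in>{..<m} - H. E H j \<inter> {z. \<forall>h\<in>H. z \<in> G j h})"
      using AE_good by eventually_elim (use cover in blast)
    show "(\<Union>H\<in>?HH. \<Union>j\<in>{..<m} - H. E H j \<inter> {z. \<forall>h\<in>H. z \<in> G j h}) \<in> sets P"
      by (rule mW)
  qed
  also have "\<dots> \<le> (\<Sum>H\<in>?HH. emeasure P (\<Union>j\<in>{..<m} - H. E H j \<inter> {z. \<forall>h\<in>H. z \<in> G j h}))"
    by (rule emeasure_subadditive_finite) (use mU in \<open>auto simp only: image_subset_iff\<close>)
  also have "\<dots> \<le> (\<Sum>H\<in>?HH. ennreal (?q * (1 - p * a)) ^ card H * ennreal (1 - ?q) ^ card ({..<m} - H))"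
  proof (intro sum_mono)
    fix H assume H: "H \<in> ?HH"
    have "emeasure P (\<Union>j\<in>{..<m} - H. E H j \<inter> {z. \<forall>h\<in>H. z \<in> G j h}) \<le> (\<Sum>j\<in>{..<m} - H. emeasure P (E H j \<inter> {z. \<forall>h\<in>H. z \<in> G j h}))"
      by (rule emeasure_subadditive_finite) (use mEG[OF H] in \<open>auto simp only: image_subset_iff\<close>)
    also have "\<dots> \<le> (\<Sum>j\<in>{..<m} - H. ennreal (?q * (1 - p * a)) ^ card H * emeasure P (E H j))"
      using H fH[OF H] by (intro sum_mono step) auto
    also have "\<dots> = ennreal (?q * (1 - p * a)) ^ card H * (\<Sum>j\<in>{..<m} - H. emeasure P (E H j))"
      by (rule sum_distrib_left[symmetric])
    also have "\<dots> \<le> ennreal (?q * (1 - p * a)) ^ card H * ennreal (1 - ?q) ^ card ({..<m} - H)"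
      by (intro mult_left_mono sumE) simp
    finally show "emeasure P (\<Union>j\<in>{..<m} - H. E H j \<inter> {z. \<forall>h\<in>H. z \<in> G j h}) \<le> ennreal (?q * (1 - p * a)) ^ card H * ennreal (1 - ?q) ^ card ({..<m} - H)" .
  qed
  also have "\<dots> = ennreal (\<Sum>H\<in>?HH. (?q * (1 - p * a)) ^ card H * (1 - ?q) ^ card ({..<m} - H))"
    using q pa by (simp add: ennreal_power ennreal_mult[symmetric] sum_ennreal)
  \<comment> \<open>\<open>v\<close> never lies in \<open>H\<close>, which accounts for the separate
    factor \<open>1 - ?q\<close> and for the exponent \<open>m - 1\<close> in the end.\<close>
  also have "(\<Sum>H\<in>?HH. (?q * (1 - p * a)) ^ card H * (1 - ?q) ^ card ({..<m} - H)) =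
    (1 - ?q) * (\<Sum>H\<in>?HH. (\<Prod>i\<in>H. ?q * (1 - p * a)) * (\<Prod>i\<in>({..<m} - {v}) - H. 1 - ?q))"
    unfolding sum_distrib_left
  proof (intro sum.cong refl)
    fix H assume H: "H \<in> ?HH"
    have "{..<m} - H = insert v (({..<m} - {v}) - H)" using H v by auto
    then have "card ({..<m} - H) = Suc (card (({..<m} - {v}) - H))" by simp
    then show "(?q * (1 - p * a)) ^ card H * (1 - ?q) ^ card ({..<m} - H) = (1 - ?q) * ((\<Prod>i\<in>H. ?q * (1 - p * a)) * (\<Prod>i\<in>({..<m} - {v}) - H. 1 - ?q))"
      by simp
  qed
  also have "(\<Sum>H\<in>?HH. (\<Prod>i\<in>H. ?q * (1 - p * a)) * (\<Prod>i\<in>({..<m} - {v}) - H. 1 - ?q)) = (\<Prod>i\<in>{..<m} - {v}. ?q * (1 - p * a) + (1 - ?q))"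
    by (rule prod_add[symmetric]) simp
  also have "\<dots> = (1 - ?q * p * a) ^ (m - 1)"
    using v by (simp add: algebra_simps)
  also have "ennreal ((1 - ?q) * (1 - ?q * p * a) ^ (m - 1)) \<le> ennreal ((1 - ?q * p * a) ^ (m - 1))"
  proof (intro ennreal_leI mult_left_le_one_le zero_le_power)
    have "?q * (p * a) \<le> 1" using mult_le_one[of ?q "p * a"] q pa p a0 by simp
    then show "0 \<le> 1 - ?q * p * a" by (simp add: mult.assoc)
  qed (use q in auto)
  finally show ?thesis .
qed

end

section \<open>Vertices of large mark in the cube\<close>

definition cube :: "real \<Rightarrow> 'a::euclidean_space set" where
  "cube h = cbox (- h *\<^sub>R One) (h *\<^sub>R One)"

lemma mem_cube: "x \<in> cube h \<longleftrightarrow> (\<forall>b\<in>Basis. \<bar>x \<bullet> b\<bar> \<le> h)"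
  by (auto simp: cube_def mem_box abs_le_iff minus_le_iff)

lemma sets_cube [measurable, simp]: "cube h \<in> sets borel"
  and bounded_cube [simp]: "bounded (cube h)"
  by (simp_all add: cube_def)

lemma measure_cube: "0 \<le> h \<Longrightarrow> measure lborel (cube h :: 'a::euclidean_space set) = (2 * h) ^ DIM('a)"
  by (subst cube_def, subst content_cbox) (auto simp: inner_simps prod_constant mult.commute)

lemma norm_le_DIM:
  fixes x :: "'a::euclidean_space"
  assumes "\<And>b. b \<in> Basis \<Longrightarrow> \<bar>x \<bullet> b\<bar> \<le> t"
  shows "norm x \<le> real DIM('a) * t"
proof -
  have "norm x \<le> (\<Sum>b\<in>Basis. \<bar>x \<bullet> b\<bar>)" by (rule norm_le_l1)
  also have "\<dots> \<le> (\<Sum>b\<in>(Basis :: 'a set). t)" by (intro sum_mono assms)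
  finally show ?thesis by simp
qed

text \<open>Every point of a cube sees a full orthant of the cube at its own scale.\<close>

lemma cube_near:
  fixes y :: "'a::euclidean_space"
  assumes y: "y \<in> cube h" and t: "0 \<le> t" "t \<le> h" "0 < h" and \<rho>: "(real DIM('a) * t) ^ DIM('a) \<le> \<rho>"
  shows "ennreal (t ^ DIM('a) / (2 * h) ^ DIM('a)) \<le> emeasure (uniform_measure lborel (cube h)) {z. norm (y - z) ^ DIM('a) \<le> \<rho>}"
proof -
  \<comment> \<open>The corner of the orthant is chosen coordinatewise towards the centre: one moves
    down from nonnegative coordinates and up from negative ones, which stays in the cube because
    \<open>t \<le> h\<close>.\<close>
  define l where "l = (\<Sum>b\<in>Basis. (if 0 \<le> y \<bullet> b then y \<bullet> b - t else y \<bullet> b) *\<^sub>R b)"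
  define u where "u = l + t *\<^sub>R One"
  have l: "l \<bullet> b = (if 0 \<le> y \<bullet> b then y \<bullet> b - t else y \<bullet> b)" if "b \<in> Basis" for b
    using that by (simp add: l_def)
  have u: "u \<bullet> b = l \<bullet> b + t" if "b \<in> Basis" for b
    using that by (simp add: u_def inner_simps)
  have yb: "\<bar>y \<bullet> b\<bar> \<le> h" if "b \<in> Basis" for b using y that by (simp add: mem_cube)
  have sub: "cbox l u \<subseteq> cube h \<inter> {z. norm (y - z) ^ DIM('a) \<le> \<rho>}"
  proof
    fix z assume z: "z \<in> cbox l u"
    have c: "\<bar>z \<bullet> b\<bar> \<le> h \<and> \<bar>(y - z) \<bullet> b\<bar> \<le> t" if b: "b \<in> Basis" for b
    proof -
      have "l \<bullet> b \<le> z \<bullet> b" "z \<bullet> b \<le> l \<bullet> b + t" using z b u by (auto simp: mem_box)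
      then show ?thesis using yb[OF b] l[OF b] t by (auto simp: inner_simps abs_le_iff split: if_splits)
    qed
    have "norm (y - z) \<le> real DIM('a) * t" by (rule norm_le_DIM) (use c in auto)
    then have "norm (y - z) ^ DIM('a) \<le> (real DIM('a) * t) ^ DIM('a)" by (intro power_mono) auto
    then show "z \<in> cube h \<inter> {z. norm (y - z) ^ DIM('a) \<le> \<rho>}" using c \<rho> by (auto simp: mem_cube)
  qed
  have "measure lborel (cbox l u) = t ^ DIM('a)"
    using u t by (subst content_cbox) (auto simp: prod_constant)
  then have "ennreal (t ^ DIM('a)) = emeasure lborel (cbox l u)"
    using emeasure_bounded_finite[of "cbox l u"] by (simp add: emeasure_eq_ennreal_measure)
  also have "\<dots> \<le> emeasure lborel (cube h \<inter> {z. norm (y - z) ^ DIM('a) \<le> \<rho>})"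
  proof (rule emeasure_mono[OF sub])
    have "{z \<in> space borel. norm (y - z) ^ DIM('a) \<le> \<rho>} \<in> sets borel" by measurable
    then show "cube h \<inter> {z. norm (y - z) ^ DIM('a) \<le> \<rho>} \<in> sets lborel" by simp
  qed
  finally have le: "ennreal (t ^ DIM('a)) \<le> emeasure lborel (cube h \<inter> {z. norm (y - z) ^ DIM('a) \<le> \<rho>})" .
  have v: "emeasure lborel (cube h :: 'a set) = ennreal ((2 * h) ^ DIM('a))"
    using t measure_cube[of h, where 'a = 'a] emeasure_bounded_finite[of "cube h :: 'a set"]
    by (simp add: emeasure_eq_ennreal_measure)
  have "{z. norm (y - z) ^ DIM('a) \<le> \<rho>} \<in> sets borel"
  proof -
    have "{z \<in> space borel. norm (y - z) ^ DIM('a) \<le> \<rho>} \<in> sets borel" by measurable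
    then show ?thesis by simp
  qed
  then have "emeasure (uniform_measure lborel (cube h)) {z. norm (y - z) ^ DIM('a) \<le> \<rho>} =
    emeasure lborel (cube h \<inter> {z. norm (y - z) ^ DIM('a) \<le> \<rho>}) / ennreal ((2 * h) ^ DIM('a))"
    by (subst emeasure_uniform_measure) (simp_all add: v)
  also have "\<dots> \<ge> ennreal (t ^ DIM('a)) / ennreal ((2 * h) ^ DIM('a))"
    by (rule divide_right_mono_ennreal[OF le])
  finally show ?thesis using t by (simp add: divide_ennreal)
qed

lemma powr_root_power:
  assumes "0 < r" "0 < n"
  shows "(r powr (1 / real n)) ^ n = r"
proof -
  have "(r powr (1 / real n)) ^ n = (r powr (1 / real n)) powr real n"
    using assms by (subst powr_realpow) auto
  also have "\<dots> = r" using assms by (simp add: powr_powr)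
  finally show ?thesis .
qed

context random_graph_model
begin

lemma pred_marks:
  assumes x: "\<And>i. (\<lambda>z. x z i) \<in> borel_measurable T" and \<eta>: "\<eta> \<in> measurable T Q" and V: "\<And>a. Measurable.pred T (\<lambda>z. a \<in> V z)"
  shows "Measurable.pred T (\<lambda>z. (\<exists>u\<in>comp (V z) (x z) (\<eta> z) v. K \<le> mark (\<eta> z) u) \<and> (\<forall>u\<in>comp (V z) (x z) (\<eta> z) v. mark (\<eta> z) u < K'))"
    and "Measurable.pred T (\<lambda>z. \<forall>u\<in>comp (V z) (x z) (\<eta> z) v. mark (\<eta> z) u < K')"
proof -
  have [measurable]: "(\<lambda>z. mark (\<eta> z) u) \<in> borel_measurable T" for u
    by (rule measurable_compose[OF \<eta> measurable_mark])
  have [measurable]: "Measurable.pred T (\<lambda>z. u \<in> comp (V z) (x z) (\<eta> z) v)" for u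
    by (rule pred_comp[OF x \<eta> V])
  show "Measurable.pred T (\<lambda>z. (\<exists>u\<in>comp (V z) (x z) (\<eta> z) v. K \<le> mark (\<eta> z) u) \<and> (\<forall>u\<in>comp (V z) (x z) (\<eta> z) v. mark (\<eta> z) u < K'))"
    "Measurable.pred T (\<lambda>z. \<forall>u\<in>comp (V z) (x z) (\<eta> z) v. mark (\<eta> z) u < K')"
    unfolding Bex_def Ball_def by measurable
qed

lemma measurable_pts_pair: "(\<lambda>z. pts (fst z) i) \<in> borel_measurable (M \<Otimes>\<^sub>M Q)"
  by (rule measurable_compose[OF measurable_fst measurable_point])

lemma pred_points_pair: "B \<in> sets borel \<Longrightarrow> Measurable.pred (M \<Otimes>\<^sub>M Q) (\<lambda>z. a \<in> points_in (pts (fst z)) B)"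
proof -
  assume [measurable]: "B \<in> sets borel"
  note [measurable] = measurable_pts_pair
  show ?thesis by simp
qed

definition gcomp :: "'a set \<Rightarrow> 'w \<times> (nat set \<Rightarrow> real \<times> real) \<Rightarrow> nat \<Rightarrow> nat set" where
  "gcomp B z v = comp (points_in (pts (fst z)) B) (pts (fst z)) (snd z) v"

abbreviation gpts :: "'a set \<Rightarrow> 'w \<times> (nat set \<Rightarrow> real \<times> real) \<Rightarrow> nat set" where
  "gpts B z \<equiv> points_in (pts (fst z)) B"

abbreviation MQ :: "('w \<times> (nat set \<Rightarrow> real \<times> real)) measure" where
  "MQ \<equiv> M \<Otimes>\<^sub>M Q"

lemma prob_space_MQ: "prob_space MQ"
  by (rule prob_space_pair[OF prob_space_axioms prob_space_Q])

lemma pred_gcomp: "B \<in> sets borel \<Longrightarrow> Measurable.pred MQ (\<lambda>z. u \<in> gcomp B z v)"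
  unfolding gcomp_def by (rule pred_comp[OF measurable_pts_pair measurable_snd pred_points_pair])

lemma pred_gmarks:
  assumes "B \<in> sets borel"
  shows "Measurable.pred MQ (\<lambda>z. (\<exists>u\<in>gcomp B z v. K \<le> mark (snd z) u) \<and> (\<forall>u\<in>gcomp B z v. mark (snd z) u < K'))"
    "Measurable.pred MQ (\<lambda>z. \<forall>u\<in>gcomp B z v. mark (snd z) u < K')"
  unfolding gcomp_def by (rule pred_marks[OF measurable_pts_pair measurable_snd pred_points_pair[OF assms]])+

text \<open>Each of \<open>m\<close> uniform vertices is bad with a probability that is geometric in
  \<open>m - 1\<close>, so the first factorial moment of the Poisson law gives the
  exponential.\<close>

lemma expected_ladder:
  assumes B: "B \<in> sets borel" "bounded B" "0 < measure lborel B"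
    and K: "1 \<le> K" "K \<le> K'" and a: "0 \<le> a"
    and near: "\<And>y. y \<in> B \<Longrightarrow> ennreal a \<le> emeasure (uniform_measure lborel B) {z. norm (y - z) ^ DIM('a) \<le> \<beta> * (K' * K powr \<sigma>)}"
  shows "(\<integral>\<^sup>+z. ncard {v \<in> gpts B z. (\<exists>u\<in>gcomp B z v. K \<le> mark (snd z) u) \<and> (\<forall>u\<in>gcomp B z v. mark (snd z) u < K')} \<partial>MQ)
    \<le> ennreal (measure lborel B * exp (- (measure lborel B * (tailprob K' * p * a))))"
proof -
  let ?v = "measure lborel B" and ?q = "tailprob K'"
  let ?r = "1 - ?q * p * a"
  let ?U = "uniform_measure lborel B"
  let ?Y = "PiM (UNIV :: nat set) (\<lambda>_. ?U)"
  interpret U: prob_space ?U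
    using measure_lborel_positive_bounded[OF B(2,1,3)] by (intro prob_space_uniform_measure) auto
  interpret Y: prob_space ?Y by (intro prob_space_PiM U.prob_space_axioms)
  interpret Q: prob_space Q by (rule prob_space_Q)
  have q: "0 \<le> ?q" "?q \<le> 1" using tailprob[of K'] K by auto
  have a1: "a \<le> 1"
  proof -
    have "B \<noteq> {}" using B(3) by auto
    then obtain y where "y \<in> B" by auto
    from order_trans[OF near[OF this] U.emeasure_le_1] show ?thesis by simp
  qed
  have r: "0 \<le> ?r" using mult_le_one[of "?q * p" a] mult_le_one[of ?q p] q p a a1 by simp
  let ?P = "\<lambda>V (x :: nat \<Rightarrow> 'a) \<eta> v. (\<exists>u\<in>comp V x \<eta> v. K \<le> mark \<eta> u) \<and> (\<forall>u\<in>comp V x \<eta> v. mark \<eta> u < K')"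
  let ?F = "\<lambda>V x \<eta>. ncard {v \<in> V. ?P V x \<eta> v}"
  have pr: "Measurable.pred T (\<lambda>z. ?P {..<m} (fst z) (snd z) v)"
    if "\<And>i. (\<lambda>z. fst z i) \<in> borel_measurable T" "snd \<in> measurable T Q" for T and m v :: nat
    by (rule pred_marks(1)) (use that in auto)
  have m: "(\<lambda>z. ?F {..<m} (fst z) (snd z)) \<in> borel_measurable (PiM UNIV (\<lambda>_. borel) \<Otimes>\<^sub>M Q)" for m :: nat
  proof (rule measurable_ncard)
    have "Measurable.pred (PiM UNIV (\<lambda>_. borel) \<Otimes>\<^sub>M Q) (\<lambda>z. ?P {..<m} (fst z) (snd z) v)" for v
      by (rule pr[OF measurable_pair_fst_app measurable_snd])
    then show "Measurable.pred (PiM UNIV (\<lambda>_. borel) \<Otimes>\<^sub>M Q) (\<lambda>z. v \<in> {v \<in> {..<m}. ?P {..<m} (fst z) (snd z) v})" for v by simp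
  qed
  have "(\<integral>\<^sup>+z. ncard {v \<in> gpts B z. (\<exists>u\<in>gcomp B z v. K \<le> mark (snd z) u) \<and> (\<forall>u\<in>gcomp B z v. mark (snd z) u < K')} \<partial>MQ) =
    (\<integral>\<^sup>+\<omega>. \<integral>\<^sup>+\<eta>. ?F (points_in (pts \<omega>) B) (pts \<omega>) \<eta> \<partial>Q \<partial>M)"
  proof (subst Q.nn_integral_fst[symmetric])
    show "(\<lambda>z. ncard {v \<in> gpts B z. (\<exists>u\<in>gcomp B z v. K \<le> mark (snd z) u) \<and> (\<forall>u\<in>gcomp B z v. mark (snd z) u < K')}) \<in> borel_measurable MQ"
      by (rule measurable_ncard) (simp only: mem_Collect_eq, intro pred_intros_logic(3) pred_points_pair pred_gmarks B)
  qed (simp add: gcomp_def)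
  also have "\<dots> = (\<Sum>m. ennreal (pois ?v m) * (\<integral>\<^sup>+y. \<integral>\<^sup>+\<eta>. ?F {..<m} y \<eta> \<partial>Q \<partial>?Y))"
    by (rule nn_integral_binomial[OF B relabel_invariant_marks m])
  also have "\<dots> \<le> (\<Sum>m. ennreal (pois ?v m) * ennreal (real m * ?r ^ (m - 1)))"
  proof (intro suminf_le mult_left_mono)
    fix m :: nat
    have sY: "sets (?Y \<Otimes>\<^sub>M Q) = sets (PiM UNIV (\<lambda>_. borel) \<Otimes>\<^sub>M Q)"
      by (intro sets_pair_measure_cong sets_PiM_cong) auto
    have mm: "(\<lambda>z. ?F {..<m} (fst z) (snd z)) \<in> borel_measurable (?Y \<Otimes>\<^sub>M Q)"
      using m[of m] measurable_cong_sets[OF sY refl] by blast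
    have prY: "Measurable.pred (?Y \<Otimes>\<^sub>M Q) (\<lambda>z. ?P {..<m} (fst z) (snd z) v)" for v
    proof -
      have "Measurable.pred (PiM UNIV (\<lambda>_. borel) \<Otimes>\<^sub>M Q) (\<lambda>z. ?P {..<m} (fst z) (snd z) v)"
        by (rule pr[OF measurable_pair_fst_app measurable_snd])
      then show ?thesis using measurable_cong_sets[OF sY refl] by blast
    qed
    have "(\<integral>\<^sup>+y. \<integral>\<^sup>+\<eta>. ?F {..<m} y \<eta> \<partial>Q \<partial>?Y) = (\<integral>\<^sup>+z. ?F {..<m} (fst z) (snd z) \<partial>(?Y \<Otimes>\<^sub>M Q))"
      by (subst Q.nn_integral_fst[OF mm, symmetric]) simp
    also have "\<dots> = (\<Sum>v<m. emeasure (?Y \<Otimes>\<^sub>M Q) {z \<in> space (?Y \<Otimes>\<^sub>M Q). ?P {..<m} (fst z) (snd z) v})"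
      by (rule nn_integral_ncard_lessThan[OF prY])
    also have "\<dots> \<le> (\<Sum>v<m. ennreal (?r ^ (m - 1)))"
    proof (intro sum_mono)
      fix v assume "v \<in> {..<m}"
      then have "v < m" by simp
      from prob_ladder[OF B this K a near]
      show "emeasure (?Y \<Otimes>\<^sub>M Q) {z \<in> space (?Y \<Otimes>\<^sub>M Q). ?P {..<m} (fst z) (snd z) v} \<le> ennreal (?r ^ (m - 1))"
        by (simp add: space_pair_measure space_PiM)
    qed
    also have "\<dots> = ennreal (real m * ?r ^ (m - 1))"
      using r by (simp add: ennreal_mult ennreal_of_nat_eq_real_of_nat)
    finally show "(\<integral>\<^sup>+y. \<integral>\<^sup>+\<eta>. ?F {..<m} y \<eta> \<partial>Q \<partial>?Y) \<le> ennreal (real m * ?r ^ (m - 1))" .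
  qed auto
  also have "\<dots> = ennreal (?v * exp (- (?v * (1 - ?r))))"
    using r by (intro pois_factorial_1) auto
  finally show ?thesis by simp
qed

text \<open>The bound for one vertex is uniform in the locations, so it is integrated over
  \<open>\<eta>\<close> first and only the mean number of points remains.\<close>

lemma expected_large_low:
  assumes B: "B \<in> sets borel" "bounded B" "0 < measure lborel B" and K: "1 < K"
  shows "(\<integral>\<^sup>+z. ncard {v \<in> gpts B z. big k (gcomp B z v) \<and> (\<forall>u\<in>gcomp B z v. mark (snd z) u < K)} \<partial>MQ)
    \<le> ennreal (measure lborel B * (1 - tailprob K) ^ k)"
proof -
  interpret Q: prob_space Q by (rule prob_space_Q)
  have q: "0 \<le> 1 - tailprob K" using tailprob[of K] K by auto
  have pr: "Measurable.pred MQ (\<lambda>z. v \<in> {v \<in> gpts B z. big k (gcomp B z v) \<and> (\<forall>u\<in>gcomp B z v. mark (snd z) u < K)})" for v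
    unfolding mem_Collect_eq
    by (intro pred_intros_logic(3) pred_points_pair pred_gmarks measurable_big pred_gcomp B)
  have "(\<integral>\<^sup>+z. ncard {v \<in> gpts B z. big k (gcomp B z v) \<and> (\<forall>u\<in>gcomp B z v. mark (snd z) u < K)} \<partial>MQ) =
    (\<integral>\<^sup>+\<omega>. \<integral>\<^sup>+\<eta>. ncard {v \<in> gpts B (\<omega>, \<eta>). big k (gcomp B (\<omega>, \<eta>) v) \<and> (\<forall>u\<in>gcomp B (\<omega>, \<eta>) v. mark (snd (\<omega>, \<eta>)) u < K)} \<partial>Q \<partial>M)"
    by (rule Q.nn_integral_fst[symmetric]) (rule measurable_ncard[OF pr])
  also have "\<dots> \<le> (\<integral>\<^sup>+\<omega>. ncard (points_in (pts \<omega>) B) * ennreal ((1 - tailprob K) ^ k) \<partial>M)"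
  proof (rule nn_integral_mono_AE)
    show "AE \<omega> in M. (\<integral>\<^sup>+\<eta>. ncard {v \<in> gpts B (\<omega>, \<eta>). big k (gcomp B (\<omega>, \<eta>) v) \<and> (\<forall>u\<in>gcomp B (\<omega>, \<eta>) v. mark (snd (\<omega>, \<eta>)) u < K)} \<partial>Q)
      \<le> ncard (points_in (pts \<omega>) B) * ennreal ((1 - tailprob K) ^ k)"
      using AE_finite_points_in[OF B(2)] AE_space
    proof eventually_elim
      case (elim \<omega>)
      let ?V = "points_in (pts \<omega>) B"
      let ?S = "\<lambda>\<eta>. {v \<in> gpts B (\<omega>, \<eta>). big k (gcomp B (\<omega>, \<eta>) v) \<and> (\<forall>u\<in>gcomp B (\<omega>, \<eta>) v. mark (snd (\<omega>, \<eta>)) u < K)}"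
      have prQ: "Measurable.pred Q (\<lambda>\<eta>. v \<in> ?S \<eta>)" for v
        by (rule measurable_compose[OF measurable_Pair1'[OF elim(2)] pr])
      have "(\<integral>\<^sup>+\<eta>. ncard (?S \<eta>) \<partial>Q) = (\<Sum>v. emeasure Q {\<eta> \<in> space Q. v \<in> ?S \<eta>})"
        by (rule nn_integral_ncard[OF prQ])
      also have "\<dots> \<le> (\<Sum>v. indicator ?V v * ennreal ((1 - tailprob K) ^ k))"
      proof (intro suminf_le)
        fix v
        show "emeasure Q {\<eta> \<in> space Q. v \<in> ?S \<eta>} \<le> indicator ?V v * ennreal ((1 - tailprob K) ^ k)"
        proof (cases "v \<in> ?V")
          case True
          have "{\<eta> \<in> space Q. v \<in> ?S \<eta>} = {\<eta>. k \<le> card (comp ?V (pts \<omega>) \<eta> v) \<and> (\<forall>u\<in>comp ?V (pts \<omega>) \<eta> v. mark \<eta> u < K)}"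
            using True finite_subset[OF comp_subset[OF True] elim(1)] by (auto simp: gcomp_def big_finite)
          then show ?thesis using prob_large_component_low_marks[OF elim(1) True K, of k "pts \<omega>"] True by simp
        next
          case False
          then have "{\<eta> \<in> space Q. v \<in> ?S \<eta>} = {}" by auto
          then show ?thesis by (simp only: emeasure_empty zero_le)
        qed
      qed auto
      also have "\<dots> = ncard ?V * ennreal ((1 - tailprob K) ^ k)"
        unfolding ncard_def by (rule ennreal_suminf_multc)
      finally show ?case .
    qed
  qed
  also have "\<dots> = ennreal (measure lborel B) * ennreal ((1 - tailprob K) ^ k)"
  proof -
    have "(\<lambda>\<omega>. ncard (points_in (pts \<omega>) B)) \<in> borel_measurable M"
      by (rule measurable_ncard) (use B(1) in measurable)
    then show ?thesis by (subst nn_integral_multc) (simp_all add: expected_count[OF B])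
  qed
  finally show ?thesis using q by (simp add: ennreal_mult'')
qed

text \<open>With the hub exponent \<open>\<gamma> = (\<tau> + \<sigma>) / 2\<close> this is
  \<open>\<gamma> - (\<tau> - 1)\<close>, and it is also half of
  \<open>\<sigma> + 2 - \<tau>\<close>: a lower bound for the growth exponent of the number of
  better neighbours, whether the cube or the reach of the vertex is the limiting factor.\<close>

definition \<epsilon>0 :: real where "\<epsilon>0 = (\<sigma> + 2 - \<tau>) / 2"

text \<open>The two terms are the constants of the two cases of \<open>expected_level\<close>: the
  share of one orthant in the cube, and the volume constant of the reach, where
  \<open>2 powr (2 - \<tau>)\<close> stems from comparing with the upper end
  \<open>2 ^ Suc l\<close> of the level.\<close>

definition c0 :: real where
  "c0 = p * min (1 / 2 ^ DIM('a)) (\<beta> / real DIM('a) ^ DIM('a) * 2 powr (2 - \<tau>))"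

lemma \<epsilon>0_pos: "0 < \<epsilon>0" using \<tau> by (simp add: \<epsilon>0_def)
lemma c0_pos: "0 < c0" using p \<beta> by (simp add: c0_def)

definition level_bound :: "nat \<Rightarrow> real" where
  "level_bound l = exp (- (c0 * 2 powr (real l * \<epsilon>0)))"

text \<open>Even the crude estimate of \<open>exp (- x)\<close> by \<open>1 / x\<close> suffices,
  since it already yields a geometric series.\<close>

lemma summable_level_bound: "summable level_bound"
proof (rule summable_comparison_test')
  have "2 powr (- \<epsilon>0) < 2 powr 0" using \<epsilon>0_pos by (intro powr_less_mono) auto
  then show "summable (\<lambda>l. 1 / c0 * (2 powr (- \<epsilon>0)) ^ l)"
    by (intro summable_mult summable_geometric) simp
  fix l
  let ?x = "c0 * 2 powr (real l * \<epsilon>0)"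
  have x: "0 < ?x" using c0_pos by simp
  then have "?x \<le> exp ?x" using exp_ge_add_one_self[of ?x] by linarith
  then have "exp (- ?x) \<le> 1 / ?x" using x by (simp add: exp_minus inverse_eq_divide frac_le)
  also have "1 / ?x = 1 / c0 * (2 powr (- \<epsilon>0)) ^ l"
    by (simp add: powr_realpow[symmetric] powr_powr powr_minus divide_simps mult.commute)
  finally show "norm (level_bound l) \<le> 1 / c0 * (2 powr (- \<epsilon>0)) ^ l" by (simp add: level_bound_def)
qed

text \<open>The mean number of better vertices in reach of a vertex of mark about
  \<open>2 ^ l\<close> is the tail probability times the smaller of the volume of the cube and the
  reach, up to constants. The assumption \<open>l\<close> keeps the cube large enough for this
  level.\<close>

lemma expected_level:
  assumes h: "0 < h" and l: "2 powr (real (Suc l) * ((\<tau> + \<sigma>) / 2)) \<le> (2 * h) ^ DIM('a)"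
  defines "B \<equiv> (cube h :: 'a set)"
  shows "(\<integral>\<^sup>+z. ncard {v \<in> gpts B z. (\<exists>u\<in>gcomp B z v. 2 ^ l \<le> mark (snd z) u) \<and> (\<forall>u\<in>gcomp B z v. mark (snd z) u < 2 ^ Suc l)} \<partial>MQ)
    \<le> ennreal ((2 * h) ^ DIM('a) * level_bound l)"
proof -
  let ?d = "DIM('a)" and ?v = "(2 * h) ^ DIM('a)" and ?K = "2 ^ l :: real" and ?K' = "2 ^ Suc l :: real"
  let ?\<rho> = "\<beta> * (?K' * ?K powr \<sigma>)" and ?q = "tailprob (2 ^ Suc l)"
  have \<rho>: "0 < ?\<rho>" using \<beta> by simp
  \<comment> \<open>The side of the sub-box within reach: all of the orthant, or so small that a box
    of side \<open>t\<close>, of diameter at most \<open>real DIM('a) * t\<close>, fits into the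
    reach \<open>?\<rho>\<close>.\<close>
  define t where "t = min h (?\<rho> powr (1 / real ?d) / real ?d)"
  have t: "0 \<le> t" "t \<le> h" by (auto simp: t_def h less_imp_le)
  have pw: "(?\<rho> powr (1 / real ?d) / real ?d) ^ ?d = ?\<rho> / real ?d ^ ?d"
    unfolding power_divide powr_root_power[OF \<rho> DIM_positive] ..
  have td: "t ^ ?d = min (h ^ ?d) (?\<rho> / real ?d ^ ?d)"
  proof (cases "h \<le> ?\<rho> powr (1 / real ?d) / real ?d")
    case True
    then have "h ^ ?d \<le> (?\<rho> powr (1 / real ?d) / real ?d) ^ ?d" using h by (intro power_mono) auto
    then show ?thesis using True pw by (simp add: t_def)
  next
    case False
    then have "(?\<rho> powr (1 / real ?d) / real ?d) ^ ?d \<le> h ^ ?d" by (intro power_mono) auto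
    then show ?thesis using False pw by (simp add: t_def)
  qed
  have dt: "(real ?d * t) ^ ?d \<le> ?\<rho>"
  proof -
    have "(real ?d * t) ^ ?d \<le> real ?d ^ ?d * (?\<rho> / real ?d ^ ?d)" unfolding power_mult_distrib td by (intro mult_left_mono) auto
    then show ?thesis by simp
  qed
  have B: "B \<in> sets borel" "bounded B" "0 < measure lborel B" and mB: "measure lborel B = ?v"
    using h measure_cube[of h, where 'a = 'a] by (simp_all add: B_def)
  have "(\<integral>\<^sup>+z. ncard {v \<in> gpts B z. (\<exists>u\<in>gcomp B z v. ?K \<le> mark (snd z) u) \<and> (\<forall>u\<in>gcomp B z v. mark (snd z) u < ?K')} \<partial>MQ)
    \<le> ennreal (measure lborel B * exp (- (measure lborel B * (?q * p * (t ^ ?d / ?v)))))"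
  proof (rule expected_ladder[OF B])
    fix y assume "y \<in> B"
    then show "ennreal (t ^ ?d / ?v) \<le> emeasure (uniform_measure lborel B) {z. norm (y - z) ^ DIM('a) \<le> ?\<rho>}"
      unfolding B_def by (intro cube_near t h dt)
  qed (use t h in auto)
  also have "\<dots> \<le> ennreal (?v * level_bound l)"
  proof -
    have Kp: "?K = 2 powr real l" "?K' = 2 powr real (Suc l)"
      using powr_realpow[of 2 l] powr_realpow[of 2 "Suc l"] by simp_all
    have q: "?q = 2 powr (- (real (Suc l) * (\<tau> - 1)))"
      unfolding tailprob_def Kp powr_powr by (simp only: mult_minus_right)
    \<comment> \<open>The saturated case: the orthant of the cube is the limiting factor, and the
      assumption on the volume gives exactly the exponent \<open>\<epsilon>0\<close>.\<close>
    have 1: "2 powr (real l * \<epsilon>0) / 2 ^ ?d \<le> ?q * h ^ ?d"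
    proof -
      have "2 powr (real l * \<epsilon>0) \<le> 2 powr (real (Suc l) * \<epsilon>0)" using \<epsilon>0_pos by (intro powr_mono) auto
      also have "\<dots> = ?q * 2 powr (real (Suc l) * ((\<tau> + \<sigma>) / 2))"
        unfolding q powr_add[symmetric] by (simp add: \<epsilon>0_def field_simps)
      also have "\<dots> \<le> ?q * ?v" using l by (intro mult_left_mono) (simp_all add: tailprob_def)
      also have "\<dots> = ?q * h ^ ?d * 2 ^ ?d" by (simp add: power_mult_distrib)
      finally show ?thesis by (simp add: divide_le_eq)
    qed
    \<comment> \<open>The case limited by the reach: the true exponent is
      \<open>\<sigma> + 2 - \<tau>\<close>, of which only half is kept.\<close>
    have 2: "2 powr (real l * \<epsilon>0) * (\<beta> / real ?d ^ ?d * 2 powr (2 - \<tau>)) \<le> ?q * (?\<rho> / real ?d ^ ?d)"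
    proof -
      have "2 powr (real l * \<epsilon>0) * 2 powr (2 - \<tau>) \<le> 2 powr (real l * (\<sigma> + 2 - \<tau>)) * 2 powr (2 - \<tau>)"
        using \<tau> by (intro mult_right_mono powr_mono mult_left_mono) (auto simp: \<epsilon>0_def)
      also have "\<dots> = ?q * (?K' * ?K powr \<sigma>)"
        unfolding q unfolding Kp powr_powr powr_add[symmetric] by (simp add: algebra_simps)
      finally have "\<beta> / real ?d ^ ?d * (2 powr (real l * \<epsilon>0) * 2 powr (2 - \<tau>)) \<le> \<beta> / real ?d ^ ?d * (?q * (?K' * ?K powr \<sigma>))"
        using \<beta> by (intro mult_left_mono) auto
      then show ?thesis by (simp add: mult_ac)
    qed
    have "c0 * 2 powr (real l * \<epsilon>0) \<le> ?q * p * t ^ ?d"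
    proof -
      have "2 powr (real l * \<epsilon>0) * min (1 / 2 ^ ?d) (\<beta> / real ?d ^ ?d * 2 powr (2 - \<tau>)) \<le> ?q * t ^ ?d"
      proof (cases "h ^ ?d \<le> ?\<rho> / real ?d ^ ?d")
        case True
        have "2 powr (real l * \<epsilon>0) * min (1 / 2 ^ ?d) (\<beta> / real ?d ^ ?d * 2 powr (2 - \<tau>)) \<le> 2 powr (real l * \<epsilon>0) * (1 / 2 ^ ?d)"
          by (intro mult_left_mono) auto
        also have "\<dots> \<le> ?q * h ^ ?d" using 1 by simp
        finally show ?thesis using True td by simp
      next
        case False
        have "2 powr (real l * \<epsilon>0) * min (1 / 2 ^ ?d) (\<beta> / real ?d ^ ?d * 2 powr (2 - \<tau>)) \<le> 2 powr (real l * \<epsilon>0) * (\<beta> / real ?d ^ ?d * 2 powr (2 - \<tau>))"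
          by (intro mult_left_mono) auto
        also have "\<dots> \<le> ?q * (?\<rho> / real ?d ^ ?d)" by (rule 2)
        finally show ?thesis using False td by simp
      qed
      then have "p * (2 powr (real l * \<epsilon>0) * min (1 / 2 ^ ?d) (\<beta> / real ?d ^ ?d * 2 powr (2 - \<tau>))) \<le> p * (?q * t ^ ?d)"
        using p by (intro mult_left_mono) auto
      then show ?thesis unfolding c0_def by (simp only: mult_ac)
    qed
    then have "exp (- (?v * (?q * p * (t ^ ?d / ?v)))) \<le> level_bound l"
      using h by (simp add: level_bound_def)
    then show ?thesis unfolding mB using h by (intro ennreal_leI mult_left_mono) auto
  qed
  finally show ?thesis .
qed

text \<open>Classified by its largest mark, a component without hubs either stays below
  \<open>2 ^ l0\<close>, which is unlikely for large \<open>k\<close>, or tops out in a dyadic level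
  from \<open>l0\<close> to \<open>L\<close>; the levels contribute the tail of a convergent series,
  independent of \<open>h\<close>.\<close>

lemma expected_bad:
  assumes h: "0 < h" and L: "2 powr (real L * ((\<tau> + \<sigma>) / 2)) \<le> (2 * h) ^ DIM('a)" and l0: "0 < l0" "l0 \<le> L"
  defines "B \<equiv> (cube h :: 'a set)"
  shows "(\<integral>\<^sup>+z. ncard {v \<in> gpts B z. big k (gcomp B z v) \<and> (\<forall>u\<in>gcomp B z v. mark (snd z) u < 2 ^ L)} \<partial>MQ)
    \<le> ennreal ((2 * h) ^ DIM('a) * ((1 - tailprob (2 ^ l0)) ^ k + (\<Sum>l. level_bound (l + l0))))"
proof -
  let ?v = "(2 * h) ^ DIM('a)"
  let ?low = "\<lambda>K z v. \<forall>u\<in>gcomp B z v. mark (snd z) u < K"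
  let ?S = "\<lambda>z. {v \<in> gpts B z. big k (gcomp B z v) \<and> ?low (2 ^ l0) z v}"
  let ?T = "\<lambda>l z. {v \<in> gpts B z. (\<exists>u\<in>gcomp B z v. 2 ^ l \<le> mark (snd z) u) \<and> ?low (2 ^ Suc l) z v}"
  have B: "B \<in> sets borel" "bounded B" "0 < measure lborel B" and mB: "measure lborel B = ?v"
    using h measure_cube[of h, where 'a = 'a] by (simp_all add: B_def)
  have sub: "{v \<in> gpts B z. big k (gcomp B z v) \<and> ?low (2 ^ L) z v} \<subseteq> ?S z \<union> (\<Union>l\<in>{l0..<L}. ?T l z)" for z
    using l0(2)
  proof (induction L rule: dec_induct)
    case (step n)
    have split: "v \<in> {v \<in> gpts B z. big k (gcomp B z v) \<and> ?low (2 ^ n) z v} \<union> ?T n z"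
      if "v \<in> {v \<in> gpts B z. big k (gcomp B z v) \<and> ?low (2 ^ Suc n) z v}" for v
      using that by (auto simp: not_less)
    have "{l0..<Suc n} = insert n {l0..<n}" using step.hyps by auto
    then have U: "(\<Union>l\<in>{l0..<Suc n}. ?T l z) = ?T n z \<union> (\<Union>l\<in>{l0..<n}. ?T l z)" by (simp only: UN_insert)
    have "A' \<subseteq> S \<union> R'" if "A' \<subseteq> A \<union> T" "A \<subseteq> S \<union> R" "R' = T \<union> R" for A A' S R R' T :: "nat set"
      using that by blast
    from this[OF subsetI[OF split] step.IH U] show ?case .
  qed auto
  have ncU: "ncard (\<Union>l\<in>I. T l) \<le> (\<Sum>l\<in>I. ncard (T l))" if "finite I" for I and T :: "nat \<Rightarrow> nat set"
    using that
  proof (induction I)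
    case empty
    then show ?case by (simp add: ncard_finite)
  next
    case (insert i I)
    have "ncard (\<Union>l\<in>insert i I. T l) \<le> ncard (T i) + ncard (\<Union>l\<in>I. T l)" using ncard_Un_le[of "T i" "\<Union>l\<in>I. T l"] by simp
    also have "\<dots> \<le> ncard (T i) + (\<Sum>l\<in>I. ncard (T l))" by (intro add_left_mono insert.IH)
    finally show ?case using insert.hyps by simp
  qed
  have mS: "(\<lambda>z. ncard (?S z)) \<in> borel_measurable MQ"
    by (rule measurable_ncard) (simp only: mem_Collect_eq, intro pred_intros_logic(3) pred_points_pair pred_gmarks measurable_big pred_gcomp B)
  have mT: "(\<lambda>z. ncard (?T l z)) \<in> borel_measurable MQ" for l
    by (rule measurable_ncard) (simp only: mem_Collect_eq, intro pred_intros_logic(3) pred_points_pair pred_gmarks B)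
  have "(\<integral>\<^sup>+z. ncard {v \<in> gpts B z. big k (gcomp B z v) \<and> ?low (2 ^ L) z v} \<partial>MQ) \<le> (\<integral>\<^sup>+z. ncard (?S z) + (\<Sum>l\<in>{l0..<L}. ncard (?T l z)) \<partial>MQ)"
  proof (intro nn_integral_mono)
    fix z
    have "ncard {v \<in> gpts B z. big k (gcomp B z v) \<and> ?low (2 ^ L) z v} \<le> ncard (?S z \<union> (\<Union>l\<in>{l0..<L}. ?T l z))"
      by (rule ncard_mono[OF sub])
    also have "\<dots> \<le> ncard (?S z) + ncard (\<Union>l\<in>{l0..<L}. ?T l z)" by (rule ncard_Un_le)
    also have "\<dots> \<le> ncard (?S z) + (\<Sum>l\<in>{l0..<L}. ncard (?T l z))" by (intro add_left_mono ncU) simp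
    finally show "ncard {v \<in> gpts B z. big k (gcomp B z v) \<and> ?low (2 ^ L) z v} \<le> ncard (?S z) + (\<Sum>l\<in>{l0..<L}. ncard (?T l z))" .
  qed
  also have "\<dots> = (\<integral>\<^sup>+z. ncard (?S z) \<partial>MQ) + (\<Sum>l\<in>{l0..<L}. \<integral>\<^sup>+z. ncard (?T l z) \<partial>MQ)"
    using mT by (subst nn_integral_add[OF mS]) (auto simp: nn_integral_sum)
  also have "\<dots> \<le> ennreal (?v * (1 - tailprob (2 ^ l0)) ^ k) + (\<Sum>l\<in>{l0..<L}. ennreal (?v * level_bound l))"
  proof (intro add_mono sum_mono)
    have "1 < (2::real) ^ l0" using l0 by (intro one_less_power) auto
    from expected_large_low[OF B this, of k] show "(\<integral>\<^sup>+z. ncard (?S z) \<partial>MQ) \<le> ennreal (?v * (1 - tailprob (2 ^ l0)) ^ k)" unfolding mB .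
    fix l assume "l \<in> {l0..<L}"
    then have "2 powr (real (Suc l) * ((\<tau> + \<sigma>) / 2)) \<le> 2 powr (real L * ((\<tau> + \<sigma>) / 2))"
      using \<tau> \<sigma> by (intro powr_mono mult_right_mono) auto
    from order_trans[OF this L] show "(\<integral>\<^sup>+z. ncard (?T l z) \<partial>MQ) \<le> ennreal (?v * level_bound l)"
      unfolding B_def by (rule expected_level[OF h])
  qed
  also have "\<dots> = ennreal (?v * ((1 - tailprob (2 ^ l0)) ^ k + (\<Sum>l\<in>{l0..<L}. level_bound l)))"
  proof -
    have "0 \<le> 1 - tailprob (2 ^ l0)" using tailprob[of "2 ^ l0"] by simp
    then have nn: "0 \<le> ?v * (1 - tailprob (2 ^ l0)) ^ k" "0 \<le> (\<Sum>l\<in>{l0..<L}. ?v * level_bound l)" using h by (auto intro!: sum_nonneg simp: level_bound_def)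
    have "(\<Sum>l\<in>{l0..<L}. ennreal (?v * level_bound l)) = ennreal (\<Sum>l\<in>{l0..<L}. ?v * level_bound l)"
      using h by (intro sum_ennreal) (auto simp: level_bound_def)
    then show ?thesis using nn by (simp add: ennreal_plus[symmetric] distrib_left sum_distrib_left del: ennreal_plus)
  qed
  also have "\<dots> \<le> ennreal (?v * ((1 - tailprob (2 ^ l0)) ^ k + (\<Sum>l. level_bound (l + l0))))"
  proof (intro ennreal_leI mult_left_mono add_left_mono)
    have "(\<Sum>l\<in>{l0..<L}. level_bound l) = (\<Sum>l<L - l0. level_bound (l + l0))"
      using l0 by (intro sum.reindex_bij_witness[of _ "\<lambda>l. l + l0" "\<lambda>l. l - l0"]) auto
    also have "\<dots> \<le> (\<Sum>l. level_bound (l + l0))"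
      by (intro sum_le_suminf summable_ignore_initial_segment summable_level_bound) (auto simp: level_bound_def)
    finally show "(\<Sum>l\<in>{l0..<L}. level_bound l) \<le> (\<Sum>l. level_bound (l + l0))" .
  qed (use h in auto)
  finally show ?thesis .
qed

text \<open>When all pairs of vertices of mark at least \<open>K\<close> are in reach of each other,
  a coin at most \<open>p\<close> makes them adjacent. Common neighbours then put all of them into
  one component, which absorbs every component that contains at least one of them.\<close>

lemma largest_component_ge:
  assumes V: "finite V" and inj: "inj_on x V" and d: "\<And>i j. i \<in> V \<Longrightarrow> j \<in> V \<Longrightarrow> norm (x i - x j) ^ DIM('a) \<le> \<beta> * (K * K powr \<sigma>)"
    and K: "1 \<le> K" and link: "\<not> (\<exists>i\<in>V. \<exists>j\<in>V. unlinked K V \<eta> i j)"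
  shows "card {v \<in> V. big k (comp V x \<eta> v)} \<le>
    largest_component_size (edge x \<eta>) V + card {v \<in> V. big k (comp V x \<eta> v) \<and> (\<forall>u\<in>comp V x \<eta> v. mark \<eta> u < K)}"
proof -
  let ?N = "{v \<in> V. big k (comp V x \<eta> v)}" and ?Bad = "{v \<in> V. big k (comp V x \<eta> v) \<and> (\<forall>u\<in>comp V x \<eta> v. mark \<eta> u < K)}"
  have hub: "edge x \<eta> i j" if ij: "i \<in> V" "j \<in> V" "i \<noteq> j" "K \<le> mark \<eta> i" "K \<le> mark \<eta> j" "snd (\<eta> {i, j}) \<le> p" for i j
  proof -
    have "x i \<noteq> x j" using inj ij by (auto simp: inj_on_def)
    then have pos: "0 < norm (x i - x j) ^ DIM('a)" by simp
    have "K * K powr \<sigma> \<le> kernel \<sigma> (mark \<eta> i) (mark \<eta> j)"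
      unfolding kernel_def using ij K \<sigma> by (intro mult_mono powr_mono2) auto
    then have "\<beta> * (K * K powr \<sigma>) \<le> \<beta> * kernel \<sigma> (mark \<eta> i) (mark \<eta> j)" using \<beta> by (intro mult_left_mono) auto
    then have "1 \<le> \<beta> * kernel \<sigma> (mark \<eta> i) (mark \<eta> j) / norm (x i - x j) ^ DIM('a)"
      using pos d[OF ij(1,2)] by (simp add: le_divide_eq)
    then have "cp x \<eta> i j = p" by (simp add: cp_def connection_prob_def profile_ge_1)
    then show ?thesis using ij by (simp add: edge_def)
  qed
  have same: "j \<in> comp V x \<eta> i" if ij: "i \<in> V" "j \<in> V" "K \<le> mark \<eta> i" "K \<le> mark \<eta> j" for i j
  proof (cases "i = j")
    case True
    then show ?thesis by (simp add: comp_def)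
  next
    case False
    have "\<not> unlinked K V \<eta> i j" using link ij by blast
    then obtain g where g: "g \<in> V" "g \<noteq> i" "g \<noteq> j" "K \<le> mark \<eta> g" "snd (\<eta> {i, g}) \<le> p" "snd (\<eta> {j, g}) \<le> p"
      using False ij by (auto simp: unlinked_def)
    have "edge x \<eta> i g" using hub[of i g] ij g by auto
    moreover have "edge x \<eta> g j" using hub[of j g] ij g edge_sym[of x \<eta> g j] by auto
    moreover have "i \<in> component (edge x \<eta>) V i" by simp
    ultimately show ?thesis unfolding comp_def using ij g by (meson component_step)
  qed
  have "card (?N - ?Bad) \<le> largest_component_size (edge x \<eta>) V"
  proof (cases "?N - ?Bad = {}")
    case False
    then obtain v0 where v0: "v0 \<in> ?N - ?Bad" by blast
    then obtain u0 where u0: "u0 \<in> comp V x \<eta> v0" "K \<le> mark \<eta> u0" by (auto simp: not_less)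
    have v0V: "v0 \<in> V" using v0 by simp
    have u0V: "u0 \<in> V" using comp_subset[OF v0V] u0 by auto
    have "?N - ?Bad \<subseteq> comp V x \<eta> u0"
    proof
      fix v assume v: "v \<in> ?N - ?Bad"
      then obtain u where u: "u \<in> comp V x \<eta> v" "K \<le> mark \<eta> u" by (auto simp: not_less)
      have vV: "v \<in> V" using v by simp
      then have uV: "u \<in> V" using comp_subset[OF vV] u by auto
      have "u \<in> comp V x \<eta> u0" by (rule same[OF u0V uV u0(2) u(2)])
      then have "comp V x \<eta> u = comp V x \<eta> u0" unfolding comp_def by (rule component_eq[OF edge_sym])
      moreover have "comp V x \<eta> u = comp V x \<eta> v" using u(1) unfolding comp_def by (rule component_eq[OF edge_sym])
      moreover have "v \<in> comp V x \<eta> v" by (simp add: comp_def)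
      ultimately show "v \<in> comp V x \<eta> u0" by simp
    qed
    then have "card (?N - ?Bad) \<le> card (comp V x \<eta> u0)"
      by (rule card_mono[OF finite_subset[OF comp_subset[OF u0V] V]])
    also have "\<dots> \<le> largest_component_size (edge x \<eta>) V"
      unfolding comp_def by (rule largest_component_size_ge[OF V u0V])
    finally show ?thesis .
  qed (simp only: card.empty)
  moreover have "card ?N \<le> card (?N - ?Bad) + card ?Bad"
  proof -
    have "?N = (?N - ?Bad) \<union> ?Bad" by blast
    then show ?thesis using card_Un_le[of "?N - ?Bad" ?Bad] by simp
  qed
  ultimately show ?thesis by linarith
qed

text \<open>If the largest component has at least \<open>k\<close> vertices, all of them are counted
  on the right; otherwise \<open>k\<close> alone is an upper bound.\<close>

lemma largest_component_le:
  assumes V: "finite V"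
  shows "largest_component_size (edge x \<eta>) V \<le> k + card {v \<in> V. big k (comp V x \<eta> v)}"
proof (cases "V = {}")
  case True
  then show ?thesis by (simp add: largest_component_size_def)
next
  case False
  obtain v where v: "v \<in> V" and card: "card (comp V x \<eta> v) = largest_component_size (edge x \<eta>) V"
    unfolding comp_def using largest_component_size_attained[OF V False] by blast
  have fin: "finite (comp V x \<eta> v)" by (rule finite_subset[OF comp_subset[OF v] V])
  show ?thesis
  proof (cases "k \<le> card (comp V x \<eta> v)")
    case True
    have "comp V x \<eta> v \<subseteq> {v \<in> V. big k (comp V x \<eta> v)}"
    proof
      fix u assume u: "u \<in> comp V x \<eta> v"
      then have "comp V x \<eta> u = comp V x \<eta> v" unfolding comp_def by (rule component_eq[OF edge_sym])
      then show "u \<in> {v \<in> V. big k (comp V x \<eta> v)}" using u comp_subset[OF v] True fin by (auto simp: big_finite)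
    qed
    then have "card (comp V x \<eta> v) \<le> card {v \<in> V. big k (comp V x \<eta> v)}" using V by (intro card_mono) auto
    then show ?thesis using card by simp
  qed (use card in simp)
qed

end

section \<open>Lattice cells\<close>

definition shift :: "'a::euclidean_space \<Rightarrow> 'a set \<Rightarrow> 'a set" where
  "shift s D = {x. x - s \<in> D}"

lemma mem_shift [simp]: "x \<in> shift s D \<longleftrightarrow> x - s \<in> D"
  by (simp add: shift_def)

lemma shift_0 [simp]: "shift 0 D = D"
  by (simp add: shift_def)

lemma sets_shift [measurable]: "D \<in> sets borel \<Longrightarrow> shift s D \<in> sets borel"
proof -
  assume "D \<in> sets borel"
  moreover have "(\<lambda>x. x - s) \<in> borel_measurable borel" by simp
  ultimately have "(\<lambda>x. x - s) -` D \<inter> space borel \<in> sets borel" by (rule measurable_sets[rotated])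
  then show ?thesis by (simp add: shift_def vimage_def)
qed

lemma shift_eq_image: "shift s D = (\<lambda>x. s + x) ` D"
proof (intro set_eqI iffI)
  fix x assume "x \<in> shift s D"
  then show "x \<in> (\<lambda>x. s + x) ` D" by (intro image_eqI[of _ _ "x - s"]) auto
qed auto

lemma bounded_shift: "bounded D \<Longrightarrow> bounded (shift s D)"
  unfolding shift_eq_image by (rule bounded_translation)

lemma emeasure_shift: "D \<in> sets borel \<Longrightarrow> emeasure lborel (shift s D) = emeasure lborel D"
proof -
  assume D: "D \<in> sets borel"
  have "emeasure lborel D = emeasure (distr lborel borel (\<lambda>x. - s + x)) D"
    by (simp only: lborel_distr_plus)
  also have "\<dots> = emeasure lborel (shift s D)"
    using D by (subst emeasure_distr) (auto simp: shift_def vimage_def intro!: arg_cong[where f = "emeasure lborel"])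
  finally show ?thesis by simp
qed

lemma measure_shift: "D \<in> sets borel \<Longrightarrow> measure lborel (shift s D) = measure lborel D"
  by (simp add: measure_def emeasure_shift)

lemma (in poisson_process) poisson_process_shift: "poisson_process M (\<lambda>i \<omega>. X i \<omega> - s)"
proof (unfold_locales, unfold poisson_point_process_def, intro conjI allI ballI impI)
  have pin: "{i. X i \<omega> - s \<in> A} = points_in (pts \<omega>) (shift s A)" for A \<omega>
    by (simp add: points_in_def)
  show "(\<lambda>\<omega>. X i \<omega> - s) \<in> borel_measurable M" for i by measurable
  show "AE \<omega> in M. \<forall>r. finite {i. X i \<omega> - s \<in> cball 0 r}"
  proof -
    have "AE \<omega> in M. \<forall>n::nat. finite (points_in (pts \<omega>) (shift s (cball 0 (real n))))"
      by (subst AE_all_countable) (intro allI AE_finite_points_in bounded_shift bounded_cball)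
    then show ?thesis
    proof eventually_elim
      case (elim \<omega>)
      show ?case
      proof
        fix r :: real
        obtain n :: nat where "r \<le> real n" using real_arch_simple by blast
        then have "{i. X i \<omega> - s \<in> cball 0 r} \<subseteq> points_in (pts \<omega>) (shift s (cball 0 (real n)))" by auto
        then show "finite {i. X i \<omega> - s \<in> cball 0 r}" using elim finite_subset by blast
      qed
    qed
  qed
  show "prob {\<omega> \<in> space M. card {i. X i \<omega> - s \<in> A} = k} = measure lborel A ^ k / fact k * exp (- measure lborel A)"
    if "A \<in> sets borel" "emeasure lborel A < \<infinity>" for A k
  proof -
    have "\<forall>A\<in>sets borel. emeasure lborel A < \<infinity> \<longrightarrow> (\<forall>k. measure M {\<omega> \<in> space M. card {i. X i \<omega> \<in> A} = k}
             = measure lborel A ^ k / fact k * exp (- measure lborel A))"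
      using ppp unfolding poisson_point_process_def by (elim conjE)
    from this[rule_format, OF sets_shift[OF that(1), of s]] that show ?thesis
      by (simp add: emeasure_shift measure_shift)
  qed
  show "indep_vars (\<lambda>_. count_space UNIV) (\<lambda>l \<omega>. card {i. X i \<omega> - s \<in> A l}) {..<m}"
    if "\<forall>l<m. A l \<in> sets borel \<and> emeasure lborel (A l) < \<infinity>" "disjoint_family_on A {..<m}" for m :: nat and A
  proof -
    have "\<forall>l<m. shift s (A l) \<in> sets borel \<and> emeasure lborel (shift s (A l)) < \<infinity>"
      using that(1) by (simp add: emeasure_shift sets_shift)
    moreover have "disjoint_family_on (\<lambda>l. shift s (A l)) {..<m}"
      using that(2) unfolding disjoint_family_on_def by (fastforce simp: shift_def)
    ultimately have "indep_vars (\<lambda>_. count_space UNIV) (\<lambda>l \<omega>. card {i. X i \<omega> \<in> shift s (A l)}) {..<m}"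
      using ppp[unfolded poisson_point_process_def, THEN conjunct2, THEN conjunct2, THEN conjunct2, THEN spec, THEN spec, of m "\<lambda>l. shift s (A l)"]
      by (elim impE)
    then show ?thesis by (simp only: mem_shift)
  qed
qed

lemma prod_lessThan_add:
  fixes f :: "nat \<Rightarrow> 'b::comm_monoid_mult"
  shows "(\<Prod>l<m + n. f l) = (\<Prod>l<m. f l) * (\<Prod>l<n. f (m + l))"
  by (induction n) (simp_all add: mult.assoc)

text \<open>Families of disjoint sets in \<open>D\<close> and in \<open>D'\<close> are concatenated
  to one disjoint family, to which the independence of counts applies.\<close>

lemma (in poisson_process) uncorrelated_count_event:
  fixes m :: nat and k :: "nat \<Rightarrow> nat" and A :: "nat \<Rightarrow> 'a set"
  assumes A: "\<And>l. l < m \<Longrightarrow> A l \<in> sets borel" "\<And>l. l < m \<Longrightarrow> A l \<subseteq> D" and dA: "disjoint_family_on A {..<m}"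
    and bD: "bounded D" "bounded D'" and disj: "D \<inter> D' = {}"
  defines "E \<equiv> {\<omega> \<in> space M. \<forall>l<m. card (points_in (pts \<omega>) (A l)) = k l}"
  shows "uncorrelated (indicator E) D'" "E \<in> events" "emeasure M E = ennreal (\<Prod>l<m. pois (measure lborel (A l)) (k l))"
proof -
  have bA: "bounded (A l)" if "l < m" for l using bounded_subset[OF bD(1) A(2)[OF that]] .
  have ev: "{\<omega> \<in> space M. \<forall>l<n. card (points_in (pts \<omega>) (C l)) = j l} \<in> events" if C: "\<And>l. l < n \<Longrightarrow> C l \<in> sets borel" for C j and n :: nat
  proof -
    have "{\<omega> \<in> space M. card (points_in (pts \<omega>) (C l)) = j l} \<in> events" if "l \<in> {..<n}" for l
    proof -
      have [measurable]: "C l \<in> sets borel" using C that by simp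
      have "(\<lambda>\<omega>. card (points_in (pts \<omega>) (C l))) \<in> measurable M (count_space UNIV)"
        by (intro measurable_card_random_set) simp
      then show ?thesis by measurable
    qed
    then have "{\<omega> \<in> space M. \<forall>l\<in>{..<n}. card (points_in (pts \<omega>) (C l)) = j l} \<in> events"
      by (intro sets.sets_Collect_finite_All finite_lessThan)
    then show ?thesis by (simp only: Ball_def lessThan_iff)
  qed
  show E: "E \<in> events" unfolding E_def by (rule ev[OF A(1)])
  show PE: "emeasure M E = ennreal (\<Prod>l<m. pois (measure lborel (A l)) (k l))"
    unfolding emeasure_eq_measure E_def using prob_counts[OF A(1) bA dA, of k] by simp
  show "uncorrelated (indicator E) D'" unfolding uncorrelated_def
  proof (intro allI impI)
    fix n :: nat and C :: "nat \<Rightarrow> 'a set" and j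
    assume C: "\<forall>l<n. C l \<in> sets borel \<and> C l \<subseteq> D'" and dC: "disjoint_family_on C {..<n}"
    let ?G = "{\<omega> \<in> space M. \<forall>l<n. card (points_in (pts \<omega>) (C l)) = j l}"
    define H where "H = (\<lambda>l. if l < m then A l else C (l - m))"
    define i where "i = (\<lambda>l. if l < m then k l else j (l - m))"
    have G: "?G \<in> events" using C by (intro ev) auto
    have H: "H l \<in> sets borel" "bounded (H l)" if "l < m + n" for l
      using that A C bA bounded_subset[OF bD(2), of "C (l - m)"] by (auto simp: H_def)
    have dH: "disjoint_family_on H {..<m + n}"
      unfolding disjoint_family_on_def
    proof (intro ballI impI)
      fix a b assume ab: "a \<in> {..<m + n}" "b \<in> {..<m + n}" "a \<noteq> b"
      consider "a < m" "b < m" | "a < m" "m \<le> b" | "m \<le> a" "b < m" | "m \<le> a" "m \<le> b" by linarith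
      then show "H a \<inter> H b = {}"
      proof cases
        case 1
        then show ?thesis using dA ab by (auto simp: H_def disjoint_family_on_def)
      next
        case 2
        then have "H a \<subseteq> D" "H b \<subseteq> D'" using A(2) C ab by (auto simp: H_def)
        then show ?thesis using disj by blast
      next
        case 3
        then have "H b \<subseteq> D" "H a \<subseteq> D'" using A(2) C ab by (auto simp: H_def)
        then show ?thesis using disj by blast
      next
        case 4
        then have "a - m \<in> {..<n}" "b - m \<in> {..<n}" "a - m \<noteq> b - m" using ab by auto
        then have "C (a - m) \<inter> C (b - m) = {}" using dC unfolding disjoint_family_on_def by blast
        then show ?thesis using 4 by (simp add: H_def)
      qed
    qed
    have EG: "E \<inter> ?G = {\<omega> \<in> space M. \<forall>l<m + n. card (points_in (pts \<omega>) (H l)) = i l}"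
    proof -
      have "(\<forall>l<m + n. card (points_in (pts \<omega>) (H l)) = i l) \<longleftrightarrow>
        (\<forall>l<m. card (points_in (pts \<omega>) (A l)) = k l) \<and> (\<forall>l<n. card (points_in (pts \<omega>) (C l)) = j l)" for \<omega>
      proof safe
        fix l assume h: "\<forall>l<m + n. card (points_in (pts \<omega>) (H l)) = i l"
        show "card (points_in (pts \<omega>) (A l)) = k l" if "l < m" using h[rule_format, of l] that by (simp add: H_def i_def)
        show "card (points_in (pts \<omega>) (C l)) = j l" if "l < n" using h[rule_format, of "m + l"] that by (simp add: H_def i_def)
      qed (auto simp: H_def i_def)
      then show ?thesis unfolding E_def by blast
    qed
    have "(\<integral>\<^sup>+\<omega>. indicator E \<omega> * indicator ?G \<omega> \<partial>M) = emeasure M (E \<inter> ?G)"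
      by (simp only: indicator_inter_arith[symmetric] nn_integral_indicator[OF sets.Int[OF E G]])
    also have "\<dots> = ennreal (\<Prod>l<m + n. pois (measure lborel (H l)) (i l))"
      unfolding EG emeasure_eq_measure using prob_counts[OF H dH, of i] by simp
    also have "(\<Prod>l<m + n. pois (measure lborel (H l)) (i l)) = (\<Prod>l<m. pois (measure lborel (A l)) (k l)) * (\<Prod>l<n. pois (measure lborel (C l)) (j l))"
      unfolding prod_lessThan_add by (simp add: H_def i_def)
    also have "ennreal \<dots> = (\<integral>\<^sup>+\<omega>. indicator E \<omega> \<partial>M) * ennreal (\<Prod>l<n. pois (measure lborel (C l)) (j l))"
      using E PE by (simp add: ennreal_mult prod_nonneg)
    finally show "(\<integral>\<^sup>+\<omega>. indicator E \<omega> * indicator ?G \<omega> \<partial>M) = (\<integral>\<^sup>+\<omega>. indicator E \<omega> \<partial>M) * ennreal (\<Prod>l<n. pois (measure lborel (C l)) (j l))" .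
  qed
qed

section \<open>Independence over disjoint regions, translation invariance and lattice
  geometry\<close>

context random_graph_model
begin

lemma shifted_model: "random_graph_model M (\<lambda>i \<omega>. X i \<omega> - s) \<alpha> \<beta> p \<sigma> \<tau> \<mu>"
  by (intro random_graph_model.intro random_graph_model_axioms.intro poisson_process_shift \<alpha> \<beta> p \<sigma> \<tau> prob_space_\<mu> sets_\<mu> tail)

lemma comp_translate: "comp V (\<lambda>i. x i - s) \<eta> v = comp V x \<eta> v"
proof -
  have "edge (\<lambda>i. x i - s) \<eta> = edge x \<eta>"
    by (simp add: edge_def cp_def connection_prob_def fun_eq_iff)
  then show ?thesis by (simp add: comp_def)
qed

text \<open>Given the locations, the functionals use disjoint coordinates of \<open>\<eta>\<close>.
  For the locations the mixed binomial formula is used twice: with a count event in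
  \<open>D2\<close> as weight it shows that the average of \<open>F1\<close> is uncorrelated with
  counts in \<open>D2\<close>, and with this average as weight it splits off
  \<open>F2\<close>.\<close>

lemma graph_functionals_independent:
  assumes D: "D1 \<in> sets borel" "bounded D1" "0 < measure lborel D1" "D2 \<in> sets borel" "bounded D2" "0 < measure lborel D2"
    and disj: "D1 \<inter> D2 = {}" and inv: "relabel_invariant F1" "relabel_invariant F2"
    and F1: "\<And>m::nat. (\<lambda>z. F1 {..<m} (fst z) (snd z)) \<in> borel_measurable (PiM UNIV (\<lambda>_. borel) \<Otimes>\<^sub>M Q)"
    and F2: "\<And>m::nat. (\<lambda>z. F2 {..<m} (fst z) (snd z)) \<in> borel_measurable (PiM UNIV (\<lambda>_. borel) \<Otimes>\<^sub>M Q)"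
    and G1: "(\<lambda>z. F1 (gpts D1 z) (pts (fst z)) (snd z)) \<in> borel_measurable MQ"
    and G2: "(\<lambda>z. F2 (gpts D2 z) (pts (fst z)) (snd z)) \<in> borel_measurable MQ"
    and fin: "(\<integral>\<^sup>+z. F1 (gpts D1 z) (pts (fst z)) (snd z) \<partial>MQ) \<noteq> \<infinity>"
  shows "(\<integral>\<^sup>+z. F1 (gpts D1 z) (pts (fst z)) (snd z) * F2 (gpts D2 z) (pts (fst z)) (snd z) \<partial>MQ) =
    (\<integral>\<^sup>+z. F1 (gpts D1 z) (pts (fst z)) (snd z) \<partial>MQ) * (\<integral>\<^sup>+z. F2 (gpts D2 z) (pts (fst z)) (snd z) \<partial>MQ)"
proof -
  interpret Q: prob_space Q by (rule prob_space_Q)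
  let ?g1 = "\<lambda>\<omega>. \<integral>\<^sup>+\<eta>. F1 (points_in (pts \<omega>) D1) (pts \<omega>) \<eta> \<partial>Q"
  let ?g2 = "\<lambda>\<omega>. \<integral>\<^sup>+\<eta>. F2 (points_in (pts \<omega>) D2) (pts \<omega>) \<eta> \<partial>Q"
  have loc: "F V x \<eta> = F V x \<eta>'" if "relabel_invariant F" "finite V" "\<And>s. s \<noteq> {} \<Longrightarrow> s \<subseteq> V \<Longrightarrow> \<eta> s = \<eta>' s"
    for F :: "nat set \<Rightarrow> (nat \<Rightarrow> 'a) \<Rightarrow> (nat set \<Rightarrow> real \<times> real) \<Rightarrow> ennreal" and V x \<eta> \<eta>'
    by (rule that(1)[unfolded relabel_invariant_def, THEN conjunct1, rule_format]) (use that in auto)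
  have G1': "?g1 \<in> borel_measurable M" using Q.borel_measurable_nn_integral_fst[OF G1] by simp
  have I1: "(\<integral>\<^sup>+z. F1 (gpts D1 z) (pts (fst z)) (snd z) \<partial>MQ) = (\<integral>\<^sup>+\<omega>. ?g1 \<omega> \<partial>M)"
    by (subst Q.nn_integral_fst[OF G1, symmetric]) simp
  have I2: "(\<integral>\<^sup>+z. F2 (gpts D2 z) (pts (fst z)) (snd z) \<partial>MQ) = (\<integral>\<^sup>+\<omega>. ?g2 \<omega> \<partial>M)"
    by (subst Q.nn_integral_fst[OF G2, symmetric]) simp
  have "(\<integral>\<^sup>+z. F1 (gpts D1 z) (pts (fst z)) (snd z) * F2 (gpts D2 z) (pts (fst z)) (snd z) \<partial>MQ) =
    (\<integral>\<^sup>+\<omega>. \<integral>\<^sup>+\<eta>. F1 (points_in (pts \<omega>) D1) (pts \<omega>) \<eta> * F2 (points_in (pts \<omega>) D2) (pts \<omega>) \<eta> \<partial>Q \<partial>M)"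
    by (subst Q.nn_integral_fst[OF borel_measurable_times_ennreal[OF G1 G2], symmetric]) simp
  also have "\<dots> = (\<integral>\<^sup>+\<omega>. ?g1 \<omega> * ?g2 \<omega> \<partial>M)"
  proof (rule nn_integral_cong_AE)
    show "AE \<omega> in M. (\<integral>\<^sup>+\<eta>. F1 (points_in (pts \<omega>) D1) (pts \<omega>) \<eta> * F2 (points_in (pts \<omega>) D2) (pts \<omega>) \<eta> \<partial>Q) = ?g1 \<omega> * ?g2 \<omega>"
      using AE_finite_points_in[OF D(2)] AE_finite_points_in[OF D(5)] AE_space
    proof eventually_elim
      case (elim \<omega>)
      let ?V1 = "points_in (pts \<omega>) D1" and ?V2 = "points_in (pts \<omega>) D2"
      have V: "?V1 \<inter> ?V2 = {}" using disj by auto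
      have m1: "(\<lambda>\<eta>. F1 ?V1 (pts \<omega>) \<eta>) \<in> borel_measurable Q" "(\<lambda>\<eta>. F2 ?V2 (pts \<omega>) \<eta>) \<in> borel_measurable Q"
        using measurable_compose[OF measurable_Pair1'[OF elim(3)] G1] measurable_compose[OF measurable_Pair1'[OF elim(3)] G2] by simp_all
      \<comment> \<open>The empty set is the only common subset of the two vertex sets; its
        coordinate is excluded by \<open>relabel_invariant\<close>.\<close>
      show ?case unfolding Q_def
      proof (rule nn_integral_PiM_indep[OF prob_space_N, where S = "{s. s \<noteq> {} \<and> s \<subseteq> ?V1}"])
        show "F1 ?V1 (pts \<omega>) \<eta> = F1 ?V1 (pts \<omega>) \<eta>'" if "\<And>s. s \<in> {s. s \<noteq> {} \<and> s \<subseteq> ?V1} \<Longrightarrow> \<eta> s = \<eta>' s" for \<eta> \<eta>'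
          using that by (intro loc[OF inv(1) elim(1)]) auto
        show "F2 ?V2 (pts \<omega>) \<eta> = F2 ?V2 (pts \<omega>) \<eta>'" if h: "\<And>s. s \<notin> {s. s \<noteq> {} \<and> s \<subseteq> ?V1} \<Longrightarrow> \<eta> s = \<eta>' s" for \<eta> \<eta>'
        proof (rule loc[OF inv(2) elim(2)])
          fix s assume s: "s \<noteq> {}" "s \<subseteq> ?V2"
          then have "\<not> s \<subseteq> ?V1" using V by blast
          then show "\<eta> s = \<eta>' s" by (intro h) simp
        qed
      qed (use m1 in \<open>simp_all add: Q_def\<close>)
    qed
  qed
  also have "\<dots> = (\<integral>\<^sup>+\<omega>. ?g1 \<omega> \<partial>M) * (\<integral>\<^sup>+\<omega>. ?g2 \<omega> \<partial>M)"
  proof -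
    \<comment> \<open>First use of the mixed binomial formula, over \<open>D1\<close>, with the
      indicator of the count event in \<open>D2\<close> as weight.\<close>
    have unc: "uncorrelated ?g1 D2" unfolding uncorrelated_def
    proof (intro allI impI)
      fix n :: nat and C :: "nat \<Rightarrow> 'a set" and j
      assume C: "\<forall>l<n. C l \<in> sets borel \<and> C l \<subseteq> D2" and dC: "disjoint_family_on C {..<n}"
      let ?E = "{\<omega> \<in> space M. \<forall>l<n. card (points_in (pts \<omega>) (C l)) = j l}"
      have hC: "\<And>l. l < n \<Longrightarrow> C l \<in> sets borel" "\<And>l. l < n \<Longrightarrow> C l \<subseteq> D2" using C by blast+
      have "D2 \<inter> D1 = {}" using disj by blast
      note uc = uncorrelated_count_event[OF hC dC D(5,2) this]
      have u: "uncorrelated (indicator ?E) D1" by (rule uc(1))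
      have E: "?E \<in> events" by (rule uc(2))
      have PE: "emeasure M ?E = ennreal (\<Prod>l<n. pois (measure lborel (C l)) (j l))" by (rule uc(3))
      have iE: "(\<integral>\<^sup>+\<omega>. indicator ?E \<omega> \<partial>M) = ennreal (\<Prod>l<n. pois (measure lborel (C l)) (j l))"
        using E PE by (simp only: nn_integral_indicator)
      have "(\<integral>\<^sup>+\<omega>. indicator ?E \<omega> * ?g1 \<omega> \<partial>M) = (\<integral>\<^sup>+\<omega>. indicator ?E \<omega> \<partial>M) *
        (\<Sum>m. ennreal (pois (measure lborel D1) m) * (\<integral>\<^sup>+y. \<integral>\<^sup>+\<eta>. F1 {..<m} y \<eta> \<partial>Q \<partial>PiM UNIV (\<lambda>_. uniform_measure lborel D1)))"
        unfolding Q_def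
      proof (rule nn_integral_mixed_binomial[OF D(1-3) borel_measurable_indicator[OF E] _ u prob_space_N inv(1)])
        show "(\<integral>\<^sup>+\<omega>. indicator ?E \<omega> \<partial>M) \<noteq> \<infinity>" unfolding iE by simp
      qed (use F1 in \<open>simp add: Q_def\<close>)
      also have "(\<Sum>m. ennreal (pois (measure lborel D1) m) * (\<integral>\<^sup>+y. \<integral>\<^sup>+\<eta>. F1 {..<m} y \<eta> \<partial>Q \<partial>PiM UNIV (\<lambda>_. uniform_measure lborel D1))) = (\<integral>\<^sup>+\<omega>. ?g1 \<omega> \<partial>M)"
        by (rule nn_integral_binomial[OF D(1-3) inv(1) F1, symmetric])
      finally show "(\<integral>\<^sup>+\<omega>. ?g1 \<omega> * indicator ?E \<omega> \<partial>M) = (\<integral>\<^sup>+\<omega>. ?g1 \<omega> \<partial>M) * ennreal (\<Prod>l<n. pois (measure lborel (C l)) (j l))"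
        unfolding iE by (simp only: mult.commute)
    qed
    have "(\<integral>\<^sup>+\<omega>. ?g1 \<omega> * ?g2 \<omega> \<partial>M) = (\<integral>\<^sup>+\<omega>. ?g1 \<omega> \<partial>M) *
        (\<Sum>m. ennreal (pois (measure lborel D2) m) * (\<integral>\<^sup>+y. \<integral>\<^sup>+\<eta>. F2 {..<m} y \<eta> \<partial>Q \<partial>PiM UNIV (\<lambda>_. uniform_measure lborel D2)))"
      by (rule nn_integral_mixed_binomial[OF D(4-6) _ _ _ prob_space_N inv(2), folded Q_def, OF G1' fin[unfolded I1] unc F2])
    also have "(\<Sum>m. ennreal (pois (measure lborel D2) m) * (\<integral>\<^sup>+y. \<integral>\<^sup>+\<eta>. F2 {..<m} y \<eta> \<partial>Q \<partial>PiM UNIV (\<lambda>_. uniform_measure lborel D2))) = (\<integral>\<^sup>+\<omega>. ?g2 \<omega> \<partial>M)"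
      by (rule nn_integral_binomial[OF D(4-6) inv(2) F2, symmetric])
    finally show ?thesis .
  qed
  finally show ?thesis unfolding I1 I2 .
qed

definition count_big :: "nat \<Rightarrow> 'a set \<Rightarrow> 'a set \<Rightarrow> 'w \<times> (nat set \<Rightarrow> real \<times> real) \<Rightarrow> ennreal" where
  "count_big k C D z = ncard {v \<in> gpts D z. pts (fst z) v \<in> C \<and> big k (gcomp D z v)}"

lemma measurable_count_big:
  assumes "C \<in> sets borel" "D \<in> sets borel"
  shows "count_big k C D \<in> borel_measurable MQ"
proof -
  have "Measurable.pred MQ (\<lambda>z. pts (fst z) v \<in> C)" for v
    using pred_points_pair[OF assms(1), of v] by simp
  then have "Measurable.pred MQ (\<lambda>z. v \<in> {v \<in> gpts D z. pts (fst z) v \<in> C \<and> big k (gcomp D z v)})" for v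
    unfolding mem_Collect_eq by (intro pred_intros_logic(3) pred_points_pair measurable_big pred_gcomp assms)
  then show ?thesis unfolding count_big_def[abs_def] by (rule measurable_ncard)
qed

lemma measurable_big_model:
  assumes C: "C \<in> sets borel"
  shows "(\<lambda>z. ncard {v \<in> {..<m::nat}. fst z v \<in> C \<and> big k (comp {..<m} (fst z) (snd z) v)}) \<in> borel_measurable (PiM UNIV (\<lambda>_. borel) \<Otimes>\<^sub>M Q)"
proof (rule measurable_ncard)
  fix v :: nat
  have "Measurable.pred (PiM UNIV (\<lambda>_. borel) \<Otimes>\<^sub>M Q) (\<lambda>z. fst z v \<in> C)"
    by (rule measurable_compose[OF measurable_pair_fst_app]) (use C in measurable)
  moreover have "Measurable.pred (PiM UNIV (\<lambda>_. borel :: 'a measure) \<Otimes>\<^sub>M Q) (\<lambda>z. big k (comp {..<m} (fst z) (snd z) v))"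
    by (intro measurable_big pred_comp measurable_pair_fst_app measurable_snd) simp
  ultimately show "Measurable.pred (PiM UNIV (\<lambda>_. borel) \<Otimes>\<^sub>M Q) (\<lambda>z. v \<in> {v \<in> {..<m}. fst z v \<in> C \<and> big k (comp {..<m} (fst z) (snd z) v)})"
    by simp
qed

text \<open>Both sides have the same mixed binomial series, once for the given process and once for
  the shifted one; the connection probabilities depend on differences of locations only.\<close>

lemma nn_integral_count_big_shift:
  assumes D: "D \<in> sets borel" "bounded D" "0 < measure lborel D" and C: "C \<in> sets borel"
  shows "(\<integral>\<^sup>+z. count_big k (shift s C) (shift s D) z \<partial>MQ) = (\<integral>\<^sup>+z. count_big k C D z \<partial>MQ)"
proof -
  interpret Q: prob_space Q by (rule prob_space_Q)
  interpret S: random_graph_model M "\<lambda>i \<omega>. X i \<omega> - s" \<alpha> \<beta> p \<sigma> \<tau> \<mu> by (rule shifted_model)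
  let ?F = "\<lambda>V x \<eta>. ncard {v \<in> V. x v \<in> C \<and> big k (comp V x \<eta> v)}"
  have "(\<integral>\<^sup>+z. count_big k (shift s C) (shift s D) z \<partial>MQ) = (\<integral>\<^sup>+\<omega>. \<integral>\<^sup>+\<eta>. count_big k (shift s C) (shift s D) (\<omega>, \<eta>) \<partial>Q \<partial>M)"
    by (rule Q.nn_integral_fst[symmetric]) (intro measurable_count_big sets_shift C D)
  also have "\<dots> = (\<integral>\<^sup>+\<omega>. \<integral>\<^sup>+\<eta>. ?F (points_in (\<lambda>i. X i \<omega> - s) D) (\<lambda>i. X i \<omega> - s) \<eta> \<partial>Q \<partial>M)"
    by (simp add: count_big_def gcomp_def comp_translate points_in_def)
  also have "\<dots> = (\<Sum>m. ennreal (pois (measure lborel D) m) *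
      (\<integral>\<^sup>+y. \<integral>\<^sup>+\<eta>. ?F {..<m} y \<eta> \<partial>Q \<partial>PiM UNIV (\<lambda>_. uniform_measure lborel D)))"
    by (rule S.nn_integral_binomial[OF D relabel_invariant_big measurable_big_model[OF C]])
  also have "\<dots> = (\<integral>\<^sup>+\<omega>. \<integral>\<^sup>+\<eta>. ?F (points_in (pts \<omega>) D) (pts \<omega>) \<eta> \<partial>Q \<partial>M)"
    by (rule nn_integral_binomial[OF D relabel_invariant_big measurable_big_model[OF C], symmetric])
  also have "\<dots> = (\<integral>\<^sup>+\<omega>. \<integral>\<^sup>+\<eta>. count_big k C D (\<omega>, \<eta>) \<partial>Q \<partial>M)"
    by (simp add: count_big_def gcomp_def)
  also have "\<dots> = (\<integral>\<^sup>+z. count_big k C D z \<partial>MQ)"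
    by (rule Q.nn_integral_fst) (intro measurable_count_big C D)
  finally show ?thesis .
qed

text \<open>Half-open, so that the lattice translates partition the space. The thick cell below adds
  a margin \<open>L\<close>, in which components of vertices of the unit cell are approximated
  locally.\<close>

definition unit_cell :: "'a set" where "unit_cell = {x. \<forall>b\<in>Basis. 0 \<le> x \<bullet> b \<and> x \<bullet> b < 1}"
definition thick_cell :: "nat \<Rightarrow> 'a set" where "thick_cell L = {x. \<forall>b\<in>Basis. - real L \<le> x \<bullet> b \<and> x \<bullet> b < 1 + real L}"

lemma sets_cells [simp]: "unit_cell \<in> sets borel" "thick_cell L \<in> sets borel"
proof -
  have "unit_cell = {x \<in> space borel. \<forall>b\<in>Basis. 0 \<le> x \<bullet> b \<and> x \<bullet> b < 1}" by (simp add: unit_cell_def)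
  also have "\<dots> \<in> sets borel" by measurable
  finally show "unit_cell \<in> sets borel" .
  have "thick_cell L = {x \<in> space borel. \<forall>b\<in>Basis. - real L \<le> x \<bullet> b \<and> x \<bullet> b < 1 + real L}" by (simp add: thick_cell_def)
  also have "\<dots> \<in> sets borel" by measurable
  finally show "thick_cell L \<in> sets borel" .
qed

lemma unit_cell_thick: "unit_cell \<subseteq> thick_cell L" by (force simp: unit_cell_def thick_cell_def)

lemma bounded_thick_cell [simp]: "bounded (thick_cell L)"
  by (rule bounded_subset[OF bounded_cube[of "1 + real L"]]) (force simp: thick_cell_def mem_cube abs_le_iff)

lemma bounded_unit_cell [simp]: "bounded unit_cell"
  by (rule bounded_subset[OF bounded_thick_cell[of 0] unit_cell_thick])

lemma emeasure_unit_cell: "emeasure lborel unit_cell = 1" and measure_unit_cell: "measure lborel unit_cell = 1"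
proof -
  have "box 0 One \<subseteq> unit_cell" "unit_cell \<subseteq> cbox 0 One" by (auto simp: unit_cell_def mem_box less_imp_le)
  then have "emeasure lborel (box 0 One :: 'a set) \<le> emeasure lborel unit_cell" "emeasure lborel unit_cell \<le> emeasure lborel (cbox 0 One :: 'a set)"
    by (intro emeasure_mono; simp)+
  then show "emeasure lborel unit_cell = 1" by (auto simp: emeasure_lborel_box_eq emeasure_lborel_cbox_eq intro: antisym)
  then show "measure lborel unit_cell = 1" by (simp add: measure_def)
qed

lemma measure_thick_cell: "0 < measure lborel (thick_cell L)"
proof -
  have "emeasure lborel unit_cell \<le> emeasure lborel (thick_cell L)" by (intro emeasure_mono unit_cell_thick) simp
  then have "0 < emeasure lborel (thick_cell L)" by (simp add: emeasure_unit_cell less_le_trans[OF zero_less_one])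
  moreover have "emeasure lborel (thick_cell L) < \<infinity>" by (rule emeasure_bounded_finite) simp
  ultimately show ?thesis by (simp add: measure_def enn2real_positive_iff)
qed

definition Lat :: "int \<Rightarrow> 'a set" where
  "Lat r = (\<lambda>f. \<Sum>b\<in>Basis. of_int (f b) *\<^sub>R b) ` (Basis \<rightarrow>\<^sub>E {-r..<r})"

lemma Lat_iff: "z \<in> Lat r \<longleftrightarrow> (\<forall>b\<in>Basis. \<exists>k\<in>{-r..<r}. z \<bullet> b = of_int k)"
proof
  assume "z \<in> Lat r"
  then obtain f where f: "f \<in> Basis \<rightarrow>\<^sub>E {-r..<r}" "z = (\<Sum>b\<in>Basis. of_int (f b) *\<^sub>R b)" by (auto simp: Lat_def)
  then show "\<forall>b\<in>Basis. \<exists>k\<in>{-r..<r}. z \<bullet> b = of_int k" by (auto simp: PiE_iff Pi_iff intro!: bexI[of _ "f _"])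
next
  assume "\<forall>b\<in>Basis. \<exists>k\<in>{-r..<r}. z \<bullet> b = of_int k"
  then obtain k where k: "\<And>b. b \<in> Basis \<Longrightarrow> k b \<in> {-r..<r} \<and> z \<bullet> b = of_int (k b)" by metis
  define f where "f = restrict k Basis"
  have "f \<in> Basis \<rightarrow>\<^sub>E {-r..<r}" using k by (auto simp: f_def)
  moreover have "z = (\<Sum>b\<in>Basis. of_int (f b) *\<^sub>R b)"
    using k by (subst euclidean_representation[symmetric]) (auto simp: f_def intro!: sum.cong)
  ultimately show "z \<in> Lat r" unfolding Lat_def by blast
qed

lemma finite_Lat: "finite (Lat r)"
  unfolding Lat_def by (intro finite_imageI finite_PiE) auto

lemma card_Lat: "0 \<le> r \<Longrightarrow> real (card (Lat r)) = (2 * real_of_int r) ^ DIM('a)"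
proof -
  assume r: "0 \<le> r"
  let ?g = "\<lambda>f :: 'a \<Rightarrow> int. \<Sum>b\<in>Basis. of_int (f b) *\<^sub>R b :: 'a"
  have "inj_on ?g (Basis \<rightarrow>\<^sub>E {-r..<r})"
  proof (rule inj_onI)
    fix f g assume fg: "f \<in> Basis \<rightarrow>\<^sub>E {-r..<r}" "g \<in> Basis \<rightarrow>\<^sub>E {-r..<r}" "?g f = ?g g"
    have "f b = g b" if "b \<in> Basis" for b
      using arg_cong[OF fg(3), of "\<lambda>z. z \<bullet> b"] that by simp
    then show "f = g" using fg by (intro PiE_ext) auto
  qed
  then have "card (Lat r) = card ((Basis :: 'a set) \<rightarrow>\<^sub>E {-r..<r})" unfolding Lat_def by (rule card_image)
  also have "\<dots> = nat (2 * r) ^ DIM('a)" by (simp add: card_PiE)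
  finally show ?thesis using r by simp
qed

lemma shift_unit_cell_disjoint:
  assumes "s \<in> Lat r" "t \<in> Lat r'" "x \<in> shift s unit_cell" "x \<in> shift t unit_cell"
  shows "s = t"
proof (rule euclidean_eqI)
  fix b :: 'a assume b: "b \<in> Basis"
  obtain k l where kl: "s \<bullet> b = of_int k" "t \<bullet> b = of_int l" using assms b by (force simp: Lat_iff)
  have "of_int k \<le> x \<bullet> b" "x \<bullet> b < of_int k + 1" "of_int l \<le> x \<bullet> b" "x \<bullet> b < of_int l + 1"
    using assms(3,4) b kl by (auto simp: unit_cell_def inner_simps)
  then have "k = \<lfloor>x \<bullet> b\<rfloor>" "l = \<lfloor>x \<bullet> b\<rfloor>" by (auto intro!: floor_unique[symmetric])
  then show "s \<bullet> b = t \<bullet> b" using kl by simp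
qed

lemma cube_covered: "h < of_int r \<Longrightarrow> x \<in> cube h \<Longrightarrow> \<exists>s\<in>Lat r. x \<in> shift s unit_cell"
proof -
  assume h: "h < of_int r" and x: "x \<in> cube h"
  define s :: 'a where "s = (\<Sum>b\<in>Basis. of_int \<lfloor>x \<bullet> b\<rfloor> *\<^sub>R b)"
  have sb: "s \<bullet> b = of_int \<lfloor>x \<bullet> b\<rfloor>" if "b \<in> Basis" for b using that by (simp add: s_def)
  have "\<lfloor>x \<bullet> b\<rfloor> \<in> {-r..<r}" if "b \<in> Basis" for b
  proof -
    have "\<bar>x \<bullet> b\<bar> < of_int r" using x h that by (force simp: mem_cube)
    then show ?thesis by (simp add: le_floor_iff floor_less_iff abs_less_iff)
  qed
  then have "s \<in> Lat r" using sb by (auto simp: Lat_iff)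
  moreover have "x \<in> shift s unit_cell"
  proof -
    have "0 \<le> x \<bullet> b - of_int \<lfloor>x \<bullet> b\<rfloor> \<and> x \<bullet> b - of_int \<lfloor>x \<bullet> b\<rfloor> < 1" for b by linarith
    then show ?thesis by (simp add: unit_cell_def inner_simps sb)
  qed
  ultimately show ?thesis by blast
qed

lemma thick_cell_in_cube:
  assumes "s \<in> Lat r" "of_int r + real L \<le> h"
  shows "shift s (thick_cell L) \<subseteq> cube h"
proof
  fix x assume x: "x \<in> shift s (thick_cell L)"
  have "\<bar>x \<bullet> b\<bar> \<le> h" if b: "b \<in> Basis" for b
  proof -
    obtain k where k: "s \<bullet> b = of_int k" "- r \<le> k" "k < r" using assms(1) b by (force simp: Lat_iff)
    have "- real L \<le> x \<bullet> b - of_int k" "x \<bullet> b - of_int k < 1 + real L"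
      using x b k by (auto simp: thick_cell_def inner_simps)
    moreover have "- real_of_int r \<le> of_int k" "real_of_int k + 1 \<le> of_int r" using k by linarith+
    ultimately show ?thesis using assms(2) by linarith
  qed
  then show "x \<in> cube h" by (simp add: mem_cube)
qed

text \<open>This bounds the range of dependence: all but a number of cells depending only on
  \<open>L\<close> have thick cells disjoint from that of a given one.\<close>

lemma thick_cells_meet:
  assumes "s \<in> Lat r" "t \<in> Lat r" "shift s (thick_cell L) \<inter> shift t (thick_cell L) \<noteq> {}"
  shows "t - s \<in> Lat (2 * int L + 2)"
  unfolding Lat_iff
proof
  fix b :: 'a assume b: "b \<in> Basis"
  obtain x where x: "x \<in> shift s (thick_cell L)" "x \<in> shift t (thick_cell L)" using assms(3) by blast
  obtain k l where kl: "s \<bullet> b = of_int k" "t \<bullet> b = of_int l" using assms b by (force simp: Lat_iff)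
  have "- real L \<le> x \<bullet> b - of_int k" "x \<bullet> b - of_int k < 1 + real L" "- real L \<le> x \<bullet> b - of_int l" "x \<bullet> b - of_int l < 1 + real L"
    using x b kl by (auto simp: thick_cell_def inner_simps)
  then have "\<bar>real_of_int (l - k)\<bar> < 1 + 2 * real L" by (simp add: abs_less_iff)
  then have "\<bar>l - k\<bar> < 1 + 2 * int L" by linarith
  then show "\<exists>j\<in>{- (2 * int L + 2)..<2 * int L + 2}. (t - s) \<bullet> b = of_int j"
    using kl by (intro bexI[of _ "l - k"]) (auto simp: inner_simps)
qed

end

section \<open>Concentration of the number of vertices in large components\<close>

lemma (in prob_space) prob_ge_le:
  assumes u: "u \<in> borel_measurable M" "(\<integral>\<^sup>+x. u x \<partial>M) \<le> ennreal (c * e)" and c: "0 < c" "0 \<le> e"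
  shows "prob {x \<in> space M. ennreal c \<le> u x} \<le> e"
proof -
  let ?A = "{x \<in> space M. ennreal c \<le> u x}"
  have A: "?A \<in> events" using u(1) by measurable
  have "ennreal c * emeasure M ?A = (\<integral>\<^sup>+x. ennreal c * indicator ?A x \<partial>M)"
    by (rule nn_integral_cmult_indicator[OF A, symmetric])
  also have "\<dots> \<le> (\<integral>\<^sup>+x. u x \<partial>M)" by (intro nn_integral_mono) (auto simp: indicator_def)
  also have "\<dots> \<le> ennreal c * ennreal e" using u(2) c by (simp add: ennreal_mult)
  finally have "emeasure M ?A \<le> ennreal e" using c by (subst (asm) ennreal_mult_le_mult_iff) auto
  then show ?thesis using c by (simp add: emeasure_eq_measure)
qed

lemma (in prob_space) integrable_enn2real:
  assumes S: "S \<in> borel_measurable M" "(\<integral>\<^sup>+x. S x \<partial>M) = ennreal e" "0 \<le> e"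
  shows "integrable M (\<lambda>x. enn2real (S x))" "expectation (\<lambda>x. enn2real (S x)) = e"
    "AE x in M. S x \<noteq> \<infinity>"
proof -
  show fin: "AE x in M. S x \<noteq> \<infinity>" using S by (intro nn_integral_PInf_AE) auto
  have m: "(\<lambda>x. enn2real (S x)) \<in> borel_measurable M" using S(1) by measurable
  have eq: "(\<integral>\<^sup>+x. ennreal (enn2real (S x)) \<partial>M) = ennreal e"
    unfolding S(2)[symmetric] using fin by (intro nn_integral_cong_AE) (auto simp: less_top[symmetric])
  show "integrable M (\<lambda>x. enn2real (S x))" by (rule integrableI_nn_integral_finite[OF m _ eq]) simp
  show "expectation (\<lambda>x. enn2real (S x)) = e"
    using integral_eq_nn_integral[OF m] S(3) by (simp add: eq)
qed

lemma (in prob_space) Chebyshev_enn2real: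
  assumes S: "S \<in> borel_measurable M" "(\<integral>\<^sup>+x. S x \<partial>M) = ennreal e" "0 \<le> e"
    and SS: "(\<integral>\<^sup>+x. S x * S x \<partial>M) \<le> ennreal (e\<^sup>2 + w)" and w: "0 \<le> w" "0 < t"
  shows "prob {x \<in> space M. enn2real (S x) \<le> e - t} \<le> w / t\<^sup>2"
proof -
  let ?f = "\<lambda>x. enn2real (S x)"
  note f = integrable_enn2real[OF S]
  have m: "?f \<in> borel_measurable M" using S(1) by measurable
  have sq: "(\<integral>\<^sup>+x. ennreal ((?f x)\<^sup>2) \<partial>M) \<le> ennreal (e\<^sup>2 + w)"
  proof -
    have "(\<integral>\<^sup>+x. ennreal ((?f x)\<^sup>2) \<partial>M) = (\<integral>\<^sup>+x. S x * S x \<partial>M)"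
      using f(3) by (intro nn_integral_cong_AE) (auto simp: less_top[symmetric] power2_eq_square ennreal_mult)
    then show ?thesis using SS by simp
  qed
  have int: "integrable M (\<lambda>x. (?f x)\<^sup>2)"
  proof (rule integrableI_bounded)
    show "(\<lambda>x. (?f x)\<^sup>2) \<in> borel_measurable M" using m by measurable
    show "(\<integral>\<^sup>+x. ennreal (norm ((?f x)\<^sup>2)) \<partial>M) < \<infinity>" using sq by (simp add: le_less_trans[OF _ ennreal_less_top])
  qed
  have "expectation (\<lambda>x. (?f x)\<^sup>2) = enn2real (\<integral>\<^sup>+x. ennreal ((?f x)\<^sup>2) \<partial>M)"
    using m by (intro integral_eq_nn_integral) auto
  also have "\<dots> \<le> enn2real (ennreal (e\<^sup>2 + w))" by (rule enn2real_mono[OF sq]) simp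
  finally have "expectation (\<lambda>x. (?f x)\<^sup>2) \<le> e\<^sup>2 + w"
    by (simp only: enn2real_ennreal[OF add_nonneg_nonneg[OF zero_le_power2 w(1)]])
  then have var: "variance ?f \<le> w" by (subst variance_eq[OF f(1) int]) (simp add: f(2))
  have "prob {x \<in> space M. ?f x \<le> e - t} \<le> prob {x \<in> space M. t \<le> \<bar>?f x - expectation ?f\<bar>}"
  proof (rule finite_measure_mono)
    show "{x \<in> space M. t \<le> \<bar>?f x - expectation ?f\<bar>} \<in> events" using m by measurable
  qed (use f(2) in auto)
  also have "\<dots> \<le> variance ?f / t\<^sup>2" by (rule Chebyshev_inequality[OF m int w(2)])
  also have "\<dots> \<le> w / t\<^sup>2" using var by (intro divide_right_mono) auto
  finally show ?thesis .
qed

text \<open>If the mean is hardly larger than \<open>c\<close> and values much below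
  \<open>c\<close> are unlikely, then values much above \<open>c\<close> are unlikely too, since
  nothing could compensate them. This replaces a second moment for the upper tail.\<close>

lemma (in prob_space) prob_above_le:
  assumes f: "integrable M f" "\<And>x. 0 \<le> f x" "expectation f \<le> e" and c: "0 \<le> c" "0 \<le> y" "0 < t"
    and low: "prob {x \<in> space M. f x \<le> c - y} \<le> \<zeta>"
  shows "t * prob {x \<in> space M. c + t \<le> f x} \<le> e + y - c * (1 - \<zeta>)"
proof -
  let ?A = "{x \<in> space M. f x \<le> c - y}" and ?B = "{x \<in> space M. c + t \<le> f x}"
  have m: "f \<in> borel_measurable M" using f(1) by simp
  have A: "?A \<in> events" and B: "?B \<in> events" using m by measurable
  have iA: "integrable M (indicator (space M - ?A) :: _ \<Rightarrow> real)"
    by (rule integrable_real_indicator[OF sets.compl_sets[OF A]]) (simp add: emeasure_eq_measure)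
  have iB: "integrable M (indicator ?B :: _ \<Rightarrow> real)"
    by (rule integrable_real_indicator[OF B]) (simp add: emeasure_eq_measure)
  \<comment> \<open>The integrated form of a pointwise bound: off \<open>?A\<close> the value plus
    \<open>y\<close> exceeds \<open>c\<close>, and on \<open>?B\<close> it is at least
    \<open>c + t\<close>.\<close>
  have "c * (1 - prob ?A) + t * prob ?B = expectation (\<lambda>x. c * indicator (space M - ?A) x) + expectation (\<lambda>x. t * indicator ?B x)"
    using prob_compl[OF A] sets.Int_space_eq2[OF B] sets.Int_space_eq2[OF sets.compl_sets[OF A]] by simp
  also have "\<dots> = expectation (\<lambda>x. c * indicator (space M - ?A) x + t * indicator ?B x)"
    by (intro Bochner_Integration.integral_add[symmetric] integrable_mult_right iA iB)
  also have "\<dots> \<le> expectation (\<lambda>x. f x + y)"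
  proof (rule integral_mono)
    show "integrable M (\<lambda>x. c * indicator (space M - ?A) x + t * indicator ?B x)" by (intro Bochner_Integration.integrable_add integrable_mult_right iA iB)
    show "integrable M (\<lambda>x. f x + y)" using f(1) by simp
    fix x assume "x \<in> space M"
    then show "c * indicator (space M - ?A) x + t * indicator ?B x \<le> f x + y"
      using f(2)[of x] c by (auto simp: indicator_def)
  qed
  also have "\<dots> = expectation f + y" using f(1) by (simp add: prob_space)
  finally have "c * (1 - prob ?A) + t * prob ?B \<le> e + y" using f(3) by simp
  moreover have "c * (1 - \<zeta>) \<le> c * (1 - prob ?A)" using low c by (intro mult_left_mono) auto
  ultimately show ?thesis by simp
qed

lemma ncard_emeasure: "ncard D = emeasure (count_space UNIV) D"
  unfolding ncard_eq_nn_integral by simp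

lemma ncard_SUP: "incseq A \<Longrightarrow> (SUP n. ncard (A n)) = ncard (\<Union>n. A n)"
  unfolding ncard_emeasure by (rule SUP_emeasure_incseq) auto

lemma ncard_INF: "decseq A \<Longrightarrow> finite (A 0) \<Longrightarrow> (INF n. ncard (A n)) = ncard (\<Inter>n. A n)"
  unfolding ncard_emeasure by (rule INF_emeasure_decseq') (auto intro!: exI[of _ 0] simp: emeasure_count_space_finite)

lemma enn2real_ncard: "enn2real (ncard D) = real (card D)"
  unfolding ncard_emeasure by (cases "finite D") (simp_all add: emeasure_count_space_finite emeasure_count_space_infinite ennreal_of_nat_eq_real_of_nat)

lemma ncard_UN_le: "finite I \<Longrightarrow> ncard (\<Union>i\<in>I. A i) \<le> (\<Sum>i\<in>I. ncard (A i))"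
  unfolding ncard_emeasure by (rule emeasure_subadditive_finite) auto

lemma ncard_UN_eq: "finite I \<Longrightarrow> disjoint_family_on A I \<Longrightarrow> (\<Sum>i\<in>I. ncard (A i)) = ncard (\<Union>i\<in>I. A i)"
  unfolding ncard_emeasure by (rule sum_emeasure) auto

lemma ennreal_mult_le_squares: "a * b \<le> a\<^sup>2 + (b\<^sup>2 :: ennreal)"
proof (cases "a \<le> b")
  case True
  then have "a * b \<le> b\<^sup>2" unfolding power2_eq_square by (rule mult_right_mono) simp
  then show ?thesis by (rule order_trans) (simp add: add_increasing)
next
  case False
  then have "a * b \<le> a\<^sup>2" unfolding power2_eq_square by (intro mult_left_mono) auto
  then show ?thesis by (rule order_trans) (simp add: add_increasing2)
qed

section \<open>Palm densities of large components and concentration of their counts\<close>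

context random_graph_model
begin

lemma AE_MQ_fst:
  assumes "AE \<omega> in M. P \<omega>"
  shows "AE z in MQ. P (fst z)"
proof -
  interpret Q: prob_space Q by (rule prob_space_Q)
  obtain N where N: "{\<omega> \<in> space M. \<not> P \<omega>} \<subseteq> N" "emeasure M N = 0" "N \<in> events" using assms by (rule AE_E)
  show ?thesis
  proof (rule AE_I)
    show "{z \<in> space MQ. \<not> P (fst z)} \<subseteq> N \<times> space Q" using N(1) by (auto simp: space_pair_measure)
    show "emeasure MQ (N \<times> space Q) = 0" using Q.emeasure_pair_measure_Times[OF N(3) sets.top] N(2) by simp
    show "N \<times> space Q \<in> sets MQ" by (rule pair_measureI[OF N(3) sets.top])
  qed
qed

lemma nn_integral_MQ_fst:
  assumes "g \<in> borel_measurable M"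
  shows "(\<integral>\<^sup>+z. g (fst z) \<partial>MQ) = (\<integral>\<^sup>+\<omega>. g \<omega> \<partial>M)"
proof -
  interpret Q: prob_space Q by (rule prob_space_Q)
  have "(\<lambda>z. g (fst z)) \<in> borel_measurable MQ" by (rule measurable_compose[OF measurable_fst assms])
  from Q.nn_integral_fst[OF this, symmetric] show ?thesis by (simp only: fst_conv nn_integral_const Q.emeasure_space_1 mult_1_right)
qed

lemma AE_finite_gpts: "bounded B \<Longrightarrow> AE z in MQ. finite (gpts B z)"
  by (rule AE_MQ_fst[OF AE_finite_points_in])

lemma measurable_ncard_points: "B \<in> sets borel \<Longrightarrow> (\<lambda>\<omega>. ncard (points_in (pts \<omega>) B)) \<in> borel_measurable M"
  by (rule measurable_ncard, simp only: points_in_def mem_Collect_eq, erule pred_sets2, rule measurable_point)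

lemma gcomp_mono: "D \<subseteq> D' \<Longrightarrow> gcomp D z v \<subseteq> gcomp D' z v"
  unfolding gcomp_def comp_def by (rule component_mono) (auto simp: points_in_def)

lemma gcomp_SUP:
  assumes "incseq D" "T \<subseteq> gcomp (\<Union>n. D n) z v" "finite T"
  shows "\<exists>n. T \<subseteq> gcomp (D n) z v"
proof -
  have 1: "incseq (\<lambda>n. gpts (D n) z)" using assms(1) by (fastforce simp: incseq_def points_in_def)
  have "gpts (\<Union>n. D n) z = (\<Union>n. gpts (D n) z)" by (auto simp: points_in_def)
  then show ?thesis using component_finite_witness[OF 1 assms(3)] assms(2) unfolding gcomp_def comp_def by auto
qed

lemma count_big_mono: "C \<subseteq> C' \<Longrightarrow> D \<subseteq> D' \<Longrightarrow> count_big k C D z \<le> count_big k C' D' z"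
  unfolding count_big_def by (rule ncard_mono) (auto simp: points_in_def intro: big_mono[OF _ gcomp_mono])

lemma count_big_le: "count_big k C D z \<le> ncard (gpts C z)"
  unfolding count_big_def by (rule ncard_mono) (auto simp: points_in_def)

lemma count_big_SUP:
  assumes "incseq D" "C \<subseteq> D 0"
  shows "(SUP n. count_big k C (D n) z) = count_big k C (\<Union>n. D n) z"
proof -
  let ?A = "\<lambda>n. {v \<in> gpts (D n) z. pts (fst z) v \<in> C \<and> big k (gcomp (D n) z v)}"
  have C: "C \<subseteq> D n" for n using assms incseqD[OF assms(1), of 0 n] by blast
  have "incseq ?A"
  proof (rule incseq_SucI)
    fix n
    have "D n \<subseteq> D (Suc n)" using assms(1) by (simp add: incseq_SucD)
    then show "?A n \<subseteq> ?A (Suc n)" by (auto simp: points_in_def intro: big_mono[OF _ gcomp_mono])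
  qed
  moreover have "(\<Union>n. ?A n) = {v \<in> gpts (\<Union>n. D n) z. pts (fst z) v \<in> C \<and> big k (gcomp (\<Union>n. D n) z v)}"
  proof (intro set_eqI iffI)
    fix v assume "v \<in> (\<Union>n. ?A n)"
    then show "v \<in> {v \<in> gpts (\<Union>n. D n) z. pts (fst z) v \<in> C \<and> big k (gcomp (\<Union>n. D n) z v)}"
      by (auto simp: points_in_def intro: big_mono[OF _ gcomp_mono])
  next
    fix v assume v: "v \<in> {v \<in> gpts (\<Union>n. D n) z. pts (fst z) v \<in> C \<and> big k (gcomp (\<Union>n. D n) z v)}"
    then obtain T where T: "finite T" "card T = k" "T \<subseteq> gcomp (\<Union>n. D n) z v" by (auto simp: big_def)
    then obtain n where "T \<subseteq> gcomp (D n) z v" using gcomp_SUP[OF assms(1)] by blast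
    then have "big k (gcomp (D n) z v)" using T by (auto simp: big_def)
    then show "v \<in> (\<Union>n. ?A n)" using v C[of n] by (auto simp: points_in_def)
  qed
  ultimately show ?thesis unfolding count_big_def by (subst ncard_SUP) simp_all
qed

lemma thick_cells: "incseq (\<lambda>L. shift s (thick_cell L) :: 'a set)" "(\<Union>L. shift s (thick_cell L) :: 'a set) = UNIV"
  "shift s unit_cell \<subseteq> (shift s (thick_cell L) :: 'a set)"
proof -
  show "incseq (\<lambda>L. shift s (thick_cell L) :: 'a set)"
    by (rule incseq_SucI) (force simp: thick_cell_def)
  show "(\<Union>L. shift s (thick_cell L) :: 'a set) = UNIV"
  proof (intro set_eqI iffI UNIV_I)
    fix x :: 'a
    obtain L :: nat where L: "norm (x - s) \<le> real L" using real_arch_simple by blast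
    have "- real L \<le> (x - s) \<bullet> b \<and> (x - s) \<bullet> b < 1 + real L" if "b \<in> Basis" for b
      using Basis_le_norm[OF that, of "x - s"] L by linarith
    then show "x \<in> (\<Union>L. shift s (thick_cell L))" by (auto simp: thick_cell_def)
  qed
  show "shift s unit_cell \<subseteq> (shift s (thick_cell L) :: 'a set)" by (auto intro: subsetD[OF unit_cell_thick])
qed

text \<open>The unit cell has volume 1, so these expected numbers of vertices are Palm
  probabilities: of a component of size at least \<open>k\<close> within margin \<open>L\<close>, in
  the whole space (\<open>\<theta>\<close>), and of an infinite component
  (\<open>\<theta>inf\<close>).\<close>

definition \<theta>L :: "nat \<Rightarrow> nat \<Rightarrow> real" where
  "\<theta>L k L = enn2real (\<integral>\<^sup>+z. count_big k unit_cell (thick_cell L) z \<partial>MQ)"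

definition \<theta> :: "nat \<Rightarrow> real" where
  "\<theta> k = enn2real (\<integral>\<^sup>+z. count_big k unit_cell UNIV z \<partial>MQ)"

definition \<theta>inf :: real where
  "\<theta>inf = enn2real (\<integral>\<^sup>+z. ncard {v \<in> gpts unit_cell z. infinite (gcomp UNIV z v)} \<partial>MQ)"

lemma expected_gpts_cell: "(\<integral>\<^sup>+z. ncard (gpts (shift s unit_cell) z) \<partial>MQ) = 1"
  "(\<integral>\<^sup>+z. (ncard (gpts (shift s unit_cell) z))\<^sup>2 \<partial>MQ) = 2"
proof -
  have c: "shift s unit_cell \<in> sets borel" "bounded (shift s unit_cell :: 'a set)" "0 < measure lborel (shift s unit_cell :: 'a set)"
    by (simp_all add: sets_shift bounded_shift measure_shift measure_unit_cell)
  have m: "(\<lambda>\<omega>. ncard (points_in (pts \<omega>) (shift s unit_cell))) \<in> borel_measurable M"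
    by (rule measurable_ncard_points[OF c(1)])
  show "(\<integral>\<^sup>+z. ncard (gpts (shift s unit_cell) z) \<partial>MQ) = 1"
    by (subst nn_integral_MQ_fst[OF m]) (simp add: expected_count(1)[OF c] measure_shift measure_unit_cell)
  have m2: "(\<lambda>\<omega>. (ncard (points_in (pts \<omega>) (shift s unit_cell)))\<^sup>2) \<in> borel_measurable M" using m by measurable
  show "(\<integral>\<^sup>+z. (ncard (gpts (shift s unit_cell) z))\<^sup>2 \<partial>MQ) = 2"
    by (subst nn_integral_MQ_fst[OF m2]) (simp add: expected_count(2)[OF c] measure_shift measure_unit_cell)
qed

lemma expected_count_big_le_1: "(\<integral>\<^sup>+z. count_big k (shift s unit_cell) D z \<partial>MQ) \<le> 1"
  unfolding expected_gpts_cell(1)[of s, symmetric] by (intro nn_integral_mono count_big_le)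

lemma \<theta>_bounds: "0 \<le> \<theta> k" "\<theta> k \<le> 1" "0 \<le> \<theta>L k L"
  and ennreal_\<theta>: "(\<integral>\<^sup>+z. count_big k unit_cell UNIV z \<partial>MQ) = ennreal (\<theta> k)"
  and ennreal_\<theta>L: "(\<integral>\<^sup>+z. count_big k unit_cell (thick_cell L) z \<partial>MQ) = ennreal (\<theta>L k L)"
proof -
  have le: "(\<integral>\<^sup>+z. count_big k unit_cell D z \<partial>MQ) \<le> 1" for D using expected_count_big_le_1[of k 0 D] by simp
  have fin: "(\<integral>\<^sup>+z. count_big k unit_cell D z \<partial>MQ) < \<top>" for D using le[of D] ennreal_one_less_top by (rule le_less_trans)
  show "0 \<le> \<theta> k" "0 \<le> \<theta>L k L" by (simp_all add: \<theta>_def \<theta>L_def)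
  show "\<theta> k \<le> 1" unfolding \<theta>_def using enn2real_mono[OF le[of UNIV]] by simp
  show "(\<integral>\<^sup>+z. count_big k unit_cell UNIV z \<partial>MQ) = ennreal (\<theta> k)" unfolding \<theta>_def by (rule ennreal_enn2real[OF fin, symmetric])
  show "(\<integral>\<^sup>+z. count_big k unit_cell (thick_cell L) z \<partial>MQ) = ennreal (\<theta>L k L)" unfolding \<theta>L_def by (rule ennreal_enn2real[OF fin, symmetric])
qed

lemma expected_thick_cell: "(\<integral>\<^sup>+z. count_big k (shift s unit_cell) (shift s (thick_cell L)) z \<partial>MQ) = ennreal (\<theta>L k L)"
  unfolding ennreal_\<theta>L[symmetric] by (rule nn_integral_count_big_shift) (simp_all add: measure_thick_cell)

lemma measurable_count_big_cell: "count_big k (shift s unit_cell) (shift s (thick_cell L)) \<in> borel_measurable MQ"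
  by (intro measurable_count_big sets_shift sets_cells)

text \<open>Monotone convergence: a finite part of a component in the whole space is already
  connected inside some thick cell.\<close>

lemma SUP_\<theta>L: "(\<integral>\<^sup>+z. count_big k (shift s unit_cell) UNIV z \<partial>MQ) = (SUP L. ennreal (\<theta>L k L))"
proof -
  have "(SUP L. count_big k (shift s unit_cell) (shift s (thick_cell L)) z) = count_big k (shift s unit_cell) UNIV z" for z
    using count_big_SUP[OF thick_cells(1) thick_cells(3)] by (simp only: thick_cells(2))
  then have "(\<integral>\<^sup>+z. count_big k (shift s unit_cell) UNIV z \<partial>MQ) = (\<integral>\<^sup>+z. (SUP L. count_big k (shift s unit_cell) (shift s (thick_cell L)) z) \<partial>MQ)"
    by (simp only:)
  also have "\<dots> = (SUP L. \<integral>\<^sup>+z. count_big k (shift s unit_cell) (shift s (thick_cell L)) z \<partial>MQ)"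
  proof (rule nn_integral_monotone_convergence_SUP[OF _ measurable_count_big_cell])
    show "incseq (\<lambda>L. count_big k (shift s unit_cell) (shift s (thick_cell L)))"
      by (intro incseq_SucI le_funI count_big_mono order_refl incseq_SucD[OF thick_cells(1)])
  qed
  finally show ?thesis by (simp only: expected_thick_cell)
qed

text \<open>Translation invariance for the infinite graph. The mixed binomial formula covers bounded
  regions only, so it is inherited from the thick cells, whose values do not depend on
  \<open>s\<close>.\<close>

lemma expected_cell: "(\<integral>\<^sup>+z. count_big k (shift s unit_cell) UNIV z \<partial>MQ) = ennreal (\<theta> k)"
  using SUP_\<theta>L[of k s] SUP_\<theta>L[of k 0] by (simp add: ennreal_\<theta>)

lemma \<theta>L_tendsto: "(\<lambda>L. \<theta>L k L) \<longlonglongrightarrow> \<theta> k"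
proof -
  have "incseq (\<lambda>L. ennreal (\<theta>L k L))" unfolding ennreal_\<theta>L[symmetric]
  proof (intro incseq_SucI nn_integral_mono count_big_mono order_refl)
    show "thick_cell L \<subseteq> (thick_cell (Suc L) :: 'a set)" for L using incseq_SucD[OF thick_cells(1)[of 0], of L] by simp
  qed
  then have "(\<lambda>L. ennreal (\<theta>L k L)) \<longlonglongrightarrow> (SUP L. ennreal (\<theta>L k L))" by (rule LIMSEQ_SUP)
  then have "(\<lambda>L. ennreal (\<theta>L k L)) \<longlonglongrightarrow> ennreal (\<theta> k)" unfolding SUP_\<theta>L[of k 0, symmetric] by (simp add: ennreal_\<theta>)
  from tendsto_enn2real[OF this] show ?thesis by (simp add: \<theta>_bounds)
qed

text \<open>Continuity from above of the counting measure requires finite sets, which almost surely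
  holds because the counted vertices lie in the bounded unit cell.\<close>

lemma \<theta>_tendsto: "\<theta> \<longlonglongrightarrow> \<theta>inf" and \<theta>_ge: "\<theta>inf \<le> \<theta> k"
  and ennreal_\<theta>inf: "(\<integral>\<^sup>+z. ncard {v \<in> gpts unit_cell z. infinite (gcomp UNIV z v)} \<partial>MQ) = ennreal \<theta>inf"
proof -
  let ?F = "\<lambda>z. ncard {v \<in> gpts unit_cell z. infinite (gcomp UNIV z v)}"
  let ?A = "\<lambda>z k. {v \<in> gpts UNIV z. pts (fst z) v \<in> unit_cell \<and> big k (gcomp UNIV z v)}"
  have dec: "decseq (?A z)" for z by (intro decseq_SucI) (auto intro: big_antimono)
  have inf: "(\<Inter>k. ?A z k) = {v \<in> gpts unit_cell z. infinite (gcomp UNIV z v)}" for z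
    by (auto simp: infinite_iff_big points_in_def)
  have "AE z in MQ. (INF k. count_big k unit_cell UNIV z) = ?F z"
    using AE_finite_gpts[OF bounded_unit_cell]
  proof eventually_elim
    case (elim z)
    have "finite (?A z 0)" by (rule finite_subset[OF _ elim]) (auto simp: points_in_def)
    from ncard_INF[OF dec this] show ?case unfolding count_big_def inf .
  qed
  then have "(\<integral>\<^sup>+z. ?F z \<partial>MQ) = (\<integral>\<^sup>+z. (INF k. count_big k unit_cell UNIV z) \<partial>MQ)"
    by (intro nn_integral_cong_AE) (auto elim: AE_mp)
  also have "\<dots> = (INF k. \<integral>\<^sup>+z. count_big k unit_cell UNIV z \<partial>MQ)"
  proof (rule nn_integral_monotone_convergence_INF_AE)
    show "AE z in MQ. count_big (Suc k) unit_cell UNIV z \<le> count_big k unit_cell UNIV z" for k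
      unfolding count_big_def using decseq_SucD[OF dec] by (intro AE_I2 ncard_mono)
    show "count_big k unit_cell UNIV \<in> borel_measurable MQ" for k by (rule measurable_count_big) auto
    show "(\<integral>\<^sup>+z. count_big 0 unit_cell UNIV z \<partial>MQ) < \<infinity>" by (simp add: ennreal_\<theta>)
  qed
  finally have eq: "(\<integral>\<^sup>+z. ?F z \<partial>MQ) = (INF k. ennreal (\<theta> k))" unfolding ennreal_\<theta> .
  have le: "(\<integral>\<^sup>+z. ?F z \<partial>MQ) \<le> ennreal (\<theta> k)" for k unfolding eq by (rule INF_lower) simp
  then have "(\<integral>\<^sup>+z. ?F z \<partial>MQ) < \<top>" by (rule le_less_trans[OF _ ennreal_less_top])
  then show e: "(\<integral>\<^sup>+z. ?F z \<partial>MQ) = ennreal \<theta>inf" unfolding \<theta>inf_def by (rule ennreal_enn2real[symmetric])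
  show "\<theta>inf \<le> \<theta> k" using le[of k] unfolding e by (simp add: \<theta>_bounds)
  have "decseq (\<lambda>k. ennreal (\<theta> k))" unfolding ennreal_\<theta>[symmetric]
    by (intro decseq_SucI nn_integral_mono) (use decseq_SucD[OF dec] in \<open>unfold count_big_def, intro ncard_mono\<close>)
  then have "(\<lambda>k. ennreal (\<theta> k)) \<longlonglongrightarrow> ennreal \<theta>inf" unfolding e[symmetric] eq by (rule LIMSEQ_INF)
  from tendsto_enn2real[OF this] show "\<theta> \<longlonglongrightarrow> \<theta>inf" by (simp add: \<theta>_bounds \<theta>inf_def)
qed

definition cell_sum :: "nat \<Rightarrow> nat \<Rightarrow> int \<Rightarrow> 'w \<times> (nat set \<Rightarrow> real \<times> real) \<Rightarrow> ennreal" where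
  "cell_sum k L r z = (\<Sum>s\<in>Lat r. count_big k (shift s unit_cell) (shift s (thick_cell L)) z)"

lemma measurable_cell_sum: "cell_sum k L r \<in> borel_measurable MQ"
  unfolding cell_sum_def[abs_def] by (intro borel_measurable_sum measurable_count_big_cell)

lemma expected_cell_sum: "(\<integral>\<^sup>+z. cell_sum k L r z \<partial>MQ) = ennreal (real (card (Lat r)) * \<theta>L k L)"
  unfolding cell_sum_def 
  by (simp add: nn_integral_sum[OF measurable_count_big_cell] expected_thick_cell ennreal_mult \<theta>_bounds ennreal_of_nat_eq_real_of_nat)

text \<open>Cells with disjoint thick cells are uncorrelated. For the others the product is bounded
  by the squared point counts of both cells, of mean 2 each, and every cell has at most
  \<open>card (Lat (2 * int L + 2))\<close> such partners.\<close>

lemma expected_cell_sum_square: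
  "(\<integral>\<^sup>+z. cell_sum k L r z * cell_sum k L r z \<partial>MQ)
    \<le> ennreal ((real (card (Lat r)) * \<theta>L k L)\<^sup>2 + 4 * real (card (Lat r)) * real (card (Lat (2 * int L + 2))))"
proof -
  let ?Z = "\<lambda>s. count_big k (shift s unit_cell) (shift s (thick_cell L))"
  let ?near = "\<lambda>s t. t - s \<in> Lat (2 * int L + 2)"
  let ?m = "real (card (Lat r))" and ?c = "real (card (Lat (2 * int L + 2)))"
  have pair: "(\<integral>\<^sup>+z. ?Z s z * ?Z t z \<partial>MQ) \<le> ennreal ((\<theta>L k L)\<^sup>2 + (if ?near s t then 4 else 0))"
    if st: "s \<in> Lat r" "t \<in> Lat r" for s t
  proof (cases "?near s t")
    case True
    have "(\<integral>\<^sup>+z. ?Z s z * ?Z t z \<partial>MQ) \<le> (\<integral>\<^sup>+z. (ncard (gpts (shift s unit_cell) z))\<^sup>2 + (ncard (gpts (shift t unit_cell) z))\<^sup>2 \<partial>MQ)"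
      by (intro nn_integral_mono order_trans[OF mult_mono ennreal_mult_le_squares] count_big_le) auto
    also have "\<dots> = 2 + 2"
    proof (subst nn_integral_add)
      have "(\<lambda>z. ncard (gpts (shift s unit_cell) z)) \<in> borel_measurable MQ" for s
        by (rule measurable_compose[OF measurable_fst measurable_ncard_points]) (intro sets_shift sets_cells)
      then show "(\<lambda>z. (ncard (gpts (shift s unit_cell) z))\<^sup>2) \<in> borel_measurable MQ" "(\<lambda>z. (ncard (gpts (shift t unit_cell) z))\<^sup>2) \<in> borel_measurable MQ"
        unfolding power2_eq_square by (intro borel_measurable_times_ennreal; assumption)+
    qed (simp only: expected_gpts_cell)
    also have "\<dots> = ennreal 4" by simp
    also have "\<dots> \<le> ennreal ((\<theta>L k L)\<^sup>2 + (if ?near s t then 4 else 0))" using True by (intro ennreal_leI) simp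
    finally show ?thesis .
  next
    case False
    then have disj: "shift s (thick_cell L) \<inter> shift t (thick_cell L) = {}" using thick_cells_meet[OF st] by blast
    let ?F = "\<lambda>s V x \<eta>. ncard {v \<in> V. x v \<in> shift s unit_cell \<and> big k (comp V x \<eta> v)}"
    have m: "(\<lambda>z. ?F s (gpts (shift s (thick_cell L)) z) (pts (fst z)) (snd z)) \<in> borel_measurable MQ" for s
      using measurable_count_big_cell[of k s L] unfolding count_big_def[abs_def] gcomp_def .
    have sh: "shift s (thick_cell L) \<in> sets borel" "bounded (shift s (thick_cell L) :: 'a set)" "0 < measure lborel (shift s (thick_cell L) :: 'a set)" for s
      by (simp_all add: sets_shift bounded_shift measure_shift measure_thick_cell)
    have e: "(\<integral>\<^sup>+z. ?F s (gpts (shift s (thick_cell L)) z) (pts (fst z)) (snd z) \<partial>MQ) = ennreal (\<theta>L k L)" for s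
      using expected_thick_cell[of k s L] unfolding count_big_def gcomp_def .
    have "(\<integral>\<^sup>+z. ?F s (gpts (shift s (thick_cell L)) z) (pts (fst z)) (snd z) * ?F t (gpts (shift t (thick_cell L)) z) (pts (fst z)) (snd z) \<partial>MQ) =
      (\<integral>\<^sup>+z. ?F s (gpts (shift s (thick_cell L)) z) (pts (fst z)) (snd z) \<partial>MQ) * (\<integral>\<^sup>+z. ?F t (gpts (shift t (thick_cell L)) z) (pts (fst z)) (snd z) \<partial>MQ)"
    proof (rule graph_functionals_independent[OF sh sh disj relabel_invariant_big relabel_invariant_big measurable_big_model measurable_big_model m m])
      show "(\<integral>\<^sup>+z. ?F s (gpts (shift s (thick_cell L)) z) (pts (fst z)) (snd z) \<partial>MQ) \<noteq> \<infinity>" by (simp only: e) simp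
    qed (rule sets_shift[OF sets_cells(1)])+
    also have "\<dots> = ennreal (\<theta>L k L) * ennreal (\<theta>L k L)" by (simp only: e)
    finally have "(\<integral>\<^sup>+z. ?Z s z * ?Z t z \<partial>MQ) = ennreal (\<theta>L k L) * ennreal (\<theta>L k L)"
      unfolding count_big_def gcomp_def .
    then show ?thesis using False by (simp add: power2_eq_square ennreal_mult \<theta>_bounds)
  qed
  have near: "(\<Sum>t\<in>Lat r. if ?near s t then 4 else (0::real)) \<le> 4 * ?c" if "s \<in> Lat r" for s
  proof -
    have "card {t \<in> Lat r. ?near s t} \<le> card (Lat (2 * int L + 2) :: 'a set)"
      by (rule card_inj_on_le[of "\<lambda>t. t - s"]) (auto simp: inj_on_def finite_Lat)
    then show ?thesis by (simp add: sum.If_cases finite_Lat Int_def conj_commute)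
  qed
  have "(\<integral>\<^sup>+z. cell_sum k L r z * cell_sum k L r z \<partial>MQ) = (\<Sum>s\<in>Lat r. \<Sum>t\<in>Lat r. \<integral>\<^sup>+z. ?Z s z * ?Z t z \<partial>MQ)"
    unfolding cell_sum_def sum_product
    by (simp only: nn_integral_sum borel_measurable_sum borel_measurable_times_ennreal measurable_count_big_cell)
  also have "\<dots> \<le> (\<Sum>s\<in>Lat r. \<Sum>t\<in>Lat r. ennreal ((\<theta>L k L)\<^sup>2 + (if ?near s t then 4 else 0)))"
    by (intro sum_mono pair)
  also have "\<dots> = ennreal (\<Sum>s\<in>Lat r. \<Sum>t\<in>Lat r. (\<theta>L k L)\<^sup>2 + (if ?near s t then 4 else 0))"
    by (simp add: sum_nonneg del: ennreal_plus)
  also have "\<dots> \<le> ennreal ((?m * \<theta>L k L)\<^sup>2 + 4 * ?m * ?c)"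
  proof (rule ennreal_leI)
    have "(\<Sum>s\<in>Lat r. \<Sum>t\<in>Lat r. (\<theta>L k L)\<^sup>2 + (if ?near s t then 4 else 0)) \<le> (\<Sum>s\<in>(Lat r :: 'a set). ?m * (\<theta>L k L)\<^sup>2 + 4 * ?c)"
      by (intro sum_mono) (use near in \<open>simp add: sum.distrib\<close>)
    also have "\<dots> = (?m * \<theta>L k L)\<^sup>2 + 4 * ?m * ?c" by (simp add: power2_eq_square algebra_simps)
    finally show "(\<Sum>s\<in>Lat r. \<Sum>t\<in>Lat r. (\<theta>L k L)\<^sup>2 + (if ?near s t then 4 else 0)) \<le> (?m * \<theta>L k L)\<^sup>2 + 4 * ?m * ?c" .
  qed
  finally show ?thesis .
qed

text \<open>A component within a thick cell inside the cube is part of a component of the graph in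
  the cube, and the half-open cells are disjoint, so no vertex is counted twice.\<close>

lemma cell_sum_le:
  assumes "of_int r + real L \<le> h"
  shows "cell_sum k L r z \<le> count_big k (cube h) (cube h) z"
proof -
  let ?A = "\<lambda>s. {v \<in> gpts (shift s (thick_cell L)) z. pts (fst z) v \<in> shift s unit_cell \<and> big k (gcomp (shift s (thick_cell L)) z v)}"
  have "disjoint_family_on ?A (Lat r)" unfolding disjoint_family_on_def
  proof (intro ballI impI)
    fix s t :: 'a assume st: "s \<in> Lat r" "t \<in> Lat r" "s \<noteq> t"
    then show "?A s \<inter> ?A t = {}" using shift_unit_cell_disjoint[OF st(1,2)] by blast
  qed
  then have "cell_sum k L r z = ncard (\<Union>s\<in>Lat r. ?A s)" unfolding cell_sum_def count_big_def by (rule ncard_UN_eq[OF finite_Lat])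
  also have "\<dots> \<le> count_big k (cube h) (cube h) z" unfolding count_big_def
  proof (rule ncard_mono, rule UN_least, rule subsetI)
    fix s v assume s: "s \<in> Lat r" and v: "v \<in> ?A s"
    have sub: "shift s (thick_cell L) \<subseteq> cube h" by (rule thick_cell_in_cube[OF s assms])
    have "pts (fst z) v \<in> shift s (thick_cell L)" using v by (simp add: points_in_def)
    then have "pts (fst z) v \<in> cube h" using sub by blast
    then show "v \<in> {v \<in> gpts (cube h) z. pts (fst z) v \<in> cube h \<and> big k (gcomp (cube h) z v)}"
      using v big_mono[OF _ gcomp_mono[OF sub]] by (simp add: points_in_def)
  qed
  finally show ?thesis .
qed

text \<open>Enlarging the graph to the whole space enlarges components, and there every lattice cell
  contributes exactly \<open>\<theta> k\<close>.\<close>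

lemma expected_count_big_cube:
  assumes h: "h < of_int r" "0 \<le> r"
  shows "(\<integral>\<^sup>+z. count_big k (cube h) (cube h) z \<partial>MQ) \<le> ennreal ((2 * of_int r) ^ DIM('a) * \<theta> k)"
proof -
  have "count_big k (cube h) (cube h) z \<le> (\<Sum>s\<in>Lat r. count_big k (shift s unit_cell) UNIV z)" for z
  proof -
    have "count_big k (cube h) (cube h) z \<le> count_big k (\<Union>s\<in>Lat r. shift s unit_cell) UNIV z"
      using cube_covered[OF h(1)] by (intro count_big_mono) auto
    also have "\<dots> \<le> ncard (\<Union>s\<in>Lat r. {v \<in> gpts UNIV z. pts (fst z) v \<in> shift s unit_cell \<and> big k (gcomp UNIV z v)})"
      unfolding count_big_def by (rule ncard_mono) blast
    also have "\<dots> \<le> (\<Sum>s\<in>Lat r. count_big k (shift s unit_cell) UNIV z)"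
      unfolding count_big_def by (rule ncard_UN_le[OF finite_Lat])
    finally show ?thesis .
  qed
  then have "(\<integral>\<^sup>+z. count_big k (cube h) (cube h) z \<partial>MQ) \<le> (\<integral>\<^sup>+z. (\<Sum>s\<in>Lat r. count_big k (shift s unit_cell) UNIV z) \<partial>MQ)"
    by (rule nn_integral_mono)
  also have "\<dots> = (\<Sum>s\<in>Lat r. \<integral>\<^sup>+z. count_big k (shift s unit_cell) UNIV z \<partial>MQ)"
    by (rule nn_integral_sum) (intro measurable_count_big sets_shift sets_cells, simp)
  also have "\<dots> = ennreal (real (card (Lat r :: 'a set)) * \<theta> k)"
    by (simp add: expected_cell ennreal_mult \<theta>_bounds ennreal_of_nat_eq_real_of_nat)
  finally show ?thesis by (simp only: card_Lat[OF h(2)])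
qed

lemma measurable_count_big_cube: "count_big k (cube h) (cube h) \<in> borel_measurable MQ"
  by (intro measurable_count_big sets_cube)

text \<open>For a fixed margin \<open>L\<close> the cell sum has a variance linear in the number of
  cells, while the allowed deviation is linear too; Chebyshev then gives a bound of the inverse
  order of the number of cells.\<close>

lemma count_lower:
  assumes \<eta>: "0 < \<eta>" and \<delta>: "0 < \<delta>"
  shows "\<forall>\<^sub>F h in at_top. measure MQ {z \<in> space MQ. enn2real (count_big k (cube h) (cube h) z) \<le> (2 * h) ^ DIM('a) * (\<theta> k - \<eta>)} \<le> \<delta>"
proof -
  interpret MQ: prob_space MQ by (rule prob_space_MQ)
  obtain L where L: "\<theta> k - \<eta> / 3 < \<theta>L k L"
    using order_tendstoD(1)[OF \<theta>L_tendsto, of "\<theta> k - \<eta> / 3" k] \<eta> by (auto simp: eventually_sequentially)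
  define c where "c = real (card (Lat (2 * int L + 2) :: 'a set))"
  have "((\<lambda>h::real. ((1 - (1 + real L) * inverse h)) ^ DIM('a)) \<longlongrightarrow> (1 - (1 + real L) * 0) ^ DIM('a)) at_top"
    by (intro tendsto_intros tendsto_inverse_0_at_top filterlim_ident)
  then have ratio: "((\<lambda>h::real. ((1 - (1 + real L) * inverse h)) ^ DIM('a)) \<longlongrightarrow> 1) at_top" by simp
  \<comment> \<open>The cells whose thick cells fit into the cube fill almost all of its volume; the
    lower bound 1/2 serves to make their number comparable to \<open>h\<close> below.\<close>
  have "\<forall>\<^sub>F h in at_top. max (1 - \<eta> / 3) (1 / 2) < (1 - (1 + real L) * inverse h) ^ DIM('a)"
    by (rule order_tendstoD(1)[OF ratio]) (use \<eta> in auto)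
  moreover have "\<forall>\<^sub>F h in at_top. max (2 + real L) (36 * c / (\<eta>\<^sup>2 * \<delta>) + 1) \<le> h" by (rule eventually_ge_at_top)
  ultimately show ?thesis
  proof eventually_elim
    case (elim h)
    define v where "v = (2 * h) ^ DIM('a)"
    \<comment> \<open>The margin \<open>L\<close> is given up on every side, so that the thick cells
      stay inside the cube.\<close>
    define r where "r = \<lfloor>h\<rfloor> - int L"
    have r: "h - 1 - real L \<le> of_int r" "of_int r + real L \<le> h" using floor_correct[of h] by (simp_all add: r_def)
    have h: "2 + real L \<le> h" "36 * c / (\<eta>\<^sup>2 * \<delta>) + 1 \<le> h" using elim by auto
    then have r0: "0 \<le> r" "0 < h" using r by linarith+
    define m where "m = real (card (Lat r :: 'a set))"
    have m: "m = (2 * of_int r) ^ DIM('a)" unfolding m_def by (rule card_Lat[OF r0(1)])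
    have v: "0 < v" using r0 by (simp add: v_def)
    have mle: "m \<le> v" unfolding m v_def using r r0 by (intro power_mono) auto
    have "v * (1 - (1 + real L) * inverse h) ^ DIM('a) = (2 * (h - 1 - real L)) ^ DIM('a)"
    proof -
      have "2 * h * (1 - (1 + real L) * inverse h) = 2 * (h - 1 - real L)" using r0 by (simp add: field_simps)
      then show ?thesis unfolding v_def by (simp only: power_mult_distrib[symmetric])
    qed
    also have "\<dots> \<le> m" unfolding m using r h by (intro power_mono mult_left_mono) auto
    finally have "v * (1 - (1 + real L) * inverse h) ^ DIM('a) \<le> m" .
    moreover have "v * max (1 - \<eta> / 3) (1 / 2) \<le> v * (1 - (1 + real L) * inverse h) ^ DIM('a)"
      using elim(1) v by (intro mult_left_mono) auto
    ultimately have mv: "v * max (1 - \<eta> / 3) (1 / 2) \<le> m" by linarith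
    have "v * (1 - \<eta> / 3) \<le> v * max (1 - \<eta> / 3) (1 / 2)" "v * (1 / 2) \<le> v * max (1 - \<eta> / 3) (1 / 2)"
      using v by (intro mult_left_mono; simp)+
    then have mv1: "v * (1 - \<eta> / 3) \<le> m" and mv2: "v / 2 \<le> m" using mv by linarith+
    have mpos: "0 < m" using mv2 v by linarith
    \<comment> \<open>The loss \<open>\<eta>\<close> is spent in thirds: on the volume near the
      boundary, on replacing \<open>\<theta>\<close> by \<open>\<theta>L\<close>, and on the
      deviation in Chebyshev's inequality.\<close>
    have key: "v * (\<theta> k - \<eta>) \<le> m * \<theta>L k L - m * (\<eta> / 3)"
    proof -
      have "(v - m) * \<theta> k \<le> (v - m) * 1" using \<theta>_bounds[of k] mle by (intro mult_left_mono) auto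
      moreover have "m * (2 * \<eta> / 3) \<le> v * (2 * \<eta> / 3)" using mle \<eta> by (intro mult_right_mono) auto
      moreover have "m * (\<theta> k - \<eta> / 3) \<le> m * \<theta>L k L" using L mpos by (intro mult_left_mono) auto
      ultimately show ?thesis using mv1 by (simp add: algebra_simps)
    qed
    have "MQ.prob {z \<in> space MQ. enn2real (count_big k (cube h) (cube h) z) \<le> v * (\<theta> k - \<eta>)}
      \<le> MQ.prob {z \<in> space MQ. enn2real (cell_sum k L r z) \<le> m * \<theta>L k L - m * (\<eta> / 3)}"
    proof (rule MQ.finite_measure_mono_AE)
      show "{z \<in> space MQ. enn2real (cell_sum k L r z) \<le> m * \<theta>L k L - m * (\<eta> / 3)} \<in> MQ.events"
        using measurable_cell_sum[of k L r] by measurable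
      show "AE z in MQ. z \<in> {z \<in> space MQ. enn2real (count_big k (cube h) (cube h) z) \<le> v * (\<theta> k - \<eta>)} \<longrightarrow>
          z \<in> {z \<in> space MQ. enn2real (cell_sum k L r z) \<le> m * \<theta>L k L - m * (\<eta> / 3)}"
        using AE_finite_gpts[OF bounded_cube, of h]
      proof eventually_elim
        case (elim z)
        have "count_big k (cube h) (cube h) z \<le> ncard (gpts (cube h) z)" by (rule count_big_le)
        also have "\<dots> < \<top>" using elim by (simp add: ncard_finite of_nat_less_top)
        finally have "enn2real (cell_sum k L r z) \<le> enn2real (count_big k (cube h) (cube h) z)"
          by (rule enn2real_mono[OF cell_sum_le[OF r(2)]])
        then show ?case using key by auto
      qed
    qed
    also have "\<dots> \<le> 4 * m * c / (m * (\<eta> / 3))\<^sup>2"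
    proof (rule MQ.Chebyshev_enn2real[OF measurable_cell_sum])
      show "(\<integral>\<^sup>+z. cell_sum k L r z \<partial>MQ) = ennreal (m * \<theta>L k L)" unfolding m_def by (rule expected_cell_sum)
      show "(\<integral>\<^sup>+z. cell_sum k L r z * cell_sum k L r z \<partial>MQ) \<le> ennreal ((m * \<theta>L k L)\<^sup>2 + 4 * m * c)"
        unfolding m_def c_def by (rule expected_cell_sum_square)
    qed (use mpos \<eta> \<theta>_bounds in \<open>auto simp: c_def\<close>)
    also have "\<dots> = 36 * c / (\<eta>\<^sup>2 * m)" using mpos \<eta> by (simp add: power2_eq_square field_simps)
    also have "\<dots> \<le> \<delta>"
    proof -
      have "36 * c / (\<eta>\<^sup>2 * \<delta>) \<le> h" using h by simp
      also have "\<dots> \<le> m"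
      proof -
        have "1 \<le> 2 * h" using h by simp
        from self_le_power[OF this, of "DIM('a)"] have "2 * h \<le> v" unfolding v_def by simp
        then show ?thesis using mv2 by linarith
      qed
      finally show ?thesis using \<eta> \<delta> mpos by (simp add: field_simps)
    qed
    finally show ?case unfolding v_def .
  qed
qed

text \<open>The components in the cube may extend to the whole space, where no independence is
  available; hence the mean is combined with the lower tail from \<open>count_lower\<close>.\<close>

lemma count_upper:
  assumes \<epsilon>: "0 < \<epsilon>" and \<delta>: "0 < \<delta>"
  shows "\<forall>\<^sub>F h in at_top. measure MQ {z \<in> space MQ. (2 * h) ^ DIM('a) * (\<theta> k + \<epsilon>) \<le> enn2real (count_big k (cube h) (cube h) z)} \<le> \<delta>"
proof -
  interpret MQ: prob_space MQ by (rule prob_space_MQ)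
  \<comment> \<open>Three errors of relative size \<open>\<zeta>\<close> arise: in the mean, in the
    lower deviation and in its probability. Divided by \<open>\<epsilon>\<close> they must give
    \<open>\<delta>\<close>.\<close>
  define \<zeta> where "\<zeta> = \<epsilon> * \<delta> / 3"
  have \<zeta>: "0 < \<zeta>" using \<epsilon> \<delta> by (simp add: \<zeta>_def)
  have "((\<lambda>h::real. ((1 + 1 * inverse h)) ^ DIM('a)) \<longlongrightarrow> (1 + 1 * 0) ^ DIM('a)) at_top"
    by (intro tendsto_intros tendsto_inverse_0_at_top filterlim_ident)
  then have "\<forall>\<^sub>F h in at_top. (1 + 1 * inverse h) ^ DIM('a) < 1 + \<zeta>"
    by (rule order_tendstoD(2)) (use \<zeta> in auto)
  moreover have "\<forall>\<^sub>F h in at_top. (1::real) \<le> h" by (rule eventually_ge_at_top)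
  moreover note count_lower[OF \<zeta> \<zeta>, of k]
  ultimately show ?thesis
  proof eventually_elim
    case (elim h)
    define v where "v = (2 * h) ^ DIM('a)"
    let ?N = "count_big k (cube h) (cube h)"
    have v: "0 < v" using elim by (simp add: v_def)
    have h: "h < of_int (\<lfloor>h\<rfloor> + 1)" "0 \<le> \<lfloor>h\<rfloor> + 1" "of_int (\<lfloor>h\<rfloor> + 1) \<le> h + 1" using elim by linarith+
    have "(2 * of_int (\<lfloor>h\<rfloor> + 1)) ^ DIM('a) \<le> (2 * (h + 1)) ^ DIM('a)" using h by (intro power_mono mult_left_mono) auto
    also have "\<dots> = v * (1 + 1 * inverse h) ^ DIM('a)"
    proof -
      have "2 * h * (1 + 1 * inverse h) = 2 * (h + 1)" using elim by (simp add: field_simps)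
      then show ?thesis unfolding v_def by (simp only: power_mult_distrib[symmetric])
    qed
    also have "\<dots> \<le> v * (1 + \<zeta>)" using elim v by (intro mult_left_mono) auto
    finally have "(2 * of_int (\<lfloor>h\<rfloor> + 1)) ^ DIM('a) * \<theta> k \<le> v * (1 + \<zeta>) * \<theta> k" by (intro mult_right_mono \<theta>_bounds)
    then have EN: "(\<integral>\<^sup>+z. ?N z \<partial>MQ) \<le> ennreal (v * (1 + \<zeta>) * \<theta> k)"
      by (intro order_trans[OF expected_count_big_cube[OF h(1,2)]] ennreal_leI)
    then have "(\<integral>\<^sup>+z. ?N z \<partial>MQ) < \<top>" by (rule le_less_trans) simp
    then have eN: "(\<integral>\<^sup>+z. ?N z \<partial>MQ) = ennreal (enn2real (\<integral>\<^sup>+z. ?N z \<partial>MQ))" by (rule ennreal_enn2real[symmetric])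
    note int = MQ.integrable_enn2real[OF measurable_count_big_cube eN enn2real_nonneg]
    have "enn2real (\<integral>\<^sup>+z. ?N z \<partial>MQ) \<le> v * (1 + \<zeta>) * \<theta> k"
      using enn2real_mono[OF EN] v \<zeta> \<theta>_bounds[of k] by simp
    then have e: "MQ.expectation (\<lambda>z. enn2real (?N z)) \<le> v * (1 + \<zeta>) * \<theta> k" unfolding int(2) .
    have "v * \<epsilon> * MQ.prob {z \<in> space MQ. v * \<theta> k + v * \<epsilon> \<le> enn2real (?N z)} \<le> v * (1 + \<zeta>) * \<theta> k + v * \<zeta> - v * \<theta> k * (1 - \<zeta>)"
    proof (rule MQ.prob_above_le[OF int(1) _ e])
      show "MQ.prob {z \<in> space MQ. enn2real (?N z) \<le> v * \<theta> k - v * \<zeta>} \<le> \<zeta>" using elim(3)[folded v_def] by (simp only: right_diff_distrib)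
    qed (use v \<epsilon> \<zeta> \<theta>_bounds in auto)
    also have "\<dots> = v * (2 * \<zeta> * \<theta> k + \<zeta>)" by (simp add: algebra_simps)
    also have "\<dots> \<le> v * (2 * \<zeta> * 1 + \<zeta>)" using v \<zeta> \<theta>_bounds[of k] by (intro mult_left_mono add_mono) auto
    also have "\<dots> = v * \<epsilon> * \<delta>" by (simp add: \<zeta>_def)
    finally have "MQ.prob {z \<in> space MQ. v * \<theta> k + v * \<epsilon> \<le> enn2real (?N z)} \<le> \<delta>"
      using v \<epsilon> by (subst (asm) mult_le_cancel_left_pos) auto
    then show ?case unfolding v_def by (simp only: distrib_left)
  qed
qed

end

section \<open>The largest component\<close>

lemma filterlim_powr_at_top:
  assumes "0 < s"
  shows "filterlim (\<lambda>v::real. v powr s) at_top at_top"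
  unfolding filterlim_at_top
proof
  fix Z :: real
  have "\<forall>\<^sub>F v in at_top. max Z 1 powr (1 / s) \<le> v" by (rule eventually_ge_at_top)
  then show "\<forall>\<^sub>F v in at_top. Z \<le> v powr s"
  proof eventually_elim
    case (elim v)
    have "(max Z 1 powr (1 / s)) powr s \<le> v powr s" using elim assms by (intro powr_mono2) auto
    moreover have "(max Z 1 powr (1 / s)) powr s = max Z 1" using assms by (simp add: powr_powr)
    ultimately show ?case by simp
  qed
qed

lemma square_exp_powr_tendsto_0:
  fixes q e :: real
  assumes "0 < q" "0 < e"
  shows "((\<lambda>v. v\<^sup>2 * exp (- (q * v powr e))) \<longlongrightarrow> 0) at_top"
proof -
  \<comment> \<open>With \<open>e * n \<ge> 2\<close> the square of \<open>v\<close> is dominated by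
    the \<open>n\<close>-th power of the exponent, which the exponential beats.\<close>
  obtain n :: nat where n: "2 / e \<le> real n" using real_arch_simple by blast
  have lim: "filterlim (\<lambda>v. q * v powr e) at_top at_top"
    by (intro filterlim_tendsto_pos_mult_at_top[OF tendsto_const assms(1)] filterlim_powr_at_top assms)
  have "((\<lambda>v. 1 / q ^ n * ((q * v powr e) ^ n / exp (q * v powr e))) \<longlongrightarrow> 1 / q ^ n * 0) at_top"
    by (intro tendsto_mult_left filterlim_compose[OF tendsto_power_div_exp_0 lim])
  then have g: "((\<lambda>v. 1 / q ^ n * ((q * v powr e) ^ n / exp (q * v powr e))) \<longlongrightarrow> 0) at_top" by simp
  show ?thesis
  proof (rule tendsto_sandwich[OF _ _ tendsto_const g])
    show "\<forall>\<^sub>F v in at_top. v\<^sup>2 * exp (- (q * v powr e)) \<le> 1 / q ^ n * ((q * v powr e) ^ n / exp (q * v powr e))"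
      using eventually_ge_at_top[of 1]
    proof eventually_elim
      case (elim v)
      have "v\<^sup>2 = v powr (e * (2 / e))" using elim assms by simp
      also have "\<dots> \<le> v powr (e * real n)" using elim n assms by (intro powr_mono mult_left_mono) auto
      also have "\<dots> = (v powr e) ^ n" using elim by (simp add: powr_powr[symmetric] powr_realpow)
      finally have "v\<^sup>2 * exp (- (q * v powr e)) \<le> (v powr e) ^ n * exp (- (q * v powr e))" by (intro mult_right_mono) auto
      also have "\<dots> = 1 / q ^ n * ((q * v powr e) ^ n / exp (q * v powr e))"
        using assms by (simp add: power_mult_distrib exp_minus field_simps)
      finally show ?case .
    qed
  qed auto
qed

section \<open>Two-sided bounds for the largest component\<close>

context random_graph_model
begin

text \<open>The threshold \<open>2 ^ L\<close> for the hubs is about \<open>v powr (1 / \<gamma>)\<close> with \<open>\<tau> - 1 < \<gamma> < 1 + \<sigma>\<close>: below \<open>\<gamma> = 1 + \<sigma>\<close>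
  all hubs are within reach of each other, above \<open>\<gamma> = \<tau> - 1\<close> their number diverges.\<close>

lemma hub_level:
  fixes l0 :: nat
  assumes D: "0 < D" and \<delta>: "0 < \<delta>"
  shows "\<forall>\<^sub>F v in at_top. \<exists>L\<ge>l0. 2 powr (real L * ((\<tau> + \<sigma>) / 2)) \<le> v \<and> D * v \<le> \<beta> * (2 ^ L * (2 ^ L) powr \<sigma>) \<and>
    v\<^sup>2 * exp (- (v * (tailprob (2 ^ L) * p\<^sup>2))) \<le> \<delta>"
proof -
  \<comment> \<open>The midpoint of \<open>\<tau> - 1\<close> and \<open>1 + \<sigma>\<close>; it
    lies strictly between them because \<open>\<tau> < 2 + \<sigma>\<close>.\<close>
  define \<gamma> where "\<gamma> = (\<tau> + \<sigma>) / 2"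
  have \<gamma>: "0 < \<gamma>" "\<tau> - 1 < \<gamma>" "\<gamma> < 1 + \<sigma>" using \<tau> \<sigma> by (auto simp: \<gamma>_def field_simps)
  have e: "0 < 1 - (\<tau> - 1) / \<gamma>" "0 < (1 + \<sigma>) / \<gamma> - 1" "0 < 1 / \<gamma>" using \<gamma> by (simp_all add: field_simps)
  have "\<forall>\<^sub>F v in at_top. v\<^sup>2 * exp (- (p\<^sup>2 * v powr (1 - (\<tau> - 1) / \<gamma>))) < \<delta>"
    by (rule order_tendstoD(2)[OF square_exp_powr_tendsto_0]) (use p e \<delta> in auto)
  moreover have "\<forall>\<^sub>F v in at_top. D / \<beta> * 2 powr (1 + \<sigma>) \<le> v powr ((1 + \<sigma>) / \<gamma> - 1)"
    using filterlim_powr_at_top[OF e(2)] by (simp add: filterlim_at_top)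
  moreover have "\<forall>\<^sub>F v in at_top. 2 powr (real l0 + 1) \<le> v powr (1 / \<gamma>)"
    using filterlim_powr_at_top[OF e(3)] by (simp add: filterlim_at_top)
  moreover have "\<forall>\<^sub>F v in at_top. (1::real) \<le> v" by (rule eventually_ge_at_top)
  ultimately show ?thesis
  proof eventually_elim
    case (elim v)
    \<comment> \<open>The largest power of 2 not above \<open>v powr (1 / \<gamma>)\<close>; it is
      off by a factor of at most 2, which the strict inequalities for \<open>\<gamma>\<close>
      absorb.\<close>
    define L where "L = nat \<lfloor>log 2 v / \<gamma>\<rfloor>"
    have l: "v powr (1 / \<gamma>) = 2 powr (log 2 v / \<gamma>)"
      using elim(4) by (simp add: powr_def log_def)
    have "real l0 + 1 \<le> log 2 v / \<gamma>" using elim(3) unfolding l by (simp add: powr_le_cancel_iff)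
    then have L: "real L \<le> log 2 v / \<gamma>" "log 2 v / \<gamma> - 1 \<le> real L" "l0 \<le> L"
      unfolding L_def by linarith+
    have K: "(2::real) ^ L = 2 powr real L" by (simp add: powr_realpow)
    have Kle: "2 ^ L \<le> v powr (1 / \<gamma>)" unfolding K l using L by (intro powr_mono) auto
    have Kge: "v powr (1 / \<gamma>) / 2 \<le> 2 ^ L"
    proof -
      have "v powr (1 / \<gamma>) / 2 = 2 powr (log 2 v / \<gamma> - 1)" unfolding l by (simp add: powr_diff)
      also have "\<dots> \<le> 2 ^ L" unfolding K using L by (intro powr_mono) auto
      finally show ?thesis .
    qed
    have 1: "2 powr (real L * \<gamma>) \<le> v"
    proof -
      have "2 powr (real L * \<gamma>) = (2 ^ L) powr \<gamma>" unfolding K by (simp add: powr_powr)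
      also have "\<dots> \<le> (v powr (1 / \<gamma>)) powr \<gamma>" using Kle \<gamma> by (intro powr_mono2) auto
      also have "\<dots> = v" using \<gamma> elim(4) by (simp add: powr_powr)
      finally show ?thesis .
    qed
    have 2: "D * v \<le> \<beta> * (2 ^ L * (2 ^ L) powr \<sigma>)"
    proof -
      have "D / \<beta> * 2 powr (1 + \<sigma>) * v \<le> v powr ((1 + \<sigma>) / \<gamma> - 1) * v powr 1" using mult_right_mono[OF elim(2), of v] elim(4) by simp
      also have "\<dots> = (v powr (1 / \<gamma>)) powr (1 + \<sigma>)" unfolding powr_add[symmetric] powr_powr by simp
      finally have "D / \<beta> * v \<le> (v powr (1 / \<gamma>)) powr (1 + \<sigma>) / 2 powr (1 + \<sigma>)" by (simp add: field_simps)
      also have "\<dots> = (v powr (1 / \<gamma>) / 2) powr (1 + \<sigma>)" by (simp add: powr_divide)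
      also have "\<dots> \<le> (2 ^ L) powr (1 + \<sigma>)" using Kge \<sigma> by (intro powr_mono2) auto
      also have "\<dots> = 2 ^ L * (2 ^ L) powr \<sigma>" by (simp add: powr_add)
      finally show ?thesis using \<beta> by (simp add: field_simps)
    qed
    have "v powr (1 - (\<tau> - 1) / \<gamma>) = v powr 1 * (v powr (1 / \<gamma>)) powr (- (\<tau> - 1))"
    proof -
      have "1 - (\<tau> - 1) / \<gamma> = 1 + 1 / \<gamma> * (- (\<tau> - 1))" using \<gamma> by (simp add: field_simps)
      then show ?thesis unfolding powr_add[symmetric] powr_powr by (simp only:)
    qed
    also have "\<dots> \<le> v * tailprob (2 ^ L)"
      unfolding tailprob_def using Kle elim(4) \<tau> by (intro mult_mono powr_mono2') auto
    finally have "p\<^sup>2 * v powr (1 - (\<tau> - 1) / \<gamma>) \<le> p\<^sup>2 * (v * tailprob (2 ^ L))"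
      by (rule mult_left_mono) simp
    then have "p\<^sup>2 * v powr (1 - (\<tau> - 1) / \<gamma>) \<le> v * (tailprob (2 ^ L) * p\<^sup>2)" by (simp only: mult_ac)
    then have "v\<^sup>2 * exp (- (v * (tailprob (2 ^ L) * p\<^sup>2))) \<le> v\<^sup>2 * exp (- (p\<^sup>2 * v powr (1 - (\<tau> - 1) / \<gamma>)))"
      by (intro mult_left_mono) auto
    then have 3: "v\<^sup>2 * exp (- (v * (tailprob (2 ^ L) * p\<^sup>2))) \<le> \<delta>" using elim(1) by linarith
    show ?case using L 1 2 3 unfolding \<gamma>_def by blast
  qed
qed

definition largest :: "real \<Rightarrow> 'w \<times> (nat set \<Rightarrow> real \<times> real) \<Rightarrow> real" where
  "largest h z = real (largest_component_size (edge (pts (fst z)) (snd z)) (gpts (cube h) z))"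

lemma filterlim_volume: "filterlim (\<lambda>h. (2 * h) ^ DIM('a)) at_top (at_top :: real filter)"
proof (rule filterlim_at_top_mono)
  show "filterlim (\<lambda>h::real. h) at_top at_top" by (rule filterlim_ident)
  show "\<forall>\<^sub>F h::real in at_top. h \<le> (2 * h) ^ DIM('a)" using eventually_ge_at_top[of 1]
  proof eventually_elim
    case (elim h)
    then have "1 \<le> 2 * h" by simp
    from self_le_power[OF this, of "DIM('a)"] elim show ?case by simp
  qed
qed

lemma card_big_cube: "real (card {v \<in> gpts (cube h) z. big k (gcomp (cube h) z v)}) = enn2real (count_big k (cube h) (cube h) z)"
proof -
  have "{v \<in> gpts (cube h) z. pts (fst z) v \<in> cube h \<and> big k (gcomp (cube h) z v)} = {v \<in> gpts (cube h) z. big k (gcomp (cube h) z v)}"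
    by (auto simp: points_in_def)
  then show ?thesis unfolding count_big_def by (simp only: enn2real_ncard)
qed

text \<open>The constant \<open>k\<close> of \<open>largest_component_le\<close> is negligible
  against the volume, so the density is at most \<open>\<theta> k\<close> up to a small error, for a
  \<open>k\<close> with \<open>\<theta> k\<close> close to \<open>\<theta>inf\<close>.\<close>

lemma largest_upper:
  assumes \<epsilon>: "0 < \<epsilon>" and \<delta>: "0 < \<delta>"
  shows "\<forall>\<^sub>F h in at_top. measure MQ {z \<in> space MQ. (2 * h) ^ DIM('a) * (\<theta>inf + \<epsilon>) \<le> largest h z} \<le> \<delta>"
proof -
  interpret MQ: prob_space MQ by (rule prob_space_MQ)
  obtain k where k: "\<theta> k < \<theta>inf + \<epsilon> / 3"
    using order_tendstoD(2)[OF \<theta>_tendsto, of "\<theta>inf + \<epsilon> / 3"] \<epsilon> by (auto simp: eventually_sequentially)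
  have "\<forall>\<^sub>F h::real in at_top. 3 * real k / \<epsilon> \<le> (2 * h) ^ DIM('a)"
    using filterlim_volume by (simp add: filterlim_at_top)
  moreover have "\<forall>\<^sub>F h in at_top. measure MQ {z \<in> space MQ. (2 * h) ^ DIM('a) * (\<theta> k + \<epsilon> / 3) \<le> enn2real (count_big k (cube h) (cube h) z)} \<le> \<delta>"
    using \<epsilon> \<delta> by (intro count_upper) auto
  moreover have "\<forall>\<^sub>F h in at_top. (0::real) < h" by (rule eventually_gt_at_top)
  ultimately show ?thesis
  proof eventually_elim
    case (elim h)
    define v where "v = (2 * h) ^ DIM('a)"
    have v: "0 < v" using elim by (simp add: v_def)
    have kv: "real k \<le> v * (\<epsilon> / 3)" using elim(1) \<epsilon> unfolding v_def[symmetric] by (simp add: field_simps)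
    have "MQ.prob {z \<in> space MQ. v * (\<theta>inf + \<epsilon>) \<le> largest h z} \<le> MQ.prob {z \<in> space MQ. v * (\<theta> k + \<epsilon> / 3) \<le> enn2real (count_big k (cube h) (cube h) z)}"
    proof (rule MQ.finite_measure_mono_AE)
      show "{z \<in> space MQ. v * (\<theta> k + \<epsilon> / 3) \<le> enn2real (count_big k (cube h) (cube h) z)} \<in> MQ.events"
        using measurable_count_big_cube[of k h] by measurable
      show "AE z in MQ. z \<in> {z \<in> space MQ. v * (\<theta>inf + \<epsilon>) \<le> largest h z} \<longrightarrow>
          z \<in> {z \<in> space MQ. v * (\<theta> k + \<epsilon> / 3) \<le> enn2real (count_big k (cube h) (cube h) z)}"
        using AE_finite_gpts[OF bounded_cube, of h]
      proof eventually_elim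
        case (elim z)
        have "largest h z \<le> real k + enn2real (count_big k (cube h) (cube h) z)"
          using largest_component_le[OF elim, of "pts (fst z)" "snd z" k]
          unfolding card_big_cube[symmetric] largest_def gcomp_def by linarith
        moreover have "v * \<theta> k \<le> v * (\<theta>inf + \<epsilon> / 3)" using k v by (intro mult_left_mono) auto
        ultimately show ?case using kv by (auto simp: algebra_simps)
      qed
    qed
    then show ?case using elim(2) unfolding v_def by linarith
  qed
qed

lemma measurable_low_count:
  "(\<lambda>z. ncard {v \<in> gpts (cube h) z. big k (gcomp (cube h) z v) \<and> (\<forall>u\<in>gcomp (cube h) z v. mark (snd z) u < K)}) \<in> borel_measurable MQ"
  by (rule measurable_ncard) (simp only: mem_Collect_eq, intro pred_intros_logic(3) pred_points_pair pred_gmarks measurable_big pred_gcomp sets_cube)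

text \<open>The order of the choices matters: first the level \<open>l0\<close>, from the tail of
  the series, then the size \<open>k\<close>, which makes components below that level rare, and
  finally the cube and the hub level \<open>L\<close>.\<close>

lemma largest_lower:
  assumes \<epsilon>: "0 < \<epsilon>" and \<delta>: "0 < \<delta>"
  shows "\<forall>\<^sub>F h in at_top. measure MQ {z \<in> space MQ. largest h z \<le> (2 * h) ^ DIM('a) * (\<theta>inf - \<epsilon>)} \<le> \<delta>"
proof -
  interpret MQ: prob_space MQ by (rule prob_space_MQ)
  interpret Q: prob_space Q by (rule prob_space_Q)
  \<comment> \<open>Two errors of this size amount to
    \<open>\<epsilon> / 2 * (\<delta> / 3)\<close>, which is what Markov's inequality needs for the
    event \<open>?E2\<close>.\<close>
  let ?b = "\<epsilon> * \<delta> / 12"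
  have b: "0 < ?b" using \<epsilon> \<delta> by simp
  \<comment> \<open>The tail of the level series is uniform in \<open>h\<close>, so
    \<open>l0\<close> can be fixed before the cube.\<close>
  obtain l1 where l1: "\<And>n. l1 \<le> n \<Longrightarrow> norm (\<Sum>l. level_bound (l + n)) < ?b"
    using suminf_exist_split[OF b summable_level_bound] by blast
  define l0 where "l0 = Suc l1"
  have l0: "0 < l0" "(\<Sum>l. level_bound (l + l0)) \<le> ?b" using l1[of l0] by (auto simp: l0_def)
  have "1 < (2::real) ^ l0" using l0 by (intro one_less_power) auto
  then have "1 - tailprob (2 ^ l0) < 1" using tailprob(1)[of "2 ^ l0"] by simp
  from real_arch_pow_inv[OF b this] obtain k where k: "(1 - tailprob (2 ^ l0)) ^ k < ?b" by blast
  have D: "0 < real DIM('a) ^ DIM('a)" by simp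
  have "\<forall>\<^sub>F h::real in at_top. \<exists>L\<ge>l0. 2 powr (real L * ((\<tau> + \<sigma>) / 2)) \<le> (2 * h) ^ DIM('a) \<and>
     real DIM('a) ^ DIM('a) * (2 * h) ^ DIM('a) \<le> \<beta> * (2 ^ L * (2 ^ L) powr \<sigma>) \<and>
     ((2 * h) ^ DIM('a))\<^sup>2 * exp (- ((2 * h) ^ DIM('a) * (tailprob (2 ^ L) * p\<^sup>2))) \<le> \<delta> / 3"
    by (rule eventually_compose_filterlim[OF hub_level[OF D] filterlim_volume]) (use \<delta> in simp)
  moreover have "\<forall>\<^sub>F h in at_top. measure MQ {z \<in> space MQ. enn2real (count_big k (cube h) (cube h) z) \<le> (2 * h) ^ DIM('a) * (\<theta> k - \<epsilon> / 2)} \<le> \<delta> / 3"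
    using \<epsilon> \<delta> by (intro count_lower) auto
  moreover have "\<forall>\<^sub>F h in at_top. (0::real) < h" by (rule eventually_gt_at_top)
  ultimately show ?thesis
  proof eventually_elim
    case (elim h)
    define v where "v = (2 * h) ^ DIM('a)"
    have v: "0 < v" using elim by (simp add: v_def)
    obtain L where L: "l0 \<le> L" "2 powr (real L * ((\<tau> + \<sigma>) / 2)) \<le> v" "real DIM('a) ^ DIM('a) * v \<le> \<beta> * (2 ^ L * (2 ^ L) powr \<sigma>)"
      "v\<^sup>2 * exp (- (v * (tailprob (2 ^ L) * p\<^sup>2))) \<le> \<delta> / 3" using elim(1) unfolding v_def by blast
    define Bad where "Bad = (\<lambda>z. {v \<in> gpts (cube h) z. big k (gcomp (cube h) z v) \<and> (\<forall>u\<in>gcomp (cube h) z v. mark (snd z) u < 2 ^ L)})"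
    define Unl where "Unl = (\<lambda>z :: 'w \<times> (nat set \<Rightarrow> real \<times> real). {i \<in> gpts (cube h) z. \<exists>j\<in>gpts (cube h) z. unlinked (2 ^ L) (gpts (cube h) z) (snd z) i j})"
    \<comment> \<open>The three ways to fail: few vertices in large components, many of them in
      components without a hub, or two hubs without a common neighbour. Counts being integers, the
      last event is \<open>ncard \<ge> 1\<close>.\<close>
    let ?E1 = "{z \<in> space MQ. enn2real (count_big k (cube h) (cube h) z) \<le> v * (\<theta> k - \<epsilon> / 2)}"
    let ?E2 = "{z \<in> space MQ. ennreal (v * \<epsilon> / 2) \<le> ncard (Bad z)}"
    let ?E3 = "{z \<in> space MQ. ennreal 1 \<le> ncard (Unl z)}"
    have mBad: "(\<lambda>z. ncard (Bad z)) \<in> borel_measurable MQ" unfolding Bad_def by (rule measurable_low_count)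
    have mUnl: "(\<lambda>z. ncard (Unl z)) \<in> borel_measurable MQ"
    proof (rule measurable_ncard)
      fix i
      have mk: "(\<lambda>z. mark (snd z) u) \<in> borel_measurable MQ" for u by (rule measurable_compose[OF measurable_snd measurable_mark])
      have pk: "Measurable.pred MQ (\<lambda>z. 2 ^ L \<le> mark (snd z) u)" for u using mk by measurable
      have pc: "Measurable.pred MQ (\<lambda>z. snd (snd z s) \<le> p)" for s :: "nat set"
      proof -
        have [measurable]: "(\<lambda>z. snd (snd z s)) \<in> borel_measurable MQ"
          by (rule measurable_compose[OF measurable_snd]) (simp add: Q_def N_def)
        show ?thesis by measurable
      qed
      have pp: "Measurable.pred MQ (\<lambda>z. a \<in> gpts (cube h) z)" for a by (rule pred_points_pair[OF sets_cube])
      have pu: "Measurable.pred MQ (\<lambda>z. unlinked (2 ^ L) (gpts (cube h) z) (snd z) i j)" for j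
      proof -
        have eq: "unlinked (2 ^ L) V \<eta> i j \<longleftrightarrow> i \<noteq> j \<and> 2 ^ L \<le> mark \<eta> i \<and> 2 ^ L \<le> mark \<eta> j \<and>
          (\<forall>h. h \<in> V \<longrightarrow> \<not> (h \<noteq> i \<and> h \<noteq> j \<and> (2 ^ L \<le> mark \<eta> h \<and> snd (\<eta> {i, h}) \<le> p \<and> snd (\<eta> {j, h}) \<le> p)))" for V \<eta>
          by (auto simp: unlinked_def)
        show ?thesis unfolding eq by (intro pred_intros_logic pred_intros_countable pk pc pp) simp_all
      qed
      show "Measurable.pred MQ (\<lambda>z. i \<in> Unl z)"
      proof -
        have eq: "i \<in> Unl z \<longleftrightarrow> i \<in> gpts (cube h) z \<and> (\<exists>j. j \<in> gpts (cube h) z \<and> unlinked (2 ^ L) (gpts (cube h) z) (snd z) i j)" for z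
          by (auto simp: Unl_def)
        show ?thesis unfolding eq by (intro pred_intros_logic(3) pred_intros_countable pp pu)
      qed
    qed
    have E2: "MQ.prob ?E2 \<le> \<delta> / 3"
    proof (rule MQ.prob_ge_le[OF mBad])
      have "(\<integral>\<^sup>+z. ncard (Bad z) \<partial>MQ) \<le> ennreal (v * ((1 - tailprob (2 ^ l0)) ^ k + (\<Sum>l. level_bound (l + l0))))"
        unfolding Bad_def v_def by (rule expected_bad[OF elim(3) L(2)[unfolded v_def] l0(1) L(1)])
      also have "\<dots> \<le> ennreal (v * \<epsilon> / 2 * (\<delta> / 3))"
      proof (rule ennreal_leI)
        have "v * ((1 - tailprob (2 ^ l0)) ^ k + (\<Sum>l. level_bound (l + l0))) \<le> v * (?b + ?b)"
          using k l0 v by (intro mult_left_mono add_mono) auto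
        then show "v * ((1 - tailprob (2 ^ l0)) ^ k + (\<Sum>l. level_bound (l + l0))) \<le> v * \<epsilon> / 2 * (\<delta> / 3)" by (simp add: mult_ac)
      qed
      finally show "(\<integral>\<^sup>+z. ncard (Bad z) \<partial>MQ) \<le> ennreal (v * \<epsilon> / 2 * (\<delta> / 3))" .
    qed (use v \<epsilon> \<delta> in auto)
    have E3: "MQ.prob ?E3 \<le> \<delta> / 3"
    proof (rule MQ.prob_ge_le[OF mUnl])
      have B: "cube h \<in> sets borel" "bounded (cube h :: 'a set)" "0 < measure lborel (cube h :: 'a set)" and mB: "measure lborel (cube h :: 'a set) = v"
        using elim(3) measure_cube[of h, where 'a = 'a] by (simp_all add: v_def)
      have "(\<integral>\<^sup>+z. ncard (Unl z) \<partial>MQ) = (\<integral>\<^sup>+\<omega>. \<integral>\<^sup>+\<eta>. ncard (Unl (\<omega>, \<eta>)) \<partial>Q \<partial>M)"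
        by (rule Q.nn_integral_fst[OF mUnl, symmetric])
      also have "\<dots> \<le> ennreal (v\<^sup>2 * exp (- (v * (tailprob (2 ^ L) * p\<^sup>2))))"
        using expected_unlinked[OF B, of "2 ^ L"] unfolding mB Unl_def by simp
      also have "\<dots> \<le> ennreal (1 * (\<delta> / 3))" using L(4) by (intro ennreal_leI) simp
      finally show "(\<integral>\<^sup>+z. ncard (Unl z) \<partial>MQ) \<le> ennreal (1 * (\<delta> / 3))" .
    qed (use \<delta> in auto)
    have E: "?E1 \<in> MQ.events" "?E2 \<in> MQ.events" "?E3 \<in> MQ.events"
      using measurable_count_big_cube[of k h] mBad mUnl by measurable
    have "AE z in MQ. \<forall>i j. pts (fst z) i = pts (fst z) j \<longrightarrow> i = j" by (rule AE_MQ_fst) (rule AE_simple)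
    with AE_finite_gpts[OF bounded_cube, of h]
    have ae: "AE z in MQ. z \<in> {z \<in> space MQ. largest h z \<le> v * (\<theta>inf - \<epsilon>)} \<longrightarrow> z \<in> ?E1 \<union> ?E2 \<union> ?E3"
    proof eventually_elim
      case (elim z)
      show ?case
      proof (rule impI, rule ccontr)
        assume z: "z \<in> {z \<in> space MQ. largest h z \<le> v * (\<theta>inf - \<epsilon>)}" and n: "z \<notin> ?E1 \<union> ?E2 \<union> ?E3"
        have fin: "finite (Bad z)" "finite (Unl z)"
          unfolding Bad_def Unl_def by (rule finite_subset[OF Collect_restrict elim(1)])+
        have "Unl z = {}"
        proof (rule ccontr)
          assume "Unl z \<noteq> {}"
          then have "1 \<le> card (Unl z)" using fin by (simp add: Suc_le_eq card_gt_0_iff)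
          then have "ennreal 1 \<le> ncard (Unl z)" using fin by (simp add: ncard_finite ennreal_of_nat_eq_real_of_nat)
          then show False using z n by blast
        qed
        then have link: "\<not> (\<exists>i\<in>gpts (cube h) z. \<exists>j\<in>gpts (cube h) z. unlinked (2 ^ L) (gpts (cube h) z) (snd z) i j)" unfolding Unl_def by blast
        have dist: "norm (pts (fst z) i - pts (fst z) j) ^ DIM('a) \<le> \<beta> * (2 ^ L * (2 ^ L) powr \<sigma>)"
          if ij: "i \<in> gpts (cube h) z" "j \<in> gpts (cube h) z" for i j
        proof -
          have "\<bar>(pts (fst z) i - pts (fst z) j) \<bullet> b\<bar> \<le> 2 * h" if "b \<in> Basis" for b
          proof -
            have "\<bar>pts (fst z) i \<bullet> b\<bar> \<le> h" "\<bar>pts (fst z) j \<bullet> b\<bar> \<le> h" using ij that by (auto simp: points_in_def mem_cube)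
            then show ?thesis unfolding inner_diff_left by linarith
          qed
          then have "norm (pts (fst z) i - pts (fst z) j) \<le> real DIM('a) * (2 * h)" by (rule norm_le_DIM)
          then have "norm (pts (fst z) i - pts (fst z) j) ^ DIM('a) \<le> (real DIM('a) * (2 * h)) ^ DIM('a)" by (intro power_mono) auto
          also have "\<dots> = real DIM('a) ^ DIM('a) * v" unfolding v_def by (rule power_mult_distrib)
          finally show ?thesis using L(3) by linarith
        qed
        have "inj_on (pts (fst z)) (gpts (cube h) z)" using elim(2) by (auto intro: inj_onI)
        from largest_component_ge[OF elim(1) this dist _ link, of k]
        have "enn2real (count_big k (cube h) (cube h) z) \<le> largest h z + real (card (Bad z))"
          unfolding card_big_cube[symmetric] largest_def Bad_def gcomp_def by simp
        moreover have "real (card (Bad z)) < v * \<epsilon> / 2"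
        proof -
          have "ncard (Bad z) < ennreal (v * \<epsilon> / 2)" using z n by (auto simp: not_le)
          then show ?thesis using fin v \<epsilon> by (simp add: ncard_finite ennreal_of_nat_eq_real_of_nat ennreal_less_iff)
        qed
        moreover have "v * \<theta>inf \<le> v * \<theta> k" using v \<theta>_ge by (intro mult_left_mono) auto
        moreover have "largest h z \<le> v * (\<theta>inf - \<epsilon>)" using z by simp
        moreover have "\<not> enn2real (count_big k (cube h) (cube h) z) \<le> v * (\<theta> k - \<epsilon> / 2)" using z n by blast
        ultimately show False by (simp add: algebra_simps)
      qed
    qed
    have "MQ.prob {z \<in> space MQ. largest h z \<le> v * (\<theta>inf - \<epsilon>)} \<le> MQ.prob (?E1 \<union> ?E2 \<union> ?E3)"
      by (rule MQ.finite_measure_mono_AE[OF ae]) (intro sets.Un E)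
    also have "\<dots> \<le> MQ.prob ?E1 + MQ.prob ?E2 + MQ.prob ?E3"
      by (intro order_trans[OF measure_Un_le] add_right_mono measure_Un_le sets.Un E)
    also have "\<dots> \<le> \<delta>" using E2 E3 elim(2)[folded v_def] by linarith
    finally show ?case unfolding v_def .
  qed
qed

theorem largest_converges:
  assumes \<epsilon>: "0 < \<epsilon>"
  shows "((\<lambda>h. measure MQ {z \<in> space MQ. \<bar>largest h z / (2 * h) ^ DIM('a) - \<theta>inf\<bar> > \<epsilon>}) \<longlongrightarrow> 0) at_top"
proof (rule tendstoI)
  interpret MQ: prob_space MQ by (rule prob_space_MQ)
  fix e :: real assume e: "0 < e"
  then have "0 < e / 3" by simp
  note largest_upper[OF \<epsilon> this] largest_lower[OF \<epsilon> this]
  moreover have "\<forall>\<^sub>F h in at_top. (0::real) < h" by (rule eventually_gt_at_top)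
  ultimately show "\<forall>\<^sub>F h in at_top. dist (measure MQ {z \<in> space MQ. \<bar>largest h z / (2 * h) ^ DIM('a) - \<theta>inf\<bar> > \<epsilon>}) 0 < e"
  proof eventually_elim
    case (elim h)
    define v where "v = (2 * h) ^ DIM('a)"
    have v: "0 < v" using elim by (simp add: v_def)
    have "largest h \<in> borel_measurable MQ"
    proof -
      have "(\<lambda>z. largest_component_size (edge (pts (fst z)) (snd z)) (gpts (cube h) z)) \<in> measurable MQ (count_space UNIV)"
        by (intro measurable_largest_component_size pred_edge measurable_pts_pair measurable_snd pred_points_pair sets_cube)
      then show ?thesis unfolding largest_def[abs_def] by (rule measurable_compose) simp
    qed
    then have E: "{z \<in> space MQ. v * (\<theta>inf + \<epsilon>) \<le> largest h z} \<in> MQ.events" "{z \<in> space MQ. largest h z \<le> v * (\<theta>inf - \<epsilon>)} \<in> MQ.events"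
      by measurable
    have "MQ.prob {z \<in> space MQ. \<bar>largest h z / v - \<theta>inf\<bar> > \<epsilon>} \<le> MQ.prob ({z \<in> space MQ. v * (\<theta>inf + \<epsilon>) \<le> largest h z} \<union> {z \<in> space MQ. largest h z \<le> v * (\<theta>inf - \<epsilon>)})"
    proof (rule MQ.finite_measure_mono)
      show "{z \<in> space MQ. \<bar>largest h z / v - \<theta>inf\<bar> > \<epsilon>} \<subseteq> {z \<in> space MQ. v * (\<theta>inf + \<epsilon>) \<le> largest h z} \<union> {z \<in> space MQ. largest h z \<le> v * (\<theta>inf - \<epsilon>)}"
        using v by (auto simp: abs_if field_simps split: if_splits)
    qed (intro sets.Un E)
    also have "\<dots> \<le> MQ.prob {z \<in> space MQ. v * (\<theta>inf + \<epsilon>) \<le> largest h z} + MQ.prob {z \<in> space MQ. largest h z \<le> v * (\<theta>inf - \<epsilon>)}"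
      by (rule measure_Un_le[OF E])
    also have "\<dots> \<le> e / 3 + e / 3" using elim(1,2) unfolding v_def by (rule add_mono)
    finally show ?case using e unfolding v_def by simp
  qed
qed

end

section \<open>From the model to an arbitrary spatial random graph\<close>

lemma nn_integral_distr':
  assumes "T \<in> measurable M K" "f \<in> borel_measurable K"
  shows "integral\<^sup>N (distr M K T) f = (\<integral>\<^sup>+x. f (T x) \<partial>M)"
  by (rule nn_integral_distr) (use assms in simp_all)

section \<open>Edge probabilities in the constructed model\<close>

context random_graph_model
begin

lemma marks_law: "distr Q (PiM UNIV (\<lambda>_. borel)) (\<lambda>\<eta> i. mark \<eta> i) = PiM (UNIV :: nat set) (\<lambda>_. \<mu>)"
proof -
  interpret U: prob_space unif01 by (rule prob_space_unif01)
  have fst: "fst \<in> measurable N borel" unfolding N_def using measurable_fst[of \<mu> unif01] by (simp cong: measurable_cong_sets)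
  have "distr N borel fst = \<mu>"
  proof (rule measure_eqI)
    fix A assume "A \<in> sets (distr N borel fst)"
    then have A: "A \<in> sets \<mu>" by simp
    have "fst -` A \<inter> space N = A \<times> space unif01" by (auto simp: space_N)
    then have "emeasure (distr N borel fst) A = emeasure N (A \<times> space unif01)" using A by (simp add: emeasure_distr[OF fst])
    also have "\<dots> = emeasure \<mu> A"
      unfolding N_def using U.emeasure_pair_measure_Times[OF A sets.top] U.emeasure_space_1 by simp
    finally show "emeasure (distr N borel fst) A = emeasure \<mu> A" .
  qed simp
  then show ?thesis unfolding Q_def mark_def
    using PiM_UNIV_distr[OF prob_space_N fst, of "\<lambda>i::nat. {i}"] by simp
qed

lemma AE_marks_ge_1: "AE \<eta> in Q. \<forall>i. 1 \<le> mark \<eta> i"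
proof (subst AE_all_countable, rule allI)
  fix i
  interpret N: prob_space N by (rule prob_space_N)
  have "emeasure N {a. 1 \<le> fst a} = 1"
    using nn_integral_N_mark[of 1] sets_N_mark[of 1] by (simp add: tailprob_def)
  then have "AE a in N. a \<in> {a. 1 \<le> fst a}" using sets_N_mark[of 1] by (intro N.AE_prob_1) (simp add: measure_def)
  then have "AE \<eta> in Q. \<eta> {i} \<in> {a. 1 \<le> fst a}" unfolding Q_def by (intro AE_PiM_component prob_space_N) auto
  then show "AE \<eta> in Q. 1 \<le> mark \<eta> i" by (simp add: mark_def)
qed

lemma cp_bounds: "0 \<le> connection_prob \<alpha> \<beta> p \<sigma> (x :: 'a) w y w'" "(\<And>i. 1 \<le> mark \<eta> i) \<Longrightarrow> cp x' \<eta> i j \<le> 1"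
proof -
  show "0 \<le> connection_prob \<alpha> \<beta> p \<sigma> x w y w'" unfolding connection_prob_def using p profile_bounds(1) by simp
  assume m: "\<And>i. 1 \<le> mark \<eta> i"
  have "0 \<le> \<beta> * kernel \<sigma> (mark \<eta> i) (mark \<eta> j) / norm (x' i - x' j) ^ DIM('a)"
    unfolding kernel_def using \<beta> m[of i] by (intro divide_nonneg_nonneg mult_nonneg_nonneg) auto
  then have "profile \<alpha> (\<beta> * kernel \<sigma> (mark \<eta> i) (mark \<eta> j) / norm (x' i - x' j) ^ DIM('a)) \<le> 1" by (rule profile_bounds(2))
  from mult_mono[OF p(2) this] show "cp x' \<eta> i j \<le> 1" unfolding cp_def connection_prob_def using p profile_bounds(1) by simp
qed

lemma emeasure_N_coin: "0 \<le> c \<Longrightarrow> c \<le> 1 \<Longrightarrow> emeasure N {a. snd a \<le> c} = ennreal c"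
  and sets_N_coin': "{a. snd a \<le> c} \<in> sets N"
proof -
  interpret \<mu>: prob_space \<mu> by (rule prob_space_\<mu>)
  interpret U: prob_space unif01 by (rule prob_space_unif01)
  have eq: "{a. snd a \<le> c} = space \<mu> \<times> {..c}" by auto
  have U: "{..c} \<in> sets unif01" by (simp add: unif01_def)
  show "{a. snd a \<le> c} \<in> sets N" unfolding eq N_def by (rule pair_measureI[OF sets.top U])
  assume "0 \<le> c" "c \<le> 1"
  then show "emeasure N {a. snd a \<le> c} = ennreal c"
    unfolding eq N_def U.emeasure_pair_measure_Times[OF sets.top U] by (simp only: \<mu>.emeasure_space_1 emeasure_unif01_atMost mult_1_left)
qed

text \<open>The singleton coordinates, which carry the marks, are frozen; given them the edges of
  \<open>S\<close> are decided by independent uniform variables on different pairs, so the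
  conditional probability is a product.\<close>

lemma prob_edges:
  fixes x :: "nat \<Rightarrow> 'a"
  assumes S: "finite S" "S \<subseteq> {(i, j). i < j}"
  shows "(\<integral>\<^sup>+\<eta>. indicator {\<eta>. \<forall>(i, j)\<in>S. edge x \<eta> i j} \<eta> \<partial>Q) =
    (\<integral>\<^sup>+w. (\<Prod>(i, j)\<in>S. ennreal (connection_prob \<alpha> \<beta> p \<sigma> (x i) (w i) (x j) (w j))) \<partial>PiM UNIV (\<lambda>_. \<mu>))"
proof -
  define J where "J = (\<lambda>(i, j). {i, j}) ` S"
  \<comment> \<open>The coordinates that carry marks; integrating the others first is conditioning
    on the marks.\<close>
  define Sg where "Sg = {s :: nat set. \<exists>i. s = {i}}"
  \<comment> \<open>Ordered pairs with \<open>i < j\<close> are recovered from their sets by minimum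
    and maximum, so different edges have different coins.\<close>
  have inj: "inj_on (\<lambda>(i, j). {i, j}) S" 
  proof (rule inj_on_inverseI[where g = "\<lambda>s. (Min s, Max s)"])
    fix e assume "e \<in> S"
    then obtain i j where "e = (i, j)" "i < j" using S(2) by auto
    then show "(Min ((\<lambda>(i, j). {i, j}) e), Max ((\<lambda>(i, j). {i, j}) e)) = e" by (simp add: min_def max_def)
  qed
  have pe: "Measurable.pred Q (\<lambda>\<eta>. edge x \<eta> i j)" for i j by (rule pred_edge) auto
  have "Measurable.pred Q (\<lambda>\<eta>. \<forall>e\<in>S. edge x \<eta> (fst e) (snd e))" by (intro pred_intros_finite(3) S(1) pe)
  then have "{\<eta> \<in> space Q. \<forall>e\<in>S. edge x \<eta> (fst e) (snd e)} \<in> sets Q" by (simp only: pred_def)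
  then have mI: "(\<lambda>\<eta>. indicator {\<eta>. \<forall>(i, j)\<in>S. edge x \<eta> i j} \<eta> :: ennreal) \<in> borel_measurable Q"
    by (intro borel_measurable_indicator) (simp add: split_beta)
  have inner: "(\<integral>\<^sup>+\<eta>'. indicator {\<eta>. \<forall>(i, j)\<in>S. edge x \<eta> i j} (\<lambda>s. if s \<in> Sg then \<eta> s else \<eta>' s) \<partial>Q) = (\<Prod>(i, j)\<in>S. ennreal (cp x \<eta> i j))"
    if m: "\<forall>i. 1 \<le> mark \<eta> i" for \<eta>
  proof -
    let ?A = "\<lambda>s. {a :: real \<times> real. snd a \<le> cp x \<eta> (Min s) (Max s)}"
    have A: "?A s \<in> sets N" for s by (rule sets_N_coin')
    have e: "edge x (\<lambda>s. if s \<in> Sg then \<eta> s else \<eta>' s) i j \<longleftrightarrow> \<eta>' {i, j} \<in> ?A {i, j}" if "i < j" for i j \<eta>'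
    proof -
      have "{i, j} \<notin> Sg" "{i} \<in> Sg" "{j} \<in> Sg" using that by (auto simp: Sg_def doubleton_eq_iff)
      moreover have "Min {i, j} = i" "Max {i, j} = j" using that by (auto simp: min_def max_def)
      ultimately show ?thesis using that by (simp add: edge_def cp_def mark_def)
    qed
    have eq: "{\<eta>'. \<forall>(i, j)\<in>S. edge x (\<lambda>s. if s \<in> Sg then \<eta> s else \<eta>' s) i j} = {\<eta>' \<in> space (PiM UNIV (\<lambda>_. N)). \<forall>s\<in>J. \<eta>' s \<in> ?A s}"
    proof -
      have "(\<forall>(i, j)\<in>S. edge x (\<lambda>s. if s \<in> Sg then \<eta> s else \<eta>' s) i j) \<longleftrightarrow> (\<forall>s\<in>J. \<eta>' s \<in> ?A s)" for \<eta>'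
      proof -
        have "(\<forall>(i, j)\<in>S. edge x (\<lambda>s. if s \<in> Sg then \<eta> s else \<eta>' s) i j) \<longleftrightarrow> (\<forall>e\<in>S. edge x (\<lambda>s. if s \<in> Sg then \<eta> s else \<eta>' s) (fst e) (snd e))" by auto
        also have "\<dots> \<longleftrightarrow> (\<forall>e\<in>S. \<eta>' {fst e, snd e} \<in> ?A {fst e, snd e})"
          by (rule ball_cong[OF refl], rule e) (use S(2) in auto)
        also have "\<dots> \<longleftrightarrow> (\<forall>s\<in>J. \<eta>' s \<in> ?A s)" unfolding J_def by (simp add: split_beta)
        finally show ?thesis .
      qed
      then show ?thesis by (simp add: space_PiM)
    qed
    have sets: "{\<eta>' \<in> space (PiM UNIV (\<lambda>_. N)). \<forall>s\<in>J. \<eta>' s \<in> ?A s} \<in> sets (PiM UNIV (\<lambda>_. N))"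
    proof -
      have "Measurable.pred (PiM UNIV (\<lambda>_. N)) (\<lambda>\<eta>'. \<eta>' s \<in> ?A s)" for s :: "nat set"
        by (rule pred_sets2[OF A]) simp
      then have "Measurable.pred (PiM UNIV (\<lambda>_. N)) (\<lambda>\<eta>'. \<forall>s\<in>J. \<eta>' s \<in> ?A s)"
        unfolding J_def by (intro pred_intros_finite(3) finite_imageI S(1))
      then show ?thesis by (simp only: pred_def)
    qed
    have "(\<integral>\<^sup>+\<eta>'. indicator {\<eta>. \<forall>(i, j)\<in>S. edge x \<eta> i j} (\<lambda>s. if s \<in> Sg then \<eta> s else \<eta>' s) \<partial>Q) =
      (\<integral>\<^sup>+\<eta>'. indicator {\<eta>'. \<forall>(i, j)\<in>S. edge x (\<lambda>s. if s \<in> Sg then \<eta> s else \<eta>' s) i j} \<eta>' \<partial>Q)"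
      unfolding indicator_def by (simp only: mem_Collect_eq)
    also have "\<dots> = emeasure Q {\<eta>' \<in> space (PiM UNIV (\<lambda>_. N)). \<forall>s\<in>J. \<eta>' s \<in> ?A s}"
      unfolding eq by (rule nn_integral_indicator) (simp only: Q_def sets)
    also have "\<dots> = (\<Prod>s\<in>J. emeasure N (?A s))"
      unfolding Q_def by (rule emeasure_PiM_UNIV_Collect[OF prob_space_N _ A]) (simp add: J_def S(1))
    also have "\<dots> = (\<Prod>s\<in>J. ennreal (cp x \<eta> (Min s) (Max s)))"
    proof (rule prod.cong[OF refl], rule emeasure_N_coin)
      fix s
      show "0 \<le> cp x \<eta> (Min s) (Max s)" unfolding cp_def by (rule cp_bounds(1))
      show "cp x \<eta> (Min s) (Max s) \<le> 1" by (rule cp_bounds(2)) (use m in blast)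
    qed
    also have "\<dots> = (\<Prod>(i, j)\<in>S. ennreal (cp x \<eta> i j))"
      unfolding J_def prod.reindex[OF inj]
    proof (rule prod.cong[OF refl])
      fix e assume "e \<in> S"
      then obtain i j where "e = (i, j)" "i < j" using S(2) by auto
      then show "((\<lambda>s. ennreal (cp x \<eta> (Min s) (Max s))) \<circ> (\<lambda>(i, j). {i, j})) e = (case e of (i, j) \<Rightarrow> ennreal (cp x \<eta> i j))"
        by (simp add: min_def max_def)
    qed
    finally show ?thesis .
  qed
  have mprod: "(\<lambda>w. \<Prod>(i, j)\<in>S. ennreal (connection_prob \<alpha> \<beta> p \<sigma> (x i) (w i) (x j) (w j))) \<in> borel_measurable (PiM UNIV (\<lambda>_. borel))"
  proof (rule borel_measurable_prod_ennreal)
    fix e :: "nat \<times> nat"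
    obtain i j where e: "e = (i, j)" by (cases e)
    have c: "(\<lambda>w. w i) \<in> borel_measurable (PiM UNIV (\<lambda>_. borel :: real measure))" for i :: nat by simp
    have "(\<lambda>w. connection_prob \<alpha> \<beta> p \<sigma> (x i) (w i) (x j) (w j)) \<in> borel_measurable (PiM UNIV (\<lambda>_. borel))"
      by (rule measurable_connection_prob[OF borel_measurable_const c borel_measurable_const c])
    from measurable_compose[OF this measurable_ennreal]
    show "(\<lambda>w. case e of (i, j) \<Rightarrow> ennreal (connection_prob \<alpha> \<beta> p \<sigma> (x i) (w i) (x j) (w j))) \<in> borel_measurable (PiM UNIV (\<lambda>_. borel))"
      unfolding e prod.case .
  qed
  have mm: "(\<lambda>\<eta> i. mark \<eta> i) \<in> measurable Q (PiM (UNIV :: nat set) (\<lambda>_. borel))"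
    by (rule measurable_PiM_UNIV) (rule measurable_mark)
  have "(\<integral>\<^sup>+\<eta>. indicator {\<eta>. \<forall>(i, j)\<in>S. edge x \<eta> i j} \<eta> \<partial>Q) =
    (\<integral>\<^sup>+\<eta>. \<integral>\<^sup>+\<eta>'. indicator {\<eta>. \<forall>(i, j)\<in>S. edge x \<eta> i j} (\<lambda>s. if s \<in> Sg then \<eta> s else \<eta>' s) \<partial>Q \<partial>Q)"
    using nn_integral_PiM_merge[OF prob_space_N mI[unfolded Q_def], of Sg] unfolding Q_def .
  also have "\<dots> = (\<integral>\<^sup>+\<eta>. (\<Prod>(i, j)\<in>S. ennreal (cp x \<eta> i j)) \<partial>Q)"
    by (rule nn_integral_cong_AE) (rule AE_mp[OF AE_marks_ge_1 AE_I2], rule impI, erule inner)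
  also have "\<dots> = (\<integral>\<^sup>+w. (\<Prod>(i, j)\<in>S. ennreal (connection_prob \<alpha> \<beta> p \<sigma> (x i) (w i) (x j) (w j))) \<partial>PiM UNIV (\<lambda>_. \<mu>))"
    unfolding marks_law[symmetric]
    by (subst nn_integral_distr'[OF mm mprod]) (simp only: cp_def)
  finally show ?thesis .
qed

end

section \<open>Joint law of locations, marks and edges of the given graph\<close>

locale kernel_graph = spatial_random_graph M \<alpha> \<beta> p \<sigma> \<tau> X W E
  for M :: "'w measure" and \<alpha> :: ereal and \<beta> p \<sigma> \<tau> :: real
    and X :: "nat \<Rightarrow> 'w \<Rightarrow> 'a::euclidean_space" and W :: "nat \<Rightarrow> 'w \<Rightarrow> real" and E :: "nat \<Rightarrow> nat \<Rightarrow> 'w \<Rightarrow> bool" +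
  assumes params: "1 < \<alpha>" "0 < \<beta>" "0 < p" "p \<le> 1" "0 < \<sigma>" "2 < \<tau>" "\<tau> < 2 + \<sigma>"
begin

definition \<mu> :: "real measure" where
  "\<mu> = distr M borel (W 0)"

lemma measurable_W [measurable]: "W i \<in> borel_measurable M"
  using marks_indep unfolding indep_vars_def by simp

text \<open>The tail at 1 already has full mass, so the probabilities of all closed upper rays are
  determined, and these generate the Borel sets.\<close>

lemma law_W: "distr M borel (W i) = \<mu>"
proof -
  have pr: "prob {\<omega> \<in> space M. w \<le> W i \<omega>} = (if 1 \<le> w then w powr (- (\<tau> - 1)) else 1)" for i w
  proof (cases "1 \<le> w")
    case False
    have "prob {\<omega> \<in> space M. 1 \<le> W i \<omega>} \<le> prob {\<omega> \<in> space M. w \<le> W i \<omega>}"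
      using False by (intro finite_measure_mono) auto
    then show ?thesis using False marks_law[of 1 i] prob_le_1[of "{\<omega> \<in> space M. w \<le> W i \<omega>}"] by simp
  qed (simp add: marks_law)
  have em: "emeasure (distr M borel (W i)) {w..} = ennreal (if 1 \<le> w then w powr (- (\<tau> - 1)) else 1)" for i w
  proof -
    have "W i -` {w..} \<inter> space M = {\<omega> \<in> space M. w \<le> W i \<omega>}" by auto
    then show ?thesis by (simp add: emeasure_distr emeasure_eq_measure pr del: ennreal_eq_0_iff)
  qed
  have gen: "sets (borel :: real measure) = sigma_sets UNIV (range (\<lambda>w. {w..}))"
    by (subst borel_Ici) (simp add: sets_measure_of)
  show ?thesis unfolding \<mu>_def
  proof (rule measure_eqI_generator_eq[where E = "range (\<lambda>w. {w..})" and \<Omega> = UNIV and A = "\<lambda>n. {- real n..}"])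
    show "Int_stable (range (\<lambda>w::real. {w..}))" 
    proof (rule Int_stableI)
      fix a b :: "real set" assume "a \<in> range (\<lambda>w. {w..})" "b \<in> range (\<lambda>w. {w..})"
      then obtain u v where "a = {u..}" "b = {v..}" by blast
      then have "a \<inter> b = {max u v..}" by auto
      then show "a \<inter> b \<in> range (\<lambda>w. {w..})" by blast
    qed
    show "(\<Union>n. {- real n..}) = UNIV"
    proof (intro set_eqI iffI UNIV_I)
      fix y :: real
      obtain n :: nat where "- y \<le> real n" using real_arch_simple by blast
      then show "y \<in> (\<Union>n. {- real n..})" by (auto intro!: exI[of _ n])
    qed
    show "emeasure (distr M borel (W i)) A = emeasure (distr M borel (W 0)) A" if "A \<in> range (\<lambda>w. {w..})" for A
      using that by (auto simp only: em)
    show "emeasure (distr M borel (W i)) {- real n..} \<noteq> \<infinity>" for n by (simp add: em)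
  qed (use gen in auto)
qed

lemma model: "random_graph_model M X \<alpha> \<beta> p \<sigma> \<tau> \<mu>"
proof (intro random_graph_model.intro random_graph_model_axioms.intro poisson_process.intro poisson_process_axioms.intro params locations prob_space_axioms)
  show "prob_space \<mu>" unfolding \<mu>_def by (rule prob_space_distr) measurable
  show "sets \<mu> = sets borel" by (simp add: \<mu>_def)
  fix w :: real assume w: "1 \<le> w"
  have "W 0 -` {w..} \<inter> space M = {\<omega> \<in> space M. w \<le> W 0 \<omega>}" by auto
  then show "measure \<mu> {w..} = w powr (- (\<tau> - 1))" unfolding \<mu>_def by (simp add: measure_distr marks_law[OF w])
qed

sublocale G: random_graph_model M X \<alpha> \<beta> p \<sigma> \<tau> \<mu> by (rule model)

abbreviation PX :: "(nat \<Rightarrow> 'a) measure" where "PX \<equiv> PiM UNIV (\<lambda>_. borel)"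
abbreviation PW :: "(nat \<Rightarrow> real) measure" where "PW \<equiv> PiM UNIV (\<lambda>_. borel)"
abbreviation PE :: "(nat \<times> nat \<Rightarrow> bool) measure" where "PE \<equiv> PiM UNIV (\<lambda>_. count_space UNIV)"

lemma measurable_locations: "(\<lambda>\<omega> i. X i \<omega>) \<in> measurable M PX"
  by (rule measurable_PiM_UNIV) (rule G.measurable_point)

lemma measurable_marks: "(\<lambda>\<omega> i. W i \<omega>) \<in> measurable M PW"
  by (rule measurable_PiM_UNIV) (rule measurable_W)

lemma law_marks: "distr M PW (\<lambda>\<omega> i. W i \<omega>) = PiM UNIV (\<lambda>_. \<mu>)"
  using marks_indep indep_vars_iff_distr_eq_PiM[of "UNIV :: nat set" W "\<lambda>_. borel"] by (simp add: law_W restrict_UNIV)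

lemma law_locations_marks:
  "distr M (PX \<Otimes>\<^sub>M PW) (\<lambda>\<omega>. (\<lambda>i. X i \<omega>, \<lambda>i. W i \<omega>)) = distr M PX (\<lambda>\<omega> i. X i \<omega>) \<Otimes>\<^sub>M PiM UNIV (\<lambda>_. \<mu>)"
proof -
  interpret LX: prob_space "distr M PX (\<lambda>\<omega> i. X i \<omega>)" by (rule prob_space_distr[OF measurable_locations])
  interpret LW: prob_space "distr M PW (\<lambda>\<omega> i. W i \<omega>)" by (rule prob_space_distr[OF measurable_marks])
  have V: "(\<lambda>\<omega>. (\<lambda>i. X i \<omega>, \<lambda>i. W i \<omega>)) \<in> measurable M (PX \<Otimes>\<^sub>M PW)"
    by (intro measurable_Pair measurable_locations measurable_marks)
  have "distr M PX (\<lambda>\<omega> i. X i \<omega>) \<Otimes>\<^sub>M distr M PW (\<lambda>\<omega> i. W i \<omega>) = distr M (PX \<Otimes>\<^sub>M PW) (\<lambda>\<omega>. (\<lambda>i. X i \<omega>, \<lambda>i. W i \<omega>))"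
  proof (rule pair_measure_eqI)
    show "sets (distr M PX (\<lambda>\<omega> i. X i \<omega>) \<Otimes>\<^sub>M distr M PW (\<lambda>\<omega> i. W i \<omega>)) = sets (distr M (PX \<Otimes>\<^sub>M PW) (\<lambda>\<omega>. (\<lambda>i. X i \<omega>, \<lambda>i. W i \<omega>)))"
      unfolding sets_distr by (intro sets_pair_measure_cong sets_distr)
    fix A B assume "A \<in> sets (distr M PX (\<lambda>\<omega> i. X i \<omega>))" "B \<in> sets (distr M PW (\<lambda>\<omega> i. W i \<omega>))"
    then have A: "A \<in> sets PX" and B: "B \<in> sets PW" by simp_all
    let ?A = "(\<lambda>\<omega> i. X i \<omega>) -` A \<inter> space M" and ?B = "(\<lambda>\<omega> i. W i \<omega>) -` B \<inter> space M"
    have "prob (?A \<inter> ?B) = prob ?A * prob ?B"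
      by (rule indep_setD[OF marks_indep_locations]) (auto simp: sets_vimage_algebra2 space_PiM intro: A B)
    moreover have "(\<lambda>\<omega>. (\<lambda>i. X i \<omega>, \<lambda>i. W i \<omega>)) -` (A \<times> B) \<inter> space M = ?A \<inter> ?B" by auto
    ultimately show "emeasure (distr M PX (\<lambda>\<omega> i. X i \<omega>)) A * emeasure (distr M PW (\<lambda>\<omega> i. W i \<omega>)) B =
      emeasure (distr M (PX \<Otimes>\<^sub>M PW) (\<lambda>\<omega>. (\<lambda>i. X i \<omega>, \<lambda>i. W i \<omega>))) (A \<times> B)"
      using emeasure_distr[OF measurable_locations A] emeasure_distr[OF measurable_marks B] emeasure_distr[OF V pair_measureI[OF A B]]
      by (simp only: emeasure_eq_measure ennreal_mult measure_nonneg)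
  qed (rule LX.sigma_finite_measure_axioms LW.sigma_finite_measure_axioms)+
  then show ?thesis unfolding law_marks by (rule sym)
qed

lemma measurable_E: "Measurable.pred M (\<lambda>\<omega>. E i j \<omega>)"
  using edge_measurable by (simp only: pred_def)

text \<open>The location event belongs to the conditioning \<open>\<sigma>\<close>-algebra, so the
  defining property of the conditional expectation replaces the edge event by the product of
  connection probabilities. The marks are then integrated out as an independent i.i.d.
  family.\<close>

lemma joint_edge_prob:
  assumes S: "finite S" "S \<subseteq> {(i, j). i < j}" and A: "A \<in> sets PX"
  shows "emeasure M {\<omega> \<in> space M. (\<lambda>i. X i \<omega>) \<in> A \<and> (\<forall>(i, j)\<in>S. E i j \<omega>)} =
    (\<integral>\<^sup>+\<omega>. \<integral>\<^sup>+w. indicator A (\<lambda>i. X i \<omega>) *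
      (\<Prod>(i, j)\<in>S. ennreal (connection_prob \<alpha> \<beta> p \<sigma> (X i \<omega>) (w i) (X j \<omega>) (w j))) \<partial>PiM UNIV (\<lambda>_. \<mu>) \<partial>M)"
proof -
  let ?V = "\<lambda>\<omega>. (\<lambda>i. X i \<omega>, \<lambda>i. W i \<omega>)"
  let ?c = "\<lambda>x w. \<lambda>(i, j). connection_prob \<alpha> \<beta> p \<sigma> (x i :: 'a) (w i) (x j) (w j)"
  define F where "F = vimage_algebra (space M) ?V (PX \<Otimes>\<^sub>M PW)"
  define I where "I = {\<omega> \<in> space M. \<forall>(i, j)\<in>S. E i j \<omega>}"
  define B where "B = {\<omega> \<in> space M. (\<lambda>i. X i \<omega>) \<in> A}"
  define g where "g = (\<lambda>z :: (nat \<Rightarrow> 'a) \<times> (nat \<Rightarrow> real). indicator A (fst z) * (\<Prod>e\<in>S. ennreal (?c (fst z) (snd z) e)))"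
  have V: "?V \<in> measurable M (PX \<Otimes>\<^sub>M PW)" by (intro measurable_Pair measurable_locations measurable_marks)
  have setsF: "sets F = {?V -` C \<inter> space M | C. C \<in> sets (PX \<Otimes>\<^sub>M PW)}"
    unfolding F_def by (rule sets_vimage_algebra2) (use measurable_space[OF V] in auto)
  have sub: "subalgebra M F" unfolding subalgebra_def
  proof (intro conjI subsetI)
    show "space F = space M" by (simp add: F_def)
    show "C \<in> events" if "C \<in> sets F" for C using that measurable_sets[OF V] unfolding setsF by auto
  qed
  interpret F: finite_measure_subalgebra M F by unfold_locales (rule sub)
  have "Measurable.pred M (\<lambda>\<omega>. \<forall>e\<in>S. E (fst e) (snd e) \<omega>)" by (intro pred_intros_finite(3) S(1) measurable_E)
  moreover have "I = {\<omega> \<in> space M. \<forall>e\<in>S. E (fst e) (snd e) \<omega>}" unfolding I_def by auto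
  ultimately have I: "I \<in> events" by (simp only: pred_def)
  have BF: "B \<in> sets F"
  proof -
    have "B = ?V -` (A \<times> space PW) \<inter> space M" by (auto simp: B_def space_PiM)
    then show ?thesis unfolding setsF using pair_measureI[OF A sets.top[of PW]] by blast
  qed
  then have B: "B \<in> events" using sub by (auto simp: subalgebra_def)
  have iI: "integrable M (indicator I :: _ \<Rightarrow> real)" by (rule integrable_real_indicator[OF I]) (simp add: emeasure_eq_measure)
  have cond: "AE \<omega> in M. real_cond_exp M F (indicator I) \<omega> = (\<Prod>e\<in>S. ?c (\<lambda>i. X i \<omega>) (\<lambda>i. W i \<omega>) e)"
    unfolding F_def I_def by (rule edges_given_vertices[OF S])
  have c0: "0 \<le> ?c x w e" for x w e by (cases e) (simp add: G.cp_bounds(1))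
  have gV: "(\<integral>\<^sup>+\<omega>. g (?V \<omega>) \<partial>M) = (\<integral>\<^sup>+z. g z \<partial>distr M (PX \<Otimes>\<^sub>M PW) ?V)"
    and gL: "(\<integral>\<^sup>+z. g z \<partial>(distr M PX (\<lambda>\<omega> i. X i \<omega>) \<Otimes>\<^sub>M PiM UNIV (\<lambda>_. \<mu>))) = (\<integral>\<^sup>+\<omega>. \<integral>\<^sup>+w. g (\<lambda>i. X i \<omega>, w) \<partial>PiM UNIV (\<lambda>_. \<mu>) \<partial>M)"
  proof -
    have x: "(\<lambda>z. fst z i) \<in> borel_measurable (PX \<Otimes>\<^sub>M PW)" for i by (rule measurable_compose[OF measurable_fst]) simp
    have w: "(\<lambda>z. snd z i) \<in> borel_measurable (PX \<Otimes>\<^sub>M PW)" for i by (rule measurable_compose[OF measurable_snd]) simp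
    have "(\<lambda>z. ennreal (?c (fst z) (snd z) e)) \<in> borel_measurable (PX \<Otimes>\<^sub>M PW)" for e
    proof (cases e)
      case (Pair i j)
      show ?thesis unfolding Pair prod.case
        by (rule measurable_compose[OF G.measurable_connection_prob[OF x w x w] measurable_ennreal])
    qed
    then have g: "g \<in> borel_measurable (PX \<Otimes>\<^sub>M PW)"
      unfolding g_def by (intro borel_measurable_times_ennreal borel_measurable_prod_ennreal measurable_compose[OF measurable_fst borel_measurable_indicator[OF A]])
    show "(\<integral>\<^sup>+\<omega>. g (?V \<omega>) \<partial>M) = (\<integral>\<^sup>+z. g z \<partial>distr M (PX \<Otimes>\<^sub>M PW) ?V)"
      by (rule nn_integral_distr'[OF V g, symmetric])
    interpret L: prob_space "PiM (UNIV :: nat set) (\<lambda>_. \<mu>)" by (intro prob_space_PiM G.prob_space_\<mu>)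
    have cong: "sets (distr M PX (\<lambda>\<omega> i. X i \<omega>) \<Otimes>\<^sub>M PiM UNIV (\<lambda>_. \<mu>)) = sets (PX \<Otimes>\<^sub>M PW)"
      by (intro sets_pair_measure_cong sets_PiM_cong) simp_all
    have g': "g \<in> borel_measurable (distr M PX (\<lambda>\<omega> i. X i \<omega>) \<Otimes>\<^sub>M PiM UNIV (\<lambda>_. \<mu>))"
      using g unfolding measurable_cong_sets[OF cong refl] .
    have g'': "g \<in> borel_measurable (PX \<Otimes>\<^sub>M PiM UNIV (\<lambda>_. \<mu>))"
      using g' by (simp cong: measurable_cong_sets sets_pair_measure_cong)
    show "(\<integral>\<^sup>+z. g z \<partial>(distr M PX (\<lambda>\<omega> i. X i \<omega>) \<Otimes>\<^sub>M PiM UNIV (\<lambda>_. \<mu>))) = (\<integral>\<^sup>+\<omega>. \<integral>\<^sup>+w. g (\<lambda>i. X i \<omega>, w) \<partial>PiM UNIV (\<lambda>_. \<mu>) \<partial>M)"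
      unfolding L.nn_integral_fst[OF g', symmetric]
      by (rule nn_integral_distr'[OF measurable_locations L.borel_measurable_nn_integral_fst[OF g'']])
  qed
  have "emeasure M {\<omega> \<in> space M. (\<lambda>i. X i \<omega>) \<in> A \<and> (\<forall>(i, j)\<in>S. E i j \<omega>)} = emeasure M (B \<inter> I)"
    by (rule arg_cong[where f = "emeasure M"]) (auto simp: B_def I_def)
  also have "\<dots> = ennreal (\<integral>\<omega>\<in>B. indicator I \<omega> \<partial>M)"
  proof -
    have "(\<integral>\<omega>\<in>B. indicator I \<omega> \<partial>M) = (\<integral>\<omega>. indicator (B \<inter> I) \<omega> \<partial>M)"
      unfolding set_lebesgue_integral_def by (rule Bochner_Integration.integral_cong[OF refl]) (auto simp: indicator_def)
    also have "\<dots> = measure M (B \<inter> I)"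
      using sets.Int_space_eq2[OF sets.Int[OF B I]] by simp
    finally show ?thesis by (simp only: emeasure_eq_measure)
  qed
  also have "\<dots> = ennreal (\<integral>\<omega>. indicator B \<omega> * real_cond_exp M F (indicator I) \<omega> \<partial>M)"
    using F.real_cond_exp_intA[OF iI BF] by (simp only: set_lebesgue_integral_def real_scaleR_def)
  also have "\<dots> = (\<integral>\<^sup>+\<omega>. ennreal (indicator B \<omega> * real_cond_exp M F (indicator I) \<omega>) \<partial>M)"
  proof (rule nn_integral_eq_integral[symmetric])
    show "integrable M (\<lambda>\<omega>. indicator B \<omega> * real_cond_exp M F (indicator I) \<omega>)"
      using integrable_mult_indicator[OF B F.real_cond_exp_int(1)[OF iI]] by simp
    show "AE \<omega> in M. 0 \<le> indicator B \<omega> * real_cond_exp M F (indicator I) \<omega>"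
      using cond by eventually_elim (simp add: prod_nonneg c0)
  qed
  also have "\<dots> = (\<integral>\<^sup>+\<omega>. g (?V \<omega>) \<partial>M)"
  proof (rule nn_integral_cong_AE)
    show "AE \<omega> in M. ennreal (indicator B \<omega> * real_cond_exp M F (indicator I) \<omega>) = g (?V \<omega>)"
      using cond AE_space
    proof eventually_elim
      case (elim \<omega>)
      have "(\<Prod>e\<in>S. ennreal (?c (\<lambda>i. X i \<omega>) (\<lambda>i. W i \<omega>) e)) = ennreal (\<Prod>e\<in>S. ?c (\<lambda>i. X i \<omega>) (\<lambda>i. W i \<omega>) e)"
        by (rule prod_ennreal) (rule c0)
      then show ?case using elim by (simp only: g_def fst_conv snd_conv) (simp add: indicator_def B_def)
    qed
  qed
  also have "\<dots> = (\<integral>\<^sup>+z. g z \<partial>distr M (PX \<Otimes>\<^sub>M PW) ?V)" by (rule gV)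
  also have "\<dots> = (\<integral>\<^sup>+\<omega>. \<integral>\<^sup>+w. g (\<lambda>i. X i \<omega>, w) \<partial>PiM UNIV (\<lambda>_. \<mu>) \<partial>M)"
    unfolding law_locations_marks by (rule gL)
  finally show ?thesis by (simp only: g_def fst_conv snd_conv split_beta split_beta')
qed

end

text \<open>Events that prescribe the presence, but not the absence, of finitely many edges are
  stable under intersection and generate; so the presence probabilities determine the joint
  law.\<close>

lemma pair_bool_generator:
  fixes K :: "'x measure"
  assumes K: "space K = UNIV"
  defines "\<E> \<equiv> {A \<times> {e :: 's \<Rightarrow> bool. \<forall>s\<in>S. e s} | A S. A \<in> sets K \<and> finite S}"
  shows "sets (K \<Otimes>\<^sub>M PiM UNIV (\<lambda>_. count_space UNIV)) = sigma_sets UNIV \<E>" "Int_stable \<E>"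
proof -
  let ?P = "PiM (UNIV :: 's set) (\<lambda>_. count_space (UNIV :: bool set))"
  have sp: "space (K \<Otimes>\<^sub>M ?P) = UNIV" by (simp add: space_pair_measure space_PiM K)
  have gen: "A \<times> {e :: 's \<Rightarrow> bool. \<forall>s\<in>S. e s} \<in> \<E>" if "A \<in> sets K" "finite S" for A S
    using that unfolding \<E>_def by blast
  show "sets (K \<Otimes>\<^sub>M ?P) = sigma_sets UNIV \<E>"
  proof
    show "sigma_sets UNIV \<E> \<subseteq> sets (K \<Otimes>\<^sub>M ?P)"
    proof (subst sp[symmetric], rule sets.sigma_sets_subset, rule subsetI)
      fix C assume "C \<in> \<E>"
      then obtain A and S :: "'s set" where C: "C = A \<times> {e. \<forall>s\<in>S. e s}" "A \<in> sets K" "finite S" unfolding \<E>_def by blast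
      have "Measurable.pred ?P (\<lambda>e. e s)" for s by simp
      then have "Measurable.pred ?P (\<lambda>e. \<forall>s\<in>S. e s)" by (intro pred_intros_finite(3) C(3))
      then have "{e. \<forall>s\<in>S. e s} \<in> sets ?P" by (simp add: pred_def space_PiM)
      then show "C \<in> sets (K \<Otimes>\<^sub>M ?P)" unfolding C(1) by (intro pair_measureI C(2))
    qed
    define G where "G = sigma UNIV \<E>"
    have sG: "sets G = sigma_sets UNIV \<E>" "space G = UNIV" by (simp_all add: G_def)
    have inG: "C \<in> sets G" if "C \<in> \<E>" for C unfolding sG(1) using that by (rule sigma_sets.Basic)
    have "fst \<in> measurable G K"
    proof (rule measurableI)
      fix A assume "A \<in> sets K"
      then have "A \<times> {e :: 's \<Rightarrow> bool. \<forall>s\<in>{}. e s} \<in> sets G" by (intro inG gen) auto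
      moreover have "fst -` A \<inter> space G = A \<times> {e :: 's \<Rightarrow> bool. \<forall>s\<in>{}. e s}" by (auto simp: sG)
      ultimately show "fst -` A \<inter> space G \<in> sets G" by simp
    qed (simp add: K)
    moreover have "snd \<in> measurable G ?P"
    proof (rule measurable_PiM_UNIV)
      fix s
      have "UNIV \<times> {e :: 's \<Rightarrow> bool. \<forall>s\<in>{s}. e s} \<in> sets G" using sets.top[of K] by (intro inG gen) (simp_all add: K)
      moreover have "{z \<in> space G. snd z s} = UNIV \<times> {e :: 's \<Rightarrow> bool. \<forall>s\<in>{s}. e s}" by (auto simp: sG)
      ultimately have "{z \<in> space G. snd z s} \<in> sets G" by simp
      then show "(\<lambda>z. snd z s) \<in> measurable G (count_space UNIV)" by (simp only: pred_def)
    qed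
    ultimately have id: "(\<lambda>z. (fst z, snd z)) \<in> measurable G (K \<Otimes>\<^sub>M ?P)" by (rule measurable_Pair)
    show "sets (K \<Otimes>\<^sub>M ?P) \<subseteq> sigma_sets UNIV \<E>"
    proof
      fix C assume "C \<in> sets (K \<Otimes>\<^sub>M ?P)"
      from measurable_sets[OF id this] show "C \<in> sigma_sets UNIV \<E>" by (simp add: sG)
    qed
  qed
  show "Int_stable \<E>"
  proof (rule Int_stableI)
    fix C D assume "C \<in> \<E>" "D \<in> \<E>"
    then obtain A B and S T :: "'s set" where "C = A \<times> {e. \<forall>s\<in>S. e s}" "A \<in> sets K" "finite S"
      "D = B \<times> {e. \<forall>s\<in>T. e s}" "B \<in> sets K" "finite T" unfolding \<E>_def by blast
    moreover from this have "C \<inter> D = (A \<inter> B) \<times> {e. \<forall>s\<in>S \<union> T. e s}" by auto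
    ultimately show "C \<inter> D \<in> \<E>" using gen[of "A \<inter> B" "S \<union> T"] by simp
  qed
qed

lemma suminf_swap_ennreal:
  fixes f :: "nat \<Rightarrow> nat \<Rightarrow> ennreal"
  shows "(\<Sum>n. \<Sum>i. f n i) = (\<Sum>i. \<Sum>n. f n i)"
proof -
  have "(\<Sum>n. \<Sum>i. f n i) = (\<Sum>n. \<integral>\<^sup>+i. f n i \<partial>count_space UNIV)" by (simp add: nn_integral_count_space_nat)
  also have "\<dots> = (\<integral>\<^sup>+i. (\<Sum>n. f n i) \<partial>count_space UNIV)" by (rule nn_integral_suminf[symmetric]) simp
  finally show ?thesis by (simp add: nn_integral_count_space_nat)
qed

lemma ball_sorted_pairs:
  fixes R :: "nat \<Rightarrow> nat \<Rightarrow> bool"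
  assumes "\<And>i j. R i j \<longleftrightarrow> R j i"
  shows "(\<forall>(i, j)\<in>(\<lambda>(i, j). (min i j, max i j)) ` S. R i j) \<longleftrightarrow> (\<forall>(i, j)\<in>S. R i j)"
proof -
  have "R (min i j) (max i j) \<longleftrightarrow> R i j" for i j using assms by (cases "i \<le> j") (auto simp: min_def max_def)
  then show ?thesis by auto
qed

lemma Lambda_eq_cube: "Lambda n = (cube (n powr (1 / DIM('a)) / 2) :: 'a::euclidean_space set)"
  by (simp add: Lambda_def cube_def)

lemma measurable_largest_Lambda:
  fixes x :: "'z \<Rightarrow> nat \<Rightarrow> 'a::euclidean_space"
  assumes "\<And>i. (\<lambda>z. x z i) \<in> borel_measurable K" "\<And>i j. Measurable.pred K (\<lambda>z. R z i j)"
  shows "(\<lambda>z. largest_component_size (R z) {i. x z i \<in> Lambda n}) \<in> measurable K (count_space UNIV)"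
  unfolding Lambda_eq_cube
  by (rule measurable_largest_component_size[OF assms(2)], unfold mem_Collect_eq) (rule pred_sets2[OF sets_cube assms(1)])

section \<open>Transfer of the law and identification of the Palm probability\<close>

context kernel_graph
begin

lemma measurable_config: "(\<lambda>\<omega>. (\<lambda>i. X i \<omega>, \<lambda>(i, j). E i j \<omega>)) \<in> measurable M (PX \<Otimes>\<^sub>M PE)"
proof (rule measurable_Pair[OF measurable_locations measurable_PiM_UNIV])
  show "(\<lambda>\<omega>. case s of (i, j) \<Rightarrow> E i j \<omega>) \<in> measurable M (count_space UNIV)" for s
    using measurable_E by (cases s) simp
qed

lemma measurable_model_config:
  "(\<lambda>z. (\<lambda>i. X i (fst z), \<lambda>(i, j). G.edge (\<lambda>i. X i (fst z)) (snd z) i j)) \<in> measurable G.MQ (PX \<Otimes>\<^sub>M PE)"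
proof (rule measurable_Pair[OF measurable_compose[OF measurable_fst measurable_locations] measurable_PiM_UNIV])
  have "Measurable.pred G.MQ (\<lambda>z. G.edge (\<lambda>i. X i (fst z)) (snd z) i j)" for i j
    by (rule G.pred_edge[OF G.measurable_pts_pair G.measurable_pts_pair measurable_snd])
  then show "(\<lambda>z. case s of (i, j) \<Rightarrow> G.edge (\<lambda>i. X i (fst z)) (snd z) i j) \<in> measurable G.MQ (count_space UNIV)" for s
    by (cases s) simp
qed

lemma model_edge_prob:
  assumes S: "finite S" "S \<subseteq> {(i, j). i < j}" and A: "A \<in> sets PX"
  shows "emeasure G.MQ {z \<in> space G.MQ. (\<lambda>i. X i (fst z)) \<in> A \<and> (\<forall>(i, j)\<in>S. G.edge (\<lambda>i. X i (fst z)) (snd z) i j)} =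
    (\<integral>\<^sup>+\<omega>. \<integral>\<^sup>+w. indicator A (\<lambda>i. X i \<omega>) *
      (\<Prod>(i, j)\<in>S. ennreal (connection_prob \<alpha> \<beta> p \<sigma> (X i \<omega>) (w i) (X j \<omega>) (w j))) \<partial>PiM UNIV (\<lambda>_. \<mu>) \<partial>M)"
proof -
  interpret Q: prob_space G.Q by (rule G.prob_space_Q)
  let ?C = "{z \<in> space G.MQ. (\<lambda>i. X i (fst z)) \<in> A \<and> (\<forall>(i, j)\<in>S. G.edge (\<lambda>i. X i (fst z)) (snd z) i j)}"
  have pe: "Measurable.pred G.MQ (\<lambda>z. G.edge (\<lambda>i. X i (fst z)) (snd z) i j)" for i j
    by (rule G.pred_edge[OF G.measurable_pts_pair G.measurable_pts_pair measurable_snd])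
  have "Measurable.pred G.MQ (\<lambda>z. (\<lambda>i. X i (fst z)) \<in> A \<and> (\<forall>e\<in>S. G.edge (\<lambda>i. X i (fst z)) (snd z) (fst e) (snd e)))"
    by (intro pred_intros_logic(3) pred_intros_finite(3) S(1) pe pred_sets2[OF A] measurable_compose[OF measurable_fst measurable_locations])
  moreover have "?C = {z \<in> space G.MQ. (\<lambda>i. X i (fst z)) \<in> A \<and> (\<forall>e\<in>S. G.edge (\<lambda>i. X i (fst z)) (snd z) (fst e) (snd e))}" by auto
  ultimately have C: "?C \<in> sets G.MQ" by (simp only: pred_def)
  have eC: "indicator ?C (\<omega>, \<eta>) = (indicator A (\<lambda>i. X i \<omega>) * indicator {\<eta>. \<forall>(i, j)\<in>S. G.edge (\<lambda>i. X i \<omega>) \<eta> i j} \<eta> :: ennreal)"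
    if "\<omega> \<in> space M" for \<omega> \<eta>
    using that by (auto simp: indicator_def space_pair_measure G.space_Q)
  have mI: "(\<lambda>\<eta>. indicator {\<eta>. \<forall>(i, j)\<in>S. G.edge x \<eta> i j} \<eta> :: ennreal) \<in> borel_measurable G.Q" for x
  proof (rule borel_measurable_indicator)
    have "Measurable.pred G.Q (\<lambda>\<eta>. G.edge x \<eta> i j)" for i j by (rule G.pred_edge) auto
    then have "Measurable.pred G.Q (\<lambda>\<eta>. \<forall>e\<in>S. G.edge x \<eta> (fst e) (snd e))" by (intro pred_intros_finite(3) S(1))
    moreover have "{\<eta>. \<forall>(i, j)\<in>S. G.edge x \<eta> i j} = {\<eta> \<in> space G.Q. \<forall>e\<in>S. G.edge x \<eta> (fst e) (snd e)}" by (auto simp: G.space_Q)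
    ultimately show "{\<eta>. \<forall>(i, j)\<in>S. G.edge x \<eta> i j} \<in> sets G.Q" by (simp only: pred_def)
  qed
  have mprod: "(\<lambda>w. \<Prod>(i, j)\<in>S. ennreal (connection_prob \<alpha> \<beta> p \<sigma> (x i :: 'a) (w i) (x j) (w j))) \<in> borel_measurable (PiM UNIV (\<lambda>_. \<mu>))" for x
  proof (rule borel_measurable_prod_ennreal)
    fix e :: "nat \<times> nat"
    obtain i j where e: "e = (i, j)" by (cases e)
    have "(\<lambda>w. w i) \<in> measurable (PiM UNIV (\<lambda>_. \<mu>)) \<mu>" for i :: nat by simp
    then have c: "(\<lambda>w. w i) \<in> borel_measurable (PiM UNIV (\<lambda>_. \<mu>))" for i :: nat
      by (simp cong: measurable_cong_sets)
    from measurable_compose[OF G.measurable_connection_prob[OF borel_measurable_const c borel_measurable_const c] measurable_ennreal]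
    show "(\<lambda>w. case e of (i, j) \<Rightarrow> ennreal (connection_prob \<alpha> \<beta> p \<sigma> (x i) (w i) (x j) (w j))) \<in> borel_measurable (PiM UNIV (\<lambda>_. \<mu>))"
      unfolding e prod.case .
  qed
  have "emeasure G.MQ ?C = (\<integral>\<^sup>+z. indicator ?C z \<partial>G.MQ)" by (rule nn_integral_indicator[OF C, symmetric])
  also have "\<dots> = (\<integral>\<^sup>+\<omega>. \<integral>\<^sup>+\<eta>. indicator ?C (\<omega>, \<eta>) \<partial>G.Q \<partial>M)"
    by (rule Q.nn_integral_fst[OF borel_measurable_indicator[OF C], symmetric])
  also have "\<dots> = (\<integral>\<^sup>+\<omega>. \<integral>\<^sup>+w. indicator A (\<lambda>i. X i \<omega>) *
      (\<Prod>(i, j)\<in>S. ennreal (connection_prob \<alpha> \<beta> p \<sigma> (X i \<omega>) (w i) (X j \<omega>) (w j))) \<partial>PiM UNIV (\<lambda>_. \<mu>) \<partial>M)"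
    by (intro nn_integral_cong) (simp only: eC nn_integral_cmult[OF mI] nn_integral_cmult[OF mprod] G.prob_edges[OF S])
  finally show ?thesis .
qed

text \<open>Both laws give the same integral on the generating events. Marks are left out of the
  configuration, since the largest component and the event of an infinite component are functions of
  locations and edges.\<close>

lemma law_config:
  "distr M (PX \<Otimes>\<^sub>M PE) (\<lambda>\<omega>. (\<lambda>i. X i \<omega>, \<lambda>(i, j). E i j \<omega>)) =
    distr G.MQ (PX \<Otimes>\<^sub>M PE) (\<lambda>z. (\<lambda>i. X i (fst z), \<lambda>(i, j). G.edge (\<lambda>i. X i (fst z)) (snd z) i j))"
  (is "?L = ?R")
proof -
  let ?\<E> = "{A \<times> {e :: nat \<times> nat \<Rightarrow> bool. \<forall>s\<in>S. e s} | A S. A \<in> sets PX \<and> finite S}"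
  have sp: "space PX = UNIV" by (simp add: space_PiM)
  note gen = pair_bool_generator[OF sp, where 's = "nat \<times> nat"]
  interpret L: prob_space ?L by (rule prob_space_distr[OF measurable_config])
  show ?thesis
  proof (rule measure_eqI_generator_eq[OF gen(2), where \<Omega> = UNIV and A = "\<lambda>_. UNIV \<times> {e. \<forall>s\<in>{}. e s}"])
    show "sets ?L = sigma_sets UNIV ?\<E>" "sets ?R = sigma_sets UNIV ?\<E>" using gen(1) by simp_all
    show "range (\<lambda>_ :: nat. UNIV \<times> {e. \<forall>s\<in>{}. e s}) \<subseteq> ?\<E>" 
      by (rule image_subsetI, rule CollectI, rule exI[of _ UNIV], rule exI[of _ "{}"]) (use sets.top[of PX] sp in simp)
    show "emeasure ?L (UNIV \<times> {e. \<forall>s\<in>{}. e s}) \<noteq> \<infinity>" by simp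
    fix C assume "C \<in> ?\<E>"
    then obtain A S where C: "C = A \<times> {e. \<forall>s\<in>S. e s}" and A: "A \<in> sets PX" and S: "finite S" by blast
    have sC: "C \<in> sets (PX \<Otimes>\<^sub>M PE)" using \<open>C \<in> ?\<E>\<close> unfolding gen(1) by (rule sigma_sets.Basic)
    have eL: "emeasure ?L C = emeasure M {\<omega> \<in> space M. (\<lambda>i. X i \<omega>) \<in> A \<and> (\<forall>(i, j)\<in>S. E i j \<omega>)}"
      unfolding emeasure_distr[OF measurable_config sC] by (rule arg_cong[where f = "emeasure M"]) (auto simp: C)
    have eR: "emeasure ?R C = emeasure G.MQ {z \<in> space G.MQ. (\<lambda>i. X i (fst z)) \<in> A \<and> (\<forall>(i, j)\<in>S. G.edge (\<lambda>i. X i (fst z)) (snd z) i j)}"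
      unfolding emeasure_distr[OF measurable_model_config sC] by (rule arg_cong[where f = "emeasure G.MQ"]) (auto simp: C)
    show "emeasure ?L C = emeasure ?R C"
    \<comment> \<open>The generator allows arbitrary index pairs, whereas conditional probabilities
      are prescribed for \<open>i < j\<close>: a loop makes both events empty, and other pairs are
      sorted by symmetry.\<close>
    proof (cases "\<exists>i. (i, i) \<in> S")
      case True
      then obtain i where i: "(i, i) \<in> S" by blast
      have "\<not> (\<forall>(i, j)\<in>S. E i j \<omega>)" if "\<omega> \<in> space M" for \<omega>
      proof
        assume "\<forall>(i, j)\<in>S. E i j \<omega>"
        from bspec[OF this i] have "E i i \<omega>" by (simp only: prod.case)
        then show False using edge_irrefl[OF that] by blast
      qed
      then have e1: "{\<omega> \<in> space M. (\<lambda>i. X i \<omega>) \<in> A \<and> (\<forall>(i, j)\<in>S. E i j \<omega>)} = {}" by blast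
      have "\<not> (\<forall>(i, j)\<in>S. G.edge x \<eta> i j)" for x \<eta>
      proof
        assume "\<forall>(i, j)\<in>S. G.edge x \<eta> i j"
        from bspec[OF this i] have "G.edge x \<eta> i i" by (simp only: prod.case)
        then show False by (simp add: G.edge_def)
      qed
      then have e2: "{z \<in> space G.MQ. (\<lambda>i. X i (fst z)) \<in> A \<and> (\<forall>(i, j)\<in>S. G.edge (\<lambda>i. X i (fst z)) (snd z) i j)} = {}" by blast
      show ?thesis unfolding eL eR e1 e2 by (simp only: emeasure_empty)
    next
      case False
      let ?S = "(\<lambda>(i, j). (min i j, max i j)) ` S"
      have S': "finite ?S" "?S \<subseteq> {(i, j). i < j}"
      proof -
        show "?S \<subseteq> {(i, j). i < j}"
        proof (rule image_subsetI)
          fix e assume e: "e \<in> S"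
          obtain i j where ij: "e = (i, j)" by (cases e)
          have "i \<noteq> j" using e ij False by blast
          then show "(case e of (i, j) \<Rightarrow> (min i j, max i j)) \<in> {(i, j). i < j}"
            unfolding ij by (cases "i < j") (auto simp: min_def max_def)
        qed
      qed (use S in simp)
      have "(\<forall>(i, j)\<in>S. E i j \<omega>) \<longleftrightarrow> (\<forall>(i, j)\<in>?S. E i j \<omega>)" if "\<omega> \<in> space M" for \<omega>
        by (rule ball_sorted_pairs[symmetric]) (rule edge_sym[OF that])
      then have eqE: "{\<omega> \<in> space M. (\<lambda>i. X i \<omega>) \<in> A \<and> (\<forall>(i, j)\<in>S. E i j \<omega>)} = {\<omega> \<in> space M. (\<lambda>i. X i \<omega>) \<in> A \<and> (\<forall>(i, j)\<in>?S. E i j \<omega>)}"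
        by (intro Collect_cong conj_cong refl)
      have "(\<forall>(i, j)\<in>S. G.edge x \<eta> i j) \<longleftrightarrow> (\<forall>(i, j)\<in>?S. G.edge x \<eta> i j)" for x \<eta>
        by (rule ball_sorted_pairs[symmetric]) (rule G.edge_sym)
      then have eqG: "{z \<in> space G.MQ. (\<lambda>i. X i (fst z)) \<in> A \<and> (\<forall>(i, j)\<in>S. G.edge (\<lambda>i. X i (fst z)) (snd z) i j)} =
          {z \<in> space G.MQ. (\<lambda>i. X i (fst z)) \<in> A \<and> (\<forall>(i, j)\<in>?S. G.edge (\<lambda>i. X i (fst z)) (snd z) i j)}"
        by (intro Collect_cong conj_cong refl)
      show ?thesis unfolding eL eR unfolding eqE eqG using joint_edge_prob[OF S' A] model_edge_prob[OF S' A] by (rule trans[OF _ sym])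
    qed
  qed auto
qed

lemma config_nn_integral:
  assumes "f \<in> borel_measurable (PX \<Otimes>\<^sub>M PE)"
  shows "(\<integral>\<^sup>+\<omega>. f (\<lambda>i. X i \<omega>, \<lambda>(i, j). E i j \<omega>) \<partial>M) =
    (\<integral>\<^sup>+z. f (\<lambda>i. X i (fst z), \<lambda>(i, j). G.edge (\<lambda>i. X i (fst z)) (snd z) i j) \<partial>G.MQ)"
  unfolding nn_integral_distr'[OF measurable_config assms, symmetric] nn_integral_distr'[OF measurable_model_config assms, symmetric] law_config ..

lemma config_prob:
  assumes P: "Measurable.pred (PX \<Otimes>\<^sub>M PE) P"
  shows "measure M {\<omega> \<in> space M. P (\<lambda>i. X i \<omega>, \<lambda>(i, j). E i j \<omega>)} =
    measure G.MQ {z \<in> space G.MQ. P (\<lambda>i. X i (fst z), \<lambda>(i, j). G.edge (\<lambda>i. X i (fst z)) (snd z) i j)}"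
proof -
  let ?C = "{c \<in> space (PX \<Otimes>\<^sub>M PE). P c}"
  have C: "?C \<in> sets (PX \<Otimes>\<^sub>M PE)" using P by (simp only: pred_def)
  have sp: "space (PX \<Otimes>\<^sub>M PE) = UNIV" by (simp add: space_pair_measure space_PiM)
  have "measure (distr M (PX \<Otimes>\<^sub>M PE) (\<lambda>\<omega>. (\<lambda>i. X i \<omega>, \<lambda>(i, j). E i j \<omega>))) ?C = measure M {\<omega> \<in> space M. P (\<lambda>i. X i \<omega>, \<lambda>(i, j). E i j \<omega>)}"
    unfolding measure_distr[OF measurable_config C] by (rule arg_cong[where f = "measure M"]) (auto simp: sp)
  moreover have "measure (distr G.MQ (PX \<Otimes>\<^sub>M PE) (\<lambda>z. (\<lambda>i. X i (fst z), \<lambda>(i, j). G.edge (\<lambda>i. X i (fst z)) (snd z) i j))) ?C =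
    measure G.MQ {z \<in> space G.MQ. P (\<lambda>i. X i (fst z), \<lambda>(i, j). G.edge (\<lambda>i. X i (fst z)) (snd z) i j)}"
    unfolding measure_distr[OF measurable_model_config C] by (rule arg_cong[where f = "measure G.MQ"]) (auto simp: sp)
  ultimately show ?thesis unfolding law_config by simp
qed

lemma measurable_seen_from:
  "(\<lambda>\<omega>. seen_from (X i \<omega>) (\<lambda>j. X j \<omega>, \<lambda>j. W j \<omega>, \<lambda>(j, k). E j k \<omega>)) \<in> measurable M config_space"
  unfolding seen_from_def config_space_def prod.case
proof (intro measurable_Pair measurable_marks measurable_PiM_UNIV)
  show "(\<lambda>\<omega>. X j \<omega> - X i \<omega>) \<in> borel_measurable M" for j
    by (intro borel_measurable_diff G.measurable_point)
  show "(\<lambda>\<omega>. case s of (j, k) \<Rightarrow> E j k \<omega>) \<in> measurable M (count_space UNIV)" for s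
    using measurable_E by (cases s) simp
qed

text \<open>The set function used in \<open>palm_measure\<close> has to be shown countably additive
  before \<open>measure_of\<close> takes its values.\<close>

lemma emeasure_palm_measure:
  assumes Z: "Z \<in> sets config_space"
  shows "emeasure (palm_measure M X W E) Z = (\<integral>\<^sup>+\<omega>. (\<Sum>i. indicator (cbox 0 One) (X i \<omega>) *
    indicator Z (seen_from (X i \<omega>) (\<lambda>j. X j \<omega>, \<lambda>j. W j \<omega>, \<lambda>(j, k). E j k \<omega>))) \<partial>M)"
  unfolding palm_measure_def
proof (rule emeasure_measure_of_sigma[OF sets.sigma_algebra_axioms _ _ Z])
  let ?s = "\<lambda>i \<omega>. seen_from (X i \<omega>) (\<lambda>j. X j \<omega>, \<lambda>j. W j \<omega>, \<lambda>(j, k). E j k \<omega>)"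
  let ?b = "\<lambda>i \<omega>. indicator (cbox 0 One) (X i \<omega>) :: ennreal"
  let ?f = "\<lambda>A. \<integral>\<^sup>+\<omega>. (\<Sum>i. ?b i \<omega> * indicator A (?s i \<omega>)) \<partial>M"
  have m: "(\<lambda>\<omega>. ?b i \<omega> * indicator A (?s i \<omega>)) \<in> borel_measurable M" if "A \<in> sets config_space" for A i
    by (intro borel_measurable_times_ennreal measurable_compose[OF G.measurable_point] measurable_compose[OF measurable_seen_from]
        borel_measurable_indicator that) simp
  show "positive (sets config_space) ?f" by (simp add: positive_def)
  show "countably_additive (sets config_space) ?f"
  proof (rule countably_additiveI)
    fix A :: "nat \<Rightarrow> 'a config set" assume A: "range A \<subseteq> sets config_space" "disjoint_family A"
    have "(\<Sum>n. ?f (A n)) = (\<integral>\<^sup>+\<omega>. (\<Sum>n. \<Sum>i. ?b i \<omega> * indicator (A n) (?s i \<omega>)) \<partial>M)"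
      by (rule nn_integral_suminf[symmetric]) (intro borel_measurable_suminf_order m, use A in auto)
    also have "\<dots> = ?f (\<Union>n. A n)"
      unfolding suminf_swap_ennreal[of "\<lambda>n i. ?b i \<omega> * indicator (A n) (?s i \<omega>)" for \<omega>]
      by (simp only: ennreal_suminf_cmult suminf_indicator[OF A(2)])
    finally show "(\<Sum>n. ?f (A n)) = ?f (\<Union>n. A n)" .
  qed
qed

lemma sets_zero_to_infinity: "zero_to_infinity \<in> sets (config_space :: 'a config measure)"
proof -
  let ?C = "config_space :: 'a config measure"
  have x: "(\<lambda>z. fst z i) \<in> borel_measurable ?C" for i
    unfolding config_space_def by (rule measurable_compose[OF measurable_fst]) simp
  have e: "Measurable.pred ?C (\<lambda>z. snd (snd z) s)" for s
    unfolding config_space_def by (rule measurable_compose[OF measurable_compose[OF measurable_snd measurable_snd]]) simp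
  have "Measurable.pred ?C (\<lambda>z. fst z i = 0)" for i
    using measurable_sets[OF x, of "{0}" i] by (simp add: pred_def vimage_def Int_def conj_commute)
  moreover have "Measurable.pred ?C (\<lambda>z. infinite (component (\<lambda>j k. snd (snd z) (j, k)) UNIV i))" for i
    by (intro measurable_infinite(1) measurable_component e) simp
  ultimately have "Measurable.pred ?C (\<lambda>z. \<exists>i. fst z i = 0 \<and> infinite (component (\<lambda>j k. snd (snd z) (j, k)) UNIV i))"
    by (intro pred_intros_countable pred_intros_logic(3))
  then have "{z \<in> space ?C. \<exists>i. fst z i = 0 \<and> infinite (component (\<lambda>j k. snd (snd z) (j, k)) UNIV i)} \<in> sets ?C"
    by (simp only: pred_def)
  moreover have "{z \<in> space ?C. \<exists>i. fst z i = 0 \<and> infinite (component (\<lambda>j k. snd (snd z) (j, k)) UNIV i)} = zero_to_infinity"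
    by (auto simp: zero_to_infinity_def config_space_def space_pair_measure space_PiM)
  ultimately show ?thesis by simp
qed

lemma AE_no_points:
  assumes D: "D \<in> sets borel" "bounded D" "measure lborel D = 0"
  shows "AE \<omega> in M. \<forall>i. X i \<omega> \<notin> D"
proof -
  have "prob {\<omega> \<in> space M. card (points_in (\<lambda>i. X i \<omega>) D) = 0} = 1"
    unfolding G.prob_card_points_in[OF D(1,2)] D(3) by (simp add: pois_def)
  from AE_prob_1[OF this] G.AE_finite_points_in[OF D(2)]
  show ?thesis by eventually_elim (auto simp: points_in_def)
qed

text \<open>The Palm mass counts vertices of the unit cube in infinite components; transferred to
  the model this is the expectation that defines \<open>\<theta>inf\<close>.\<close>

lemma measure_palm: "measure (palm_measure M X W E) zero_to_infinity = G.\<theta>inf"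
proof -
  let ?R = "\<lambda>\<omega> j k. E j k \<omega>"
  let ?\<Phi> = "\<lambda>c. ncard {v. fst c v \<in> G.unit_cell \<and> infinite (component (\<lambda>j k. snd c (j, k)) UNIV v)}"
  \<comment> \<open>The Palm measure is defined with the closed unit cube and the lattice argument
    with the half-open cell; their difference is null and almost surely contains no point.\<close>
  have sub: "G.unit_cell \<subseteq> (cbox 0 One :: 'a set)" by (auto simp: G.unit_cell_def mem_box less_imp_le)
  have D: "cbox 0 One - G.unit_cell \<in> sets (borel :: 'a measure)" by (intro sets.Diff G.sets_cells) simp
  have "measure lborel (cbox 0 One - G.unit_cell :: 'a set) = 0"
    by (subst measure_Diff[OF _ _ _ sub]) (simp_all add: G.measure_unit_cell emeasure_lborel_cbox_eq)
  then have "AE \<omega> in M. \<forall>i. X i \<omega> \<notin> cbox 0 One - G.unit_cell"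
    by (intro AE_no_points[OF D bounded_subset[OF bounded_cbox[of 0 One] Diff_subset]])
  then have ae: "AE \<omega> in M. (\<Sum>i. indicator (cbox 0 One) (X i \<omega>) *
      indicator zero_to_infinity (seen_from (X i \<omega>) (\<lambda>j. X j \<omega>, \<lambda>j. W j \<omega>, \<lambda>(j, k). E j k \<omega>))) = ?\<Phi> (\<lambda>i. X i \<omega>, \<lambda>(i, j). E i j \<omega>)"
    using G.AE_simple
  proof eventually_elim
    case (elim \<omega>)
    \<comment> \<open>Locations are distinct here, so after the translation by \<open>X i\<close>
      only the vertex \<open>i\<close> itself sits at 0.\<close>
    have "seen_from (X i \<omega>) (\<lambda>j. X j \<omega>, \<lambda>j. W j \<omega>, \<lambda>(j, k). E j k \<omega>) \<in> zero_to_infinity \<longleftrightarrow> infinite (component (?R \<omega>) UNIV i)" for i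
      using elim(2) by (auto simp: zero_to_infinity_def seen_from_def)
    moreover have "X i \<omega> \<in> cbox 0 One \<longleftrightarrow> X i \<omega> \<in> G.unit_cell" for i using elim(1) sub by blast
    ultimately have "indicator (cbox 0 One) (X i \<omega>) * indicator zero_to_infinity (seen_from (X i \<omega>) (\<lambda>j. X j \<omega>, \<lambda>j. W j \<omega>, \<lambda>(j, k). E j k \<omega>)) =
      (indicator {v. X v \<omega> \<in> G.unit_cell \<and> infinite (component (?R \<omega>) UNIV v)} i :: ennreal)" for i
      by (simp add: indicator_def)
    then show ?case by (simp add: ncard_def)
  qed
  have x: "(\<lambda>c. fst c i) \<in> borel_measurable (PX \<Otimes>\<^sub>M PE)" for i by (rule measurable_compose[OF measurable_fst]) simp
  have e: "Measurable.pred (PX \<Otimes>\<^sub>M PE) (\<lambda>c. snd c s)" for s by (rule measurable_compose[OF measurable_snd]) simp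
  have "?\<Phi> \<in> borel_measurable (PX \<Otimes>\<^sub>M PE)"
  proof (rule measurable_ncard, unfold mem_Collect_eq, rule pred_intros_logic(3))
    show "Measurable.pred (PX \<Otimes>\<^sub>M PE) (\<lambda>c. fst c v \<in> G.unit_cell)" for v by (rule pred_sets2[OF G.sets_cells(1) x])
    show "Measurable.pred (PX \<Otimes>\<^sub>M PE) (\<lambda>c. infinite (component (\<lambda>j k. snd c (j, k)) UNIV v))" for v
      by (intro measurable_infinite(1) measurable_component e) simp
  qed
  note tr = config_nn_integral[OF this]
  have "emeasure (palm_measure M X W E) zero_to_infinity = (\<integral>\<^sup>+\<omega>. ?\<Phi> (\<lambda>i. X i \<omega>, \<lambda>(i, j). E i j \<omega>) \<partial>M)"
    unfolding emeasure_palm_measure[OF sets_zero_to_infinity] by (rule nn_integral_cong_AE[OF ae])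
  also have "\<dots> = (\<integral>\<^sup>+z. ncard {v \<in> points_in (\<lambda>i. X i (fst z)) G.unit_cell. infinite (G.gcomp UNIV z v)} \<partial>G.MQ)"
    unfolding tr by (simp add: points_in_def G.gcomp_def G.comp_def)
  also have "\<dots> = ennreal G.\<theta>inf" by (rule G.ennreal_\<theta>inf)
  finally show ?thesis by (simp add: measure_def G.\<theta>inf_def)
qed

text \<open>The cube \<open>Lambda n\<close> has half-width \<open>n powr (1 / DIM('a)) / 2\<close>
  and volume \<open>n\<close>; the deviation event depends on locations and edges only, so its
  probability is the same as in the model.\<close>

lemma largest_component_converges:
  "tendsto_in_prob M (\<lambda>n \<omega>. real (largest_component_size (\<lambda>i j. E i j \<omega>) {i. X i \<omega> \<in> Lambda n}) / n) G.\<theta>inf at_top"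
  unfolding tendsto_in_prob_def
proof (intro conjI allI impI)
  let ?h = "\<lambda>n :: real. n powr (1 / DIM('a)) / 2"
  show "(\<lambda>\<omega>. real (largest_component_size (\<lambda>i j. E i j \<omega>) {i. X i \<omega> \<in> Lambda n}) / n) \<in> borel_measurable M" for n
    by (rule measurable_compose[OF measurable_largest_Lambda[OF G.measurable_point measurable_E]]) simp
  fix \<epsilon> :: real assume \<epsilon>: "0 < \<epsilon>"
  have "filterlim (\<lambda>n :: real. 1 / 2 * n powr (1 / DIM('a))) at_top at_top"
    by (rule filterlim_tendsto_pos_mult_at_top[OF tendsto_const _ filterlim_powr_at_top]) simp_all
  then have "filterlim ?h at_top at_top" by simp
  from filterlim_compose[OF G.largest_converges[OF \<epsilon>] this]
  show "((\<lambda>n. prob {\<omega> \<in> space M. \<epsilon> < \<bar>real (largest_component_size (\<lambda>i j. E i j \<omega>) {i. X i \<omega> \<in> Lambda n}) / n - G.\<theta>inf\<bar>}) \<longlongrightarrow> 0) at_top"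
  proof (rule Lim_transform_eventually)
    show "\<forall>\<^sub>F n in at_top. measure G.MQ {z \<in> space G.MQ. \<bar>G.largest (?h n) z / (2 * ?h n) ^ DIM('a) - G.\<theta>inf\<bar> > \<epsilon>} =
      prob {\<omega> \<in> space M. \<epsilon> < \<bar>real (largest_component_size (\<lambda>i j. E i j \<omega>) {i. X i \<omega> \<in> Lambda n}) / n - G.\<theta>inf\<bar>}"
      using eventually_gt_at_top[of 0]
    proof eventually_elim
      case (elim n)
      let ?P = "\<lambda>c. \<epsilon> < \<bar>real (largest_component_size (\<lambda>i j. snd c (i, j)) {i. fst c i \<in> Lambda n}) / n - G.\<theta>inf\<bar>"
      have x: "(\<lambda>c. fst c i) \<in> borel_measurable (PX \<Otimes>\<^sub>M PE)" for i by (rule measurable_compose[OF measurable_fst]) simp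
      have e: "Measurable.pred (PX \<Otimes>\<^sub>M PE) (\<lambda>c. snd c (i, j))" for i j by (rule measurable_compose[OF measurable_snd]) simp
      have "Measurable.pred (PX \<Otimes>\<^sub>M PE) ?P"
        by (rule measurable_compose[OF measurable_largest_Lambda[OF x e]]) simp
      note tr = config_prob[OF this]
      have "(2 * ?h n) ^ DIM('a) = n" using powr_root_power[OF elim, of "DIM('a)"] by simp
      then show ?case using tr unfolding G.largest_def Lambda_eq_cube by (simp add: points_in_def)
    qed
  qed
qed

end

theorem corollary2p3:
  fixes M :: "'w measure"
    and X :: "nat \<Rightarrow> 'w \<Rightarrow> 'a::euclidean_space"
    and W :: "nat \<Rightarrow> 'w \<Rightarrow> real"
    and E :: "nat \<Rightarrow> nat \<Rightarrow> 'w \<Rightarrow> bool"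
    and \<alpha> :: ereal and \<beta> p \<sigma> \<tau> :: real
  assumes "1 < \<alpha>" and "0 < \<beta>" and "0 < p" and "p \<le> 1"
    and "0 < \<sigma>" and "2 < \<tau>" and "\<tau> < 2 + \<sigma>"
    and "spatial_random_graph M \<alpha> \<beta> p \<sigma> \<tau> X W E"
  shows "tendsto_in_prob M
           (\<lambda>n \<omega>. real (largest_component_size (\<lambda>i j. E i j \<omega>) {i. X i \<omega> \<in> Lambda n}) / n)
           (measure (palm_measure M X W E) zero_to_infinity) at_top"
proof -
  interpret kernel_graph M \<alpha> \<beta> p \<sigma> \<tau> X W E
    using assms by (intro kernel_graph.intro kernel_graph_axioms.intro)
  show ?thesis unfolding measure_palm by (rule largest_component_converges)
qed

end
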